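(* Let the standing assumptions in the context hold. Assume that $\inf_{\mathscr P_\mu(\mathcal X\times\mathcal Y)}\mathcal J<+\infty$ and that for all $n\in\mathbb N$ there exist $0<C_n<+\infty$ and a measurable family $(\nu_n^y)_{y\in\mathcal Y}\subset\mathscr P(\mathcal Y)$ such that for all $y,y'\in\mathcal Y$ and all $(x,y,\nu)\in\operatorname{dom}\Phi$ $$\mathcal H(\nu_n^y,\nu_n^{y'})\le C_n(1+L(y)+L(y'))\quad\text{and}\quad\int_{\mathcal Y}\Phi(x,z,\nu)\,d\nu_n^y(z)\xrightarrow[n\to\infty]{}\Phi(x,y,\nu).$$ If $(\boldsymbol\gamma_N)_{N\in\mathbb N}$ is a sequence of minimizers of $\mathcal J_{\Omega,N}$, then there exists a subsequence $(\boldsymbol\gamma_{N_k})_{k\in\mathbb N}$ converging in the narrow topology of $\mathscr P_\Omega(\mathcal X\times\mathcal Y)$ to some (non-random) $\gamma\in\mathscr P_\mu(\mathcal X\times\mathcal Y)$, and in addition $\gamma$ is a Cournot--Nash equilibrium for the cost $\Phi$ and distribution of types $\mu$. Assume in addition that $H\in\mathscr C_b(\mathcal Y\times\mathcal Y)$ (bounded and continuous). Then for any sequence of Nash equilibria of the open-loop $N$-player games, encoded by $$\boldsymbol\gamma_N=\frac1N\sum_{i=1}^N\delta_{X_i}\otimes\nu_{i,N}^{X_i}\in\mathscr P_{\Omega,N}(\mathcal X\times\mathcal Y)$$ and converging to $\gamma$ in the narrow topology of $\mathscr P_\Omega(\mathcal X\times\mathcal Y)$, it holds that $\gamma\in\mathscr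 P_\mu(\mathcal X\times\mathcal Y)$ and $\gamma$ is a Cournot--Nash equilibrium for the cost $\Phi$ and distribution of types $\mu$.
   Context: Standing assumptions: $\mathcal X,\mathcal Y$ are Polish spaces; $\mu\in\mathscr P(\mathcal X)$ (Borel probability measures) is atomless; $c:\mathcal X\times\mathcal Y\to[0,+\infty]$, $L:\mathcal Y\to[0,+\infty]$, $H:\mathcal Y\times\mathcal Y\to[0,+\infty]$ are lower semi-continuous; $H$ is symmetric; $\{L\le\kappa\}$ is compact for every $\kappa>0$. $(\Omega,\mathcal F,\mathbb P)$ is a probability space carrying an i.i.d. sequence $(X_i)_{i\in\mathbb N}$ of $\mathcal X$-valued random variables with law $\mu$. Notation: $\mathcal L(\nu)=\int L\,d\nu$, $\mathcal H(\nu,\bar\nu)=\int H\,d\nu\otimes\bar\nu$; $\mathscr P_\mu(\mathcal X\times\mathcal Y)$ is the set of $\gamma\in\mathscr P(\mathcal X\times\mathcal Y)$ with first marginal $\mu$; for such $\gamma$ with second marginal $\nu$, $\mathcal J(\gamma)=\int c\,d\gamma+\mathcal L(\nu)+\mathcal H(\nu,\nu)$. $\Phi(x,y,\nu)=c(x,y)+L(y)+2\int_{\mathcal Y}H(y,y')\,d\nu(y')$ and $\operatorname{dom}\Phi=\{\Phi<+\infty\}$. Cournot--Nash equilibrium: $\gamma\in\mathscr P(\mathcal X\times\mathcal Y)$ with first marginal $\mu$ and $\gamma(\{(x,y): y\in\operatorname{argmin}_{y'\in\mathcal Y}\Phi(x,y',\nu)\})=1$, $\nu$ being the second marginal of $\gamma$.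 A family $(\nu^x)_{x}\subset\mathscr P(\mathcal Y)$ (indexed by a Polish space) is measurable if $x\mapsto\nu^x(B)$ is Borel for every Borel $B\subset\mathcal Y$. Random measures: for a Polish space $\mathcal Z$, $\mathscr P_\Omega(\mathcal Z)$ is the set of measurable maps $\boldsymbol\gamma:\Omega\to\mathscr P(\mathcal Z)$ ($\mathscr P(\mathcal Z)$ with the Borel $\sigma$-algebra of the narrow topology); non-random measures are identified with a.s. constant random ones. The narrow topology of $\mathscr P_\Omega(\mathcal Z)$ is the weakest one making $\boldsymbol\gamma\mapsto\mathbb E[\int_{\mathcal Z} f(\omega,z)\,d(\boldsymbol\gamma(\omega))(z)]$ continuous for all $f:\Omega\times\mathcal Z\to\mathbb R$ such that $f(\omega,\cdot)$ is bounded and continuous a.s., $f(\cdot,z)$ is $\mathcal F$-measurable for all $z$, and $\omega\mapsto\|f(\omega,\cdot)\|_{L^\infty}$ is $\mathbb P$-integrable. Open-loop game: the strategy of player $i\in\{1,\dots,N\}$ is $\boldsymbol\nu_i=\nu_i^{X_i}$ for a measurable family $(\nu_i^x)_{x\in\mathcal X}\subset\mathscr P(\mathcal Y)$, and player $i$ minimizes $$\mathcal J_{\Omega,i}(\boldsymbol\nu_i,\boldsymbol\nu_{-i})=\mathbb E\Big[\int_{\mathcal Y}c(X_i,y)\,d\nu_i^{X_i}(y)+\mathcal L(\nu_i^{X_i})+\frac2N\sum_{j\ne i}\mathcal H(\nu_i^{X_i},\nu_j^{X_j})\Big].$$ A profile is a Nash equilibrium if $\mathcal J_{\Omega,i}(\boldsymbol\nu_i,\boldsymbol\nu_{-i})\le\mathcal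 J_{\Omega,i}(\bar{\boldsymbol\nu}_i,\boldsymbol\nu_{-i})$ for all $i$ and all admissible $\bar{\boldsymbol\nu}_i$. $\mathscr P_{\Omega,N}(\mathcal X\times\mathcal Y)$ is the set of random measures $\boldsymbol\gamma_N=\frac1N\sum_{i=1}^N\delta_{X_i}\otimes\nu_i^{X_i}$ with each $(\nu_i^x)_{x}$ measurable, and the potential is $$\mathcal J_{\Omega,N}(\boldsymbol\gamma_N)=\mathbb E\Big[\int c\,d\boldsymbol\gamma_N+\frac1N\sum_{i=1}^N\mathcal L(\nu_i^{X_i})+\frac1{N^2}\sum_{i\ne j}\mathcal H(\nu_i^{X_i},\nu_j^{X_j})\Big]$$ if $\boldsymbol\gamma_N\in\mathscr P_{\Omega,N}(\mathcal X\times\mathcal Y)$, $+\infty$ otherwise. *)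

theory Defs
  imports "HOL-Probability.Probability"
begin

section \<open>Semicontinuity, atomless measures, Borel probability measures\<close>

definition lower_semicontinuous :: "('a::topological_space \<Rightarrow> ennreal) \<Rightarrow> bool" where
  "lower_semicontinuous f \<longleftrightarrow> (\<forall>t. open {x. t < f x})"

definition atomless :: "'a measure \<Rightarrow> bool" where
  "atomless \<mu> \<longleftrightarrow>
     (\<forall>A\<in>sets \<mu>. 0 < emeasure \<mu> A \<longrightarrow>
        (\<exists>B\<in>sets \<mu>. B \<subseteq> A \<and> 0 < emeasure \<mu> B \<and> emeasure \<mu> B < emeasure \<mu> A))"

definition borel_probs :: "'z::topological_space measure set" where
  "borel_probs = {\<gamma>. prob_space \<gamma> \<and> sets \<gamma> = sets borel}"

definition measurable_family ::
  "('a::topological_space \<Rightarrow> 'b::topological_space measure) \<Rightarrow> bool" where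
  "measurable_family K \<longleftrightarrow>
     (\<forall>x. K x \<in> borel_probs) \<and>
     (\<forall>B\<in>sets borel. (\<lambda>x. emeasure (K x) B) \<in> borel_measurable borel)"

definition couplings_of ::
  "'x::topological_space measure \<Rightarrow> ('x \<times> 'y::topological_space) measure set" where
  "couplings_of \<mu> = {\<gamma>\<in>borel_probs. distr \<gamma> borel fst = \<mu>}"

section \<open>Narrow topologies\<close>

text \<open>The weakest topology on the set \<open>S\<close> that makes all functions in \<open>F\<close> continuous.\<close>

definition weak_topology_on :: "'a set \<Rightarrow> ('a \<Rightarrow> real) set \<Rightarrow> 'a topology" where
  "weak_topology_on S F =
     topology_generated_by (insert S {{s\<in>S. \<phi> s \<in> U} |\<phi> U. \<phi> \<in> F \<and> open U})"

definition narrow_topology :: "'z::topological_space measure topology" where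
  "narrow_topology =
     weak_topology_on borel_probs
       {\<lambda>\<gamma>. \<integral>z. f z \<partial>\<gamma> |f. continuous_on UNIV f \<and> bounded (range f)}"

definition narrow_borel :: "'z::topological_space measure measure" where
  "narrow_borel = sigma borel_probs {U. openin narrow_topology U}"

definition random_probs :: "'w measure \<Rightarrow> ('w \<Rightarrow> 'z::topological_space measure) set" where
  "random_probs M = measurable M narrow_borel"

text \<open>
  Test functions are bounded and continuous in \<open>z\<close> only for almost every \<open>\<omega>\<close>.  On the exceptional
  null set neither the supremum nor \<open>\<omega> \<mapsto> \<integral>z. f \<omega> z \<partial>\<gamma> \<omega>\<close> need be measurable with respect to \<open>M\<close>, and
  a Bochner integral over \<open>M\<close> would then be \<open>0\<close>; integrating over the completion makes the values
  on null sets irrelevant, and agrees with the integral over \<open>M\<close> for \<open>M\<close>-measurable integrands.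
\<close>

definition narrow_test :: "'w measure \<Rightarrow> ('w \<Rightarrow> 'z::topological_space \<Rightarrow> real) \<Rightarrow> bool" where
  "narrow_test M f \<longleftrightarrow>
     (AE \<omega> in M. continuous_on UNIV (f \<omega>) \<and> bounded (range (f \<omega>))) \<and>
     (\<forall>z. (\<lambda>\<omega>. f \<omega> z) \<in> borel_measurable M) \<and>
     integrable (completion M) (\<lambda>\<omega>. SUP z. \<bar>f \<omega> z\<bar>)"

definition random_narrow_topology ::
  "'w measure \<Rightarrow> ('w \<Rightarrow> 'z::topological_space measure) topology" where
  "random_narrow_topology M =
     weak_topology_on (random_probs M)
       {\<lambda>\<gamma>. \<integral>\<omega>. (\<integral>z. f \<omega> z \<partial>\<gamma> \<omega>) \<partial>completion M |f. narrow_test M f}"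

section \<open>The mean-field problem\<close>

definition interaction ::
  "('y \<times> 'y \<Rightarrow> ennreal) \<Rightarrow> 'y measure \<Rightarrow> 'y measure \<Rightarrow> ennreal" where
  "interaction H \<nu> \<nu>' = (\<integral>\<^sup>+p. H p \<partial>(\<nu> \<Otimes>\<^sub>M \<nu>'))"

definition mean_field_cost ::
  "('x \<times> 'y::topological_space \<Rightarrow> ennreal) \<Rightarrow> ('y \<Rightarrow> ennreal) \<Rightarrow> ('y \<times> 'y \<Rightarrow> ennreal) \<Rightarrow>
   ('x \<times> 'y) measure \<Rightarrow> ennreal" where
  "mean_field_cost c L H \<gamma> =
     (let \<nu> = distr \<gamma> borel snd
      in (\<integral>\<^sup>+p. c p \<partial>\<gamma>) + (\<integral>\<^sup>+y. L y \<partial>\<nu>) + interaction H \<nu> \<nu>)"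

definition Phi ::
  "('x \<times> 'y \<Rightarrow> ennreal) \<Rightarrow> ('y \<Rightarrow> ennreal) \<Rightarrow> ('y \<times> 'y \<Rightarrow> ennreal) \<Rightarrow>
   'x \<Rightarrow> 'y \<Rightarrow> 'y measure \<Rightarrow> ennreal" where
  "Phi c L H x y \<nu> = c (x, y) + L y + 2 * (\<integral>\<^sup>+y'. H (y, y') \<partial>\<nu>)"

definition dom_Phi ::
  "('x \<times> 'y::topological_space \<Rightarrow> ennreal) \<Rightarrow> ('y \<Rightarrow> ennreal) \<Rightarrow> ('y \<times> 'y \<Rightarrow> ennreal) \<Rightarrow>
   ('x \<times> 'y \<times> 'y measure) set" where
  "dom_Phi c L H = {(x, y, \<nu>). \<nu> \<in> borel_probs \<and> Phi c L H x y \<nu> < \<infinity>}"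

definition cournot_nash ::
  "('x::topological_space \<times> 'y::topological_space \<Rightarrow> ennreal) \<Rightarrow> ('y \<Rightarrow> ennreal) \<Rightarrow>
   ('y \<times> 'y \<Rightarrow> ennreal) \<Rightarrow> 'x measure \<Rightarrow> ('x \<times> 'y) measure \<Rightarrow> bool" where
  "cournot_nash c L H \<mu> \<gamma> \<longleftrightarrow>
     \<gamma> \<in> couplings_of \<mu> \<and>
     (let \<nu> = distr \<gamma> borel snd
      in emeasure \<gamma> {(x, y). \<forall>y'. Phi c L H x y \<nu> \<le> Phi c L H x y' \<nu>} = 1)"

section \<open>The open-loop game\<close>

text \<open>
  The \<open>N\<close> players are indexed by \<open>i < N\<close>, and \<open>X i\<close> is the type of player \<open>i\<close>.  A profile
  \<open>s\<close> assigns to player \<open>i\<close> the random measure \<open>s i\<close>, which is admissible if it is of the form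
  \<open>\<omega> \<mapsto> K (X i \<omega>)\<close>.
\<close>

definition strategies ::
  "(nat \<Rightarrow> 'w \<Rightarrow> 'x::topological_space) \<Rightarrow> nat \<Rightarrow> ('w \<Rightarrow> 'y::topological_space measure) set" where
  "strategies X i = {\<lambda>\<omega>. K (X i \<omega>) |K. measurable_family K}"

definition player_cost ::
  "('x \<times> 'y \<Rightarrow> ennreal) \<Rightarrow> ('y \<Rightarrow> ennreal) \<Rightarrow> ('y \<times> 'y \<Rightarrow> ennreal) \<Rightarrow> 'w measure \<Rightarrow>
   (nat \<Rightarrow> 'w \<Rightarrow> 'x) \<Rightarrow> nat \<Rightarrow> nat \<Rightarrow> (nat \<Rightarrow> 'w \<Rightarrow> 'y measure) \<Rightarrow> ennreal" where
  "player_cost c L H M X N i s =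
     (\<integral>\<^sup>+\<omega>. ((\<integral>\<^sup>+y. c (X i \<omega>, y) \<partial>s i \<omega>) + (\<integral>\<^sup>+y. L y \<partial>s i \<omega>)
        + 2 / of_nat N * (\<Sum>j\<in>{..<N} - {i}. interaction H (s i \<omega>) (s j \<omega>))) \<partial>M)"

definition open_loop_nash ::
  "('x::topological_space \<times> 'y::topological_space \<Rightarrow> ennreal) \<Rightarrow> ('y \<Rightarrow> ennreal) \<Rightarrow>
   ('y \<times> 'y \<Rightarrow> ennreal) \<Rightarrow> 'w measure \<Rightarrow> (nat \<Rightarrow> 'w \<Rightarrow> 'x) \<Rightarrow> nat \<Rightarrow>
   (nat \<Rightarrow> 'w \<Rightarrow> 'y measure) \<Rightarrow> bool" where
  "open_loop_nash c L H M X N s \<longleftrightarrow>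
     (\<forall>i<N. s i \<in> strategies X i) \<and>
     (\<forall>i<N. \<forall>s'\<in>strategies X i.
        player_cost c L H M X N i s \<le> player_cost c L H M X N i (s(i := s')))"

text \<open>\<open>1/N \<Sum>\<^sub>i \<delta>\<^bsub>X\<^sub>i\<^esub> \<otimes> \<nu>\<^sub>i\<close>.\<close>

definition empirical ::
  "(nat \<Rightarrow> 'w \<Rightarrow> 'x::topological_space) \<Rightarrow> nat \<Rightarrow> (nat \<Rightarrow> 'w \<Rightarrow> 'y::topological_space measure) \<Rightarrow>
   'w \<Rightarrow> ('x \<times> 'y) measure" where
  "empirical X N s \<omega> =
     measure_of UNIV (sets borel)
       (\<lambda>A. 1 / of_nat N * (\<Sum>i<N. emeasure (return borel (X i \<omega>) \<Otimes>\<^sub>M s i \<omega>) A))"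

text \<open>Random measures are considered up to almost sure equality.\<close>

definition represents ::
  "'w measure \<Rightarrow> (nat \<Rightarrow> 'w \<Rightarrow> 'x::topological_space) \<Rightarrow> nat \<Rightarrow>
   (nat \<Rightarrow> 'w \<Rightarrow> 'y::topological_space measure) \<Rightarrow> ('w \<Rightarrow> ('x \<times> 'y) measure) \<Rightarrow> bool" where
  "represents M X N s \<gamma> \<longleftrightarrow>
     (\<forall>i<N. s i \<in> strategies X i) \<and> (AE \<omega> in M. \<gamma> \<omega> = empirical X N s \<omega>)"

definition empirical_random_probs ::
  "'w measure \<Rightarrow> (nat \<Rightarrow> 'w \<Rightarrow> 'x::topological_space) \<Rightarrow> nat \<Rightarrow>
   ('w \<Rightarrow> ('x \<times> 'y::topological_space) measure) set" where
  "empirical_random_probs M X N = {\<gamma>\<in>random_probs M. \<exists>s. represents M X N s \<gamma>}"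

text \<open>
  For independent \<open>X\<^sub>i\<close> with a common atomless law the points \<open>X i \<omega>\<close> are almost surely pairwise
  distinct, so that \<open>\<gamma> \<omega>\<close> determines every \<open>s i \<omega>\<close> almost surely.  The infimum below therefore
  ranges over a single value and merely selects it.
\<close>

definition potential ::
  "('x::topological_space \<times> 'y::topological_space \<Rightarrow> ennreal) \<Rightarrow> ('y \<Rightarrow> ennreal) \<Rightarrow>
   ('y \<times> 'y \<Rightarrow> ennreal) \<Rightarrow> 'w measure \<Rightarrow> (nat \<Rightarrow> 'w \<Rightarrow> 'x) \<Rightarrow> nat \<Rightarrow>
   ('w \<Rightarrow> ('x \<times> 'y) measure) \<Rightarrow> ennreal" where
  "potential c L H M X N \<gamma> =
     (if \<gamma> \<in> empirical_random_probs M X N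
      then INF s\<in>{s. represents M X N s \<gamma>}.
        (\<integral>\<^sup>+\<omega>. ((\<integral>\<^sup>+p. c p \<partial>\<gamma> \<omega>) + 1 / of_nat N * (\<Sum>i<N. \<integral>\<^sup>+y. L y \<partial>s i \<omega>)
          + 1 / (of_nat N)\<^sup>2 *
            (\<Sum>i<N. \<Sum>j\<in>{..<N} - {i}. interaction H (s i \<omega>) (s j \<omega>))) \<partial>M)
      else \<infinity>)"

definition potential_minimizer ::
  "('x::topological_space \<times> 'y::topological_space \<Rightarrow> ennreal) \<Rightarrow> ('y \<Rightarrow> ennreal) \<Rightarrow>
   ('y \<times> 'y \<Rightarrow> ennreal) \<Rightarrow> 'w measure \<Rightarrow> (nat \<Rightarrow> 'w \<Rightarrow> 'x) \<Rightarrow> nat \<Rightarrow>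
   ('w \<Rightarrow> ('x \<times> 'y) measure) \<Rightarrow> bool" where
  "potential_minimizer c L H M X N \<gamma> \<longleftrightarrow>
     \<gamma> \<in> random_probs M \<and>
     (\<forall>\<gamma>'\<in>random_probs M. potential c L H M X N \<gamma> \<le> potential c L H M X N \<gamma>')"

end

theory Submission
  imports Defs
begin

text \<open>
  The whole argument rests on the fact that expected costs in the open-loop game are deterministic
  functions of the kernels used by the players. Types of different players are independent, so the
  expected interaction of two players is the interaction of the mean laws of their actions
  (\<open>nn_integral_interaction\<close>). Costs being affine or bilinear in the kernels, a profile can be compared
  with its average over the players, at the price of the diagonal terms \<open>i = j\<close>, which the game omits
  and which are of order \<open>1 / N\<close> for bounded interactions.

  The laws with first marginal \<open>\<mu>\<close> built from averaged kernels are tight, because sublevel sets of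
  \<open>L\<close> are compact. A subsequence has almost surely convergent representations
  (\<open>prokhorov_skorokhod\<close>), along which costs are lower semicontinuous by Fatou's lemma
  (\<open>limit_cost_le\<close>). A variance estimate shows that, along a sparse subsequence, the random empirical
  measures are almost surely close to these deterministic laws (\<open>empirical_AE_narrow\<close>); this gives
  convergence in the narrow topology of random measures (\<open>convergent_subsequence\<close>).

  For minimizers of the potential, comparison with profiles in which all players use the same kernel
  shows that the limit minimizes the mean-field cost. A minimizer is an equilibrium by the first-order
  condition: if the conditional mean of \<open>Phi\<close> under the minimizer exceeded the minimum of \<open>Phi\<close> on a
  set of positive measure, moving a small mass towards minimizers would lower the cost. The kernels
  \<open>\<kappa> n\<close> keep the second-order term of this perturbation finite (\<open>minimizer_cournot_nash\<close>).

  For Nash equilibria and bounded continuous \<open>H\<close>, the average of the equilibrium inequalities against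
  a common deviation passes to the limit and states directly that the mean of \<open>Phi\<close> under the limit
  is at most that of its pointwise minimum. The given limit is this one since limits of random
  measures are almost surely unique (\<open>random_narrow_limit_unique\<close>).

  Measure theory on Polish spaces is reduced to elementary facts by a Borel code with values in the
  unit interval, which brings disintegration and almost sure representation to the real line, and by
  a countable family of continuous functions, the tents, which determines narrow convergence.
\<close>

section \<open>Coding a Polish space by real numbers\<close>

text \<open>
  Base 3 with digits 0 and 1 leaves gaps: distinct digit sequences have distinct values, and close
  values share an initial segment of digits.
\<close>

definition ternary :: "(nat \<Rightarrow> bool) \<Rightarrow> real" where
  "ternary b = (\<Sum>j. of_bool (b j) / 3 ^ Suc j)"

lemma ternary_summable: "summable (\<lambda>j. of_bool (b j) / 3 ^ Suc j :: real)"
proof (rule summable_comparison_test'[where N = 0 and g = "\<lambda>j. (1/3) ^ Suc j"])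
  show "summable (\<lambda>j. (1/3 :: real) ^ Suc j)"
    by (subst summable_Suc_iff) (rule summable_geometric, simp)
qed (auto simp: power_divide)

lemma ternary_shift: "3 * ternary b = of_bool (b 0) + ternary (\<lambda>j. b (Suc j))"
proof -
  have "ternary b = of_bool (b 0) / 3 + (\<Sum>j. of_bool (b (Suc j)) / 3 ^ Suc (Suc j))"
    unfolding ternary_def using suminf_split_head[OF ternary_summable[of b]] by simp
  also have "(\<Sum>j. of_bool (b (Suc j)) / 3 ^ Suc (Suc j) :: real) = (\<Sum>j. (1/3) * (of_bool (b (Suc j)) / 3 ^ Suc j))"
    by (intro suminf_cong) simp
  also have "\<dots> = (1/3) * ternary (\<lambda>j. b (Suc j))"
    unfolding ternary_def by (rule suminf_mult[OF ternary_summable])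
  finally show ?thesis by simp
qed

lemma ternary_bounds: "0 \<le> ternary b" "ternary b \<le> 1 / 2"
proof -
  show "0 \<le> ternary b"
    unfolding ternary_def by (intro suminf_nonneg ternary_summable) simp
  have "ternary b \<le> ternary (\<lambda>_. True)"
    unfolding ternary_def by (intro suminf_le ternary_summable) (auto simp: divide_simps)
  moreover have "ternary (\<lambda>_. True) = 1 / 2"
    using ternary_shift[of "\<lambda>_. True"] by simp
  ultimately show "ternary b \<le> 1 / 2" by simp
qed

lemma ternary_head: "3 * ternary b \<ge> 1 \<longleftrightarrow> b 0"
  using ternary_shift[of b] ternary_bounds(1)[of "\<lambda>j. b (Suc j)"] ternary_bounds(2)[of "\<lambda>j. b (Suc j)"]
  by (cases "b 0") auto

text \<open>
  The shift of the digit sequence, as an operation on values.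
\<close>

definition ternary_drop :: "real \<Rightarrow> real" where
  "ternary_drop u = 3 * u - (if 3 * u \<ge> 1 then 1 else 0)"

lemma ternary_drop: "ternary_drop (ternary b) = ternary (\<lambda>j. b (Suc j))"
  unfolding ternary_drop_def ternary_head by (simp add: ternary_shift)

lemma ternary_digit: "3 * (ternary_drop ^^ j) (ternary b) \<ge> 1 \<longleftrightarrow> b j"
proof -
  have "(ternary_drop ^^ j) (ternary b) = ternary (\<lambda>i. b (i + j))"
    by (induction j) (simp_all add: ternary_drop)
  then show ?thesis
    using ternary_head[of "\<lambda>i. b (i + j)"] by simp
qed

lemma ternary_drop_measurable [measurable]: "ternary_drop \<in> borel_measurable borel"
  unfolding ternary_drop_def by measurable

lemma ternary_digit_measurable [measurable]: "(ternary_drop ^^ j) \<in> borel_measurable borel"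
proof (induction j)
  case (Suc j)
  show ?case using Suc by (simp add: comp_def del: funpow.simps(2) add: funpow.simps(2))
qed (simp add: id_def)

lemma ternary_close_head: "\<bar>3 * ternary b - 3 * ternary b'\<bar> < 1 / 2 \<Longrightarrow> b 0 = b' 0"
  using ternary_shift[of b] ternary_shift[of b'] ternary_bounds(1)[of "\<lambda>j. b (Suc j)"]
    ternary_bounds(2)[of "\<lambda>j. b (Suc j)"] ternary_bounds(1)[of "\<lambda>j. b' (Suc j)"]
    ternary_bounds(2)[of "\<lambda>j. b' (Suc j)"]
  by (cases "b 0"; cases "b' 0") (simp_all add: abs_if split: if_splits)

text \<open>
  Values whose leading digits differ are at least 1/6 apart, and dropping a common leading digit
  multiplies the distance by 3.
\<close>

lemma ternary_close:
  "\<bar>ternary b - ternary b'\<bar> < 1 / (2 * 3 ^ Suc j) \<Longrightarrow> b j = b' j"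
proof (induction j arbitrary: b b')
  case 0
  then have "\<bar>3 * ternary b - 3 * ternary b'\<bar> < 1 / 2" by (simp add: abs_if split: if_splits)
  then show ?case by (rule ternary_close_head)
next
  case (Suc j)
  have *: "\<bar>3 * ternary b - 3 * ternary b'\<bar> < 1 / (2 * 3 ^ Suc j)"
  proof -
    have "\<bar>3 * ternary b - 3 * ternary b'\<bar> = 3 * \<bar>ternary b - ternary b'\<bar>"
      by (simp add: abs_if)
    also have "\<dots> < 3 * (1 / (2 * 3 ^ Suc (Suc j)))"
      using Suc.prems by (intro mult_strict_left_mono) auto
    finally show ?thesis by simp
  qed
  have "(1::real) / (2 * 3 ^ Suc j) \<le> 1 / 2"
    using one_le_power[of "3::real" "Suc j"] by (simp add: divide_simps)
  with * have "\<bar>3 * ternary b - 3 * ternary b'\<bar> < 1 / 2" by linarith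
  then have "b 0 = b' 0" by (rule ternary_close_head)
  with * show ?case
    using Suc.IH[of "\<lambda>j. b (Suc j)" "\<lambda>j. b' (Suc j)"] ternary_shift[of b] ternary_shift[of b'] by simp
qed

lemma dense_sequence:
  obtains d :: "nat \<Rightarrow> 'a::{metric_space, second_countable_topology}"
  where "\<And>z e. 0 < e \<Longrightarrow> \<exists>k. dist z (d k) < e"
proof -
  obtain D :: "'a set" where D: "countable D" "\<And>X. open X \<Longrightarrow> X \<noteq> {} \<Longrightarrow> \<exists>z\<in>D. z \<in> X"
    using countable_dense_exists by blast
  have "D \<noteq> {}" using D(2)[of UNIV] by auto
  show ?thesis
  proof (rule that[of "from_nat_into D"])
    fix z :: 'a and e :: real assume "0 < e"
    then obtain w where "w \<in> D" "w \<in> ball z e" using D(2)[of "ball z e"] by auto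
    with D(1) obtain k where "from_nat_into D k = w" by (metis from_nat_into_surj)
    with \<open>w \<in> ball z e\<close> show "\<exists>k. dist z (from_nat_into D k) < e" by auto
  qed
qed

text \<open>
  Successive approximations by measurable functions need not converge everywhere. This lemma turns
  them into a measurable function on the whole space, with the right value wherever they do;
  decoding maps, representations of limit laws and selections all arise in this way.
\<close>

lemma measurable_Cauchy_limit:
  fixes f :: "nat \<Rightarrow> 'a \<Rightarrow> 'b::{complete_space, second_countable_topology}"
  assumes [measurable]: "\<And>n. f n \<in> borel_measurable M"
  obtains g where "g \<in> borel_measurable M" "\<And>x. Cauchy (\<lambda>n. f n x) \<Longrightarrow> (\<lambda>n. f n x) \<longlonglongrightarrow> g x"
proof -
  fix z0 :: 'b
  define f' where "f' n x = (if Cauchy (\<lambda>n. f n x) then f n x else z0)" for n x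
  have f'_lim: "(\<lambda>n. f' n x) \<longlonglongrightarrow> lim (\<lambda>n. f' n x)" for x
    unfolding convergent_LIMSEQ_iff[symmetric] f'_def
    by (cases "Cauchy (\<lambda>n. f n x)") (auto simp: Cauchy_convergent convergent_const)
  show ?thesis
  proof
    show "(\<lambda>x. lim (\<lambda>n. f' n x)) \<in> borel_measurable M"
      by (rule borel_measurable_LIMSEQ_metric[OF _ f'_lim]) (simp add: f'_def)
    show "(\<lambda>n. f n x) \<longlonglongrightarrow> lim (\<lambda>n. f' n x)" if "Cauchy (\<lambda>n. f n x)" for x
      using f'_lim[of x] that by (simp add: f'_def)
  qed
qed

text \<open>
  The ternary digits of \<open>e z\<close> answer the questions whether \<open>z\<close> is within
  \<open>2\<^sup>-\<^sup>m\<close> of \<open>d k\<close>. The centres of smaller and smaller balls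
  around \<open>z\<close> can be read off these digits, and they converge to \<open>z\<close>;
  this gives the Borel left inverse. The code is not continuous. What replaces continuity is the
  last property: close codes agree in each single digit, so along a sequence with convergent codes
  every question is eventually answered in the same way.
\<close>

lemma borel_coding:
  obtains e :: "'a::{complete_space, second_countable_topology} \<Rightarrow> real" and r :: "real \<Rightarrow> 'a"
    and d :: "nat \<Rightarrow> 'a"
  where "e \<in> borel_measurable borel" "r \<in> borel_measurable borel" "\<And>z. r (e z) = z"
    "\<And>z. e z \<in> {0..1}"
    "\<And>z \<epsilon>. 0 < \<epsilon> \<Longrightarrow> \<exists>k. dist z (d k) < \<epsilon>"
    "\<And>u k m. convergent (\<lambda>n. e (u n)) \<Longrightarrow>
       (\<forall>\<^sub>F n in sequentially. dist (u n) (d k) < 1 / 2 ^ m) \<or>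
       (\<forall>\<^sub>F n in sequentially. \<not> dist (u n) (d k) < 1 / 2 ^ m)"
proof -
  obtain d :: "nat \<Rightarrow> 'a" where d: "\<And>z \<epsilon>. 0 < \<epsilon> \<Longrightarrow> \<exists>k. dist z (d k) < \<epsilon>"
    using dense_sequence by blast
  define b where "b z j = (case prod_decode j of (k, m) \<Rightarrow> dist z (d k) < 1 / 2 ^ m)" for z j
  have b: "b z (prod_encode (k, m)) \<longleftrightarrow> dist z (d k) < 1 / 2 ^ m" for z k m
    by (simp add: b_def)
  define e where "e z = ternary (b z)" for z
  \<comment> \<open>The first centre within distance \<open>2\<^sup>-\<^sup>m\<close>, read off
  the digits of the code.\<close>
  define q where "q m u = d (LEAST k. 3 * (ternary_drop ^^ prod_encode (k, m)) u \<ge> 1)" for m u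
  have e_meas: "e \<in> borel_measurable borel"
  proof -
    have "Measurable.pred borel (\<lambda>z. b z j)" for j
      unfolding b_def by (cases "prod_decode j") simp
    then have [measurable]: "(\<lambda>z. of_bool (b z j) / 3 ^ Suc j :: real) \<in> borel_measurable borel" for j
      unfolding of_bool_def by measurable
    show ?thesis unfolding e_def ternary_def by measurable
  qed
  have digit_meas [measurable]: "Measurable.pred borel (\<lambda>u. 3 * (ternary_drop ^^ j) u \<ge> 1)" for j
    unfolding pred_def using ternary_digit_measurable by (intro borel_measurable_le) auto
  have q_meas [measurable]: "q m \<in> borel_measurable borel" for m
    unfolding q_def
    by (rule measurable_compose_countable[where f = "\<lambda>k _. d k"]) measurable
  obtain r where r_meas: "r \<in> borel_measurable borel"
    and r_lim: "\<And>u. Cauchy (\<lambda>m. q m u) \<Longrightarrow> (\<lambda>m. q m u) \<longlonglongrightarrow> r u"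
    using measurable_Cauchy_limit[of q borel, OF q_meas] by metis
  have r_e: "r (e z) = z" for z
  proof -
    have q: "dist z (q m (e z)) < 1 / 2 ^ m" for m
    proof -
      have "q m (e z) = d (LEAST k. dist z (d k) < 1 / 2 ^ m)"
        by (simp add: q_def e_def ternary_digit b)
      then show ?thesis using d[of "1 / 2 ^ m" z] by (auto intro: LeastI)
    qed
    have lim: "(\<lambda>m. q m (e z)) \<longlonglongrightarrow> z"
    proof (rule tendsto_dist_iff[THEN iffD2], rule Lim_null_comparison)
      show "\<forall>\<^sub>F m in sequentially. norm (dist (q m (e z)) z) \<le> (1 / 2) ^ m"
        using q by (intro always_eventually allI) (simp add: power_divide dist_commute less_imp_le)
      show "(\<lambda>m. (1 / 2 :: real) ^ m) \<longlonglongrightarrow> 0"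
        by (rule LIMSEQ_realpow_zero) simp_all
    qed
    then have "Cauchy (\<lambda>m. q m (e z))" by (rule LIMSEQ_imp_Cauchy)
    from lim r_lim[OF this] show ?thesis by (rule LIMSEQ_unique[symmetric])
  qed
  have e_conv: "(\<forall>\<^sub>F n in sequentially. dist (u n) (d k) < 1 / 2 ^ m) \<or>
       (\<forall>\<^sub>F n in sequentially. \<not> dist (u n) (d k) < 1 / 2 ^ m)"
    if "convergent (\<lambda>n. e (u n))" for u k m
  proof -
    let ?j = "prod_encode (k, m)"
    from that have "Cauchy (\<lambda>n. e (u n))" by (rule convergent_Cauchy)
    then obtain n0 where n0: "\<And>n. n \<ge> n0 \<Longrightarrow> \<bar>e (u n) - e (u n0)\<bar> < 1 / (2 * 3 ^ Suc ?j)"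
      using metric_CauchyD[of "\<lambda>n. e (u n)" "1 / (2 * 3 ^ Suc ?j)"] by (auto simp: dist_real_def)
    have "b (u n) ?j = b (u n0) ?j" if "n \<ge> n0" for n
      using n0[OF that] unfolding e_def by (rule ternary_close)
    then have "\<forall>n\<ge>n0. dist (u n) (d k) < 1 / 2 ^ m \<longleftrightarrow> dist (u n0) (d k) < 1 / 2 ^ m"
      unfolding b by blast
    then show ?thesis unfolding eventually_sequentially by metis
  qed
  show ?thesis
  proof (rule that[OF e_meas r_meas r_e _ d e_conv])
    show "e z \<in> {0..1}" for z using ternary_bounds[of "b z"] by (simp add: e_def)
  qed
qed

section \<open>Almost surely convergent representations of tight sequences\<close>

lemma borel_probsD:
  assumes "\<gamma> \<in> borel_probs"
  shows "prob_space \<gamma>" "sets \<gamma> = sets borel" "space \<gamma> = UNIV"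
  using assms sets_eq_imp_space_eq[of \<gamma> borel] by (auto simp: borel_probs_def)

text \<open>
  The theorems of Prokhorov and Skorokhod in one, by transport to the real line. The codes have
  laws on the unit interval, where Helly selection and the Skorokhod representation are available.
  Decoding the representing variables gives \<open>z n\<close> with the required laws, and almost
  surely the codes of \<open>z n\<close> converge. Hence each ball around a point of the dense
  sequence eventually contains \<open>z n\<close> or eventually misses it. Tightness prevents
  \<open>z n\<close> from missing all balls of a given radius, and so \<open>z n\<close> is almost
  surely Cauchy.
\<close>

lemma prokhorov_skorokhod:
  fixes \<gamma> :: "nat \<Rightarrow> 'a::{complete_space, second_countable_topology} measure"
  assumes \<gamma>: "\<And>n. \<gamma> n \<in> borel_probs"
    and tight: "\<And>\<epsilon>::real. 0 < \<epsilon> \<Longrightarrow> \<exists>K. compact K \<and> (\<forall>n. emeasure (\<gamma> n) (- K) \<le> ennreal \<epsilon>)"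
  obtains r :: "nat \<Rightarrow> nat" and \<Omega> :: "real measure" and z z\<^sub>0
  where "strict_mono r" "prob_space \<Omega>" "\<And>n. z n \<in> borel_measurable \<Omega>" "z\<^sub>0 \<in> borel_measurable \<Omega>"
    "\<And>n. distr \<Omega> borel (z n) = \<gamma> (r n)" "AE \<omega> in \<Omega>. (\<lambda>n. z n \<omega>) \<longlonglongrightarrow> z\<^sub>0 \<omega>"
proof -
  obtain e :: "'a \<Rightarrow> real" and dec :: "real \<Rightarrow> 'a" and d :: "nat \<Rightarrow> 'a"
  where e [measurable]: "e \<in> borel_measurable borel" and dec [measurable]: "dec \<in> borel_measurable borel"
    and dec_e: "\<And>z. dec (e z) = z" and e01: "\<And>z. e z \<in> {0..1}"
    and d: "\<And>z \<epsilon>. 0 < \<epsilon> \<Longrightarrow> \<exists>k. dist z (d k) < \<epsilon>"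
    and e_conv: "\<And>u k m. convergent (\<lambda>n. e (u n)) \<Longrightarrow>
       (\<forall>\<^sub>F n in sequentially. dist (u n) (d k) < 1 / 2 ^ m) \<or>
       (\<forall>\<^sub>F n in sequentially. \<not> dist (u n) (d k) < 1 / 2 ^ m)"
    by (rule borel_coding) (rule that)
  note \<gamma>D = borel_probsD[OF \<gamma>]
  define \<rho> where "\<rho> n = distr (\<gamma> n) borel e" for n
  have e' [measurable]: "e \<in> borel_measurable (\<gamma> n)" for n
    using e \<gamma>D(2) measurable_cong_sets by blast
  have \<rho>: "real_distribution (\<rho> n)" for n
    unfolding \<rho>_def by (intro prob_space.real_distribution_distr \<gamma>D) simp
  have "tight \<rho>"
    unfolding tight_def
  proof (intro conjI allI impI \<rho>)
    fix \<epsilon> :: real assume "0 < \<epsilon>"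
    have "measure (\<rho> n) {-1<..1} = 1" for n
    proof -
      interpret prob_space "\<gamma> n" by (rule \<gamma>D)
      have "e -` {-1<..1} \<inter> space (\<gamma> n) = space (\<gamma> n)"
        using e01 by (force simp: \<gamma>D)
      then show ?thesis unfolding \<rho>_def by (simp add: measure_distr prob_space)
    qed
    with \<open>0 < \<epsilon>\<close> show "\<exists>a b. a < b \<and> (\<forall>n. 1 - \<epsilon> < measure (\<rho> n) {a<..b})"
      by (intro exI[of _ "-1"] exI[of _ 1]) simp
  qed
  then obtain r M0 where r: "strict_mono r" and M0: "real_distribution M0"
    and conv: "weak_conv_m (\<rho> \<circ> id \<circ> r) M0"
    using tight_imp_convergent_subsubsequence[of \<rho> id] by (auto simp: strict_mono_id)
  have "weak_conv_m (\<lambda>n. \<rho> (r n)) M0" using conv by (simp add: comp_def)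
  from Skorohod[OF \<rho> M0 this] obtain \<Omega> U and U0 :: "real \<Rightarrow> real" where
    "prob_space \<Omega> \<and> (\<forall>n. U n \<in> measurable \<Omega> borel) \<and> (\<forall>n. distr \<Omega> borel (U n) = \<rho> (r n)) \<and>
     U0 \<in> measurable \<Omega> lborel \<and> distr \<Omega> borel U0 = M0 \<and> (\<forall>\<omega>\<in>space \<Omega>. (\<lambda>n. U n \<omega>) \<longlonglongrightarrow> U0 \<omega>)"
    by blast
  then have \<Omega>: "prob_space \<Omega>" and U [measurable]: "\<And>n. U n \<in> borel_measurable \<Omega>"
    and U_distr: "\<And>n. distr \<Omega> borel (U n) = \<rho> (r n)"
    and U_lim: "\<And>\<omega>. \<omega> \<in> space \<Omega> \<Longrightarrow> (\<lambda>n. U n \<omega>) \<longlonglongrightarrow> U0 \<omega>"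
    by blast+
  interpret \<Omega>: prob_space \<Omega> by (rule \<Omega>)
  define z where "z n \<omega> = dec (U n \<omega>)" for n \<omega>
  have z [measurable]: "z n \<in> borel_measurable \<Omega>" for n
    unfolding z_def by measurable
  have z_distr: "distr \<Omega> borel (z n) = \<gamma> (r n)" for n
  proof -
    have "distr \<Omega> borel (z n) = distr (distr \<Omega> borel (U n)) borel dec"
      unfolding z_def by (subst distr_distr) (simp_all add: comp_def)
    also have "\<dots> = distr (\<gamma> (r n)) borel (\<lambda>z. z)"
      unfolding U_distr \<rho>_def by (subst distr_distr) (simp_all add: comp_def dec_e)
    also have "\<dots> = \<gamma> (r n)" by (rule distr_id2) (simp add: \<gamma>D)
    finally show ?thesis .
  qed
  \<comment> \<open>Decoding loses nothing, because the law of \<open>U n\<close> is carried by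
  the range of \<open>e\<close>.\<close>
  have "AE \<omega> in \<Omega>. e (z n \<omega>) = U n \<omega>" for n
  proof -
    have "AE u in \<rho> (r n). e (dec u) = u"
      unfolding \<rho>_def by (subst AE_distr_iff) (simp_all add: dec_e)
    then have "AE u in distr \<Omega> borel (U n). e (dec u) = u" by (simp only: U_distr)
    then show ?thesis by (subst (asm) AE_distr_iff) (simp_all add: z_def)
  qed
  then have "AE \<omega> in \<Omega>. \<forall>n. e (z n \<omega>) = U n \<omega>" by (simp add: AE_all_countable)
  then have ez_conv: "AE \<omega> in \<Omega>. convergent (\<lambda>n. e (z n \<omega>))"
  proof (rule AE_mp, intro AE_I2 impI)
    fix \<omega> assume "\<omega> \<in> space \<Omega>" "\<forall>n. e (z n \<omega>) = U n \<omega>"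
    then show "convergent (\<lambda>n. e (z n \<omega>))" using U_lim[of \<omega>] by (auto simp: convergent_def)
  qed
  \<comment> \<open>Finitely many of the balls cover a compact set, so that eventually missing
  every ball means eventually leaving the compact set. Fatou bounds the probability of this by
  \<open>\<epsilon>\<close>.\<close>
  have total: "AE \<omega> in \<Omega>. \<exists>k. \<exists>\<^sub>F n in sequentially. dist (z n \<omega>) (d k) < 1 / 2 ^ m" for m
  proof -
    define bad where "bad = {\<omega>\<in>space \<Omega>. \<forall>k. \<forall>\<^sub>F n in sequentially. \<not> dist (z n \<omega>) (d k) < 1 / 2 ^ m}"
    have [measurable]: "bad \<in> sets \<Omega>"
      unfolding bad_def eventually_sequentially by measurable
    have "emeasure \<Omega> bad \<le> ennreal \<epsilon>" if \<epsilon>: "0 < \<epsilon>" for \<epsilon> :: real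
    proof -
      obtain K where K: "compact K" "\<And>n. emeasure (\<gamma> n) (- K) \<le> ennreal \<epsilon>"
        using tight[OF \<epsilon>] by blast
      have "K \<subseteq> (\<Union>k. ball (d k) (1 / 2 ^ m))"
        using d[of "1 / 2 ^ m"] by (auto simp: dist_commute)
      then obtain J where J: "finite J" "K \<subseteq> (\<Union>k\<in>J. ball (d k) (1 / 2 ^ m))"
        using compactE_image[OF K(1), of UNIV "\<lambda>k. ball (d k) (1 / 2 ^ m)"] by auto
      have [measurable]: "- K \<in> sets borel"
        using K(1) by (simp add: compact_imp_closed open_Compl)
      have *: "indicator bad \<omega> \<le> liminf (\<lambda>n. indicator (- K) (z n \<omega>) :: ennreal)" for \<omega>
      proof (cases "\<omega> \<in> bad")
        case True
        then have "\<forall>\<^sub>F n in sequentially. \<forall>k\<in>J. \<not> dist (z n \<omega>) (d k) < 1 / 2 ^ m"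
          using J(1) by (simp add: bad_def eventually_ball_finite)
        then have "\<forall>\<^sub>F n in sequentially. 1 \<le> (indicator (- K) (z n \<omega>) :: ennreal)"
          by eventually_elim (use J(2) in \<open>auto simp: indicator_def dist_commute\<close>)
        then show ?thesis using True by (simp add: Liminf_bounded)
      qed simp
      have "emeasure \<Omega> bad = (\<integral>\<^sup>+\<omega>. indicator bad \<omega> \<partial>\<Omega>)" by simp
      also have "\<dots> \<le> (\<integral>\<^sup>+\<omega>. liminf (\<lambda>n. indicator (- K) (z n \<omega>)) \<partial>\<Omega>)"
        by (intro nn_integral_mono *)
      also have "\<dots> \<le> liminf (\<lambda>n. \<integral>\<^sup>+\<omega>. indicator (- K) (z n \<omega>) \<partial>\<Omega>)"
        by (intro nn_integral_liminf) measurable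
      also have "\<dots> = liminf (\<lambda>n. emeasure (\<gamma> (r n)) (- K))"
      proof (intro arg_cong[where f = liminf] ext)
        fix n
        have "(\<integral>\<^sup>+\<omega>. indicator (- K) (z n \<omega>) \<partial>\<Omega>) = (\<integral>\<^sup>+y. indicator (- K) y \<partial>distr \<Omega> borel (z n))"
          by (subst nn_integral_distr) simp_all
        also have "\<dots> = emeasure (\<gamma> (r n)) (- K)"
          unfolding z_distr by (rule nn_integral_indicator) (simp add: \<gamma>D)
        finally show "(\<integral>\<^sup>+\<omega>. indicator (- K) (z n \<omega>) \<partial>\<Omega>) = emeasure (\<gamma> (r n)) (- K)" .
      qed
      also have "\<dots> \<le> ennreal \<epsilon>"
        by (intro Liminf_le) (simp_all add: K)
      finally show ?thesis .
    qed
    then have "emeasure \<Omega> bad \<le> 0 + ennreal \<epsilon>" if "0 < \<epsilon>" for \<epsilon> :: real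
      using that by simp
    then have "emeasure \<Omega> bad \<le> 0" by (rule ennreal_le_epsilon)
    then have "bad \<in> null_sets \<Omega>" by (intro null_setsI) simp_all
    then have "AE \<omega> in \<Omega>. \<omega> \<notin> bad" by (rule AE_not_in)
    then show ?thesis
    proof (rule AE_mp, intro AE_I2 impI)
      fix \<omega> assume "\<omega> \<in> space \<Omega>" "\<omega> \<notin> bad"
      then show "\<exists>k. \<exists>\<^sub>F n in sequentially. dist (z n \<omega>) (d k) < 1 / 2 ^ m"
        unfolding bad_def frequently_def by blast
    qed
  qed
  have Cauchy: "AE \<omega> in \<Omega>. Cauchy (\<lambda>n. z n \<omega>)"
  proof -
    have "AE \<omega> in \<Omega>. \<forall>m. \<exists>k. \<exists>\<^sub>F n in sequentially. dist (z n \<omega>) (d k) < 1 / 2 ^ m"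
      using total by (simp add: AE_all_countable)
    then show ?thesis using ez_conv
    proof eventually_elim
      case (elim \<omega>)
      show "Cauchy (\<lambda>n. z n \<omega>)"
      proof (rule metric_CauchyI)
        fix \<epsilon> :: real assume "0 < \<epsilon>"
        then obtain m where m: "(1 / 2 :: real) ^ m < \<epsilon> / 2"
          using real_arch_pow_inv[of "\<epsilon> / 2" "1 / 2"] by auto
        obtain k where "\<exists>\<^sub>F n in sequentially. dist (z n \<omega>) (d k) < 1 / 2 ^ m" using elim(1) by blast
        then have "\<forall>\<^sub>F n in sequentially. dist (z n \<omega>) (d k) < 1 / 2 ^ m"
          using e_conv[OF elim(2), of k m] unfolding frequently_def by blast
        then have "\<forall>\<^sub>F n in sequentially. dist (z n \<omega>) (d k) < \<epsilon> / 2"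
        proof (rule eventually_mono)
          fix n assume "dist (z n \<omega>) (d k) < 1 / 2 ^ m"
          with m show "dist (z n \<omega>) (d k) < \<epsilon> / 2" by (simp add: power_divide)
        qed
        then obtain n0 where n0: "\<And>n. n \<ge> n0 \<Longrightarrow> dist (z n \<omega>) (d k) < \<epsilon> / 2"
          unfolding eventually_sequentially by blast
        show "\<exists>M. \<forall>i\<ge>M. \<forall>n\<ge>M. dist (z i \<omega>) (z n \<omega>) < \<epsilon>"
          by (intro exI[of _ n0] allI impI dist_triangle_half_l[OF n0 n0])
      qed
    qed
  qed
  obtain z0 where z0: "z0 \<in> borel_measurable \<Omega>"
    "\<And>\<omega>. Cauchy (\<lambda>n. z n \<omega>) \<Longrightarrow> (\<lambda>n. z n \<omega>) \<longlonglongrightarrow> z0 \<omega>"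
    using measurable_Cauchy_limit[of z \<Omega>, OF z] by metis
  show ?thesis
  proof (rule that[OF r \<Omega> z z0(1) z_distr])
    show "AE \<omega> in \<Omega>. (\<lambda>n. z n \<omega>) \<longlonglongrightarrow> z0 \<omega>"
      using Cauchy by (rule eventually_mono) (rule z0(2))
  qed
qed

section \<open>Kernels and disintegration\<close>

lemma measurable_family_iff:
  "measurable_family K \<longleftrightarrow> K \<in> borel \<rightarrow>\<^sub>M prob_algebra borel"
proof
  assume K: "measurable_family K"
  show "K \<in> borel \<rightarrow>\<^sub>M prob_algebra borel"
    using K unfolding measurable_family_def borel_probs_def
    by (intro measurable_prob_algebraI measurable_subprob_algebra)
       (auto intro: prob_space_imp_subprob_space)
next
  assume K: "K \<in> borel \<rightarrow>\<^sub>M prob_algebra borel"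
  show "measurable_family K"
    unfolding measurable_family_def borel_probs_def
  proof (intro conjI allI ballI CollectI)
    fix x
    have "K x \<in> space (prob_algebra borel)" using measurable_space[OF K, of x] by simp
    then show "prob_space (K x)" "sets (K x) = sets borel"
      by (auto simp: space_prob_algebra)
  next
    fix B :: "'b set" assume "B \<in> sets borel"
    then show "(\<lambda>x. emeasure (K x) B) \<in> borel_measurable borel"
      using measurable_prob_algebraD[OF K]
      by (intro measurable_emeasure_kernel) simp_all
  qed
qed

lemma measurable_family_kernel:
  "measurable_family K \<Longrightarrow> K \<in> borel \<rightarrow>\<^sub>M subprob_algebra borel"
  by (simp add: measurable_family_iff measurable_prob_algebraD)

lemma measurable_familyD:
  assumes "measurable_family K"
  shows "prob_space (K x)" "sets (K x) = sets borel" "space (K x) = UNIV"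
  using assms borel_probsD[of "K x"] by (auto simp: measurable_family_def)

definition joint ::
  "'x::topological_space measure \<Rightarrow> ('x \<Rightarrow> 'y::topological_space measure) \<Rightarrow> ('x \<times> 'y) measure" where
  "joint \<mu> K = \<mu> \<bind> (\<lambda>x. distr (K x) borel (Pair x))"

lemma measurable_joint_kernel:
  fixes K :: "'x::second_countable_topology \<Rightarrow> 'y::second_countable_topology measure"
  assumes "measurable_family K"
  shows "(\<lambda>x. distr (K x) borel (Pair x)) \<in> borel \<rightarrow>\<^sub>M prob_algebra borel"
proof (rule measurable_prob_algebraI)
  note [measurable] = measurable_family_kernel[OF assms]
  show "prob_space (distr (K x) borel (Pair x))" for x
    using measurable_familyD[OF assms, of x]
    by (intro prob_space.prob_space_distr) (auto simp: borel_prod[symmetric] cong: measurable_cong_sets)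
  have "(\<lambda>(x, y). (x, y)) \<in> borel \<Otimes>\<^sub>M borel \<rightarrow>\<^sub>M (borel :: ('x \<times> 'y) measure)"
    by (simp add: borel_prod)
  from measurable_distr2[OF this measurable_family_kernel[OF assms]]
  show "(\<lambda>x. distr (K x) borel (Pair x)) \<in> borel \<rightarrow>\<^sub>M subprob_algebra borel" by simp
qed

lemma
  fixes K :: "'x::second_countable_topology \<Rightarrow> 'y::second_countable_topology measure"
  assumes \<mu>: "\<mu> \<in> borel_probs" and K: "measurable_family K"
  shows nn_integral_joint: "f \<in> borel_measurable borel \<Longrightarrow>
      (\<integral>\<^sup>+p. f p \<partial>joint \<mu> K) = (\<integral>\<^sup>+x. \<integral>\<^sup>+y. f (x, y) \<partial>K x \<partial>\<mu>)"
    and joint_coupling: "joint \<mu> K \<in> couplings_of \<mu>"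
proof -
  note D = borel_probsD[OF \<mu>] and KD = measurable_familyD[OF K]
  let ?D = "\<lambda>x. distr (K x) borel (Pair x)"
  have D\<mu>: "?D \<in> \<mu> \<rightarrow>\<^sub>M prob_algebra borel"
    using measurable_joint_kernel[OF K] D(2) by (simp cong: measurable_cong_sets)
  have Pair: "Pair x \<in> K x \<rightarrow>\<^sub>M borel" for x
    using KD(2)[of x] by (auto simp: borel_prod[symmetric] cong: measurable_cong_sets)
  have int: "(\<integral>\<^sup>+p. f p \<partial>joint \<mu> K) = (\<integral>\<^sup>+x. \<integral>\<^sup>+y. f (x, y) \<partial>K x \<partial>\<mu>)"
    if f: "f \<in> borel_measurable borel" for f
    unfolding joint_def
    by (subst nn_integral_bind[OF f measurable_prob_algebraD[OF D\<mu>]])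
       (simp add: nn_integral_distr Pair f)
  then show "f \<in> borel_measurable borel \<Longrightarrow>
      (\<integral>\<^sup>+p. f p \<partial>joint \<mu> K) = (\<integral>\<^sup>+x. \<integral>\<^sup>+y. f (x, y) \<partial>K x \<partial>\<mu>)" .
  interpret \<mu>: prob_space \<mu> by (rule D)
  have P: "joint \<mu> K \<in> borel_probs"
    unfolding borel_probs_def
  proof (intro CollectI conjI)
    show "prob_space (joint \<mu> K)"
      unfolding joint_def
      by (rule \<mu>.prob_space_bind[OF AE_I2 measurable_prob_algebraD[OF D\<mu>]])
         (rule prob_space.prob_space_distr[OF KD(1) Pair])
    show "sets (joint \<mu> K) = sets borel"
      unfolding joint_def using \<mu>.not_empty by (intro sets_bind) simp_all
  qed
  have "distr (joint \<mu> K) borel fst = \<mu>"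
  proof (rule measure_eqI)
    show "sets (distr (joint \<mu> K) borel fst) = sets \<mu>" by (simp add: D)
    fix A :: "'x set" assume "A \<in> sets (distr (joint \<mu> K) borel fst)"
    then have A: "A \<in> sets borel" by simp
    note J = borel_probsD[OF P]
    have fst: "fst \<in> joint \<mu> K \<rightarrow>\<^sub>M borel"
      using J(2) by (auto simp: borel_prod[symmetric] cong: measurable_cong_sets)
    have "emeasure (distr (joint \<mu> K) borel fst) A = (\<integral>\<^sup>+x. indicator A x \<partial>distr (joint \<mu> K) borel fst)"
      using A by simp
    also have "\<dots> = (\<integral>\<^sup>+p. indicator A (fst p) \<partial>joint \<mu> K)"
      using A fst by (subst nn_integral_distr) simp_all
    also have "\<dots> = (\<integral>\<^sup>+x. \<integral>\<^sup>+y. indicator A x \<partial>K x \<partial>\<mu>)"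
      using A by (subst int) (simp_all add: borel_prod[symmetric])
    also have "\<dots> = (\<integral>\<^sup>+x. indicator A x \<partial>\<mu>)"
      using KD prob_space.emeasure_space_1[OF KD(1)] by simp
    also have "\<dots> = emeasure \<mu> A" using A D by simp
    finally show "emeasure (distr (joint \<mu> K) borel fst) A = emeasure \<mu> A" .
  qed
  with P show "joint \<mu> K \<in> couplings_of \<mu>" by (simp add: couplings_of_def)
qed

lemma AE_le_if_set_nn_integral_le:
  fixes f g :: "'a \<Rightarrow> ennreal"
  assumes [measurable]: "f \<in> borel_measurable M" "g \<in> borel_measurable M"
    and fin: "(\<integral>\<^sup>+x. g x \<partial>M) < \<infinity>"
    and le: "\<And>A. A \<in> sets M \<Longrightarrow> (\<integral>\<^sup>+x. f x * indicator A x \<partial>M) \<le> (\<integral>\<^sup>+x. g x * indicator A x \<partial>M)"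
  shows "AE x in M. f x \<le> g x"
proof -
  define A where "A = {x\<in>space M. g x < f x}"
  have [measurable]: "A \<in> sets M" unfolding A_def by measurable
  have fin': "(\<integral>\<^sup>+x. g x * indicator A x \<partial>M) < \<infinity>"
    by (rule le_less_trans[OF nn_integral_mono fin]) (auto simp: indicator_def)
  have "(\<integral>\<^sup>+x. f x * indicator A x - g x * indicator A x \<partial>M) =
      (\<integral>\<^sup>+x. f x * indicator A x \<partial>M) - (\<integral>\<^sup>+x. g x * indicator A x \<partial>M)"
    using fin' by (intro nn_integral_diff) (auto simp: A_def indicator_def less_imp_le)
  also have "\<dots> = 0"
    using le[of A] fin' by (intro diff_eq_0_ennreal) (auto intro: le_less_trans)
  finally have "AE x in M. f x * indicator A x - g x * indicator A x = 0"
    by (subst (asm) nn_integral_0_iff_AE) simp_all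
  then show ?thesis
  proof (rule AE_mp, intro AE_I2 impI)
    fix x assume "x \<in> space M" "f x * indicator A x - g x * indicator A x = 0"
    then show "f x \<le> g x"
      by (cases "x \<in> A") (auto simp: A_def diff_eq_0_iff_ennreal)
  qed
qed

text \<open>
  The conditional distribution functions are the Radon-Nikodym derivatives \<open>g t\<close> of
  \<open>A \<mapsto> N (A \<times> {..t})\<close> with respect to \<open>M\<close>. Monotonicity
  and the limits 0 and 1 hold for them almost everywhere, outside a single null set if
  \<open>t\<close> runs through the rationals only. Taking infima over larger rationals then
  yields right-continuous distribution functions, and these still have the prescribed integrals.
  On the null set any probability measure will do.
\<close>

lemma disintegration_real:
  assumes M: "prob_space M" and N: "prob_space N" "sets N = sets (M \<Otimes>\<^sub>M (borel :: real measure))"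
    and marginal: "distr N M fst = M"
  obtains K where "K \<in> M \<rightarrow>\<^sub>M prob_algebra borel"
    "\<And>A B. A \<in> sets M \<Longrightarrow> B \<in> sets borel \<Longrightarrow>
       emeasure N (A \<times> B) = (\<integral>\<^sup>+x. emeasure (K x) B * indicator A x \<partial>M)"
proof -
  interpret M: prob_space M by fact
  interpret N: prob_space N by fact
  note [measurable_cong] = N(2)
  have le_M: "emeasure N (A \<times> B) \<le> emeasure M A" if [measurable]: "A \<in> sets M" "B \<in> sets borel" for A B
  proof -
    have "emeasure M A = emeasure (distr N M fst) A" by (simp add: marginal)
    also have "\<dots> = emeasure N (fst -` A \<inter> space N)" by (rule emeasure_distr) measurable
    also have "\<dots> \<ge> emeasure N (A \<times> B)"
      using sets.sets_into_space[OF that(1)] sets_eq_imp_space_eq[OF N(2)]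
      by (intro emeasure_mono) (auto simp: space_pair_measure)
    finally show ?thesis .
  qed
  have "\<exists>g\<in>borel_measurable M. \<forall>A\<in>sets M.
      (\<integral>\<^sup>+x. g x * indicator A x \<partial>M) = emeasure N (A \<times> {..t})" for t
  proof -
    define Nt where "Nt = distr (density N (indicator (space M \<times> {..t}))) M fst"
    have [measurable]: "fst \<in> N \<rightarrow>\<^sub>M M" by measurable
    have Nt: "emeasure Nt A = emeasure N (A \<times> {..t})" if [measurable]: "A \<in> sets M" for A
    proof -
      have "emeasure Nt A = (\<integral>\<^sup>+p. indicator (space M \<times> {..t}) p * indicator (fst -` A \<inter> space N) p \<partial>N)"
        unfolding Nt_def by (subst emeasure_distr) (simp_all add: emeasure_density)
      also have "\<dots> = (\<integral>\<^sup>+p. indicator (A \<times> {..t}) p \<partial>N)"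
        using sets.sets_into_space[OF that(1)] sets_eq_imp_space_eq[OF N(2)]
        by (intro nn_integral_cong) (auto simp: indicator_def space_pair_measure)
      also have "\<dots> = emeasure N (A \<times> {..t})" by simp
      finally show ?thesis .
    qed
    have "absolutely_continuous M Nt"
      unfolding absolutely_continuous_def
    proof
      fix A assume "A \<in> null_sets M"
      then have "A \<in> sets M" "emeasure M A = 0" by auto
      then show "A \<in> null_sets Nt"
        using Nt[of A] le_M[of A "{..t}"] by (auto simp: null_sets_def Nt_def)
    qed
    from M.Radon_Nikodym[OF this] obtain g where g: "g \<in> borel_measurable M" "density M g = Nt"
      by (auto simp: Nt_def)
    show ?thesis
      by (rule bexI[OF _ g(1)]) (use g Nt in \<open>auto simp: emeasure_density[symmetric]\<close>)
  qed
  then obtain g where g [measurable]: "\<And>t. g t \<in> borel_measurable M"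
    and g_int: "\<And>t A. A \<in> sets M \<Longrightarrow> (\<integral>\<^sup>+x. g t x * indicator A x \<partial>M) = emeasure N (A \<times> {..t})"
    by metis
  have g_int': "(\<integral>\<^sup>+x. g t x \<partial>M) = emeasure N (space M \<times> {..t})" for t
    unfolding g_int[OF sets.top, symmetric] by (intro nn_integral_cong) simp
  have spaceN: "space N = space M \<times> UNIV"
    using sets_eq_imp_space_eq[OF N(2)] by (simp add: space_pair_measure)
  have g_mono: "AE x in M. g s x \<le> g t x" if "s \<le> t" for s t
  proof (rule AE_le_if_set_nn_integral_le)
    show "(\<integral>\<^sup>+x. g t x \<partial>M) < \<infinity>"
      unfolding g_int' using N.emeasure_finite by (simp add: less_top[symmetric])
    fix A assume [measurable]: "A \<in> sets M"
    show "(\<integral>\<^sup>+x. g s x * indicator A x \<partial>M) \<le> (\<integral>\<^sup>+x. g t x * indicator A x \<partial>M)"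
      using that by (simp add: g_int) (intro emeasure_mono, auto)
  qed measurable
  have g_le_1: "AE x in M. g t x \<le> 1" for t
  proof (rule AE_le_if_set_nn_integral_le)
    fix A assume [measurable]: "A \<in> sets M"
    show "(\<integral>\<^sup>+x. g t x * indicator A x \<partial>M) \<le> (\<integral>\<^sup>+x. 1 * indicator A x \<partial>M)"
      by (simp add: g_int le_M)
  qed (simp_all add: M.emeasure_space_1)
  have g_bot: "AE x in M. (INF n::nat. g (- real n) x) = 0"
  proof -
    have le: "(\<integral>\<^sup>+x. (INF n::nat. g (- real n) x) \<partial>M) \<le> emeasure N (space M \<times> {..- real n})" for n
      unfolding g_int'[symmetric] by (intro nn_integral_mono INF_lower) simp
    have empty: "(\<Inter>n::nat. space M \<times> {..- real n}) = {}"
    proof -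
      have "\<exists>n::nat. \<not> y \<le> - real n" for y :: real
      proof -
        obtain n :: nat where "- y < real n" using reals_Archimedean2 by blast
        then show ?thesis by (intro exI[of _ n]) simp
      qed
      then show ?thesis by auto
    qed
    have "(\<integral>\<^sup>+x. (INF n::nat. g (- real n) x) \<partial>M) \<le> (INF n::nat. emeasure N (space M \<times> {..- real n}))"
      by (intro INF_greatest le)
    also have "\<dots> = emeasure N (\<Inter>n::nat. space M \<times> {..- real n})"
    proof (rule INF_emeasure_decseq)
      show "range (\<lambda>n::nat. space M \<times> {..- real n}) \<subseteq> sets N" by auto
    qed (auto simp: decseq_def)
    finally have "(\<integral>\<^sup>+x. (INF n::nat. g (- real n) x) \<partial>M) = 0" unfolding empty by simp
    then show ?thesis by (subst (asm) nn_integral_0_iff_AE) simp_all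
  qed
  have g_top: "AE x in M. (SUP n::nat. g (real n) x) = 1"
  proof -
    have "emeasure N (\<Union>n::nat. space M \<times> {..real n}) = (SUP n::nat. emeasure N (space M \<times> {..real n}))"
    proof (rule SUP_emeasure_incseq[symmetric])
      show "range (\<lambda>n::nat. space M \<times> {..real n}) \<subseteq> sets N" by auto
    qed (auto simp: incseq_def)
    also have "(\<Union>n::nat. space M \<times> {..real n}) = space N"
      using real_arch_simple by (auto simp: spaceN)
    finally have "1 = (SUP n::nat. \<integral>\<^sup>+x. g (real n) x \<partial>M)"
      by (simp add: N.emeasure_space_1 g_int')
    also have "\<dots> \<le> (\<integral>\<^sup>+x. (SUP n::nat. g (real n) x) \<partial>M)"
      by (intro SUP_least nn_integral_mono SUP_upper) simp
    finally have ge: "1 \<le> (\<integral>\<^sup>+x. (SUP n::nat. g (real n) x) \<partial>M)" .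
    have le1: "AE x in M. (SUP n::nat. g (real n) x) \<le> 1"
    proof -
      have "AE x in M. \<forall>n::nat. g (real n) x \<le> 1" using g_le_1 by (simp add: AE_all_countable)
      then show ?thesis by eventually_elim (simp add: SUP_le_iff)
    qed
    have "(\<integral>\<^sup>+x. (SUP n::nat. g (real n) x) \<partial>M) \<le> (\<integral>\<^sup>+x. 1 \<partial>M)"
      by (rule nn_integral_mono_AE[OF le1])
    then have "(\<integral>\<^sup>+x. (SUP n::nat. g (real n) x) \<partial>M) \<noteq> \<infinity>"
      by (auto simp: M.emeasure_space_1 top_unique)
    then have "(\<integral>\<^sup>+x. 1 - (SUP n::nat. g (real n) x) \<partial>M) = 1 - (\<integral>\<^sup>+x. (SUP n::nat. g (real n) x) \<partial>M)"
      by (subst nn_integral_diff[OF _ _ _ le1]) (simp_all add: M.emeasure_space_1)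
    also have "\<dots> = 0" using ge by (intro diff_eq_0_ennreal) simp_all
    finally have "AE x in M. 1 - (SUP n::nat. g (real n) x) = 0"
      by (subst (asm) nn_integral_0_iff_AE) simp_all
    with le1 show ?thesis by eventually_elim (auto simp: diff_eq_0_iff_ennreal intro: antisym)
  qed
  define good where "good x \<longleftrightarrow> (\<forall>p q::rat. p \<le> q \<longrightarrow> g (of_rat p) x \<le> g (of_rat q) x) \<and>
    (\<forall>q::rat. g (of_rat q) x \<le> 1) \<and>
    (INF n::nat. g (- real n) x) = 0 \<and> (SUP n::nat. g (real n) x) = 1" for x
  have good_meas [measurable]: "Measurable.pred M good"
    unfolding good_def by measurable
  have good_AE: "AE x in M. good x"
  proof -
    have "AE x in M. \<forall>p q::rat. p \<le> q \<longrightarrow> g (of_rat p) x \<le> g (of_rat q) x"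
      unfolding AE_all_countable using g_mono by (auto simp: of_rat_less_eq)
    moreover have "AE x in M. \<forall>q::rat. g (of_rat q) x \<le> 1"
      unfolding AE_all_countable using g_le_1 by blast
    ultimately show ?thesis
      unfolding good_def using g_bot g_top by eventually_elim simp
  qed
  define G where "G x t = (INF q\<in>{q::rat. t < of_rat q}. g (of_rat q) x)" for x and t :: real
  have G_meas [measurable]: "(\<lambda>x. G x t) \<in> borel_measurable M" for t
    unfolding G_def by (intro borel_measurable_INF) auto
  define F where "F x t = enn2real (G x t)" for x t
  have rat_above: "\<exists>q::rat. t < of_rat q" for t :: real
    using of_rat_dense[of t "t + 1"] by auto
  have G_le_1: "G x t \<le> 1" if "good x" for x t
    using rat_above[of t] that unfolding G_def good_def by (auto intro: INF_lower2)
  have F_G: "ennreal (F x t) = G x t" if "good x" for x t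
    using G_le_1[OF that, of t] unfolding F_def
    by (intro ennreal_enn2real) (auto simp: le_less_trans[OF _ ennreal_one_less_top])
  have G_mono: "G x s \<le> G x t" if "s \<le> t" for x s t
    unfolding G_def using that by (intro INF_superset_mono) auto
  have F_mono: "F x s \<le> F x t" if "good x" "s \<le> t" for x s t
    using G_mono[OF that(2), of x] G_le_1[OF that(1), of t] unfolding F_def
    by (intro enn2real_mono) (auto simp: le_less_trans[OF _ ennreal_one_less_top])
  have F_cont: "continuous (at_right a) (F x)" if "good x" for x a
  proof (subst continuous_within, rule decreasing_tendsto)
    show "\<forall>\<^sub>F t in at_right a. F x a \<le> F x t"
      using F_mono[OF that] by (auto simp: eventually_at_filter)
    fix l assume "F x a < l"
    then have "G x a < ennreal l"
      unfolding F_G[OF that, symmetric] by (simp add: F_def ennreal_less_iff)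
    then obtain q :: rat where q: "a < of_rat q" "g (of_rat q) x < ennreal l"
      unfolding G_def by (auto simp: INF_less_iff)
    have "F x t < l" if t: "t < of_rat q" for t
    proof -
      have "ennreal (F x t) \<le> g (of_rat q) x"
        unfolding F_G[OF \<open>good x\<close>] unfolding G_def using t by (auto intro: INF_lower)
      with q(2) have "ennreal (F x t) < ennreal l" by simp
      then show ?thesis by (simp add: F_def ennreal_less_iff)
    qed
    then show "\<forall>\<^sub>F t in at_right a. F x t < l"
      using eventually_at_right_less[of a] eventually_at_right_field q(1) by blast
  qed
  have F_bot: "(F x \<longlongrightarrow> 0) at_bot" if "good x" for x
  proof (rule decreasing_tendsto)
    fix l :: real assume "0 < l"
    then have "(INF n::nat. g (- real n) x) < ennreal l" using that by (simp add: good_def)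
    then obtain n :: nat where n: "g (- real n) x < ennreal l" by (auto simp: INF_less_iff)
    have "F x t < l" if t: "t < - real n" for t
    proof -
      have "ennreal (F x t) \<le> g (- real n) x"
        unfolding F_G[OF \<open>good x\<close>] unfolding G_def using t
        by (intro INF_lower2[of "- of_nat n"]) (auto simp: of_rat_minus)
      with n have "ennreal (F x t) < ennreal l" by simp
      then show ?thesis by (simp add: F_def ennreal_less_iff)
    qed
    then show "\<forall>\<^sub>F t in at_bot. F x t < l"
      unfolding eventually_at_bot_dense by blast
  qed (simp add: F_def)
  have F_top: "(F x \<longlongrightarrow> 1) at_top" if "good x" for x
  proof (rule increasing_tendsto)
    have "ennreal (F x t) \<le> ennreal 1" for t using G_le_1[OF that] F_G[OF that] by simp
    then show "\<forall>\<^sub>F t in at_top. F x t \<le> 1" by (simp add: ennreal_le_iff)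
    fix l :: real assume l: "l < 1"
    show "\<forall>\<^sub>F t in at_top. l < F x t"
    proof (cases "l < 0")
      case True
      then have "l < F x t" for t unfolding F_def using enn2real_nonneg[of "G x t"] by linarith
      then show ?thesis by simp
    next
      case False
      then have "ennreal l < (SUP n::nat. g (real n) x)"
        using that l by (simp add: good_def ennreal_less_one_iff)
      then obtain n :: nat where n: "ennreal l < g (real n) x" by (auto simp: less_SUP_iff)
      have "l < F x t" if t: "real n < t" for t
      proof -
        have "g (real n) x \<le> G x t"
          unfolding G_def
        proof (rule INF_greatest)
          fix q assume "q \<in> {q::rat. t < of_rat q}"
          with t have "of_nat n \<le> q"
            by (metis mem_Collect_eq less_imp_le less_trans of_rat_less of_rat_of_nat_eq)
          with \<open>good x\<close> show "g (real n) x \<le> g (of_rat q) x"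
            unfolding good_def by (metis of_rat_of_nat_eq)
        qed
        with n have "ennreal l < ennreal (F x t)" unfolding F_G[OF \<open>good x\<close>] by simp
        then show ?thesis using False by (simp add: ennreal_less_iff)
      qed
      then show ?thesis unfolding eventually_at_top_dense by blast
    qed
  qed
  define K where "K x = (if good x then interval_measure (F x) else return borel (0::real))" for x
  have dist: "real_distribution (interval_measure (F x))" if "good x" for x
    using that by (intro real_distribution_interval_measure F_mono F_cont F_bot F_top)
  have K_Iic: "emeasure (K x) {..t} = (if good x then G x t else indicator {..t} 0)" for x t
  proof (cases "good x")
    case True
    interpret R: real_distribution "interval_measure (F x)" using dist[OF True] .
    have "cdf (interval_measure (F x)) = F x"
      using True by (intro cdf_interval_measure F_mono F_cont F_bot)
    then have "measure (interval_measure (F x)) {..t} = F x t" by (simp add: cdf_def fun_eq_iff)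
    then show ?thesis using True by (simp add: K_def R.emeasure_eq_measure F_G)
  qed (simp add: K_def)
  have K_prob: "prob_space (K x)" for x
    using dist[of x] by (auto simp: K_def real_distribution_def intro: prob_space_return)
  have K_sets: "sets (K x) = sets borel" for x by (simp add: K_def)
  have K_meas: "K \<in> M \<rightarrow>\<^sub>M prob_algebra borel"
  proof (rule measurable_prob_algebra_generated)
    show "sets borel = sigma_sets UNIV (range (\<lambda>t::real. {..t}))"
      unfolding borel_eq_atMost by (simp add: sets_measure_of)
    show "Int_stable (range (\<lambda>t::real. {..t}))"
      by (auto simp: Int_stable_def)
    show "(\<lambda>x. emeasure (K x) A) \<in> borel_measurable M" if "A \<in> range (\<lambda>t::real. {..t})" for A
      using that by (auto simp: K_Iic)
  qed (auto simp: K_prob K_sets)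
  have Iic: "(\<integral>\<^sup>+x. emeasure (K x) {..t} * indicator A x \<partial>M) = emeasure N (A \<times> {..t})"
    if [measurable]: "A \<in> sets M" for A t
  proof -
    have *: "(\<integral>\<^sup>+x. emeasure (K x) {..t} * indicator A x \<partial>M) = (\<integral>\<^sup>+x. G x t * indicator A x \<partial>M)"
      using good_AE by (intro nn_integral_cong_AE) (auto simp: K_Iic elim!: eventually_mono)
    show ?thesis unfolding *
    proof (rule antisym)
      have "(\<integral>\<^sup>+x. G x t * indicator A x \<partial>M) \<le> emeasure N (A \<times> {..t + 1 / Suc n})" for n
      proof -
        obtain q :: rat where q: "t < of_rat q" "of_rat q < t + 1 / Suc n"
          using of_rat_dense[of t "t + 1 / Suc n"] by auto
        have "(\<integral>\<^sup>+x. G x t * indicator A x \<partial>M) \<le> (\<integral>\<^sup>+x. g (of_rat q) x * indicator A x \<partial>M)"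
          unfolding G_def using q(1) by (intro nn_integral_mono mult_right_mono INF_lower) auto
        also have "\<dots> = emeasure N (A \<times> {..of_rat q})" by (simp add: g_int)
        also have "\<dots> \<le> emeasure N (A \<times> {..t + 1 / Suc n})"
          using q(2) by (intro emeasure_mono) auto
        finally show ?thesis .
      qed
      then have "(\<integral>\<^sup>+x. G x t * indicator A x \<partial>M) \<le> (INF n. emeasure N (A \<times> {..t + 1 / Suc n}))"
        by (intro INF_greatest)
      also have "\<dots> = emeasure N (\<Inter>n. A \<times> {..t + 1 / Suc n})"
      proof (rule INF_emeasure_decseq)
        show "range (\<lambda>n. A \<times> {..t + 1 / Suc n}) \<subseteq> sets N" by auto
        have "t + 1 / real (Suc n) \<le> t + 1 / real (Suc m)" if "m \<le> n" for m n
          using that by (intro add_left_mono divide_left_mono) auto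
        then show "decseq (\<lambda>n. A \<times> {..t + 1 / Suc n})"
          unfolding decseq_def by (intro allI impI Sigma_mono order_refl) (simp only: atMost_subset_iff)
      qed simp
      also have "(\<Inter>n. A \<times> {..t + 1 / Suc n}) = A \<times> {..t}"
      proof -
        have "y \<le> t" if y: "\<And>n. y \<le> t + 1 / Suc n" for y
        proof (rule field_le_epsilon)
          fix \<epsilon> :: real assume "0 < \<epsilon>"
          then obtain n where "1 / real (Suc n) < \<epsilon>" using nat_approx_posE by blast
          then show "y \<le> t + \<epsilon>" using y[of n] by simp
        qed
        then have "{..t} = (\<Inter>n. {..t + 1 / Suc n})" by (auto intro: order_trans)
        then show ?thesis by auto
      qed
      finally show "(\<integral>\<^sup>+x. G x t * indicator A x \<partial>M) \<le> emeasure N (A \<times> {..t})" .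
      have "AE x in M. \<forall>q::rat. t < of_rat q \<longrightarrow> g t x \<le> g (of_rat q) x"
        using g_mono[of t] by (auto simp: AE_all_countable)
      then have "AE x in M. g t x * indicator A x \<le> G x t * indicator A x"
        unfolding G_def by eventually_elim (auto intro!: mult_right_mono INF_greatest)
      then have "(\<integral>\<^sup>+x. g t x * indicator A x \<partial>M) \<le> (\<integral>\<^sup>+x. G x t * indicator A x \<partial>M)"
        by (rule nn_integral_mono_AE)
      then show "emeasure N (A \<times> {..t}) \<le> (\<integral>\<^sup>+x. G x t * indicator A x \<partial>M)"
        by (simp add: g_int)
    qed
  qed
  show ?thesis
  proof (rule that[OF K_meas])
    fix A :: "'a set" and B :: "real set" assume A [measurable]: "A \<in> sets M" and B [measurable]: "B \<in> sets borel"
    have [measurable]: "snd \<in> N \<rightarrow>\<^sub>M borel" by measurable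
    note [measurable] = measurable_prob_algebraD[OF K_meas]
    \<comment> \<open>Both sides are finite measures in \<open>B\<close> with the same
    distribution function.\<close>
    define N1 where "N1 = distr (density N (indicator (A \<times> UNIV))) borel snd"
    define N2 where "N2 = density M (indicator A) \<bind> K"
    have N1: "emeasure N1 B = emeasure N (A \<times> B)" if [measurable]: "B \<in> sets borel" for B
    proof -
      have "emeasure N1 B = (\<integral>\<^sup>+p. indicator (A \<times> UNIV) p * indicator (snd -` B \<inter> space N) p \<partial>N)"
        unfolding N1_def by (subst emeasure_distr) (simp_all add: emeasure_density)
      also have "\<dots> = (\<integral>\<^sup>+p. indicator (A \<times> B) p \<partial>N)"
        by (intro nn_integral_cong) (auto simp: indicator_def)
      finally show ?thesis by simp
    qed
    have N2_sets: "sets N2 = sets borel"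
      unfolding N2_def using M.not_empty K_prob
      by (intro sets_bind) (auto simp: K_def)
    have N2: "emeasure N2 B = (\<integral>\<^sup>+x. emeasure (K x) B * indicator A x \<partial>M)" if [measurable]: "B \<in> sets borel" for B
    proof -
      have "emeasure N2 B = (\<integral>\<^sup>+x. emeasure (K x) B \<partial>density M (indicator A))"
        unfolding N2_def using M.not_empty by (intro emeasure_bind[where N = borel]) simp_all
      also have "\<dots> = (\<integral>\<^sup>+x. indicator A x * emeasure (K x) B \<partial>M)"
        by (subst nn_integral_density) (simp_all add: measurable_emeasure_kernel)
      finally show ?thesis by (simp add: mult.commute)
    qed
    have "finite_borel_measure N1"
    proof (intro finite_borel_measure.intro finite_borel_measure_axioms.intro finite_measureI)
      show "sets N1 = sets borel" by (simp add: N1_def)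
      show "emeasure N1 (space N1) \<noteq> \<infinity>"
        using N1[of UNIV] N.emeasure_finite by (simp add: N1_def)
    qed
    moreover have "finite_borel_measure N2"
    proof (intro finite_borel_measure.intro finite_borel_measure_axioms.intro finite_measureI)
      show "sets N2 = sets borel" by (rule N2_sets)
      have "space N2 = UNIV" using sets_eq_imp_space_eq[OF N2_sets] by simp
      then have "emeasure N2 (space N2) = (\<integral>\<^sup>+x. emeasure (K x) UNIV * indicator A x \<partial>M)"
        using N2[of UNIV] by simp
      also have "\<dots> \<le> (\<integral>\<^sup>+x. 1 \<partial>M)"
        using prob_space.emeasure_le_1[OF K_prob] by (intro nn_integral_mono) (auto simp: indicator_def)
      finally show "emeasure N2 (space N2) \<noteq> \<infinity>"
        by (auto simp: M.emeasure_space_1 top_unique)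
    qed
    moreover have "cdf N1 = cdf N2"
    proof
      fix t
      have "emeasure N1 {..t} = emeasure N2 {..t}"
        using N1[of "{..t}"] N2[of "{..t}"] Iic[OF A, of t] by simp
      then show "cdf N1 t = cdf N2 t" by (simp add: cdf_def measure_def)
    qed
    ultimately have "N1 = N2" by (rule cdf_unique')
    then show "emeasure N (A \<times> B) = (\<integral>\<^sup>+x. emeasure (K x) B * indicator A x \<partial>M)"
      using N1[OF B] N2[OF B] by metis
  qed
qed

text \<open>
  The real case, applied to codes of the second coordinate and decoded.
\<close>

lemma disintegration:
  fixes \<gamma> :: "('x::second_countable_topology \<times> 'y::{complete_space, second_countable_topology}) measure"
  assumes \<mu>: "\<mu> \<in> borel_probs" and \<gamma>: "\<gamma> \<in> couplings_of \<mu>"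
  obtains K where "measurable_family K" "\<gamma> = joint \<mu> K"
proof -
  obtain e :: "'y \<Rightarrow> real" and dec :: "real \<Rightarrow> 'y" and d :: "nat \<Rightarrow> 'y"
    where e [measurable]: "e \<in> borel_measurable borel" and dec [measurable]: "dec \<in> borel_measurable borel"
    and dec_e: "\<And>y. dec (e y) = y"
    by (rule borel_coding) (rule that)
  note \<mu>D = borel_probsD[OF \<mu>]
  have \<gamma>P: "\<gamma> \<in> borel_probs" and \<gamma>\<mu>: "distr \<gamma> borel fst = \<mu>" using \<gamma> by (auto simp: couplings_of_def)
  note \<gamma>D = borel_probsD[OF \<gamma>P]
  have [measurable_cong]: "sets \<gamma> = sets (borel \<Otimes>\<^sub>M borel)" "sets \<mu> = sets borel"
    using \<gamma>D(2) \<mu>D(2) unfolding borel_prod by auto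
  define code where "code p = (fst p, e (snd p))" for p :: "'x \<times> 'y"
  have [measurable]: "code \<in> \<gamma> \<rightarrow>\<^sub>M \<mu> \<Otimes>\<^sub>M borel" unfolding code_def by measurable
  define N where "N = distr \<gamma> (\<mu> \<Otimes>\<^sub>M borel) code"
  have N: "prob_space N" "sets N = sets (\<mu> \<Otimes>\<^sub>M borel)"
    using \<gamma>D(1) by (auto simp: N_def intro: prob_space.prob_space_distr)
  have "distr N \<mu> fst = distr \<gamma> \<mu> fst"
    unfolding N_def by (subst distr_distr) (simp_all add: comp_def code_def)
  also have "\<dots> = \<mu>"
    unfolding \<gamma>\<mu>[symmetric] by (rule distr_cong) simp_all
  finally have marginal: "distr N \<mu> fst = \<mu>" .
  obtain K' where K' [measurable]: "K' \<in> \<mu> \<rightarrow>\<^sub>M prob_algebra borel"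
    and N_rect: "\<And>A B. A \<in> sets \<mu> \<Longrightarrow> B \<in> sets borel \<Longrightarrow>
       emeasure N (A \<times> B) = (\<integral>\<^sup>+x. emeasure (K' x) B * indicator A x \<partial>\<mu>)"
    using disintegration_real[OF \<mu>D(1) N marginal] by blast
  define K where "K x = distr (K' x) borel dec" for x
  have "K \<in> \<mu> \<rightarrow>\<^sub>M prob_algebra borel"
    unfolding K_def by (rule measurable_compose[OF K' measurable_distr_prob_space]) simp
  then have K: "measurable_family K"
    by (simp add: measurable_family_iff cong: measurable_cong_sets)
  have K'_sets: "sets (K' x) = sets borel" for x
    using measurable_space[OF K', of x] by (simp add: \<mu>D space_prob_algebra)
  have J: "joint \<mu> K \<in> borel_probs"
    using joint_coupling[OF \<mu> K] by (simp add: couplings_of_def)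
  note JD = borel_probsD[OF J]
  have "\<gamma> = joint \<mu> K"
  proof (rule measure_eqI_generator_eq[where \<Omega> = UNIV and A = "\<lambda>_. UNIV" and
        E = "{A \<times> B | A B. A \<in> sets borel \<and> B \<in> sets borel}"])
    show "Int_stable {A \<times> B | A B. A \<in> sets (borel :: 'x measure) \<and> B \<in> sets (borel :: 'y measure)}"
      using Int_stable_pair_measure_generator[of "borel :: 'x measure" "borel :: 'y measure"] by simp
    have "sets (borel :: ('x \<times> 'y) measure) = sigma_sets UNIV {A \<times> B | A B. A \<in> sets borel \<and> B \<in> sets borel}"
      unfolding borel_prod[symmetric] sets_pair_measure by simp
    then show "sets \<gamma> = sigma_sets UNIV {A \<times> B | A B. A \<in> sets borel \<and> B \<in> sets borel}"
      "sets (joint \<mu> K) = sigma_sets UNIV {A \<times> B | A B. A \<in> sets borel \<and> B \<in> sets borel}"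
      using \<gamma>D JD by simp_all
    show "range (\<lambda>_. UNIV) \<subseteq> {A \<times> B | A B. A \<in> sets (borel :: 'x measure) \<and> B \<in> sets (borel :: 'y measure)}"
      by (auto intro!: exI[of _ UNIV])
    fix X assume "X \<in> {A \<times> B | A B. A \<in> sets (borel :: 'x measure) \<and> B \<in> sets (borel :: 'y measure)}"
    then obtain A B where X: "X = A \<times> B" and [measurable]: "A \<in> sets borel" "B \<in> sets borel" by blast
    have AB: "A \<times> B \<in> sets borel" unfolding borel_prod[symmetric] by measurable
    have decB: "dec -` B \<in> sets borel" using measurable_sets[OF dec, of B] by simp
    have "emeasure \<gamma> (A \<times> B) = emeasure N (A \<times> (dec -` B))"
      unfolding N_def using decB
      by (subst emeasure_distr) (auto simp: \<gamma>D code_def dec_e \<mu>D intro!: arg_cong[where f = "emeasure \<gamma>"])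
    also have "\<dots> = (\<integral>\<^sup>+x. emeasure (K' x) (dec -` B) * indicator A x \<partial>\<mu>)"
      using decB by (intro N_rect) (simp_all add: \<mu>D)
    also have "\<dots> = (\<integral>\<^sup>+x. \<integral>\<^sup>+y. indicator (A \<times> B) (x, y) \<partial>K x \<partial>\<mu>)"
    proof (rule nn_integral_cong)
      fix x
      have "emeasure (K' x) (dec -` B) = emeasure (K x) B"
        unfolding K_def using K'_sets[of x] sets_eq_imp_space_eq[OF K'_sets[of x]]
        by (subst emeasure_distr) (auto cong: measurable_cong_sets)
      moreover have "(\<integral>\<^sup>+y. indicator (A \<times> B) (x, y) \<partial>K x) = (\<integral>\<^sup>+y. indicator B y * indicator A x \<partial>K x)"
        by (intro nn_integral_cong) (auto simp: indicator_def)
      moreover have "\<dots> = emeasure (K x) B * indicator A x"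
        by (subst nn_integral_multc) (auto simp: K_def)
      ultimately show "emeasure (K' x) (dec -` B) * indicator A x = (\<integral>\<^sup>+y. indicator (A \<times> B) (x, y) \<partial>K x)"
        by simp
    qed
    also have "\<dots> = emeasure (joint \<mu> K) (A \<times> B)"
      using AB by (subst nn_integral_joint[OF \<mu> K, symmetric]) (simp_all add: JD)
    finally show "emeasure \<gamma> X = emeasure (joint \<mu> K) X" by (simp add: X)
  next
    show "emeasure \<gamma> UNIV \<noteq> \<infinity>" using prob_space.emeasure_space_1[OF \<gamma>D(1)] \<gamma>D(3) by simp
  qed auto
  with K show ?thesis by (rule that)
qed

section \<open>Countably many test functions for the narrow topology\<close>

lemma integrable_bounded:
  fixes f :: "'a \<Rightarrow> real"
  assumes "prob_space \<nu>" "f \<in> borel_measurable \<nu>" "\<And>z. \<bar>f z\<bar> \<le> b"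
  shows "integrable \<nu> f"
proof -
  interpret prob_space \<nu> by fact
  show ?thesis
  proof (rule integrable_const_bound[where B = b])
    show "AE z in \<nu>. norm (f z) \<le> b" using assms(3) by simp
  qed fact
qed

lemma integral_shift:
  fixes f :: "'a \<Rightarrow> real"
  assumes "prob_space \<nu>" "integrable \<nu> f"
  shows "(\<integral>z. b + f z \<partial>\<nu>) = b + (\<integral>z. f z \<partial>\<nu>)" "(\<integral>z. b - f z \<partial>\<nu>) = b - (\<integral>z. f z \<partial>\<nu>)"
proof -
  interpret prob_space \<nu> by fact
  show "(\<integral>z. b + f z \<partial>\<nu>) = b + (\<integral>z. f z \<partial>\<nu>)" "(\<integral>z. b - f z \<partial>\<nu>) = b - (\<integral>z. f z \<partial>\<nu>)"
    using assms(2) by (simp_all add: prob_space)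
qed

text \<open>
  The cone of slope \<open>m\<close> over the ball with centre \<open>d k\<close> and radius
  \<open>2\<^sup>-\<^sup>p\<close>.
\<close>

definition cone :: "(nat \<Rightarrow> 'z::metric_space) \<Rightarrow> nat \<times> nat \<times> nat \<Rightarrow> 'z \<Rightarrow> real" where
  "cone d = (\<lambda>(k, p, m) z. real m * max 0 (1 / 2 ^ p - dist z (d k)))"

text \<open>
  Finite suprema of cones form a countable family of bounded continuous functions that exhausts
  every nonnegative lower semicontinuous function from below. Therefore this family determines
  probability measures, their narrow convergence, and the Borel structure on them.
\<close>

definition tent :: "(nat \<Rightarrow> 'z::metric_space) \<Rightarrow> (nat \<times> nat \<times> nat) list \<Rightarrow> 'z \<Rightarrow> real" where
  "tent d l z = foldr (\<lambda>i s. max (cone d i z) s) l 0"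

lemma cone_bounds: "0 \<le> cone d i z" "cone d (k, p, m) z \<le> real m / 2 ^ p"
proof -
  show "0 \<le> cone d i z" by (auto simp: cone_def split: prod.split)
  have "max 0 (1 / 2 ^ p - dist z (d k)) \<le> 1 / 2 ^ p" by simp
  from mult_left_mono[OF this, of "real m"] show "cone d (k, p, m) z \<le> real m / 2 ^ p"
    by (simp add: cone_def)
qed

lemma tent_Nil [simp]: "tent d [] z = 0"
  and tent_Cons [simp]: "tent d (i # l) z = max (cone d i z) (tent d l z)"
  by (simp_all add: tent_def)

lemma tent_nonneg: "0 \<le> tent d l z"
  by (induction l) auto

lemma tent_ge: "i \<in> set l \<Longrightarrow> cone d i z \<le> tent d l z"
  by (induction l) auto

lemma tent_le: "(\<And>i. i \<in> set l \<Longrightarrow> cone d i z \<le> b) \<Longrightarrow> 0 \<le> b \<Longrightarrow> tent d l z \<le> b"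
  by (induction l) auto

lemma tent_continuous: "continuous_on UNIV (tent d l)"
proof (induction l)
  case Nil
  have "tent d [] = (\<lambda>_. 0)" by (rule ext) simp
  then show ?case by (simp only: continuous_on_const)
next
  case (Cons i l)
  obtain k p m where i: "i = (k, p, m)" by (cases i)
  have "continuous_on UNIV (\<lambda>z. real m * max 0 (1 / 2 ^ p - dist z (d k)))"
    by (intro continuous_intros)
  then have "continuous_on UNIV (\<lambda>z. max (cone d i z) (tent d l z))"
    unfolding i cone_def prod.case using Cons by (rule continuous_on_max)
  moreover have "tent d (i # l) = (\<lambda>z. max (cone d i z) (tent d l z))" by (rule ext) simp
  ultimately show ?case by (simp only:)
qed

lemma tent_bounded: "\<exists>b. \<forall>z. \<bar>tent d l z\<bar> \<le> b"
proof (induction l)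
  case Nil
  show ?case by (intro exI[of _ 0]) simp
next
  case (Cons i l)
  then obtain b where b: "\<And>z. \<bar>tent d l z\<bar> \<le> b" by blast
  obtain k p m where i: "i = (k, p, m)" by (cases i)
  have "\<bar>tent d (i # l) z\<bar> \<le> max (real m / 2 ^ p) b" for z
  proof -
    have "tent d l z \<le> b" using b[of z] by linarith
    then have "tent d (i # l) z \<le> max (real m / 2 ^ p) b"
      using cone_bounds(2)[of d k p m z] unfolding i tent_Cons by (intro max.mono)
    then show ?thesis using tent_nonneg[of d "i # l" z] by linarith
  qed
  then show ?case by (intro exI allI)
qed

lemma tent_measurable: "tent d l \<in> borel_measurable borel"
  using tent_continuous by (rule borel_measurable_continuous_onI)

text \<open>
  If \<open>a < b < f z\<close> then \<open>f\<close> exceeds \<open>b\<close> near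
  \<open>z\<close>. A narrow cone of height slightly below \<open>b\<close>, centred at a point of
  the dense sequence close to \<open>z\<close>, lies below \<open>f\<close> and exceeds
  \<open>a\<close> at \<open>z\<close>. The \<open>n\<close>-th tent is the supremum of those
  among the first \<open>n\<close> cones that lie below \<open>f\<close>.
\<close>

lemma tent_exhausts:
  fixes f :: "'z::metric_space \<Rightarrow> real"
  assumes d: "\<And>z e. 0 < e \<Longrightarrow> \<exists>k. dist z (d k) < e"
    and lsc: "\<And>a. open {z. a < f z}" and nonneg: "\<And>z. 0 \<le> f z"
  shows "\<exists>l. (\<forall>n z. tent d (l n) z \<le> f z) \<and> (\<forall>z. (\<lambda>n. tent d (l n) z) \<longlonglongrightarrow> f z)"
proof -
  define l where "l n = filter (\<lambda>i. \<forall>z. cone d i z \<le> f z) (map from_nat [0..<n])" for n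
  have le: "tent d (l n) z \<le> f z" for n z
    using nonneg by (intro tent_le) (auto simp: l_def)
  have "(\<lambda>n. tent d (l n) z) \<longlonglongrightarrow> f z" for z
  proof (rule increasing_tendsto)
    show "\<forall>\<^sub>F n in sequentially. tent d (l n) z \<le> f z" using le by simp
    fix a assume a: "a < f z"
    show "\<forall>\<^sub>F n in sequentially. a < tent d (l n) z"
    proof (cases "a < 0")
      case True
      then have "a < tent d (l n) z" for n using tent_nonneg[of d "l n" z] by simp
      then show ?thesis by simp
    next
      case False
      obtain b where b: "a < b" "b < f z" using a dense by blast
      obtain e where e: "0 < e" "\<And>z'. dist z z' < e \<Longrightarrow> b < f z'"
        using lsc[of b] b(2) unfolding open_dist by (auto simp: dist_commute)
      define g where "g = min (e / 2) ((b - a) / 2)"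
      have "0 < g" using e(1) b(1) by (simp add: g_def)
      then obtain p where p: "(1 / 2 :: real) ^ p < g"
        using real_arch_pow_inv[of g "1 / 2"] by auto
      \<comment> \<open>The largest integral slope for which the height \<open>m /
      2\<^sup>p\<close> does not exceed \<open>b\<close>.\<close>
      define m where "m = nat \<lfloor>b * 2 ^ p\<rfloor>"
      have m: "real m \<le> b * 2 ^ p" "b * 2 ^ p < real m + 1"
        using b(1) False unfolding m_def by (auto simp: of_nat_nat)
      define \<delta> where "\<delta> = min (1 / 2 ^ p) ((b - a) / (4 * (real m + 1)))"
      have "0 < \<delta>" using b(1) by (simp add: \<delta>_def)
      then obtain k where k: "dist z (d k) < \<delta>" using d by blast
      have below: "cone d (k, p, m) z' \<le> f z'" for z'
      proof (cases "dist z' (d k) < 1 / 2 ^ p")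
        case True
        have "dist z z' \<le> dist z (d k) + dist z' (d k)" by (rule dist_triangle2)
        also have "\<dots> < 2 * (1 / 2) ^ p" using True k by (simp add: \<delta>_def power_divide)
        also have "\<dots> \<le> e" using p by (simp add: g_def)
        finally have "b < f z'" by (rule e(2))
        moreover have "cone d (k, p, m) z' \<le> b"
        proof -
          have "cone d (k, p, m) z' \<le> real m / 2 ^ p" by (rule cone_bounds)
          also have "\<dots> \<le> b" using m(1) by (simp add: pos_divide_le_eq)
          finally show ?thesis .
        qed
        ultimately show ?thesis by simp
      qed (use nonneg in \<open>simp add: cone_def max_def\<close>)
      have "real m * dist z (d k) \<le> real m * ((b - a) / (4 * (real m + 1)))"
        using k by (intro mult_left_mono) (auto simp: \<delta>_def)
      also have "\<dots> \<le> (b - a) / 4"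
        using b(1) by (simp add: divide_simps)
      finally have 1: "real m * dist z (d k) \<le> (b - a) / 4" .
      have 2: "b - (b - a) / 2 < real m * (1 / 2 ^ p)"
      proof -
        have "b < (real m + 1) / 2 ^ p" using m(2) by (simp add: pos_less_divide_eq)
        also have "\<dots> = real m * (1 / 2 ^ p) + (1 / 2) ^ p" by (simp add: add_divide_distrib power_divide)
        also have "(1 / 2 :: real) ^ p < (b - a) / 2" using p by (simp add: g_def)
        finally show ?thesis by simp
      qed
      have arith: "Q \<le> (b - a) / 4 \<Longrightarrow> b - (b - a) / 2 < P \<Longrightarrow> a < b \<Longrightarrow> a < P - Q" for P Q :: real
        by (simp add: field_simps)
      have "a < real m * (1 / 2 ^ p) - real m * dist z (d k)" by (rule arith[OF 1 2 b(1)])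
      also have "\<dots> = real m * (1 / 2 ^ p - dist z (d k))" by (simp add: right_diff_distrib)
      also have "\<dots> \<le> cone d (k, p, m) z"
        unfolding cone_def by (auto intro: mult_left_mono)
      finally have gt: "a < cone d (k, p, m) z" .
      have "a < tent d (l n) z" if n: "n > to_nat (k, p, m)" for n
      proof -
        have "(k, p, m) \<in> set (map from_nat [0..<n])"
          using n by (auto intro!: image_eqI[of _ _ "to_nat (k, p, m)"])
        then have "(k, p, m) \<in> set (l n)" using below by (simp add: l_def)
        from tent_ge[OF this, of d z] gt show ?thesis by simp
      qed
      then show ?thesis by (rule eventually_mono[OF eventually_gt_at_top])
    qed
  qed
  with le show ?thesis by (intro exI[of _ l] conjI allI)
qed

lemma tent_integral_exhausts:
  fixes f :: "'z::metric_space \<Rightarrow> real"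
  assumes "prob_space \<nu>" and sets: "sets \<nu> = sets borel"
    and l: "\<And>n z. tent d (l n) z \<le> f z" "\<And>z. (\<lambda>n. tent d (l n) z) \<longlonglongrightarrow> f z"
    and b: "\<And>z. \<bar>f z\<bar> \<le> b" and f: "f \<in> borel_measurable borel"
  shows "(\<lambda>n. \<integral>z. tent d (l n) z \<partial>\<nu>) \<longlonglongrightarrow> (\<integral>z. f z \<partial>\<nu>)"
proof (rule integral_dominated_convergence[where w = "\<lambda>_. b"])
  show "integrable \<nu> (\<lambda>_. b)" using assms(1) by (intro integrable_bounded[where b = "\<bar>b\<bar>"]) auto
  show "AE z in \<nu>. norm (tent d (l n) z) \<le> b" for n
  proof (rule AE_I2)
    fix z show "norm (tent d (l n) z) \<le> b"
      using l(1)[of n z] b[of z] tent_nonneg[of d "l n" z] by simp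
  qed
  show "AE z in \<nu>. (\<lambda>n. tent d (l n) z) \<longlonglongrightarrow> f z" by (intro AE_I2 l(2))
  show "f \<in> borel_measurable \<nu>" "tent d (l n) \<in> borel_measurable \<nu>" for n
    unfolding measurable_cong_sets[OF sets refl] by (rule f tent_measurable)+
qed

text \<open>
  Tents below a nonnegative continuous function have integrals arbitrarily close to its own, so
  convergence on tents bounds its integrals from below in the limit. Applied to \<open>b +
  f\<close> and \<open>b - f\<close> this gives both bounds for \<open>f\<close>.
\<close>

lemma tents_determine_narrow_convergence:
  fixes f :: "'z::{metric_space, second_countable_topology} \<Rightarrow> real"
  assumes d: "\<And>(z::'z) e. 0 < e \<Longrightarrow> \<exists>k. dist z (d k) < e"
    and \<nu>: "\<And>i. \<nu> i \<in> borel_probs" "\<nu>\<^sub>0 \<in> borel_probs"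
    and tents: "\<And>l. ((\<lambda>i. \<integral>z. tent d l z \<partial>\<nu> i) \<longlongrightarrow> (\<integral>z. tent d l z \<partial>\<nu>\<^sub>0)) F"
    and f: "continuous_on UNIV f" "bounded (range f)"
  shows "((\<lambda>i. \<integral>z. f z \<partial>\<nu> i) \<longlongrightarrow> (\<integral>z. f z \<partial>\<nu>\<^sub>0)) F"
proof -
  note D = borel_probsD[OF \<nu>(1)] and D0 = borel_probsD[OF \<nu>(2)]
  note [measurable_cong] = D(2) D0(2)
  have lower: "\<forall>\<^sub>F i in F. a < (\<integral>z. g z \<partial>\<nu> i)"
    if g: "continuous_on UNIV g" "\<And>z. 0 \<le> g z" "\<And>z. \<bar>g z\<bar> \<le> b" and a: "a < (\<integral>z. g z \<partial>\<nu>\<^sub>0)" for g :: "'z \<Rightarrow> real" and a b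
  proof -
    have [measurable]: "g \<in> borel_measurable borel"
      using g(1) by (rule borel_measurable_continuous_onI)
    have "open {z. c < g z}" for c
      using g(1) by (intro open_Collect_less) (auto intro: continuous_on_const)
    then obtain l where l: "\<And>n z. tent d (l n) z \<le> g z" "\<And>z. (\<lambda>n. tent d (l n) z) \<longlonglongrightarrow> g z"
      using tent_exhausts[of d g, OF d _ g(2)] by auto
    have "(\<lambda>n. \<integral>z. tent d (l n) z \<partial>\<nu>\<^sub>0) \<longlonglongrightarrow> (\<integral>z. g z \<partial>\<nu>\<^sub>0)"
      by (rule tent_integral_exhausts[OF D0(1,2) l g(3)]) simp
    then have "\<forall>\<^sub>F n in sequentially. a < (\<integral>z. tent d (l n) z \<partial>\<nu>\<^sub>0)"
      using a by (rule order_tendstoD)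
    then obtain n where "a < (\<integral>z. tent d (l n) z \<partial>\<nu>\<^sub>0)"
      using eventually_happens'[OF sequentially_bot] by auto
    with tents have "\<forall>\<^sub>F i in F. a < (\<integral>z. tent d (l n) z \<partial>\<nu> i)" by (rule order_tendstoD)
    then show ?thesis
    proof (rule eventually_mono)
      fix i assume "a < (\<integral>z. tent d (l n) z \<partial>\<nu> i)"
      also have "\<dots> \<le> (\<integral>z. g z \<partial>\<nu> i)"
      proof (rule integral_mono)
        show "integrable (\<nu> i) g" using D(1) g(3) by (intro integrable_bounded) auto
        have "\<bar>tent d (l n) z\<bar> \<le> b" for z
          using l(1)[of n z] tent_nonneg[of d "l n" z] g(3)[of z] by simp
        then show "integrable (\<nu> i) (tent d (l n))"
          using D(1) tent_measurable measurable_cong_sets[OF D(2) refl] by (intro integrable_bounded) blast+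
      qed (rule l)
      finally show "a < (\<integral>z. g z \<partial>\<nu> i)" .
    qed
  qed
  obtain b where b: "\<And>z. \<bar>f z\<bar> \<le> b" using f(2) by (auto simp: bounded_iff)
  have [measurable]: "f \<in> borel_measurable borel"
    using f(1) by (rule borel_measurable_continuous_onI)
  have int: "integrable (\<nu> i) f" "integrable \<nu>\<^sub>0 f" for i
    by (rule integrable_bounded[OF D(1) _ b] integrable_bounded[OF D0(1) _ b], measurable)+
  note shift = integral_shift[OF D(1) int(1), where b = b] integral_shift[OF D0(1) int(2), where b = b]
  show ?thesis
  proof (rule order_tendstoI)
    fix a assume a: "a < (\<integral>z. f z \<partial>\<nu>\<^sub>0)"
    have "\<forall>\<^sub>F i in F. b + a < (\<integral>z. b + f z \<partial>\<nu> i)"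
    proof (rule lower[where b = "2 * b"])
      show "continuous_on UNIV (\<lambda>z. b + f z)" using f(1) by (intro continuous_intros)
      show "0 \<le> b + f z" "\<bar>b + f z\<bar> \<le> 2 * b" for z using b[of z] by auto
      show "b + a < (\<integral>z. b + f z \<partial>\<nu>\<^sub>0)" using a by (simp only: shift add_strict_left_mono diff_strict_left_mono)
    qed
    then show "\<forall>\<^sub>F i in F. a < (\<integral>z. f z \<partial>\<nu> i)" by (simp only: shift add_less_cancel_left)
  next
    fix a assume a: "(\<integral>z. f z \<partial>\<nu>\<^sub>0) < a"
    have "\<forall>\<^sub>F i in F. b - a < (\<integral>z. b - f z \<partial>\<nu> i)"
    proof (rule lower[where b = "2 * b"])
      show "continuous_on UNIV (\<lambda>z. b - f z)" using f(1) by (intro continuous_intros)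
      show "0 \<le> b - f z" "\<bar>b - f z\<bar> \<le> 2 * b" for z using b[of z] by auto
      show "b - a < (\<integral>z. b - f z \<partial>\<nu>\<^sub>0)" using a by (simp only: shift add_strict_left_mono diff_strict_left_mono)
    qed
    then show "\<forall>\<^sub>F i in F. (\<integral>z. f z \<partial>\<nu> i) < a"
      unfolding shift by (rule eventually_mono) simp
  qed
qed

lemma borel_measure_eqI_open:
  assumes \<nu>: "\<nu> \<in> borel_probs" "\<nu>' \<in> borel_probs"
    and eq: "\<And>O'. open O' \<Longrightarrow> emeasure \<nu> O' = emeasure \<nu>' O'"
  shows "\<nu> = \<nu>'"
proof (rule measure_eqI_generator_eq[where \<Omega> = UNIV and A = "\<lambda>_. UNIV" and E = "{S. open S}"])
  note D = borel_probsD[OF \<nu>(1)] and D' = borel_probsD[OF \<nu>(2)]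
  show "Int_stable {S. open S}" by (auto simp: Int_stable_def)
  show "sets \<nu> = sigma_sets UNIV {S. open S}" "sets \<nu>' = sigma_sets UNIV {S. open S}"
    using D D' by (simp_all add: borel_def)
  show "emeasure \<nu> UNIV \<noteq> \<infinity>" using prob_space.emeasure_space_1[OF D(1)] D(3) by simp
qed (use eq in auto)

text \<open>
  The indicator of an open set is lower semicontinuous and thus a limit of tents below it.
\<close>

lemma tent_integral_open:
  fixes \<nu> :: "'z::{metric_space, second_countable_topology} measure"
  assumes d: "\<And>(z::'z) e. 0 < e \<Longrightarrow> \<exists>k. dist z (d k) < e" and U: "open U"
  obtains l where "\<And>\<nu>. \<nu> \<in> borel_probs \<Longrightarrow> (\<lambda>n. \<integral>z. tent d (l n) z \<partial>\<nu>) \<longlonglongrightarrow> measure \<nu> U"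
proof -
  have "{z. a < indicator U z} = (if a < 0 then UNIV else if a < 1 then U else {})" for a :: real
    by (auto simp: indicator_def)
  then have "open {z. a < (indicator U z :: real)}" for a
    using U by simp
  then obtain l where l: "\<And>n z. tent d (l n) z \<le> indicator U z" "\<And>z. (\<lambda>n. tent d (l n) z) \<longlonglongrightarrow> indicator U z"
    using tent_exhausts[of d "indicator U", OF d _ indicator_pos_le] by auto
  have [measurable]: "U \<in> sets borel" using U by simp
  show ?thesis
  proof (rule that)
    fix \<nu> :: "'z measure" assume "\<nu> \<in> borel_probs"
    note D = borel_probsD[OF this]
    have "(\<lambda>n. \<integral>z. tent d (l n) z \<partial>\<nu>) \<longlonglongrightarrow> (\<integral>z. indicator U z \<partial>\<nu>)"
      using U by (intro tent_integral_exhausts[OF D(1,2) l, where b = 1]) simp_all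
    then show "(\<lambda>n. \<integral>z. tent d (l n) z \<partial>\<nu>) \<longlonglongrightarrow> measure \<nu> U" by (simp add: D)
  qed
qed

lemma tents_determine_measure:
  fixes \<nu> :: "'z::{metric_space, second_countable_topology} measure"
  assumes d: "\<And>(z::'z) e. 0 < e \<Longrightarrow> \<exists>k. dist z (d k) < e"
    and \<nu>: "\<nu> \<in> borel_probs" "\<nu>' \<in> borel_probs"
    and eq: "\<And>l. (\<integral>z. tent d l z \<partial>\<nu>) = (\<integral>z. tent d l z \<partial>\<nu>')"
  shows "\<nu> = \<nu>'"
proof (rule borel_measure_eqI_open[OF \<nu>])
  fix U :: "'z set" assume "open U"
  then obtain l where l: "\<And>\<nu>. \<nu> \<in> borel_probs \<Longrightarrow> (\<lambda>n. \<integral>z. tent d (l n) z \<partial>\<nu>) \<longlonglongrightarrow> measure \<nu> U"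
    using tent_integral_open[OF d] by blast
  have "measure \<nu> U = measure \<nu>' U"
    using l[OF \<nu>(1)] l[OF \<nu>(2)] unfolding eq by (rule LIMSEQ_unique)
  then show "emeasure \<nu> U = emeasure \<nu>' U"
    using borel_probsD(1)[OF \<nu>(1)] borel_probsD(1)[OF \<nu>(2)]
    by (simp add: finite_measure.emeasure_eq_measure prob_space.finite_measure)
qed

lemma topspace_weak_topology_on: "topspace (weak_topology_on S F) = S"
  unfolding weak_topology_on_def topology_generated_by_topspace by auto

text \<open>
  Convergence can be tested on the subbasis that generates the topology.
\<close>

lemma limitin_weak_topology_on:
  "limitin (weak_topology_on S F) f l G \<longleftrightarrow>
     l \<in> S \<and> (\<forall>\<^sub>F i in G. f i \<in> S) \<and> (\<forall>\<phi>\<in>F. ((\<lambda>i. \<phi> (f i)) \<longlongrightarrow> \<phi> l) G)"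
  (is "?lim \<longleftrightarrow> ?rhs")
proof
  let ?B = "insert S {{s\<in>S. \<phi> s \<in> U} |\<phi> U. \<phi> \<in> F \<and> open U}"
  have basic: "openin (weak_topology_on S F) B" if "B \<in> ?B" for B
    unfolding weak_topology_on_def using that by (intro topology_generated_by_Basis)
  {
    assume L: ?lim
    then have ev: "\<And>U. openin (weak_topology_on S F) U \<Longrightarrow> l \<in> U \<Longrightarrow> \<forall>\<^sub>F i in G. f i \<in> U" and l: "l \<in> S"
      by (auto simp: limitin_def topspace_weak_topology_on)
    show ?rhs
    proof (intro conjI ballI l)
      show "\<forall>\<^sub>F i in G. f i \<in> S" using l by (intro ev basic) auto
      fix \<phi> assume \<phi>: "\<phi> \<in> F"
      show "((\<lambda>i. \<phi> (f i)) \<longlongrightarrow> \<phi> l) G"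
      proof (rule topological_tendstoI)
        fix U assume "open U" "\<phi> l \<in> U"
        then have "\<forall>\<^sub>F i in G. f i \<in> {s\<in>S. \<phi> s \<in> U}" using \<phi> l by (intro ev basic) auto
        then show "\<forall>\<^sub>F i in G. \<phi> (f i) \<in> U" by (rule eventually_mono) simp
      qed
    qed
  }
  assume R: ?rhs
  have "\<forall>\<^sub>F i in G. f i \<in> U" if "generate_topology_on ?B U" "l \<in> U" for U
    using that
  proof induction
    case (Int a b)
    then show ?case by (auto intro: eventually_conj)
  next
    case (UN K)
    then obtain k where "k \<in> K" "l \<in> k" by blast
    with UN have "\<forall>\<^sub>F i in G. f i \<in> k" by blast
    then show ?case by (rule eventually_mono) (use \<open>k \<in> K\<close> in blast)
  next
    case (Basis s)
    then show ?case
    proof (elim insertE CollectE exE conjE)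
      fix \<phi> U assume s: "s = {s\<in>S. \<phi> s \<in> U}" and \<phi>: "\<phi> \<in> F" and U: "open U"
      have "((\<lambda>i. \<phi> (f i)) \<longlongrightarrow> \<phi> l) G" using R \<phi> by blast
      then have "\<forall>\<^sub>F i in G. \<phi> (f i) \<in> U" using U Basis.prems s by (intro topological_tendstoD) auto
      then show ?thesis using R s by (auto elim: eventually_elim2)
    qed (use R in simp)
  qed simp
  with R show ?lim
    unfolding limitin_def topspace_weak_topology_on
    by (simp add: weak_topology_on_def openin_topology_generated_by_iff)
qed

lemma space_narrow_borel: "space narrow_borel = borel_probs"
  unfolding narrow_borel_def by (simp add: space_measure_of_conv)

lemma openin_narrow_subset: "openin narrow_topology U \<Longrightarrow> U \<subseteq> borel_probs"
  using openin_subset[of narrow_topology U] by (simp add: narrow_topology_def topspace_weak_topology_on)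

lemma openin_narrow_measurable:
  assumes "openin narrow_topology U"
  shows "U \<in> sets narrow_borel"
proof -
  have "{U. openin narrow_topology U} \<subseteq> Pow borel_probs"
    by (intro subsetI PowI) (simp add: openin_narrow_subset[THEN subsetD])
  then have "sets (narrow_borel :: 'a measure measure) = sigma_sets borel_probs {U. openin narrow_topology U}"
    unfolding narrow_borel_def by (rule sets_measure_of)
  with assms show ?thesis by (simp add: sigma_sets.Basic)
qed

lemma narrow_integral_measurable:
  fixes f :: "'z::topological_space \<Rightarrow> real"
  assumes f: "continuous_on UNIV f" "bounded (range f)"
  shows "(\<lambda>\<gamma>. \<integral>z. f z \<partial>\<gamma>) \<in> borel_measurable narrow_borel"
proof (rule borel_measurableI)
  fix S :: "real set" assume S: "open S"
  have "openin narrow_topology {\<gamma>\<in>borel_probs. (\<integral>z. f z \<partial>\<gamma>) \<in> S}"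
    unfolding narrow_topology_def weak_topology_on_def
  proof (rule topology_generated_by_Basis, rule insertI2, rule CollectI)
    let ?\<phi> = "\<lambda>\<gamma> :: 'z measure. \<integral>z. f z \<partial>\<gamma>"
    have "?\<phi> \<in> {\<lambda>\<gamma>. \<integral>z. f z \<partial>\<gamma> |f. continuous_on UNIV f \<and> bounded (range f)}" using f by blast
    with S show "\<exists>\<phi> U. {\<gamma>\<in>borel_probs. (\<integral>z. f z \<partial>\<gamma>) \<in> S} = {s\<in>borel_probs. \<phi> s \<in> U} \<and>
        \<phi> \<in> {\<lambda>\<gamma>. \<integral>z. (f :: 'z \<Rightarrow> real) z \<partial>\<gamma> |f. continuous_on UNIV f \<and> bounded (range f)} \<and> open U"
      by (intro exI[where x = ?\<phi>] exI[where x = S]) simp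
  qed
  from openin_narrow_measurable[OF this]
  show "(\<lambda>\<gamma>. \<integral>z. f z \<partial>\<gamma>) -` S \<inter> space narrow_borel \<in> sets narrow_borel"
    unfolding space_narrow_borel by (simp add: vimage_def Int_def conj_commute)
qed

lemma random_probsD:
  assumes \<gamma>: "\<gamma> \<in> random_probs M"
  shows "\<And>\<omega>. \<omega> \<in> space M \<Longrightarrow> \<gamma> \<omega> \<in> borel_probs"
  using measurable_space[OF \<gamma>[unfolded random_probs_def]] by (simp add: space_narrow_borel)

text \<open>
  Random measures in the sense of the narrow Borel structure are probability kernels: the measure
  of an open set is a limit of tent integrals, each of which is narrowly continuous.
\<close>

lemma random_probs_kernel:
  fixes \<gamma> :: "'w \<Rightarrow> 'z::{metric_space, second_countable_topology} measure"
  assumes \<gamma>: "\<gamma> \<in> random_probs M"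
  shows "\<gamma> \<in> M \<rightarrow>\<^sub>M prob_algebra borel"
proof (rule measurable_prob_algebra_generated)
  note P = random_probsD[OF \<gamma>]
  show "sets borel = sigma_sets UNIV {S :: 'z set. open S}" by (simp add: borel_def)
  show "Int_stable {S :: 'z set. open S}" by (auto simp: Int_stable_def)
  show "prob_space (\<gamma> \<omega>)" "sets (\<gamma> \<omega>) = sets borel" if "\<omega> \<in> space M" for \<omega>
    using borel_probsD[OF P[OF that]] by auto
  obtain d :: "nat \<Rightarrow> 'z" where d: "\<And>z e. 0 < e \<Longrightarrow> \<exists>k. dist z (d k) < e"
    using dense_sequence by blast
  fix U :: "'z set" assume "U \<in> {S. open S}"
  then obtain l where l: "\<And>\<nu>. \<nu> \<in> borel_probs \<Longrightarrow> (\<lambda>n. \<integral>z. tent d (l n) z \<partial>\<nu>) \<longlonglongrightarrow> measure \<nu> U"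
    using tent_integral_open[OF d] by blast
  have "(\<lambda>\<omega>. measure (\<gamma> \<omega>) U) \<in> borel_measurable M"
  proof (rule borel_measurable_LIMSEQ_real)
    show "(\<lambda>n. \<integral>z. tent d (l n) z \<partial>\<gamma> \<omega>) \<longlonglongrightarrow> measure (\<gamma> \<omega>) U" if "\<omega> \<in> space M" for \<omega>
      using l[OF P[OF that]] .
    show "(\<lambda>\<omega>. \<integral>z. tent d (l n) z \<partial>\<gamma> \<omega>) \<in> borel_measurable M" for n
    proof (rule measurable_compose[OF \<gamma>[unfolded random_probs_def] narrow_integral_measurable])
      show "bounded (range (tent d (l n)))"
        using tent_bounded[of d "l n"] by (auto simp: bounded_iff)
    qed (rule tent_continuous)
  qed
  then have "(\<lambda>\<omega>. ennreal (measure (\<gamma> \<omega>) U)) \<in> borel_measurable M" by measurable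
  moreover have "emeasure (\<gamma> \<omega>) U = ennreal (measure (\<gamma> \<omega>) U)" if "\<omega> \<in> space M" for \<omega>
    using borel_probsD(1)[OF P[OF that]]
    by (simp add: finite_measure.emeasure_eq_measure prob_space.finite_measure)
  ultimately show "(\<lambda>\<omega>. emeasure (\<gamma> \<omega>) U) \<in> borel_measurable M"
    by (simp cong: measurable_cong)
qed simp

text \<open>
  Conversely, kernels are random measures, because the narrow topology has a countable base of
  sets that are measurable for the evaluations: conditions, with rational data, on finitely many
  tent integrals.
\<close>

lemma random_probsI:
  fixes \<gamma> :: "'w \<Rightarrow> 'z::{metric_space, second_countable_topology} measure"
  assumes P: "\<And>\<omega>. \<omega> \<in> space M \<Longrightarrow> \<gamma> \<omega> \<in> borel_probs"
    and \<gamma>: "\<gamma> \<in> M \<rightarrow>\<^sub>M subprob_algebra borel"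
  shows "\<gamma> \<in> random_probs M"
  unfolding random_probs_def narrow_borel_def
proof (rule measurable_sigma_sets)
  show "sets (sigma borel_probs {U. openin narrow_topology U}) = sigma_sets borel_probs {U. openin narrow_topology U}"
    by (intro sets_measure_of subsetI PowI) (simp add: openin_narrow_subset[THEN subsetD])
  show "{U. openin narrow_topology U} \<subseteq> Pow borel_probs"
    by (intro subsetI PowI) (simp add: openin_narrow_subset[THEN subsetD])
  show "\<gamma> \<in> space M \<rightarrow> borel_probs" using P by blast
  obtain d :: "nat \<Rightarrow> 'z" where d: "\<And>z e. 0 < e \<Longrightarrow> \<exists>k. dist z (d k) < e"
    using dense_sequence by blast
  define t where "t i \<nu> = (\<integral>z. tent d (from_nat i) z \<partial>\<nu>)" for i and \<nu> :: "'z measure"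
  define W where "W n q = {\<nu>\<in>borel_probs. \<forall>i<n. \<bar>t i \<nu> - real_of_rat (q ! i)\<bar> < 1 / (2 * real (Suc n))}"
    for n and q :: "rat list"
  have W_meas: "{\<omega>\<in>space M. \<gamma> \<omega> \<in> W n q} \<in> sets M" for n q
  proof -
    have "(\<lambda>\<nu>. t i \<nu>) \<in> borel_measurable (subprob_algebra borel)" for i
    proof -
      show ?thesis unfolding t_def
        by (rule integral_measurable_subprob_algebra[OF tent_measurable])
    qed
    note [measurable] = measurable_compose[OF \<gamma> this]
    have "{\<omega>\<in>space M. \<gamma> \<omega> \<in> W n q} =
        {\<omega>\<in>space M. \<forall>i<n. \<bar>t i (\<gamma> \<omega>) - real_of_rat (q ! i)\<bar> < 1 / (2 * real (Suc n))}"
      using P by (auto simp: W_def)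
    also have "\<dots> \<in> sets M" by measurable
    finally show ?thesis .
  qed
  fix U :: "'z measure set" assume "U \<in> {U. openin narrow_topology U}"
  then have U: "openin narrow_topology U" by simp
  then have US: "U \<subseteq> borel_probs" by (rule openin_narrow_subset)
  have "\<exists>n q. \<nu> \<in> W n q \<and> W n q \<subseteq> U" if \<nu>: "\<nu> \<in> U" for \<nu>
  proof -
    \<comment> \<open>Otherwise some sequence outside \<open>U\<close> has all its tent integrals
    converging to those of \<open>\<nu>\<close>, and so converges narrowly to \<open>\<nu> \<in>
    U\<close>.\<close>
    have "\<exists>n. \<forall>\<nu>'\<in>borel_probs. (\<forall>i<n. \<bar>t i \<nu>' - t i \<nu>\<bar> < 1 / real (Suc n)) \<longrightarrow> \<nu>' \<in> U"
    proof (rule ccontr)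
      assume "\<not> ?thesis"
      then have "\<forall>n. \<exists>\<nu>'\<in>borel_probs. (\<forall>i<n. \<bar>t i \<nu>' - t i \<nu>\<bar> < 1 / real (Suc n)) \<and> \<nu>' \<notin> U" by blast
      then obtain s where s: "\<And>n. s n \<in> borel_probs" "\<And>n. s n \<notin> U"
        "\<And>n i. i < n \<Longrightarrow> \<bar>t i (s n) - t i \<nu>\<bar> < 1 / real (Suc n)"
        by metis
      have t_lim: "(\<lambda>n. t i (s n)) \<longlonglongrightarrow> t i \<nu>" for i
      proof (rule LIM_zero_cancel, rule Lim_null_comparison)
        show "\<forall>\<^sub>F n in sequentially. norm (t i (s n) - t i \<nu>) \<le> inverse (real (Suc n))"
          using eventually_gt_at_top[of i] by (rule eventually_mono) (use s(3) in \<open>force simp: inverse_eq_divide\<close>)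
        show "(\<lambda>n. inverse (real (Suc n))) \<longlonglongrightarrow> 0" by (rule LIMSEQ_inverse_real_of_nat)
      qed
      have tents: "(\<lambda>n. \<integral>z. tent d l z \<partial>s n) \<longlonglongrightarrow> (\<integral>z. tent d l z \<partial>\<nu>)" for l
        using t_lim[of "to_nat l"] by (simp add: t_def)
      have \<nu>P: "\<nu> \<in> borel_probs" using US \<nu> by blast
      have "limitin narrow_topology s \<nu> sequentially"
        unfolding narrow_topology_def limitin_weak_topology_on
      proof (intro conjI ballI \<nu>P)
        show "\<forall>\<^sub>F n in sequentially. s n \<in> borel_probs" by (simp add: s(1))
        fix \<phi> :: "'z measure \<Rightarrow> real"
        assume "\<phi> \<in> {\<lambda>\<gamma>. \<integral>z. f z \<partial>\<gamma> |f. continuous_on UNIV f \<and> bounded (range f)}"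
        then obtain f where f: "\<phi> = (\<lambda>\<gamma>. \<integral>z. f z \<partial>\<gamma>)" "continuous_on UNIV f" "bounded (range f)" by blast
        show "(\<lambda>n. \<phi> (s n)) \<longlonglongrightarrow> \<phi> \<nu>"
          unfolding f(1) by (rule tents_determine_narrow_convergence[OF d s(1) \<nu>P tents f(2,3)])
      qed
      then have "\<forall>\<^sub>F n in sequentially. s n \<in> U"
        using U \<nu> unfolding limitin_def by blast
      with s(2) show False by simp
    qed
    then obtain n where n: "\<And>\<nu>'. \<nu>' \<in> borel_probs \<Longrightarrow> (\<And>i. i < n \<Longrightarrow> \<bar>t i \<nu>' - t i \<nu>\<bar> < 1 / real (Suc n)) \<Longrightarrow> \<nu>' \<in> U"
      by blast
    have "\<exists>r. \<bar>t i \<nu> - real_of_rat r\<bar> < 1 / (2 * real (Suc n))" for i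
    proof -
      obtain r where "t i \<nu> < of_rat r" "of_rat r < t i \<nu> + 1 / (2 * real (Suc n))"
        using of_rat_dense[of "t i \<nu>" "t i \<nu> + 1 / (2 * real (Suc n))"] by auto
      then show ?thesis by (intro exI[of _ r]) simp
    qed
    then obtain r where r: "\<And>i. \<bar>t i \<nu> - real_of_rat (r i)\<bar> < 1 / (2 * real (Suc n))" by metis
    have "\<nu> \<in> W n (map r [0..<n])" using r US \<nu> by (auto simp: W_def)
    moreover have "W n (map r [0..<n]) \<subseteq> U"
    proof
      fix \<nu>' assume \<nu>': "\<nu>' \<in> W n (map r [0..<n])"
      show "\<nu>' \<in> U"
      proof (rule n)
        show "\<nu>' \<in> borel_probs" using \<nu>' by (simp add: W_def)
        fix i assume "i < n"
        then have "\<bar>t i \<nu>' - real_of_rat (r i)\<bar> < 1 / (2 * real (Suc n))" using \<nu>' by (auto simp: W_def)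
        moreover have "\<bar>a - q\<bar> < h \<Longrightarrow> \<bar>b - q\<bar> < h \<Longrightarrow> \<bar>a - b\<bar> < 2 * h" for a b q h :: real
          by linarith
        ultimately have "\<bar>t i \<nu>' - t i \<nu>\<bar> < 2 * (1 / (2 * real (Suc n)))" using r[of i] by blast
        then show "\<bar>t i \<nu>' - t i \<nu>\<bar> < 1 / real (Suc n)" by (simp add: field_simps)
      qed
    qed
    ultimately show ?thesis by blast
  qed
  then have cover: "\<And>\<nu>. \<nu> \<in> U \<Longrightarrow> \<exists>n q. \<nu> \<in> W n q \<and> W n q \<subseteq> U" .
  have "\<gamma> -` U \<inter> space M = (\<Union>p\<in>{p. W (fst p) (snd p) \<subseteq> U}. {\<omega>\<in>space M. \<gamma> \<omega> \<in> W (fst p) (snd p)})"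
  proof (intro equalityI subsetI)
    fix \<omega> assume \<omega>: "\<omega> \<in> \<gamma> -` U \<inter> space M"
    then obtain n q where "\<gamma> \<omega> \<in> W n q" "W n q \<subseteq> U" using cover[of "\<gamma> \<omega>"] by auto
    with \<omega> show "\<omega> \<in> (\<Union>p\<in>{p. W (fst p) (snd p) \<subseteq> U}. {\<omega>\<in>space M. \<gamma> \<omega> \<in> W (fst p) (snd p)})"
      by (intro UN_I[of "(n, q)"]) simp_all
  next
    fix \<omega> assume "\<omega> \<in> (\<Union>p\<in>{p. W (fst p) (snd p) \<subseteq> U}. {\<omega>\<in>space M. \<gamma> \<omega> \<in> W (fst p) (snd p)})"
    then show "\<omega> \<in> \<gamma> -` U \<inter> space M" by (elim UN_E) (simp add: subset_iff)
  qed
  also have "\<dots> \<in> sets M"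
    by (rule sets.countable_UN') (use W_meas in \<open>auto intro: countable_subset[OF subset_UNIV]\<close>)
  finally show "\<gamma> -` U \<inter> space M \<in> sets M" .
qed

section \<open>Interaction energies and averages of kernels\<close>

lemma
  fixes H :: "'y::second_countable_topology \<times> 'y \<Rightarrow> ennreal"
  assumes \<nu>: "\<nu> \<in> borel_probs" and \<nu>': "\<nu>' \<in> borel_probs" and H: "H \<in> borel_measurable borel"
  shows interaction_fst: "interaction H \<nu> \<nu>' = (\<integral>\<^sup>+y. \<integral>\<^sup>+y'. H (y, y') \<partial>\<nu>' \<partial>\<nu>)"
    and interaction_snd: "interaction H \<nu> \<nu>' = (\<integral>\<^sup>+y'. \<integral>\<^sup>+y. H (y, y') \<partial>\<nu> \<partial>\<nu>')"
proof -
  interpret \<nu>: prob_space \<nu> by (rule borel_probsD[OF \<nu>])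
  interpret \<nu>': prob_space \<nu>' by (rule borel_probsD[OF \<nu>'])
  interpret P: pair_sigma_finite \<nu> \<nu>' ..
  have "sets (\<nu> \<Otimes>\<^sub>M \<nu>') = sets (borel \<Otimes>\<^sub>M borel)"
    by (rule sets_pair_measure_cong) (rule borel_probsD[OF \<nu>] borel_probsD[OF \<nu>'])+
  then have "sets (\<nu> \<Otimes>\<^sub>M \<nu>') = sets (borel :: ('y \<times> 'y) measure)" unfolding borel_prod .
  note sets_eq = this
  from H have H': "H \<in> borel_measurable (\<nu> \<Otimes>\<^sub>M \<nu>')"
    unfolding measurable_cong_sets[OF sets_eq refl] .
  show "interaction H \<nu> \<nu>' = (\<integral>\<^sup>+y. \<integral>\<^sup>+y'. H (y, y') \<partial>\<nu>' \<partial>\<nu>)"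
    unfolding interaction_def by (rule \<nu>'.nn_integral_fst[OF H', symmetric])
  show "interaction H \<nu> \<nu>' = (\<integral>\<^sup>+y'. \<integral>\<^sup>+y. H (y, y') \<partial>\<nu> \<partial>\<nu>')"
    unfolding interaction_def by (rule P.nn_integral_snd[OF H', symmetric])
qed

lemma Pair_borel_measurable:
  "Pair x \<in> borel \<rightarrow>\<^sub>M (borel :: ('x::second_countable_topology \<times> 'y::second_countable_topology) measure)"
  unfolding borel_prod[symmetric] by (rule measurable_Pair1') simp

lemma measurable_Pair_borel:
  fixes f :: "'a::second_countable_topology \<times> 'b::second_countable_topology \<Rightarrow> ennreal"
  assumes "f \<in> borel_measurable borel"
  shows "(\<lambda>y. f (x, y)) \<in> borel_measurable borel" "(\<lambda>x. f (x, y)) \<in> borel_measurable borel"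
proof -
  have [measurable]: "f \<in> borel_measurable (borel \<Otimes>\<^sub>M borel)" using assms by (simp add: borel_prod)
  show "(\<lambda>y. f (x, y)) \<in> borel_measurable borel" "(\<lambda>x. f (x, y)) \<in> borel_measurable borel"
    by measurable
qed

lemma measurable_nn_integral_kernel:
  fixes f :: "'a::second_countable_topology \<times> 'b::second_countable_topology \<Rightarrow> ennreal"
  assumes "f \<in> borel_measurable borel" "measurable_family K"
  shows "(\<lambda>x. \<integral>\<^sup>+y. f (x, y) \<partial>K x) \<in> borel_measurable borel"
  using assms(1) measurable_family_kernel[OF assms(2)]
  by (intro nn_integral_measurable_subprob_algebra2[where N = borel]) (simp_all add: borel_prod)

lemma measurable_family_const: "\<nu> \<in> borel_probs \<Longrightarrow> measurable_family (\<lambda>_. \<nu>)"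
  by (simp add: measurable_family_def)

lemma measurable_nn_integral_const:
  fixes f :: "'a::second_countable_topology \<times> 'b::second_countable_topology \<Rightarrow> ennreal"
  assumes "f \<in> borel_measurable borel" "\<nu> \<in> borel_probs"
  shows "(\<lambda>x. \<integral>\<^sup>+y. f (x, y) \<partial>\<nu>) \<in> borel_measurable borel"
  by (rule measurable_nn_integral_kernel[OF assms(1) measurable_family_const[OF assms(2)]])

lemma measurable_nn_integral_const_fst:
  fixes H :: "'y::second_countable_topology \<times> 'y \<Rightarrow> ennreal"
  assumes "H \<in> borel_measurable borel" "\<rho> \<in> borel_probs"
  shows "(\<lambda>y'. \<integral>\<^sup>+y. H (y, y') \<partial>\<rho>) \<in> borel_measurable borel"
proof -
  have "(\<lambda>p. H (snd p, fst p)) \<in> borel_measurable (borel \<Otimes>\<^sub>M borel)"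
    using assms(1) by (intro measurable_compose[OF _ assms(1)]) (simp add: borel_prod[symmetric])
  then have "(\<lambda>p. H (snd p, fst p)) \<in> borel_measurable borel" by (simp add: borel_prod)
  from measurable_nn_integral_const[OF this assms(2)] show ?thesis by simp
qed

lemma measurable_interaction_kernels:
  fixes H :: "'y::second_countable_topology \<times> 'y \<Rightarrow> ennreal"
    and K K' :: "'x::second_countable_topology \<Rightarrow> 'y measure"
  assumes H: "H \<in> borel_measurable borel" and K: "measurable_family K" and K': "measurable_family K'"
  shows "(\<lambda>(x, x'). interaction H (K x) (K' x')) \<in> borel_measurable (borel \<Otimes>\<^sub>M borel)"
proof -
  have P: "K x \<in> borel_probs" "K' x \<in> borel_probs" for x
    using K K' by (simp_all add: measurable_family_def)
  note [measurable] = measurable_family_kernel[OF K] measurable_family_kernel[OF K']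
  have [measurable]: "H \<in> borel_measurable (borel \<Otimes>\<^sub>M borel)" using H by (simp add: borel_prod)
  have [measurable]: "(\<lambda>p. K (fst p)) \<in> borel \<Otimes>\<^sub>M borel \<rightarrow>\<^sub>M subprob_algebra borel"
    "(\<lambda>p. K' (snd (fst p))) \<in> (borel \<Otimes>\<^sub>M borel) \<Otimes>\<^sub>M borel \<rightarrow>\<^sub>M subprob_algebra borel"
    by measurable
  have 1: "(\<lambda>q. \<integral>\<^sup>+y'. H (snd q, y') \<partial>K' (snd (fst q))) \<in> borel_measurable ((borel \<Otimes>\<^sub>M borel) \<Otimes>\<^sub>M borel)"
    by (rule nn_integral_measurable_subprob_algebra2[where N = borel]) measurable
  have "(\<lambda>p. \<integral>\<^sup>+y. \<integral>\<^sup>+y'. H (y, y') \<partial>K' (snd p) \<partial>K (fst p)) \<in> borel_measurable (borel \<Otimes>\<^sub>M borel)"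
    by (rule nn_integral_measurable_subprob_algebra2[where N = borel])
       (use 1 in \<open>simp_all add: case_prod_beta'\<close>)
  then show ?thesis by (simp add: case_prod_beta' interaction_fst[OF P H])
qed

definition mean_law :: "'x measure \<Rightarrow> ('x \<Rightarrow> 'y::topological_space measure) \<Rightarrow> 'y measure" where
  "mean_law \<mu> K = \<mu> \<bind> K"

lemma
  assumes \<mu>: "\<mu> \<in> borel_probs" and K: "measurable_family K"
  shows mean_law_prob: "mean_law \<mu> K \<in> borel_probs"
    and nn_integral_mean_law: "f \<in> borel_measurable borel \<Longrightarrow>
      (\<integral>\<^sup>+y. f y \<partial>mean_law \<mu> K) = (\<integral>\<^sup>+x. \<integral>\<^sup>+y. f y \<partial>K x \<partial>\<mu>)"
proof -
  interpret prob_space \<mu> by (rule borel_probsD[OF \<mu>])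
  have K': "K \<in> \<mu> \<rightarrow>\<^sub>M subprob_algebra borel"
    using measurable_family_kernel[OF K] measurable_cong_sets[OF borel_probsD(2)[OF \<mu>] refl] by blast
  show "mean_law \<mu> K \<in> borel_probs"
    unfolding borel_probs_def mean_law_def
  proof (intro CollectI conjI)
    show "prob_space (\<mu> \<bind> K)"
      by (rule prob_space_bind[OF AE_I2 K']) (rule measurable_familyD[OF K])
    show "sets (\<mu> \<bind> K) = sets borel"
      by (rule sets_bind_measurable[OF K' not_empty])
  qed
  show "(\<integral>\<^sup>+y. f y \<partial>mean_law \<mu> K) = (\<integral>\<^sup>+x. \<integral>\<^sup>+y. f y \<partial>K x \<partial>\<mu>)" if "f \<in> borel_measurable borel"
    unfolding mean_law_def by (rule nn_integral_bind[OF that K'])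
qed

lemma distr_joint_snd:
  fixes K :: "'x::second_countable_topology \<Rightarrow> 'y::second_countable_topology measure"
  assumes \<mu>: "\<mu> \<in> borel_probs" and K: "measurable_family K"
  shows "distr (joint \<mu> K) borel snd = mean_law \<mu> K"
proof (rule measure_eqI)
  have J: "joint \<mu> K \<in> borel_probs" using joint_coupling[OF \<mu> K] by (simp add: couplings_of_def)
  note JD = borel_probsD[OF J] and MD = borel_probsD[OF mean_law_prob[OF \<mu> K]]
  have snd: "snd \<in> joint \<mu> K \<rightarrow>\<^sub>M borel"
    unfolding measurable_cong_sets[OF JD(2) refl] by (simp add: borel_prod[symmetric])
  show "sets (distr (joint \<mu> K) borel snd) = sets (mean_law \<mu> K)" by (simp add: MD)
  fix A assume "A \<in> sets (distr (joint \<mu> K) borel snd)"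
  then have A: "A \<in> sets borel" by simp
  have i: "(\<lambda>p. indicator A (snd p) :: ennreal) \<in> borel_measurable (borel :: ('x \<times> 'y) measure)"
    using A by (simp add: borel_prod[symmetric])
  have "emeasure (distr (joint \<mu> K) borel snd) A = (\<integral>\<^sup>+y. indicator A y \<partial>distr (joint \<mu> K) borel snd)"
    using A by simp
  also have "\<dots> = (\<integral>\<^sup>+p. indicator A (snd p) \<partial>joint \<mu> K)"
    by (rule nn_integral_distr[OF snd]) (use A in simp)
  also have "\<dots> = (\<integral>\<^sup>+x. \<integral>\<^sup>+y. indicator A y \<partial>K x \<partial>\<mu>)"
    by (subst nn_integral_joint[OF \<mu> K i]) simp
  also have "\<dots> = (\<integral>\<^sup>+y. indicator A y \<partial>mean_law \<mu> K)"
    by (rule nn_integral_mean_law[OF \<mu> K, symmetric]) (use A in simp)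
  also have "\<dots> = emeasure (mean_law \<mu> K) A" using A MD by simp
  finally show "emeasure (distr (joint \<mu> K) borel snd) A = emeasure (mean_law \<mu> K) A" .
qed

lemma
  fixes H :: "'y::second_countable_topology \<times> 'y \<Rightarrow> ennreal"
  assumes \<mu>: "\<mu> \<in> borel_probs" and K: "measurable_family K" and \<nu>: "\<nu> \<in> borel_probs"
    and H: "H \<in> borel_measurable borel"
  shows interaction_mean_law_left: "interaction H (mean_law \<mu> K) \<nu> = (\<integral>\<^sup>+x. interaction H (K x) \<nu> \<partial>\<mu>)"
    and interaction_mean_law_right: "interaction H \<nu> (mean_law \<mu> K) = (\<integral>\<^sup>+x. interaction H \<nu> (K x) \<partial>\<mu>)"
proof -
  have P: "K x \<in> borel_probs" for x using K by (simp add: measurable_family_def)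
  note m = mean_law_prob[OF \<mu> K]
  show "interaction H (mean_law \<mu> K) \<nu> = (\<integral>\<^sup>+x. interaction H (K x) \<nu> \<partial>\<mu>)"
    unfolding interaction_fst[OF m \<nu> H] interaction_fst[OF P \<nu> H]
    by (rule nn_integral_mean_law[OF \<mu> K measurable_nn_integral_const[OF H \<nu>]])
  have "(\<lambda>y'. \<integral>\<^sup>+y. H (y, y') \<partial>\<nu>) \<in> borel_measurable borel"
  proof -
    have "(\<lambda>p. H (snd p, fst p)) \<in> borel_measurable (borel \<Otimes>\<^sub>M borel)"
      using H by (intro measurable_compose[OF _ H]) (simp add: borel_prod[symmetric])
    then have "(\<lambda>p. H (snd p, fst p)) \<in> borel_measurable borel" by (simp add: borel_prod)
    from measurable_nn_integral_const[OF this \<nu>] show ?thesis by simp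
  qed
  then show "interaction H \<nu> (mean_law \<mu> K) = (\<integral>\<^sup>+x. interaction H \<nu> (K x) \<partial>\<mu>)"
    unfolding interaction_snd[OF \<nu> m H] interaction_snd[OF \<nu> P H]
    by (rule nn_integral_mean_law[OF \<mu> K])
qed

text \<open>
  The index is drawn uniformly, so that the rules for \<open>bind\<close> give integrals and
  measurability.
\<close>

definition average :: "nat \<Rightarrow> (nat \<Rightarrow> 'z measure) \<Rightarrow> 'z measure" where
  "average N \<nu> = measure_pmf (pmf_of_set {..<N}) \<bind> \<nu>"

lemma
  assumes N: "1 \<le> N" and \<nu>: "\<And>i. \<nu> i \<in> borel_probs"
  shows average_prob: "average N \<nu> \<in> borel_probs"
    and nn_integral_average: "f \<in> borel_measurable borel \<Longrightarrow>
      (\<integral>\<^sup>+z. f z \<partial>average N \<nu>) = inverse (of_nat N) * (\<Sum>i<N. \<integral>\<^sup>+z. f z \<partial>\<nu> i)"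
proof -
  let ?p = "measure_pmf (pmf_of_set {..<N})"
  have \<nu>': "\<nu> \<in> ?p \<rightarrow>\<^sub>M subprob_algebra borel"
    using borel_probsD[OF \<nu>] by (auto simp: space_subprob_algebra intro: prob_space_imp_subprob_space)
  show "average N \<nu> \<in> borel_probs"
    unfolding borel_probs_def average_def
  proof (intro CollectI conjI)
    show "prob_space (?p \<bind> \<nu>)"
      by (rule measure_pmf.prob_space_bind[OF AE_I2 \<nu>']) (rule borel_probsD[OF \<nu>])
    show "sets (?p \<bind> \<nu>) = sets borel"
      by (rule sets_bind_measurable[OF \<nu>' measure_pmf.not_empty])
  qed
  show "(\<integral>\<^sup>+z. f z \<partial>average N \<nu>) = inverse (of_nat N) * (\<Sum>i<N. \<integral>\<^sup>+z. f z \<partial>\<nu> i)"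
    if "f \<in> borel_measurable borel"
    unfolding average_def nn_integral_bind[OF that \<nu>'] using N
    by (subst nn_integral_pmf_of_set) (auto simp: divide_ennreal_def mult.commute lessThan_empty_iff)
qed

lemma measurable_family_average:
  assumes N: "1 \<le> N" and K: "\<And>i. measurable_family (K i)"
  shows "measurable_family (\<lambda>x. average N (\<lambda>i. K i x))"
  unfolding measurable_family_def
proof (intro conjI allI ballI)
  have P: "K i x \<in> borel_probs" for i x using K by (simp add: measurable_family_def)
  show A: "average N (\<lambda>i. K i x) \<in> borel_probs" for x by (rule average_prob[OF N P])
  fix B :: "'b set" assume B: "B \<in> sets borel"
  have "emeasure (average N (\<lambda>i. K i x)) B = inverse (of_nat N) * (\<Sum>i<N. emeasure (K i x) B)" for x
    using nn_integral_average[where \<nu> = "\<lambda>i. K i x" and f = "indicator B", OF N P] B borel_probsD(2)[OF A] borel_probsD(2)[OF P] by simp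
  moreover have "(\<lambda>x. emeasure (K i x) B) \<in> borel_measurable borel" for i
    using K B by (simp add: measurable_family_def)
  ultimately show "(\<lambda>x. emeasure (average N (\<lambda>i. K i x)) B) \<in> borel_measurable borel"
    by simp
qed

lemma empirical_eq_average:
  fixes X :: "nat \<Rightarrow> 'w \<Rightarrow> 'x::second_countable_topology"
    and s :: "nat \<Rightarrow> 'w \<Rightarrow> 'y::second_countable_topology measure"
  assumes N: "1 \<le> N" and s: "\<And>i. s i \<omega> \<in> borel_probs"
  shows "empirical X N s \<omega> = average N (\<lambda>i. distr (s i \<omega>) borel (Pair (X i \<omega>)))"
    and "distr (s i \<omega>) borel (Pair (X i \<omega>)) \<in> borel_probs"
proof -
  have Pair: "Pair x \<in> s i \<omega> \<rightarrow>\<^sub>M (borel :: ('x \<times> 'y) measure)" for i x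
    unfolding measurable_cong_sets[OF borel_probsD(2)[OF s] refl] by (rule Pair_borel_measurable)
  show P: "distr (s i \<omega>) borel (Pair (X i \<omega>)) \<in> borel_probs" for i
    using prob_space.prob_space_distr[OF borel_probsD(1)[OF s] Pair] by (simp add: borel_probs_def)
  let ?A = "average N (\<lambda>i. distr (s i \<omega>) borel (Pair (X i \<omega>)))"
  note AD = borel_probsD[OF average_prob[OF N P]]
  have "empirical X N s \<omega> = measure_of UNIV (sets borel) (emeasure ?A)"
    unfolding empirical_def
  proof (rule measure_of_eq)
    fix B :: "('x \<times> 'y) set" assume "B \<in> sigma_sets UNIV (sets borel)"
    then have B: "B \<in> sets borel" by (metis sets.sigma_sets_eq space_borel)
    have "emeasure (return borel (X i \<omega>) \<Otimes>\<^sub>M s i \<omega>) B = emeasure (distr (s i \<omega>) borel (Pair (X i \<omega>))) B" for i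
    proof -
      interpret s: prob_space "s i \<omega>" by (rule borel_probsD[OF s])
      have "sets (return borel (X i \<omega>) \<Otimes>\<^sub>M s i \<omega>) = sets (borel \<Otimes>\<^sub>M borel)"
        by (rule sets_pair_measure_cong) (simp_all add: borel_probsD(2)[OF s])
      then have B': "B \<in> sets (return borel (X i \<omega>) \<Otimes>\<^sub>M s i \<omega>)" using B unfolding borel_prod by (simp only:)
      have "emeasure (return borel (X i \<omega>) \<Otimes>\<^sub>M s i \<omega>) B = (\<integral>\<^sup>+x. emeasure (s i \<omega>) (Pair x -` B) \<partial>return borel (X i \<omega>))"
        by (rule s.emeasure_pair_measure_alt[OF B'])
      also have "\<dots> = emeasure (s i \<omega>) (Pair (X i \<omega>) -` B)"
        using s.measurable_emeasure_Pair[OF B'] by (intro nn_integral_return) simp_all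
      also have "\<dots> = emeasure (distr (s i \<omega>) borel (Pair (X i \<omega>))) B"
        by (subst emeasure_distr[OF Pair B]) (simp add: borel_probsD(3)[OF s])
      finally show ?thesis .
    qed
    then show "1 / of_nat N * (\<Sum>i<N. emeasure (return borel (X i \<omega>) \<Otimes>\<^sub>M s i \<omega>) B) = emeasure ?A B"
      using nn_integral_average[OF N P, of "indicator B"] B AD(2)
      by (simp add: divide_ennreal_def)
  qed simp
  also have "\<dots> = ?A" using measure_of_of_measure[of ?A] AD by simp
  finally show "empirical X N s \<omega> = ?A" .
qed

lemma nn_integral_empirical:
  fixes X :: "nat \<Rightarrow> 'w \<Rightarrow> 'x::second_countable_topology"
    and s :: "nat \<Rightarrow> 'w \<Rightarrow> 'y::second_countable_topology measure"
  assumes N: "1 \<le> N" and s: "\<And>i. s i \<omega> \<in> borel_probs" and f: "f \<in> borel_measurable borel"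
  shows "(\<integral>\<^sup>+p. f p \<partial>empirical X N s \<omega>) = inverse (of_nat N) * (\<Sum>i<N. \<integral>\<^sup>+y. f (X i \<omega>, y) \<partial>s i \<omega>)"
proof -
  have Pair: "Pair x \<in> s i \<omega> \<rightarrow>\<^sub>M (borel :: ('x \<times> 'y) measure)" for i x
    unfolding measurable_cong_sets[OF borel_probsD(2)[OF s] refl] by (rule Pair_borel_measurable)
  have "(\<integral>\<^sup>+p. f p \<partial>distr (s i \<omega>) borel (Pair (X i \<omega>))) = (\<integral>\<^sup>+y. f (X i \<omega>, y) \<partial>s i \<omega>)" for i
    by (rule nn_integral_distr[OF Pair]) (use f in simp)
  then show ?thesis
    unfolding empirical_eq_average(1)[where s = s and \<omega> = \<omega>, OF N s]
    using nn_integral_average[where \<nu> = "\<lambda>i. distr (s i \<omega>) borel (Pair (X i \<omega>))" and f = f,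
        OF N empirical_eq_average(2)[where X = X and s = s and \<omega> = \<omega>, OF N s] f] by simp
qed

lemma empirical_prob:
  fixes X :: "nat \<Rightarrow> 'w \<Rightarrow> 'x::second_countable_topology"
    and s :: "nat \<Rightarrow> 'w \<Rightarrow> 'y::second_countable_topology measure"
  assumes N: "1 \<le> N" and s: "\<And>i. s i \<omega> \<in> borel_probs"
  shows "empirical X N s \<omega> \<in> borel_probs"
  unfolding empirical_eq_average(1)[where s = s and \<omega> = \<omega>, OF N s]
  by (rule average_prob[OF N empirical_eq_average(2)[where X = X and s = s and \<omega> = \<omega>, OF N s]])

section \<open>Expected costs under independent types\<close>

definition state_cost ::
  "('x \<times> 'y \<Rightarrow> ennreal) \<Rightarrow> ('y \<Rightarrow> ennreal) \<Rightarrow> 'x measure \<Rightarrow> ('x \<Rightarrow> 'y measure) \<Rightarrow> ennreal" where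
  "state_cost c L \<mu> K = (\<integral>\<^sup>+x. (\<integral>\<^sup>+y. c (x, y) \<partial>K x) + (\<integral>\<^sup>+y. L y \<partial>K x) \<partial>\<mu>)"

locale iid_types = prob_space M
  for M :: "'w measure" +
  fixes \<mu> :: "'x::{complete_space, second_countable_topology} measure" and X :: "nat \<Rightarrow> 'w \<Rightarrow> 'x"
  assumes X_indep: "indep_vars (\<lambda>_. borel) X UNIV" and X_law: "\<And>i. distr M borel (X i) = \<mu>"
begin

lemma X_measurable [measurable]: "X i \<in> borel_measurable M"
  using X_indep by (simp add: indep_vars_def)

lemma \<mu>_prob: "\<mu> \<in> borel_probs"
  using prob_space_distr[OF X_measurable, of 0] X_law[of 0] by (auto simp: borel_probs_def)

lemma nn_integral_type:
  assumes "g \<in> borel_measurable borel"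
  shows "(\<integral>\<^sup>+\<omega>. g (X i \<omega>) \<partial>M) = (\<integral>\<^sup>+x. g x \<partial>\<mu>)"
proof -
  have "g \<in> borel_measurable (distr M borel (X i))" using assms by simp
  from nn_integral_distr[OF X_measurable this] show ?thesis by (simp only: X_law)
qed

lemma indep_pair:
  assumes "i \<noteq> j"
  shows "indep_var borel (X i) borel (X j)"
proof -
  have "indep_var borel ((\<lambda>f. f i) \<circ> (\<lambda>\<omega>. restrict (\<lambda>i. X i \<omega>) {i})) borel ((\<lambda>f. f j) \<circ> (\<lambda>\<omega>. restrict (\<lambda>i. X i \<omega>) {j}))"
    using assms by (intro indep_var_compose[OF indep_var_restrict[OF X_indep]]) auto
  then show ?thesis by (simp add: comp_def)
qed

lemma nn_integral_type_pair:
  assumes "i \<noteq> j" and G: "(\<lambda>(x, x'). G x x') \<in> borel_measurable (borel \<Otimes>\<^sub>M borel)"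
  shows "(\<integral>\<^sup>+\<omega>. G (X i \<omega>) (X j \<omega>) \<partial>M) = (\<integral>\<^sup>+x. \<integral>\<^sup>+x'. G x x' \<partial>\<mu> \<partial>\<mu>)"
proof -
  interpret \<mu>: prob_space \<mu> by (rule borel_probsD[OF \<mu>_prob])
  have law: "distr M (borel \<Otimes>\<^sub>M borel) (\<lambda>\<omega>. (X i \<omega>, X j \<omega>)) = \<mu> \<Otimes>\<^sub>M \<mu>"
    using indep_pair[OF assms(1)] unfolding indep_var_distribution_eq by (simp add: X_law)
  have "sets (\<mu> \<Otimes>\<^sub>M \<mu>) = sets (borel \<Otimes>\<^sub>M borel)"
    by (rule sets_pair_measure_cong; rule borel_probsD[OF \<mu>_prob])
  note sets_eq = this
  have G': "(\<lambda>(x, x'). G x x') \<in> borel_measurable (\<mu> \<Otimes>\<^sub>M \<mu>)"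
    unfolding measurable_cong_sets[OF sets_eq refl] by (rule G)
  have "(\<integral>\<^sup>+\<omega>. G (X i \<omega>) (X j \<omega>) \<partial>M) = (\<integral>\<^sup>+p. (\<lambda>(x, x'). G x x') p \<partial>distr M (borel \<Otimes>\<^sub>M borel) (\<lambda>\<omega>. (X i \<omega>, X j \<omega>)))"
    by (subst nn_integral_distr) (use G in simp_all)
  also have "\<dots> = (\<integral>\<^sup>+x. \<integral>\<^sup>+x'. G x x' \<partial>\<mu> \<partial>\<mu>)"
    unfolding law using \<mu>.nn_integral_fst[OF G', symmetric] by simp
  finally show ?thesis .
qed

text \<open>
  Independence turns the expected interaction of two different players into the deterministic
  interaction between the mean laws of their actions. This is what makes all expected costs of the
  open-loop game functions of the kernels alone.
\<close>

lemma nn_integral_interaction: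
  fixes H :: "'y::second_countable_topology \<times> 'y \<Rightarrow> ennreal"
  assumes "i \<noteq> j" and K: "measurable_family K" and K': "measurable_family K'"
    and H: "H \<in> borel_measurable borel"
  shows "(\<integral>\<^sup>+\<omega>. interaction H (K (X i \<omega>)) (K' (X j \<omega>)) \<partial>M) = interaction H (mean_law \<mu> K) (mean_law \<mu> K')"
proof -
  have P: "K x \<in> borel_probs" for x using K by (simp add: measurable_family_def)
  have "(\<integral>\<^sup>+\<omega>. interaction H (K (X i \<omega>)) (K' (X j \<omega>)) \<partial>M) = (\<integral>\<^sup>+x. \<integral>\<^sup>+x'. interaction H (K x) (K' x') \<partial>\<mu> \<partial>\<mu>)"
    by (rule nn_integral_type_pair[OF assms(1) measurable_interaction_kernels[OF H K K']])
  also have "\<dots> = (\<integral>\<^sup>+x. interaction H (K x) (mean_law \<mu> K') \<partial>\<mu>)"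
    by (simp only: interaction_mean_law_right[OF \<mu>_prob K' P H])
  also have "\<dots> = interaction H (mean_law \<mu> K) (mean_law \<mu> K')"
    by (rule interaction_mean_law_left[OF \<mu>_prob K mean_law_prob[OF \<mu>_prob K'] H, symmetric])
  finally show ?thesis .
qed

lemma interaction_types_measurable:
  fixes H :: "'y::second_countable_topology \<times> 'y \<Rightarrow> ennreal"
  assumes K: "measurable_family K" and K': "measurable_family K'" and H: "H \<in> borel_measurable borel"
  shows "(\<lambda>\<omega>. interaction H (K (X i \<omega>)) (K' (X j \<omega>))) \<in> borel_measurable M"
proof -
  have "(\<lambda>\<omega>. (X i \<omega>, X j \<omega>)) \<in> M \<rightarrow>\<^sub>M borel \<Otimes>\<^sub>M borel" by measurable
  from measurable_compose[OF this measurable_interaction_kernels[OF H K K']] show ?thesis by simp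
qed

lemma kernel_integral_measurable:
  fixes f :: "'x \<times> 'y::second_countable_topology \<Rightarrow> ennreal"
  assumes "f \<in> borel_measurable borel" "measurable_family K"
  shows "(\<lambda>\<omega>. \<integral>\<^sup>+y. f (X i \<omega>, y) \<partial>K (X i \<omega>)) \<in> borel_measurable M"
  by (rule measurable_compose[OF X_measurable measurable_nn_integral_kernel[OF assms]])

lemma measurable_snd_borel:
  fixes L :: "'y::second_countable_topology \<Rightarrow> ennreal"
  assumes "L \<in> borel_measurable borel"
  shows "(\<lambda>p. L (snd p)) \<in> borel_measurable (borel :: ('x \<times> 'y) measure)"
  using assms by (simp add: borel_prod[symmetric])

lemma player_cost_eq:
  fixes c :: "'x \<times> 'y::second_countable_topology \<Rightarrow> ennreal"
  assumes c: "c \<in> borel_measurable borel" and L: "L \<in> borel_measurable borel" and H: "H \<in> borel_measurable borel"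
    and K: "\<And>j. measurable_family (K j)" and s: "\<And>j. j < N \<Longrightarrow> s j = (\<lambda>\<omega>. K j (X j \<omega>))" and i: "i < N"
  shows "player_cost c L H M X N i s = state_cost c L \<mu> (K i) +
      2 / of_nat N * (\<Sum>j\<in>{..<N} - {i}. interaction H (mean_law \<mu> (K i)) (mean_law \<mu> (K j)))"
proof -
  note [measurable] = interaction_types_measurable[OF K K H] kernel_integral_measurable[OF c K]
    kernel_integral_measurable[OF measurable_snd_borel[OF L] K, simplified]
  have "player_cost c L H M X N i s = (\<integral>\<^sup>+\<omega>. ((\<integral>\<^sup>+y. c (X i \<omega>, y) \<partial>K i (X i \<omega>)) + (\<integral>\<^sup>+y. L y \<partial>K i (X i \<omega>)))
        + 2 / of_nat N * (\<Sum>j\<in>{..<N} - {i}. interaction H (K i (X i \<omega>)) (K j (X j \<omega>))) \<partial>M)"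
    unfolding player_cost_def
  proof (rule nn_integral_cong)
    fix \<omega>
    have "(\<Sum>j\<in>{..<N} - {i}. interaction H (s i \<omega>) (s j \<omega>)) =
        (\<Sum>j\<in>{..<N} - {i}. interaction H (K i (X i \<omega>)) (K j (X j \<omega>)))"
      using s i by (intro sum.cong) auto
    then show "(\<integral>\<^sup>+y. c (X i \<omega>, y) \<partial>s i \<omega>) + (\<integral>\<^sup>+y. L y \<partial>s i \<omega>)
        + 2 / of_nat N * (\<Sum>j\<in>{..<N} - {i}. interaction H (s i \<omega>) (s j \<omega>)) =
      (\<integral>\<^sup>+y. c (X i \<omega>, y) \<partial>K i (X i \<omega>)) + (\<integral>\<^sup>+y. L y \<partial>K i (X i \<omega>))
        + 2 / of_nat N * (\<Sum>j\<in>{..<N} - {i}. interaction H (K i (X i \<omega>)) (K j (X j \<omega>)))"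
      by (simp only: s[OF i])
  qed
  also have "\<dots> = (\<integral>\<^sup>+\<omega>. (\<integral>\<^sup>+y. c (X i \<omega>, y) \<partial>K i (X i \<omega>)) + (\<integral>\<^sup>+y. L y \<partial>K i (X i \<omega>)) \<partial>M) +
      2 / of_nat N * (\<Sum>j\<in>{..<N} - {i}. \<integral>\<^sup>+\<omega>. interaction H (K i (X i \<omega>)) (K j (X j \<omega>)) \<partial>M)"
    by (subst nn_integral_add) (simp_all add: nn_integral_cmult nn_integral_sum)
  also have "(\<integral>\<^sup>+\<omega>. (\<integral>\<^sup>+y. c (X i \<omega>, y) \<partial>K i (X i \<omega>)) + (\<integral>\<^sup>+y. L y \<partial>K i (X i \<omega>)) \<partial>M) = state_cost c L \<mu> (K i)"
    unfolding state_cost_def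
    using measurable_nn_integral_kernel[OF c K] measurable_nn_integral_kernel[OF measurable_snd_borel[OF L] K]
    by (intro nn_integral_type) simp
  also have "(\<Sum>j\<in>{..<N} - {i}. \<integral>\<^sup>+\<omega>. interaction H (K i (X i \<omega>)) (K j (X j \<omega>)) \<partial>M) =
      (\<Sum>j\<in>{..<N} - {i}. interaction H (mean_law \<mu> (K i)) (mean_law \<mu> (K j)))"
    by (intro sum.cong refl nn_integral_interaction K H) auto
  finally show ?thesis .
qed

lemma potential_integral_eq:
  fixes c :: "'x \<times> 'y::second_countable_topology \<Rightarrow> ennreal"
  assumes c: "c \<in> borel_measurable borel" and L: "L \<in> borel_measurable borel" and H: "H \<in> borel_measurable borel"
    and K: "\<And>j. measurable_family (K j)" and s: "\<And>j. s j = (\<lambda>\<omega>. K j (X j \<omega>))" and N: "1 \<le> N"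
    and \<gamma>: "AE \<omega> in M. \<gamma> \<omega> = empirical X N s \<omega>"
  shows "(\<integral>\<^sup>+\<omega>. ((\<integral>\<^sup>+p. c p \<partial>\<gamma> \<omega>) + 1 / of_nat N * (\<Sum>i<N. \<integral>\<^sup>+y. L y \<partial>s i \<omega>)
          + 1 / (of_nat N)\<^sup>2 * (\<Sum>i<N. \<Sum>j\<in>{..<N} - {i}. interaction H (s i \<omega>) (s j \<omega>))) \<partial>M) =
     inverse (of_nat N) * (\<Sum>i<N. state_cost c L \<mu> (K i)) +
     1 / (of_nat N)\<^sup>2 * (\<Sum>i<N. \<Sum>j\<in>{..<N} - {i}. interaction H (mean_law \<mu> (K i)) (mean_law \<mu> (K j)))"
proof -
  note [measurable] = interaction_types_measurable[OF K K H] kernel_integral_measurable[OF c K]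
    kernel_integral_measurable[OF measurable_snd_borel[OF L] K, simplified]
  have P: "s i \<omega> \<in> borel_probs" for i \<omega> using K s by (simp add: measurable_family_def)
  let ?S = "\<lambda>i \<omega>. (\<integral>\<^sup>+y. c (X i \<omega>, y) \<partial>K i (X i \<omega>)) + (\<integral>\<^sup>+y. L y \<partial>K i (X i \<omega>))"
  let ?I = "\<lambda>i j \<omega>. interaction H (K i (X i \<omega>)) (K j (X j \<omega>))"
  have "(\<integral>\<^sup>+\<omega>. ((\<integral>\<^sup>+p. c p \<partial>\<gamma> \<omega>) + 1 / of_nat N * (\<Sum>i<N. \<integral>\<^sup>+y. L y \<partial>s i \<omega>)
          + 1 / (of_nat N)\<^sup>2 * (\<Sum>i<N. \<Sum>j\<in>{..<N} - {i}. interaction H (s i \<omega>) (s j \<omega>))) \<partial>M) =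
      (\<integral>\<^sup>+\<omega>. inverse (of_nat N) * (\<Sum>i<N. ?S i \<omega>) + 1 / (of_nat N)\<^sup>2 * (\<Sum>i<N. \<Sum>j\<in>{..<N} - {i}. ?I i j \<omega>) \<partial>M)"
  proof (rule nn_integral_cong_AE, rule AE_mp[OF \<gamma>], intro AE_I2 impI)
    fix \<omega> assume "\<gamma> \<omega> = empirical X N s \<omega>"
    then have "(\<integral>\<^sup>+p. c p \<partial>\<gamma> \<omega>) = inverse (of_nat N) * (\<Sum>i<N. \<integral>\<^sup>+y. c (X i \<omega>, y) \<partial>s i \<omega>)"
      using nn_integral_empirical[where X = X and s = s and \<omega> = \<omega>, OF N P c] by simp
    then show "(\<integral>\<^sup>+p. c p \<partial>\<gamma> \<omega>) + 1 / of_nat N * (\<Sum>i<N. \<integral>\<^sup>+y. L y \<partial>s i \<omega>)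
          + 1 / (of_nat N)\<^sup>2 * (\<Sum>i<N. \<Sum>j\<in>{..<N} - {i}. interaction H (s i \<omega>) (s j \<omega>)) =
        inverse (of_nat N) * (\<Sum>i<N. ?S i \<omega>) + 1 / (of_nat N)\<^sup>2 * (\<Sum>i<N. \<Sum>j\<in>{..<N} - {i}. ?I i j \<omega>)"
      by (simp add: s sum.distrib distrib_left divide_ennreal_def)
  qed
  also have "\<dots> = inverse (of_nat N) * (\<Sum>i<N. \<integral>\<^sup>+\<omega>. ?S i \<omega> \<partial>M) +
      1 / (of_nat N)\<^sup>2 * (\<Sum>i<N. \<Sum>j\<in>{..<N} - {i}. \<integral>\<^sup>+\<omega>. ?I i j \<omega> \<partial>M)"
    by (subst nn_integral_add) (simp_all add: nn_integral_cmult nn_integral_sum)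
  also have "(\<Sum>i<N. \<integral>\<^sup>+\<omega>. ?S i \<omega> \<partial>M) = (\<Sum>i<N. state_cost c L \<mu> (K i))"
    unfolding state_cost_def
    using measurable_nn_integral_kernel[OF c K] measurable_nn_integral_kernel[OF measurable_snd_borel[OF L] K]
    by (intro sum.cong refl nn_integral_type) simp
  also have "(\<Sum>i<N. \<Sum>j\<in>{..<N} - {i}. \<integral>\<^sup>+\<omega>. ?I i j \<omega> \<partial>M) =
      (\<Sum>i<N. \<Sum>j\<in>{..<N} - {i}. interaction H (mean_law \<mu> (K i)) (mean_law \<mu> (K j)))"
    by (intro sum.cong refl nn_integral_interaction K H) auto
  finally show ?thesis .
qed

lemma empirical_random_prob:
  fixes K :: "nat \<Rightarrow> 'x \<Rightarrow> 'y::{metric_space, second_countable_topology} measure"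
  assumes K: "\<And>j. measurable_family (K j)" and N: "1 \<le> N"
  shows "empirical X N (\<lambda>j \<omega>. K j (X j \<omega>)) \<in> random_probs M"
proof (rule random_probsI)
  let ?s = "\<lambda>j \<omega>. K j (X j \<omega>)"
  have P: "?s i \<omega> \<in> borel_probs" for i \<omega> using K by (simp add: measurable_family_def)
  show E: "empirical X N ?s \<omega> \<in> borel_probs" for \<omega>
    using P by (intro empirical_prob N)
  show "empirical X N ?s \<in> M \<rightarrow>\<^sub>M subprob_algebra borel"
  proof (rule measurable_subprob_algebra)
    fix \<omega> show "subprob_space (empirical X N ?s \<omega>)" "sets (empirical X N ?s \<omega>) = sets borel"
      using borel_probsD[OF E[of \<omega>]] by (auto intro: prob_space_imp_subprob_space)
  next
    fix A :: "('x \<times> 'y) set" assume A: "A \<in> sets borel"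
    then have A': "(indicator A :: _ \<Rightarrow> ennreal) \<in> borel_measurable borel" by simp
    have "emeasure (empirical X N ?s \<omega>) A = inverse (of_nat N) * (\<Sum>i<N. \<integral>\<^sup>+y. indicator A (X i \<omega>, y) \<partial>K i (X i \<omega>))" for \<omega>
      using nn_integral_empirical[where X = X and s = ?s and \<omega> = \<omega>, OF N P A'] A borel_probsD(2)[OF E[of \<omega>]] by simp
    then show "(\<lambda>\<omega>. emeasure (empirical X N ?s \<omega>) A) \<in> borel_measurable M"
      using kernel_integral_measurable[OF A' K] by simp
  qed
qed

text \<open>
  The centred summands are pairwise orthogonal. Only the \<open>N\<close> diagonal terms survive,
  and each is at most \<open>(2 * b)\<^sup>2\<close>.
\<close>

lemma second_moment_empirical_mean:
  fixes g :: "nat \<Rightarrow> 'x \<Rightarrow> real"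
  assumes g [measurable]: "\<And>i. g i \<in> borel_measurable borel" and b: "\<And>i x. \<bar>g i x\<bar> \<le> b" and N: "1 \<le> N"
  shows "(\<integral>\<omega>. ((\<Sum>i<N. g i (X i \<omega>)) / N - (\<Sum>i<N. \<integral>x. g i x \<partial>\<mu>) / N)\<^sup>2 \<partial>M) \<le> 4 * b\<^sup>2 / N"
proof -
  interpret \<mu>: prob_space \<mu> by (rule borel_probsD[OF \<mu>_prob])
  define m where "m i = (\<integral>x. g i x \<partial>\<mu>)" for i
  define Y where "Y i \<omega> = g i (X i \<omega>) - m i" for i \<omega>
  have Y_meas [measurable]: "Y i \<in> borel_measurable M" for i unfolding Y_def by measurable
  have m_b: "\<bar>m i\<bar> \<le> b" for i
  proof -
    have "integrable \<mu> (g i)"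
    proof (rule integrable_bounded[OF \<mu>.prob_space_axioms _ b])
      show "g i \<in> borel_measurable \<mu>"
        unfolding measurable_cong_sets[OF borel_probsD(2)[OF \<mu>_prob] refl] by (rule g)
    qed
    then have "\<bar>m i\<bar> \<le> (\<integral>x. b \<partial>\<mu>)"
      unfolding m_def using b by (intro order_trans[OF integral_abs_bound integral_mono]) auto
    then show ?thesis by (simp add: \<mu>.prob_space)
  qed
  have Y_b: "\<bar>Y i \<omega>\<bar> \<le> 2 * b" for i \<omega>
    using b[of i "X i \<omega>"] m_b[of i] unfolding Y_def by linarith
  have Y_int: "integrable M (Y i)" for i
    using prob_space_axioms Y_meas Y_b by (rule integrable_bounded)
  have YY_b: "\<bar>Y i \<omega> * Y j \<omega>\<bar> \<le> 4 * b\<^sup>2" for i j \<omega>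
    using mult_mono[OF Y_b[of i \<omega>] Y_b[of j \<omega>]] order_trans[OF abs_ge_zero Y_b[of i \<omega>]]
    by (simp add: abs_mult power2_eq_square)
  have YY_int: "integrable M (\<lambda>\<omega>. Y i \<omega> * Y j \<omega>)" for i j
    by (rule integrable_bounded[OF prob_space_axioms _ YY_b]) measurable
  have EY: "(\<integral>\<omega>. Y i \<omega> \<partial>M) = 0" for i
  proof -
    have "(\<integral>\<omega>. g i (X i \<omega>) \<partial>M) = m i"
      unfolding m_def using integral_distr[OF X_measurable g, of i i] by (simp add: X_law)
    moreover have "integrable M (\<lambda>\<omega>. g i (X i \<omega>))"
      using b by (intro integrable_bounded[where b = b] prob_space_axioms) auto
    ultimately show ?thesis unfolding Y_def by (simp add: prob_space)
  qed
  have EYY: "(\<integral>\<omega>. Y i \<omega> * Y j \<omega> \<partial>M) = 0" if "i \<noteq> j" for i j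
  proof -
    have "indep_var borel ((\<lambda>x. g i x - m i) \<circ> X i) borel ((\<lambda>x. g j x - m j) \<circ> X j)"
      by (rule indep_var_compose[OF indep_pair[OF that]]) measurable
    then have "indep_var borel (Y i) borel (Y j)" by (simp add: comp_def Y_def[abs_def])
    from indep_var_lebesgue_integral[OF this Y_int Y_int] show ?thesis by (simp add: EY)
  qed
  have "(\<integral>\<omega>. (\<Sum>i<N. Y i \<omega>)\<^sup>2 \<partial>M) = (\<integral>\<omega>. (\<Sum>i<N. \<Sum>j<N. Y i \<omega> * Y j \<omega>) \<partial>M)"
    by (simp add: power2_eq_square sum_product)
  also have "\<dots> = (\<Sum>i<N. \<Sum>j<N. \<integral>\<omega>. Y i \<omega> * Y j \<omega> \<partial>M)"
    by (simp add: YY_int)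
  also have "\<dots> = (\<Sum>i<N. \<integral>\<omega>. Y i \<omega> * Y i \<omega> \<partial>M)"
  proof (rule sum.cong[OF refl])
    fix i assume "i \<in> {..<N}"
    then have "(\<Sum>j<N. \<integral>\<omega>. Y i \<omega> * Y j \<omega> \<partial>M) = (\<Sum>j\<in>{i}. \<integral>\<omega>. Y i \<omega> * Y j \<omega> \<partial>M)"
      using EYY by (intro sum.mono_neutral_right) auto
    then show "(\<Sum>j<N. \<integral>\<omega>. Y i \<omega> * Y j \<omega> \<partial>M) = (\<integral>\<omega>. Y i \<omega> * Y i \<omega> \<partial>M)" by simp
  qed
  also have "\<dots> \<le> (\<Sum>i<N. 4 * b\<^sup>2)"
  proof (rule sum_mono)
    fix i
    have "Y i \<omega> * Y i \<omega> \<le> 4 * b\<^sup>2" for \<omega> using YY_b[of i \<omega> i] by linarith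
    then have "(\<integral>\<omega>. Y i \<omega> * Y i \<omega> \<partial>M) \<le> (\<integral>\<omega>. 4 * b\<^sup>2 \<partial>M)"
      by (intro integral_mono YY_int) simp_all
    then show "(\<integral>\<omega>. Y i \<omega> * Y i \<omega> \<partial>M) \<le> 4 * b\<^sup>2" by (simp add: prob_space)
  qed
  finally have "(\<integral>\<omega>. (\<Sum>i<N. Y i \<omega>)\<^sup>2 \<partial>M) \<le> N * (4 * b\<^sup>2)" by simp
  moreover have "((\<Sum>i<N. g i (X i \<omega>)) / N - (\<Sum>i<N. \<integral>x. g i x \<partial>\<mu>) / N)\<^sup>2 = (\<Sum>i<N. Y i \<omega>)\<^sup>2 / (real N)\<^sup>2" for \<omega>
    by (simp add: Y_def m_def sum_subtractf diff_divide_distrib[symmetric] power_divide)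
  ultimately have "(\<integral>\<omega>. ((\<Sum>i<N. g i (X i \<omega>)) / N - (\<Sum>i<N. \<integral>x. g i x \<partial>\<mu>) / N)\<^sup>2 \<partial>M) \<le> N * (4 * b\<^sup>2) / (real N)\<^sup>2"
    by (simp add: divide_right_mono)
  also have "\<dots> = 4 * b\<^sup>2 / N" using N by (simp add: power2_eq_square)
  finally show ?thesis .
qed

end

section \<open>Tightness and the narrow topology of random measures\<close>

lemma lower_semicontinuous_borel:
  "lower_semicontinuous f \<Longrightarrow> f \<in> borel_measurable borel"
  by (rule borel_measurableI_greater) (simp add: lower_semicontinuous_def)

text \<open>
  The first marginal does not depend on \<open>n\<close> and is inner regular. For the second
  coordinate, sublevel sets of \<open>L\<close> are compact, and Markov's inequality bounds the
  mass outside them.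
\<close>

lemma joint_tight:
  fixes \<mu> :: "'x::{complete_space, second_countable_topology} measure"
    and K :: "nat \<Rightarrow> 'x \<Rightarrow> 'y::{metric_space, second_countable_topology} measure"
  assumes \<mu>: "\<mu> \<in> borel_probs" and K: "\<And>n. measurable_family (K n)"
    and L: "lower_semicontinuous L" and L_compact: "\<And>r::real. 0 < r \<Longrightarrow> compact {y. L y \<le> ennreal r}"
    and bound: "\<And>n. (\<integral>\<^sup>+x. \<integral>\<^sup>+y. L y \<partial>K n x \<partial>\<mu>) \<le> ennreal C" and C: "0 \<le> C" and \<epsilon>: "0 < (\<epsilon>::real)"
  shows "\<exists>T. compact T \<and> (\<forall>n. emeasure (joint \<mu> (K n)) (- T) \<le> ennreal \<epsilon>)"
proof -
  interpret prob_space \<mu> by (rule borel_probsD[OF \<mu>])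
  note \<mu>D = borel_probsD[OF \<mu>]
  have L_meas: "L \<in> borel_measurable borel" using L by (rule lower_semicontinuous_borel)
  have "ennreal (1 - \<epsilon> / 2) < emeasure \<mu> UNIV"
    using \<epsilon> emeasure_space_1 \<mu>D(3) by (cases "1 - \<epsilon> / 2 \<ge> 0") (auto simp: ennreal_less_one_iff ennreal_neg)
  also have "emeasure \<mu> UNIV = (SUP T \<in> {T. T \<subseteq> UNIV \<and> compact T}. emeasure \<mu> T)"
    by (rule inner_regular[OF \<mu>D(2)]) (use emeasure_space_1 in simp_all)
  finally obtain T where T: "compact T" "ennreal (1 - \<epsilon> / 2) < emeasure \<mu> T"
    by (auto simp: less_SUP_iff)
  have T_sets: "T \<in> sets borel" "- T \<in> sets borel"
    using T(1) by (auto simp: compact_imp_closed)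
  have T_small: "emeasure \<mu> (- T) \<le> ennreal (\<epsilon> / 2)"
  proof -
    have "measure \<mu> (- T) = 1 - measure \<mu> T"
      using prob_compl[of T] T_sets \<mu>D by (simp add: Compl_eq_Diff_UNIV)
    moreover have "1 - \<epsilon> / 2 < measure \<mu> T"
      using T(2) by (cases "1 - \<epsilon> / 2 \<ge> 0")
        (auto simp: emeasure_eq_measure ennreal_less_iff intro: less_le_trans[OF _ measure_nonneg])
    ultimately show ?thesis using \<epsilon> by (simp add: emeasure_eq_measure ennreal_leI)
  qed
  \<comment> \<open>Level at which Markov gives at most \<open>\<epsilon> / 2\<close>; the summand
  1 keeps it positive for \<open>C = 0\<close>.\<close>
  define r where "r = 2 * C / \<epsilon> + 1"
  have r: "0 < r" "C / r \<le> \<epsilon> / 2" using C \<epsilon> by (auto simp: r_def field_simps add_pos_nonneg)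
  define V where "V = {y. L y \<le> ennreal r}"
  have V: "compact V" unfolding V_def by (rule L_compact[OF r(1)])
  show ?thesis
  proof (intro exI conjI allI)
    show "compact (T \<times> V)" using T(1) V by (rule compact_Times)
    fix n
    have J: "joint \<mu> (K n) \<in> borel_probs" using joint_coupling[OF \<mu> K] by (simp add: couplings_of_def)
    have TV: "- (T \<times> V) \<in> sets borel" using \<open>compact (T \<times> V)\<close> by (simp add: compact_imp_closed open_Compl)
    have [measurable]: "(\<lambda>p. indicator (- T) (fst p) + ennreal (1 / r) * L (snd p)) \<in> borel_measurable (borel :: ('x \<times> 'y) measure)"
      using T_sets L_meas unfolding borel_prod[symmetric] by measurable
    have "emeasure (joint \<mu> (K n)) (- (T \<times> V)) = (\<integral>\<^sup>+p. indicator (- (T \<times> V)) p \<partial>joint \<mu> (K n))"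
      using TV borel_probsD(2)[OF J] by simp
    also have "\<dots> \<le> (\<integral>\<^sup>+p. indicator (- T) (fst p) + ennreal (1 / r) * L (snd p) \<partial>joint \<mu> (K n))"
    proof (rule nn_integral_mono)
      fix p :: "'x \<times> 'y"
      have "1 \<le> ennreal (1 / r) * L (snd p)" if "snd p \<notin> V"
      proof -
        have "1 = ennreal (1 / r) * ennreal r" using r(1) by (simp add: ennreal_mult[symmetric])
        also have "\<dots> \<le> ennreal (1 / r) * L (snd p)"
          using that by (intro mult_left_mono) (auto simp: V_def)
        finally show ?thesis .
      qed
      then show "indicator (- (T \<times> V)) p \<le> indicator (- T) (fst p) + ennreal (1 / r) * L (snd p)"
        by (cases p) (auto simp: indicator_def add_increasing)
    qed
    also have "\<dots> = (\<integral>\<^sup>+x. \<integral>\<^sup>+y. indicator (- T) x + ennreal (1 / r) * L y \<partial>K n x \<partial>\<mu>)"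
      by (subst nn_integral_joint[OF \<mu> K]) (simp_all)
    also have "\<dots> = (\<integral>\<^sup>+x. indicator (- T) x + ennreal (1 / r) * (\<integral>\<^sup>+y. L y \<partial>K n x) \<partial>\<mu>)"
    proof (rule nn_integral_cong)
      fix x
      have "L \<in> borel_measurable (K n x)"
        unfolding measurable_cong_sets[OF measurable_familyD(2)[OF K] refl] by (rule L_meas)
      then show "(\<integral>\<^sup>+y. indicator (- T) x + ennreal (1 / r) * L y \<partial>K n x) =
          indicator (- T) x + ennreal (1 / r) * (\<integral>\<^sup>+y. L y \<partial>K n x)"
        using prob_space.emeasure_space_1[OF measurable_familyD(1)[OF K]]
        by (simp add: nn_integral_add nn_integral_cmult)
    qed
    also have "\<dots> = emeasure \<mu> (- T) + ennreal (1 / r) * (\<integral>\<^sup>+x. \<integral>\<^sup>+y. L y \<partial>K n x \<partial>\<mu>)"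
    proof -
      have LK: "(\<lambda>x. \<integral>\<^sup>+y. L y \<partial>K n x) \<in> borel_measurable \<mu>"
        unfolding measurable_cong_sets[OF \<mu>D(2) refl]
        using measurable_compose[OF measurable_family_kernel[OF K] nn_integral_measurable_subprob_algebra[OF L_meas]] .
      then show ?thesis using T_sets \<mu>D(2)
        by (subst nn_integral_add) (auto simp: nn_integral_cmult)
    qed
    also have "\<dots> \<le> ennreal (\<epsilon> / 2) + ennreal (1 / r) * ennreal C"
      by (intro add_mono mult_left_mono bound T_small) simp
    also have "\<dots> = ennreal (\<epsilon> / 2 + C / r)"
      using r(1) C \<epsilon> by (simp add: ennreal_mult[symmetric] ennreal_plus[symmetric] del: ennreal_plus)
    also have "\<dots> \<le> ennreal \<epsilon>" using r(2) by (intro ennreal_leI) linarith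
    finally show "emeasure (joint \<mu> (K n)) (- (T \<times> V)) \<le> ennreal \<epsilon>" .
  qed
qed

text \<open>
  Approximate \<open>z\<close> by the first point of a dense sequence within
  \<open>2\<^sup>-\<^sup>m\<close>: this makes \<open>f\<close> a limit of functions that depend
  on \<open>z\<close> through a countable index only.
\<close>

lemma caratheodory_measurable:
  fixes f :: "'w \<Rightarrow> 'z::{metric_space, second_countable_topology} \<Rightarrow> real"
  assumes f: "\<And>z. (\<lambda>\<omega>. f \<omega> z) \<in> borel_measurable M"
    and cont: "\<And>\<omega>. \<omega> \<in> space M \<Longrightarrow> continuous_on UNIV (f \<omega>)"
  shows "(\<lambda>(\<omega>, z). f \<omega> z) \<in> borel_measurable (M \<Otimes>\<^sub>M borel)"
proof -
  obtain d :: "nat \<Rightarrow> 'z" where d: "\<And>z e. 0 < e \<Longrightarrow> \<exists>k. dist z (d k) < e"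
    using dense_sequence by blast
  define k where "k m z = (LEAST k. dist z (d k) < 1 / 2 ^ m)" for m :: nat and z
  have k: "dist z (d (k m z)) < 1 / 2 ^ m" for m z
    unfolding k_def using d[of "1 / 2 ^ m" z] by (auto intro: LeastI)
  have k_meas [measurable]: "k m \<in> borel \<rightarrow>\<^sub>M count_space UNIV" for m
    unfolding k_def by measurable
  have lim: "(\<lambda>m. d (k m z)) \<longlonglongrightarrow> z" for z
  proof (rule tendsto_dist_iff[THEN iffD2], rule Lim_null_comparison)
    show "\<forall>\<^sub>F m in sequentially. norm (dist (d (k m z)) z) \<le> (1 / 2) ^ m"
      using k by (intro always_eventually allI) (simp add: power_divide dist_commute less_imp_le)
    show "(\<lambda>m. (1 / 2 :: real) ^ m) \<longlonglongrightarrow> 0"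
      by (rule LIMSEQ_realpow_zero) simp_all
  qed
  have "(\<lambda>p. f (fst p) (snd p)) \<in> borel_measurable (M \<Otimes>\<^sub>M borel)"
  proof (rule borel_measurable_LIMSEQ_real)
    fix p assume "p \<in> space (M \<Otimes>\<^sub>M (borel :: 'z measure))"
    then have "fst p \<in> space M" by (auto simp: space_pair_measure)
    from cont[OF this] show "(\<lambda>m. f (fst p) (d (k m (snd p)))) \<longlonglongrightarrow> f (fst p) (snd p)"
      using lim by (rule continuous_on_tendsto_compose) auto
  next
    fix m
    have k_snd: "(\<lambda>p. k m (snd p)) \<in> M \<Otimes>\<^sub>M borel \<rightarrow>\<^sub>M count_space UNIV"
      by (rule measurable_compose[OF measurable_snd k_meas])
    have f_fst: "(\<lambda>p. f (fst p) (d j)) \<in> borel_measurable (M \<Otimes>\<^sub>M borel)" for j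
      by (rule measurable_compose[OF measurable_fst f])
    show "(\<lambda>p. f (fst p) (d (k m (snd p)))) \<in> borel_measurable (M \<Otimes>\<^sub>M borel)"
      by (rule measurable_compose_countable[where f = "\<lambda>j p. f (fst p) (d j)", OF f_fst k_snd])
  qed
  then show ?thesis by (simp add: case_prod_beta')
qed

lemma borel_measurable_completion_AE:
  fixes u g :: "'w \<Rightarrow> real"
  assumes g: "g \<in> borel_measurable M" and eq: "AE \<omega> in M. u \<omega> = g \<omega>"
  shows "u \<in> borel_measurable (completion M)"
proof (rule borel_measurableI)
  fix S :: "real set" assume S: "open S"
  define P where "P \<omega> \<longleftrightarrow> u \<omega> \<in> S \<and> u \<omega> \<noteq> g \<omega>" for \<omega>
  define Q where "Q \<omega> \<longleftrightarrow> g \<omega> \<in> S \<and> u \<omega> \<noteq> g \<omega>" for \<omega>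
  define R where "R \<omega> \<longleftrightarrow> g \<omega> \<in> S" for \<omega>
  have P: "Measurable.pred (completion M) P"
    by (rule sets_completion_AE, rule eventually_mono[OF eq]) (simp add: P_def)
  have Q: "Measurable.pred (completion M) Q"
    by (rule sets_completion_AE, rule eventually_mono[OF eq]) (simp add: Q_def)
  have R: "Measurable.pred (completion M) R"
    unfolding pred_def R_def using measurable_sets[OF measurable_completion[OF g], of S] S
    by (simp add: vimage_def Int_def conj_commute)
  have "Measurable.pred (completion M) (\<lambda>\<omega>. (R \<omega> \<and> \<not> Q \<omega>) \<or> P \<omega>)"
    by (intro pred_intros_logic P Q R)
  moreover have "u -` S \<inter> space (completion M) = {\<omega>\<in>space (completion M). (R \<omega> \<and> \<not> Q \<omega>) \<or> P \<omega>}"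
    unfolding P_def Q_def R_def by auto
  ultimately show "u -` S \<inter> space (completion M) \<in> sets (completion M)"
    unfolding pred_def by simp
qed

text \<open>
  Continuity of the sections fails on a null set, where the values of the integral are
  uncontrolled. Passing to the completion makes them irrelevant.
\<close>

lemma integral_random_prob_measurable:
  fixes f :: "'w \<Rightarrow> 'z::{metric_space, second_countable_topology} \<Rightarrow> real"
  assumes \<gamma>: "\<gamma> \<in> random_probs M" and f: "narrow_test M f"
  shows "(\<lambda>\<omega>. \<integral>z. f \<omega> z \<partial>\<gamma> \<omega>) \<in> borel_measurable (completion M)"
proof -
  note \<gamma>K = measurable_prob_algebraD[OF random_probs_kernel[OF \<gamma>]]
  have "AE \<omega> in M. continuous_on UNIV (f \<omega>) \<and> bounded (range (f \<omega>))"
    using f unfolding narrow_test_def by (rule conjunct1)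
  then obtain N where N: "\<And>\<omega>. \<omega> \<in> space M - N \<Longrightarrow> continuous_on UNIV (f \<omega>) \<and> bounded (range (f \<omega>))"
    "N \<in> null_sets M"
    using AE_E3 by blast
  define f' where "f' \<omega> z = (if \<omega> \<in> N then 0 else f \<omega> z)" for \<omega> z
  have [measurable]: "N \<in> sets M" using N(2) by auto
  have joint_meas: "(\<lambda>(\<omega>, z). f' \<omega> z) \<in> borel_measurable (M \<Otimes>\<^sub>M borel)"
  proof (rule caratheodory_measurable)
    have [measurable]: "(\<lambda>\<omega>. f \<omega> z) \<in> borel_measurable M" for z using f by (simp add: narrow_test_def)
    show "(\<lambda>\<omega>. f' \<omega> z) \<in> borel_measurable M" for z unfolding f'_def by measurable
    fix \<omega> assume \<omega>: "\<omega> \<in> space M"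
    show "continuous_on UNIV (f' \<omega>)"
    proof (cases "\<omega> \<in> N")
      case True
      then have "f' \<omega> = (\<lambda>_. 0)" by (intro ext) (simp add: f'_def)
      then show ?thesis by (simp only: continuous_on_const)
    next
      case False
      then have "f' \<omega> = f \<omega>" by (intro ext) (simp add: f'_def)
      then show ?thesis using N(1)[of \<omega>] \<omega> False by simp
    qed
  qed
  define D where "D \<omega> = distr (\<gamma> \<omega>) (M \<Otimes>\<^sub>M borel) (Pair \<omega>)" for \<omega>
  have "(\<lambda>(\<omega>, z). (\<omega>, z)) \<in> M \<Otimes>\<^sub>M borel \<rightarrow>\<^sub>M M \<Otimes>\<^sub>M (borel :: 'z measure)" by simp
  from measurable_distr2[OF this \<gamma>K] have "D \<in> M \<rightarrow>\<^sub>M subprob_algebra (M \<Otimes>\<^sub>M borel)"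
    by (simp add: D_def[abs_def])
  from measurable_compose[OF this integral_measurable_subprob_algebra[OF joint_meas]]
  have "(\<lambda>\<omega>. \<integral>p. (\<lambda>(\<omega>, z). f' \<omega> z) p \<partial>D \<omega>) \<in> borel_measurable M" .
  moreover have "AE \<omega> in M. (\<integral>z. f \<omega> z \<partial>\<gamma> \<omega>) = (\<integral>p. (\<lambda>(\<omega>, z). f' \<omega> z) p \<partial>D \<omega>)"
  proof (rule AE_mp[OF AE_not_in[OF N(2)]], intro AE_I2 impI)
    fix \<omega> assume \<omega>: "\<omega> \<in> space M" "\<omega> \<notin> N"
    have "Pair \<omega> \<in> \<gamma> \<omega> \<rightarrow>\<^sub>M M \<Otimes>\<^sub>M borel"
      unfolding measurable_cong_sets[OF borel_probsD(2)[OF random_probsD[OF \<gamma> \<omega>(1)]] refl]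
      using \<omega>(1) by (rule measurable_Pair1')
    then have "(\<integral>p. (\<lambda>(\<omega>, z). f' \<omega> z) p \<partial>D \<omega>) = (\<integral>z. f' \<omega> z \<partial>\<gamma> \<omega>)"
      unfolding D_def by (subst integral_distr[OF _ joint_meas]) simp_all
    then show "(\<integral>z. f \<omega> z \<partial>\<gamma> \<omega>) = (\<integral>p. (\<lambda>(\<omega>, z). f' \<omega> z) p \<partial>D \<omega>)"
      using \<omega>(2) by (simp add: f'_def)
  qed
  ultimately show ?thesis by (rule borel_measurable_completion_AE)
qed

lemma const_random_probs:
  fixes \<gamma> :: "'z::{metric_space, second_countable_topology} measure"
  assumes "\<gamma> \<in> borel_probs"
  shows "(\<lambda>_. \<gamma>) \<in> random_probs M"
  using assms unfolding random_probs_def by (simp add: space_narrow_borel)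

text \<open>
  For almost every \<open>\<omega>\<close> the section of a test function is bounded and
  continuous, so the inner integrals converge. Dominated convergence, with the supremum norm of
  the sections as majorant, gives convergence of the expectations.
\<close>

lemma limitin_random_narrow_if_AE:
  fixes \<Gamma> :: "nat \<Rightarrow> 'w \<Rightarrow> 'z::{metric_space, second_countable_topology} measure"
  assumes M: "prob_space M" and \<Gamma>: "\<And>k. \<Gamma> k \<in> random_probs M" and \<gamma>: "\<gamma> \<in> borel_probs"
    and lim: "AE \<omega> in M. \<forall>f::'z \<Rightarrow> real. continuous_on UNIV f \<longrightarrow> bounded (range f) \<longrightarrow>
        (\<lambda>k. \<integral>z. f z \<partial>\<Gamma> k \<omega>) \<longlonglongrightarrow> (\<integral>z. f z \<partial>\<gamma>)"
  shows "limitin (random_narrow_topology M) \<Gamma> (\<lambda>_. \<gamma>) sequentially"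
  unfolding random_narrow_topology_def limitin_weak_topology_on
proof (intro conjI ballI const_random_probs[OF \<gamma>])
  show "\<forall>\<^sub>F k in sequentially. \<Gamma> k \<in> random_probs M" by (simp add: \<Gamma>)
  fix \<phi> :: "('w \<Rightarrow> 'z measure) \<Rightarrow> real"
  assume "\<phi> \<in> {\<lambda>\<gamma>. \<integral>\<omega>. (\<integral>z. f \<omega> z \<partial>\<gamma> \<omega>) \<partial>completion M |f. narrow_test M f}"
  then obtain f where \<phi>: "\<phi> = (\<lambda>\<gamma>. \<integral>\<omega>. (\<integral>z. f \<omega> z \<partial>\<gamma> \<omega>) \<partial>completion M)" and f: "narrow_test M f" by blast
  have good: "AE \<omega> in M. continuous_on UNIV (f \<omega>) \<and> bounded (range (f \<omega>))"
    using f by (simp add: narrow_test_def)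
  show "(\<lambda>k. \<phi> (\<Gamma> k)) \<longlonglongrightarrow> \<phi> (\<lambda>_. \<gamma>)"
    unfolding \<phi>
  proof (rule integral_dominated_convergence[where w = "\<lambda>\<omega>. SUP z. \<bar>f \<omega> z\<bar>"])
    show "(\<lambda>\<omega>. \<integral>z. f \<omega> z \<partial>\<gamma>) \<in> borel_measurable (completion M)"
      by (rule integral_random_prob_measurable[OF const_random_probs[OF \<gamma>] f])
    show "(\<lambda>\<omega>. \<integral>z. f \<omega> z \<partial>\<Gamma> k \<omega>) \<in> borel_measurable (completion M)" for k
      by (rule integral_random_prob_measurable[OF \<Gamma> f])
    show "integrable (completion M) (\<lambda>\<omega>. SUP z. \<bar>f \<omega> z\<bar>)" using f by (simp add: narrow_test_def)
    have "AE \<omega> in M. (\<lambda>k. \<integral>z. f \<omega> z \<partial>\<Gamma> k \<omega>) \<longlonglongrightarrow> (\<integral>z. f \<omega> z \<partial>\<gamma>)"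
      using lim good by eventually_elim blast
    then show "AE \<omega> in completion M. (\<lambda>k. \<integral>z. f \<omega> z \<partial>\<Gamma> k \<omega>) \<longlonglongrightarrow> (\<integral>z. f \<omega> z \<partial>\<gamma>)"
      by (rule AE_completion)
    fix k
    have "AE \<omega> in M. norm (\<integral>z. f \<omega> z \<partial>\<Gamma> k \<omega>) \<le> (SUP z. \<bar>f \<omega> z\<bar>)"
    proof (rule AE_mp[OF good], intro AE_I2 impI)
      fix \<omega> assume \<omega>: "\<omega> \<in> space M" and c: "continuous_on UNIV (f \<omega>) \<and> bounded (range (f \<omega>))"
      note D = borel_probsD[OF random_probsD[OF \<Gamma>[of k] \<omega>]]
      interpret P: prob_space "\<Gamma> k \<omega>" by (rule D)
      have "bdd_above (range (\<lambda>z. \<bar>f \<omega> z\<bar>))"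
        using c by (auto simp: bounded_iff bdd_above_def)
      then have le: "\<bar>f \<omega> z\<bar> \<le> (SUP z. \<bar>f \<omega> z\<bar>)" for z by (rule cSUP_upper[OF UNIV_I])
      have "f \<omega> \<in> borel_measurable (\<Gamma> k \<omega>)"
        unfolding measurable_cong_sets[OF D(2) refl] using c by (intro borel_measurable_continuous_onI) simp
      then have int: "integrable (\<Gamma> k \<omega>) (f \<omega>)" by (rule integrable_bounded[OF D(1) _ le])
      have "norm (\<integral>z. f \<omega> z \<partial>\<Gamma> k \<omega>) \<le> (\<integral>z. \<bar>f \<omega> z\<bar> \<partial>\<Gamma> k \<omega>)"
        by (simp only: real_norm_def integral_abs_bound)
      also have "\<dots> \<le> (\<integral>z. (SUP z. \<bar>f \<omega> z\<bar>) \<partial>\<Gamma> k \<omega>)"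
        using int le by (intro integral_mono integrable_abs) simp_all
      also have "\<dots> = (SUP z. \<bar>f \<omega> z\<bar>)" by (simp add: P.prob_space)
      finally show "norm (\<integral>z. f \<omega> z \<partial>\<Gamma> k \<omega>) \<le> (SUP z. \<bar>f \<omega> z\<bar>)" .
    qed
    then show "AE \<omega> in completion M. norm (\<integral>z. f \<omega> z \<partial>\<Gamma> k \<omega>) \<le> (SUP z. \<bar>f \<omega> z\<bar>)"
      by (rule AE_completion)
  qed
qed

text \<open>
  The narrow topology of random measures separates random measures up to null sets: testing with
  \<open>indicator A \<omega> * tent d l z\<close> for all events \<open>A\<close> identifies
  almost surely each of the countably many tent integrals of the limit.
\<close>

lemma random_narrow_limit_unique:
  fixes \<Gamma> :: "nat \<Rightarrow> 'w \<Rightarrow> 'z::{metric_space, second_countable_topology} measure"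
  assumes M: "prob_space M" and lim: "limitin (random_narrow_topology M) \<Gamma> \<Gamma>\<^sub>0 sequentially"
    and lim': "limitin (random_narrow_topology M) \<Gamma> (\<lambda>_. \<gamma>) sequentially"
  shows "AE \<omega> in M. \<Gamma>\<^sub>0 \<omega> = \<gamma>"
proof -
  interpret prob_space M by fact
  note L = lim[unfolded random_narrow_topology_def limitin_weak_topology_on]
  note L' = lim'[unfolded random_narrow_topology_def limitin_weak_topology_on]
  have \<Gamma>\<^sub>0: "\<Gamma>\<^sub>0 \<in> random_probs M" and c: "(\<lambda>_. \<gamma>) \<in> random_probs M" using L L' by auto
  obtain d :: "nat \<Rightarrow> 'z" where d: "\<And>z e. 0 < e \<Longrightarrow> \<exists>k. dist z (d k) < e"
    using dense_sequence by blast
  have eq: "(\<integral>\<omega>. (\<integral>z. f \<omega> z \<partial>\<Gamma>\<^sub>0 \<omega>) \<partial>completion M) = (\<integral>\<omega>. (\<integral>z. f \<omega> z \<partial>\<gamma>) \<partial>completion M)"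
    if f: "narrow_test M f" for f
  proof (rule LIMSEQ_unique)
    let ?\<phi> = "\<lambda>\<gamma>. \<integral>\<omega>. (\<integral>z. f \<omega> z \<partial>\<gamma> \<omega>) \<partial>completion M"
    have in_tests: "?\<phi> \<in> {\<lambda>\<gamma>. \<integral>\<omega>. (\<integral>z. f \<omega> z \<partial>\<gamma> \<omega>) \<partial>completion M |f. narrow_test M f}" using f by blast
    show "(\<lambda>k. ?\<phi> (\<Gamma> k)) \<longlonglongrightarrow> ?\<phi> \<Gamma>\<^sub>0" by (rule bspec[OF conjunct2[OF conjunct2[OF L]] in_tests])
    show "(\<lambda>k. ?\<phi> (\<Gamma> k)) \<longlonglongrightarrow> (\<integral>\<omega>. (\<integral>z. f \<omega> z \<partial>\<gamma>) \<partial>completion M)" by (rule bspec[OF conjunct2[OF conjunct2[OF L']] in_tests])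
  qed
  have "AE \<omega> in M. (\<integral>z. tent d l z \<partial>\<Gamma>\<^sub>0 \<omega>) = (\<integral>z. tent d l z \<partial>\<gamma>)" for l
  proof -
    obtain b where b: "\<And>z. \<bar>tent d l z\<bar> \<le> b" using tent_bounded by blast
    define u where "u \<omega> = (\<integral>z. tent d l z \<partial>\<Gamma>\<^sub>0 \<omega>)" for \<omega>
    define v where "v = (\<integral>z. tent d l z \<partial>\<gamma>)"
    have u [measurable]: "u \<in> borel_measurable M"
      unfolding u_def
      by (rule measurable_compose[OF measurable_prob_algebraD[OF random_probs_kernel[OF \<Gamma>\<^sub>0]]
            integral_measurable_subprob_algebra[OF tent_measurable]])
    have test: "narrow_test M (\<lambda>\<omega> z. indicator A \<omega> * tent d l z)" if [measurable]: "A \<in> sets M" for A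
      unfolding narrow_test_def
    proof (intro conjI AE_I2 allI)
      show "continuous_on UNIV (\<lambda>z. indicator A \<omega> * tent d l z)" for \<omega>
        by (intro continuous_intros tent_continuous)
      show "bounded (range (\<lambda>z. indicator A \<omega> * tent d l z))" for \<omega>
      proof (rule boundedI)
        fix t assume "t \<in> range (\<lambda>z. indicator A \<omega> * tent d l z)"
        then show "norm t \<le> b" using b order_trans[OF abs_ge_zero b] by (auto simp: indicator_def)
      qed
      show "(\<lambda>\<omega>. indicator A \<omega> * tent d l z) \<in> borel_measurable M" for z by measurable
      have "(\<lambda>\<omega>. SUP z. \<bar>indicator A \<omega> * tent d l z\<bar>) = (\<lambda>\<omega>. indicator A \<omega> * (SUP z. \<bar>tent d l z\<bar>))"
        by (auto simp: fun_eq_iff indicator_def)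
      moreover have "integrable M (\<lambda>\<omega>. indicator A \<omega> * (SUP z. \<bar>tent d l z\<bar>))"
        by (rule integrable_bounded[OF M, where b = "\<bar>SUP z. \<bar>tent d l z\<bar>\<bar>"]) (measurable, auto simp: indicator_def)
      ultimately show "integrable (completion M) (\<lambda>\<omega>. SUP z. \<bar>indicator A \<omega> * tent d l z\<bar>)"
        by (simp add: integrable_completion)
    qed
    have u_b: "\<bar>u \<omega>\<bar> \<le> b" if "\<omega> \<in> space M" for \<omega>
    proof -
      note D = borel_probsD[OF random_probsD[OF \<Gamma>\<^sub>0 that]]
      interpret P: prob_space "\<Gamma>\<^sub>0 \<omega>" by (rule D)
      have "tent d l \<in> borel_measurable (\<Gamma>\<^sub>0 \<omega>)"
        unfolding measurable_cong_sets[OF D(2) refl] by (rule tent_measurable)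
      then have "integrable (\<Gamma>\<^sub>0 \<omega>) (tent d l)" by (rule integrable_bounded[OF D(1) _ b])
      then have "(\<integral>z. \<bar>tent d l z\<bar> \<partial>\<Gamma>\<^sub>0 \<omega>) \<le> (\<integral>z. b \<partial>\<Gamma>\<^sub>0 \<omega>)"
        using b by (intro integral_mono integrable_abs) simp_all
      then show ?thesis
        unfolding u_def by (intro order_trans[OF integral_abs_bound]) (simp add: P.prob_space)
    qed
    have uv: "integrable M (\<lambda>\<omega>. indicator A \<omega> * (u \<omega> - v))" if [measurable]: "A \<in> sets M" for A
    proof (rule integrable_const_bound[where B = "b + \<bar>v\<bar>"])
      show "AE \<omega> in M. norm (indicator A \<omega> * (u \<omega> - v)) \<le> b + \<bar>v\<bar>"
      proof (rule AE_I2)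
        fix \<omega> assume "\<omega> \<in> space M"
        show "norm (indicator A \<omega> * (u \<omega> - v)) \<le> b + \<bar>v\<bar>"
        proof (cases "\<omega> \<in> A")
          case True
          have "\<bar>u \<omega> - v\<bar> \<le> b + \<bar>v\<bar>" using u_b[OF \<open>\<omega> \<in> space M\<close>] by linarith
          with True show ?thesis by simp
        next
          case False
          have "0 \<le> b + \<bar>v\<bar>" using u_b[OF \<open>\<omega> \<in> space M\<close>] by linarith
          with False show ?thesis by simp
        qed
      qed
    qed measurable
    have zero: "(\<integral>\<omega>. indicator A \<omega> * (u \<omega> - v) \<partial>M) = 0" if [measurable]: "A \<in> sets M" for A
    proof -
      have "(\<integral>\<omega>. indicator A \<omega> * u \<omega> \<partial>M) = (\<integral>\<omega>. indicator A \<omega> * v \<partial>M)"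
        using eq[OF test[OF that]] unfolding u_def[symmetric] v_def[symmetric] integral_mult_right_zero
        by (simp add: integral_completion)
      moreover have "integrable M (\<lambda>\<omega>. indicator A \<omega> * v)"
        by (rule integrable_bounded[OF M, where b = "\<bar>v\<bar>"]) (measurable, auto simp: indicator_def)
      moreover have "integrable M (\<lambda>\<omega>. indicator A \<omega> * u \<omega>)"
        using Bochner_Integration.integrable_add[OF uv[OF that] calculation(2)] by (simp add: algebra_simps)
      ultimately show ?thesis by (simp add: right_diff_distrib)
    qed
    have "AE \<omega> in M. u \<omega> \<le> v"
    proof -
      define A where "A = {\<omega>\<in>space M. v < u \<omega>}"
      have [measurable]: "A \<in> sets M" unfolding A_def by measurable
      have "AE \<omega> in M. indicator A \<omega> * (u \<omega> - v) = 0"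
      proof (rule integral_nonneg_eq_0_iff_AE[THEN iffD1])
        show "integrable M (\<lambda>\<omega>. indicator A \<omega> * (u \<omega> - v))" using uv[of A] by simp
        show "(\<integral>\<omega>. indicator A \<omega> * (u \<omega> - v) \<partial>M) = 0" using zero[of A] by simp
      qed (auto simp: A_def indicator_def)
      then show ?thesis
        by (rule AE_mp) (auto simp: A_def indicator_def intro!: AE_I2)
    qed
    moreover have "AE \<omega> in M. v \<le> u \<omega>"
    proof -
      define A where "A = {\<omega>\<in>space M. u \<omega> < v}"
      have [measurable]: "A \<in> sets M" unfolding A_def by measurable
      have "AE \<omega> in M. - (indicator A \<omega> * (u \<omega> - v)) = 0"
      proof (rule integral_nonneg_eq_0_iff_AE[THEN iffD1])
        show "integrable M (\<lambda>\<omega>. - (indicator A \<omega> * (u \<omega> - v)))" using uv[of A] by simp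
        show "(\<integral>\<omega>. - (indicator A \<omega> * (u \<omega> - v)) \<partial>M) = 0" using zero[of A] by simp
      qed (auto simp: A_def indicator_def)
      then show ?thesis
        by (rule AE_mp) (auto simp: A_def indicator_def intro!: AE_I2)
    qed
    ultimately show ?thesis unfolding u_def v_def by eventually_elim simp
  qed
  then have "AE \<omega> in M. \<forall>l. (\<integral>z. tent d l z \<partial>\<Gamma>\<^sub>0 \<omega>) = (\<integral>z. tent d l z \<partial>\<gamma>)"
    by (simp add: AE_all_countable)
  then show ?thesis
  proof (rule AE_mp, intro AE_I2 impI)
    fix \<omega> assume \<omega>: "\<omega> \<in> space M" and "\<forall>l. (\<integral>z. tent d l z \<partial>\<Gamma>\<^sub>0 \<omega>) = (\<integral>z. tent d l z \<partial>\<gamma>)"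
    then show "\<Gamma>\<^sub>0 \<omega> = \<gamma>"
      using tents_determine_measure[OF d random_probsD[OF \<Gamma>\<^sub>0 \<omega>] random_probsD[OF c \<omega>]] by blast
  qed
qed

section \<open>Measurable selection of minimizers\<close>

lemma liminf_add_le:
  fixes a b :: "nat \<Rightarrow> ennreal"
  shows "liminf a + liminf b \<le> liminf (\<lambda>n. a n + b n)"
proof -
  have "liminf a + liminf b = (SUP n. (INF m\<in>{n..}. a m) + (INF m\<in>{n..}. b m))"
    unfolding liminf_SUP_INF
    by (rule ennreal_SUP_add[symmetric]) (auto simp: incseq_def intro!: INF_superset_mono)
  also have "\<dots> \<le> (SUP n. INF m\<in>{n..}. a m + b m)"
    by (intro SUP_mono' INF_greatest add_mono INF_lower)
  finally show ?thesis by (simp add: liminf_SUP_INF)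
qed

lemma lower_semicontinuous_liminf:
  assumes f: "lower_semicontinuous f" and z: "z \<longlonglongrightarrow> z\<^sub>0"
  shows "f z\<^sub>0 \<le> liminf (\<lambda>n. f (z n))"
  unfolding le_Liminf_iff
proof (intro allI impI)
  fix t assume "t < f z\<^sub>0"
  moreover have "open {x. t < f x}" using f by (simp add: lower_semicontinuous_def)
  ultimately have "\<forall>\<^sub>F n in sequentially. z n \<in> {x. t < f x}"
    using z by (intro topological_tendstoD) auto
  then show "\<forall>\<^sub>F n in sequentially. t < f (z n)" by simp
qed

text \<open>
  By coercivity and lower semicontinuity the minimum over a closed set \<open>F\<close> is
  attained, and its value \<open>m F x\<close> is measurable in \<open>x\<close>. Hence so is the
  condition that \<open>F\<close> contains a global minimizer, which says \<open>m F x \<le> m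
  UNIV x\<close>. Choosing step by step the first ball of radius \<open>2\<^sup>-\<^sup>n\<close>
  around the dense sequence whose intersection with the earlier balls still contains a minimizer,
  the centres form a measurable Cauchy sequence. Minimizers \<open>w x n\<close> in these
  intersections have the same limit, which is therefore a minimizer.
\<close>

lemma measurable_argmin:
  fixes f :: "'x::{metric_space, second_countable_topology} \<times> 'y::{complete_space, second_countable_topology} \<Rightarrow> ennreal"
  assumes lsc: "\<And>p p\<^sub>0. p \<longlonglongrightarrow> p\<^sub>0 \<Longrightarrow> f p\<^sub>0 \<le> liminf (\<lambda>n. f (p n))"
    and coercive: "\<And>r::real. 0 < r \<Longrightarrow> \<exists>C. compact C \<and> (\<forall>x y. f (x, y) \<le> ennreal r \<longrightarrow> y \<in> C)"
  obtains T where "T \<in> borel_measurable borel" "\<And>x y. f (x, T x) \<le> f (x, y)"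
proof -
  \<comment> \<open>Sequences in a closed set with bounded values accumulate in it.\<close>
  have subseq: "\<exists>y\<in>F. \<exists>\<phi>. strict_mono \<phi> \<and> (\<lambda>n. ys (\<phi> n)) \<longlonglongrightarrow> y"
    if F: "closed F" and ys: "\<And>n. ys n \<in> F" and bound: "\<And>n. f (xs n, ys n) \<le> t" and t: "t < top" for F t and xs :: "nat \<Rightarrow> 'x" and ys :: "nat \<Rightarrow> 'y"
  proof -
    obtain r :: real where r: "0 < r" "t \<le> ennreal r"
    proof (cases t)
      case (real s)
      then show ?thesis by (intro that[of "max 1 s"]) (auto intro: ennreal_leI)
    qed (use t in simp)
    obtain C where C: "compact C" "\<And>x y. f (x, y) \<le> ennreal r \<Longrightarrow> y \<in> C"
      using coercive[OF r(1)] by blast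
    have K: "compact (C \<inter> F)" using C(1) F by (rule compact_Int_closed)
    have "\<forall>n. ys n \<in> C \<inter> F" using ys C(2)[OF order_trans[OF bound r(2)]] by simp
    moreover have "(\<forall>n. ys n \<in> C \<inter> F) \<longrightarrow> (\<exists>y\<in>C \<inter> F. \<exists>\<phi>. strict_mono \<phi> \<and> (ys \<circ> \<phi>) \<longlonglongrightarrow> y)"
      using compact_imp_seq_compact[OF K] unfolding seq_compact_def by (rule spec)
    ultimately have "\<exists>y\<in>C \<inter> F. \<exists>\<phi>. strict_mono \<phi> \<and> (ys \<circ> \<phi>) \<longlonglongrightarrow> y" by (rule rev_mp)
    then obtain y \<phi> where "y \<in> C \<inter> F" "strict_mono \<phi>" "(ys \<circ> \<phi>) \<longlonglongrightarrow> y" by (elim bexE exE conjE)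
    then show ?thesis by (intro bexI[of _ y] exI[of _ \<phi>]) (simp_all add: comp_def)
  qed
  have closed: "closed {x. \<exists>y\<in>F. f (x, y) \<le> t}" if F: "closed F" and t: "t < top" for F t
    unfolding closed_sequential_limits
  proof (intro allI impI, elim conjE)
    fix xs x assume xs: "\<forall>n. xs n \<in> {x. \<exists>y\<in>F. f (x, y) \<le> t}" and x: "xs \<longlonglongrightarrow> x"
    have "\<forall>n. \<exists>y. y \<in> F \<and> f (xs n, y) \<le> t"
    proof
      fix n show "\<exists>y. y \<in> F \<and> f (xs n, y) \<le> t" using spec[OF xs, of n] by blast
    qed
    from choice[OF this] obtain ys where "\<forall>n. ys n \<in> F \<and> f (xs n, ys n) \<le> t" by (elim exE)
    then have ys: "ys n \<in> F" "f (xs n, ys n) \<le> t" for n by simp_all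
    from subseq[where ys = ys and xs = xs and t = t, OF F ys t]
    obtain y \<phi> where y: "y \<in> F" and \<phi>: "strict_mono \<phi>" "(\<lambda>n. ys (\<phi> n)) \<longlonglongrightarrow> y"
      by (elim bexE exE conjE)
    have "(\<lambda>n. (xs (\<phi> n), ys (\<phi> n))) \<longlonglongrightarrow> (x, y)"
      using LIMSEQ_subseq_LIMSEQ[OF x \<phi>(1)] \<phi>(2) by (intro tendsto_Pair) (simp_all add: comp_def)
    from lsc[OF this] have "f (x, y) \<le> liminf (\<lambda>n. f (xs (\<phi> n), ys (\<phi> n)))" .
    also have "\<dots> \<le> t" using ys(2) by (intro Liminf_le) simp_all
    finally show "x \<in> {x. \<exists>y\<in>F. f (x, y) \<le> t}" using y by blast
  qed
  define m where "m F x = (INF y\<in>F. f (x, y))" for F x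
  have attained: "\<exists>y\<in>F. f (x, y) \<le> m F x" if F: "closed F" "F \<noteq> {}" for F x
  proof (cases "m F x = top")
    case True
    then show ?thesis using F(2) by auto
  next
    case False
    have "\<exists>y\<in>F. f (x, y) \<le> m F x + ennreal (1 / Suc n)" for n
    proof -
      have "m F x < m F x + ennreal (1 / Suc n)"
      proof (cases "m F x")
        case (real a)
        then show ?thesis by (simp add: ennreal_plus[symmetric] ennreal_less_iff del: ennreal_plus)
      qed (use False in simp)
      then obtain y where "y \<in> F" "f (x, y) < m F x + ennreal (1 / Suc n)"
        unfolding m_def INF_less_iff by (elim bexE)
      then show ?thesis by (intro bexI[of _ y] less_imp_le)
    qed
    then obtain ys where ys: "\<And>n. ys n \<in> F" "\<And>n. f (x, ys n) \<le> m F x + ennreal (1 / Suc n)" by metis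
    have "f (x, ys n) \<le> m F x + 1" for n
      using ys(2)[of n] by (rule order_trans) (intro add_mono order_refl, simp add: ennreal_le_1)
    moreover have "m F x + 1 < top" using False by (simp add: less_top[symmetric])
    ultimately have "\<exists>y\<in>F. \<exists>\<phi>. strict_mono \<phi> \<and> (\<lambda>n. ys (\<phi> n)) \<longlonglongrightarrow> y"
      by (intro subseq[where ys = ys and xs = "\<lambda>_. x" and t = "m F x + 1", OF F(1) ys(1)])
    then obtain y \<phi> where y: "y \<in> F" and \<phi>: "strict_mono \<phi>" "(\<lambda>n. ys (\<phi> n)) \<longlonglongrightarrow> y"
      by (elim bexE exE conjE)
    have "(\<lambda>n. (x, ys (\<phi> n))) \<longlonglongrightarrow> (x, y)" using \<phi>(2) by (intro tendsto_Pair tendsto_const)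
    from lsc[OF this] have "f (x, y) \<le> liminf (\<lambda>n. f (x, ys (\<phi> n)))" .
    also have "\<dots> \<le> liminf (\<lambda>n. m F x + ennreal (1 / Suc (\<phi> n)))"
      by (intro Liminf_mono always_eventually allI ys(2))
    also have "\<dots> = m F x"
    proof (rule lim_imp_Liminf[OF sequentially_bot])
      have "(\<lambda>n. 1 / real (Suc n)) \<longlonglongrightarrow> 0"
        using LIMSEQ_inverse_real_of_nat by (simp add: inverse_eq_divide)
      then have "(\<lambda>n. 1 / real (Suc (\<phi> n))) \<longlonglongrightarrow> 0"
        using LIMSEQ_subseq_LIMSEQ[OF _ \<phi>(1)] by (simp add: comp_def)
      then have "(\<lambda>n. ennreal (1 / real (Suc (\<phi> n)))) \<longlonglongrightarrow> ennreal 0" by (rule tendsto_ennrealI)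
      then have "(\<lambda>n. m F x + ennreal (1 / real (Suc (\<phi> n)))) \<longlonglongrightarrow> m F x + ennreal 0"
        by (intro tendsto_add tendsto_const)
      then show "(\<lambda>n. m F x + ennreal (1 / real (Suc (\<phi> n)))) \<longlonglongrightarrow> m F x" by simp
    qed
    finally show ?thesis using y by blast
  qed
  have m_le_iff: "m F x \<le> t \<longleftrightarrow> (\<exists>y\<in>F. f (x, y) \<le> t)" if "closed F" "F \<noteq> {}" for F x t
    using attained[OF that, of x] unfolding m_def by (meson INF_lower order_trans)
  have m_meas: "m F \<in> borel_measurable borel" if F: "closed F" "F \<noteq> {}" for F
  proof (rule borel_measurableI_le)
    fix t
    show "{x \<in> space borel. m F x \<le> t} \<in> sets borel"
    proof (cases "t = top")
      case False
      then have "closed {x. m F x \<le> t}"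
        unfolding m_le_iff[OF F] by (intro closed F) (simp add: less_top)
      then show ?thesis by simp
    qed simp
  qed
  define P where "P x F \<longleftrightarrow> (\<exists>y\<in>F. \<forall>y'. f (x, y) \<le> f (x, y'))" for x F
  have P_meas: "Measurable.pred borel (\<lambda>x. P x F)" if F: "closed F" for F
  proof (cases "F = {}")
    case False
    have "P x F \<longleftrightarrow> m F x \<le> m UNIV x" for x
    proof
      assume "P x F"
      then obtain y where y: "y \<in> F" "\<And>y'. f (x, y) \<le> f (x, y')" unfolding P_def by blast
      then show "m F x \<le> m UNIV x" unfolding m_def by (intro INF_greatest INF_lower2)
    next
      assume le: "m F x \<le> m UNIV x"
      obtain y where y: "y \<in> F" "f (x, y) \<le> m F x" using attained[OF F False] by blast
      have "f (x, y) \<le> f (x, y')" for y'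
        using y(2) le INF_lower[of y' UNIV "\<lambda>y. f (x, y)"] unfolding m_def by (auto intro: order_trans)
      then show "P x F" unfolding P_def using y(1) by blast
    qed
    then have "(\<lambda>x. P x F) = (\<lambda>x. m F x \<le> m UNIV x)" by (rule ext)
    moreover have "Measurable.pred borel (\<lambda>x. m F x \<le> m UNIV x)"
    proof -
      have [measurable]: "m F \<in> borel_measurable borel" "m UNIV \<in> borel_measurable borel"
        by (rule m_meas; simp add: F False)+
      show ?thesis by measurable
    qed
    ultimately show ?thesis by (simp only:)
  qed (simp add: P_def)
  obtain d :: "nat \<Rightarrow> 'y" where d: "\<And>z e. 0 < e \<Longrightarrow> \<exists>k. dist z (d k) < e"
    using dense_sequence by blast
  define cell where "cell ks = {y. \<forall>i<length ks. dist y (d (ks ! i)) \<le> 1 / 2 ^ i}" for ks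
  have cell_closed: "closed (cell ks)" for ks
  proof -
    have "cell ks = (\<Inter>i\<in>{..<length ks}. {y. dist y (d (ks ! i)) \<le> 1 / 2 ^ i})"
      unfolding cell_def by auto
    then show ?thesis by (auto intro!: closed_INT closed_Collect_le continuous_intros)
  qed
  \<comment> \<open>Indices of the centres chosen in the first \<open>n\<close> steps.\<close>
  define sel where "sel x = rec_nat [] (\<lambda>n ks. ks @ [LEAST k. P x (cell (ks @ [k]))])" for x
  have sel_0: "sel x 0 = []" and sel_Suc: "sel x (Suc n) = sel x n @ [LEAST k. P x (cell (sel x n @ [k]))]" for x n
    by (simp_all add: sel_def)
  have sel_length: "length (sel x n) = n" for x n
    by (induction n) (simp_all add: sel_0 sel_Suc)
  have sel_P: "P x (cell (sel x n))" for x n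
  proof (induction n)
    case 0
    obtain y where "f (x, y) \<le> m UNIV x" using attained[of UNIV x] by auto
    then have "\<And>y'. f (x, y) \<le> f (x, y')"
      using INF_lower[of _ UNIV "\<lambda>y. f (x, y)"] unfolding m_def by (auto intro: order_trans)
    then show ?case by (auto simp: P_def sel_0 cell_def)
  next
    case (Suc n)
    then obtain y where y: "y \<in> cell (sel x n)" "\<And>y'. f (x, y) \<le> f (x, y')" unfolding P_def by blast
    obtain k where k: "dist y (d k) < 1 / 2 ^ n" using d[of "1 / 2 ^ n" y] by auto
    have "y \<in> cell (sel x n @ [k])"
      using y(1) k by (auto simp: cell_def nth_append sel_length less_Suc_eq)
    then have "P x (cell (sel x n @ [k]))" using y(2) unfolding P_def by blast
    then show ?case unfolding sel_Suc by (rule LeastI)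
  qed
  have sel_meas: "(\<lambda>x. sel x n) \<in> borel \<rightarrow>\<^sub>M count_space UNIV" for n
  proof (induction n)
    case 0
    show ?case by (simp add: sel_0)
  next
    case (Suc n)
    have "(\<lambda>x. ks @ [LEAST k. P x (cell (ks @ [k]))]) \<in> borel \<rightarrow>\<^sub>M count_space UNIV" for ks
    proof (rule measurable_compose[where f = "\<lambda>x. LEAST k. P x (cell (ks @ [k]))" and g = "\<lambda>k. ks @ [k]"])
      show "(\<lambda>x. LEAST k. P x (cell (ks @ [k]))) \<in> borel \<rightarrow>\<^sub>M count_space UNIV"
        by (rule measurable_Least) (rule P_meas[OF cell_closed])
    qed simp
    from measurable_compose_countable[OF this Suc] show ?case unfolding sel_Suc .
  qed
  define q where "q n x = d (last (sel x (Suc n)))" for n x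
  have q_meas: "q n \<in> borel_measurable borel" for n
    unfolding q_def by (rule measurable_compose[OF sel_meas]) simp
  have "\<exists>y. y \<in> cell (sel x n) \<and> (\<forall>y'. f (x, y) \<le> f (x, y'))" for x n
    using sel_P[of x n] unfolding P_def by blast
  then obtain w where w: "\<And>x n. w x n \<in> cell (sel x n)" "\<And>x n y'. f (x, w x n) \<le> f (x, y')" by metis
  have sel_nth: "sel x n ! i = last (sel x (Suc i))" if "i < n" for x n i
    using that
  proof (induction n)
    case (Suc n)
    then show ?case by (cases "i = n") (simp_all add: sel_Suc nth_append sel_length)
  qed simp
  have w_q: "dist (w x n) (q i x) \<le> 1 / 2 ^ i" if "i < n" for x n i
    using w(1)[of x n] that by (simp add: cell_def sel_length q_def sel_nth)
  have small: "\<exists>n. 2 * (1 / 2 ^ n :: real) < e" if "0 < e" for e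
    using real_arch_pow_inv[of "e / 2" "1 / 2"] that by (auto simp: power_divide)
  have q_Cauchy: "Cauchy (\<lambda>n. q n x)" for x
  proof (rule metric_CauchyI)
    fix e :: real assume "0 < e"
    then obtain n where n: "2 * (1 / 2 ^ n :: real) < e" using small by blast
    have "dist (q i x) (q j x) < e" if "n \<le> i" "n \<le> j" for i j
    proof -
      let ?w = "w x (Suc (max i j))"
      have "dist (q i x) (q j x) \<le> dist ?w (q i x) + dist ?w (q j x)" by (rule dist_triangle3)
      also have "\<dots> \<le> 1 / 2 ^ i + 1 / 2 ^ j" by (intro add_mono w_q) auto
      also have "\<dots> \<le> 1 / 2 ^ n + 1 / 2 ^ n"
        using that by (intro add_mono divide_left_mono power_increasing) auto
      finally show ?thesis using n by simp
    qed
    then show "\<exists>n. \<forall>i\<ge>n. \<forall>j\<ge>n. dist (q i x) (q j x) < e" by blast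
  qed
  obtain T where T: "T \<in> borel_measurable borel" "\<And>x. Cauchy (\<lambda>n. q n x) \<Longrightarrow> (\<lambda>n. q n x) \<longlonglongrightarrow> T x"
    using measurable_Cauchy_limit[of q borel, OF q_meas] by metis
  show ?thesis
  proof (rule that[OF T(1)])
    fix x y
    have "(\<lambda>n. w x (Suc n)) \<longlonglongrightarrow> T x"
    proof (rule metric_LIMSEQ_I)
      fix e :: real assume e: "0 < e"
      then obtain n where n: "2 * (1 / 2 ^ n :: real) < e" using small by blast
      have "\<forall>\<^sub>F i in sequentially. dist (q i x) (T x) < e / 2"
        using T(2)[OF q_Cauchy, of x] e by (intro tendstoD) simp_all
      then obtain n' where n': "\<And>i. i \<ge> n' \<Longrightarrow> dist (q i x) (T x) < e / 2"
        unfolding eventually_sequentially by blast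
      have "dist (w x (Suc i)) (T x) < e" if "max n n' \<le> i" for i
      proof -
        have "dist (w x (Suc i)) (T x) \<le> dist (w x (Suc i)) (q i x) + dist (q i x) (T x)"
          by (rule dist_triangle)
        also have "\<dots> < 1 / 2 ^ i + e / 2" using w_q[of i "Suc i" x] n'[of i] that by (intro add_le_less_mono) auto
        also have "1 / 2 ^ i \<le> (1 / 2 ^ n :: real)"
          using that by (intro divide_left_mono power_increasing) auto
        finally show ?thesis using n by simp
      qed
      then show "\<exists>N. \<forall>i\<ge>N. dist (w x (Suc i)) (T x) < e" by blast
    qed
    then have "(\<lambda>n. (x, w x (Suc n))) \<longlonglongrightarrow> (x, T x)" by (intro tendsto_Pair tendsto_const)
    from lsc[OF this] have "f (x, T x) \<le> liminf (\<lambda>n. f (x, w x (Suc n)))" .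
    also have "\<dots> \<le> f (x, y)" using w(2) by (intro Liminf_le) simp_all
    finally show "f (x, T x) \<le> f (x, y)" .
  qed
qed

section \<open>Law of large numbers and lower semicontinuity\<close>

lemma inverse_of_nat_sum_ennreal:
  assumes "1 \<le> N" "\<And>i. i < N \<Longrightarrow> 0 \<le> a i"
  shows "inverse (of_nat N) * (\<Sum>i<N. ennreal (a i)) = ennreal ((\<Sum>i<N. a i) / real N)"
proof -
  have "inverse (of_nat N :: ennreal) = ennreal (inverse (real N))"
    using assms(1) by (simp add: ennreal_of_nat_eq_real_of_nat inverse_ennreal)
  moreover have "(\<Sum>i<N. ennreal (a i)) = ennreal (\<Sum>i<N. a i)"
    using assms(2) by (intro sum_ennreal) auto
  moreover have "ennreal (inverse (real N)) * ennreal (\<Sum>i<N. a i) = ennreal (inverse (real N) * (\<Sum>i<N. a i))"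
    using assms by (intro ennreal_mult[symmetric]) (auto intro: sum_nonneg)
  ultimately show ?thesis by (simp add: divide_inverse mult.commute)
qed

lemma ennreal_enn2real_bounded: "x \<le> ennreal b \<Longrightarrow> ennreal (enn2real x) = x"
  by (rule ennreal_enn2real) (rule le_less_trans[OF _ ennreal_less_top])

text \<open>
  The series of squares has finite expectation and hence converges almost surely.
\<close>

lemma AE_tendsto_zero_if_second_moments_summable:
  fixes D :: "nat \<Rightarrow> 'a \<Rightarrow> real"
  assumes [measurable]: "\<And>k. D k \<in> borel_measurable M"
    and int: "\<And>k. integrable M (\<lambda>\<omega>. (D k \<omega>)\<^sup>2)"
    and bound: "\<And>k. (\<integral>\<omega>. (D k \<omega>)\<^sup>2 \<partial>M) \<le> e k" and e: "summable e"
  shows "AE \<omega> in M. (\<lambda>k. D k \<omega>) \<longlonglongrightarrow> 0"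
proof -
  have e_nonneg: "0 \<le> e k" for k
    using bound[of k] by (rule order_trans[rotated]) simp
  have "(\<integral>\<^sup>+\<omega>. (\<Sum>k. ennreal ((D k \<omega>)\<^sup>2)) \<partial>M) = (\<Sum>k. \<integral>\<^sup>+\<omega>. ennreal ((D k \<omega>)\<^sup>2) \<partial>M)"
    by (rule nn_integral_suminf) measurable
  also have "\<dots> \<le> (\<Sum>k. ennreal (e k))"
    using bound by (intro suminf_le summableI) (simp add: nn_integral_eq_integral[OF int] ennreal_leI)
  also have "\<dots> = ennreal (\<Sum>k. e k)" by (rule suminf_ennreal2[OF e_nonneg e])
  finally have "(\<integral>\<^sup>+\<omega>. (\<Sum>k. ennreal ((D k \<omega>)\<^sup>2)) \<partial>M) \<noteq> \<infinity>" by (auto simp: top_unique)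
  then have "AE \<omega> in M. (\<Sum>k. ennreal ((D k \<omega>)\<^sup>2)) \<noteq> \<infinity>"
    by (intro nn_integral_noteq_infinite) measurable
  then show ?thesis
  proof (rule eventually_mono)
    fix \<omega> assume "(\<Sum>k. ennreal ((D k \<omega>)\<^sup>2)) \<noteq> \<infinity>"
    then have "summable (\<lambda>k. (D k \<omega>)\<^sup>2)" by (intro summable_suminf_not_top) simp_all
    from summable_LIMSEQ_zero[OF this] show "(\<lambda>k. D k \<omega>) \<longlonglongrightarrow> 0" by simp
  qed
qed

context iid_types
begin

text \<open>
  The tent integral of the empirical measure is an average of independent bounded variables, and
  its mean is the tent integral of the law built from the averaged kernel. Its variance is of
  order \<open>1 / r k\<close>, which is summable along the sparse sequence \<open>r\<close>; so
  the difference vanishes almost surely. There are only countably many tents, and they determine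
  narrow convergence.
\<close>

lemma empirical_AE_narrow:
  fixes K :: "nat \<Rightarrow> nat \<Rightarrow> 'x \<Rightarrow> 'y::{metric_space, second_countable_topology} measure"
  assumes K: "\<And>N i. measurable_family (K N i)" and r: "\<And>k. (Suc k)\<^sup>2 \<le> r k" and \<gamma>: "\<gamma> \<in> borel_probs"
    and conv: "\<And>f::'x \<times> 'y \<Rightarrow> real. continuous_on UNIV f \<Longrightarrow> bounded (range f) \<Longrightarrow>
      (\<lambda>k. \<integral>p. f p \<partial>joint \<mu> (\<lambda>x. average (r k) (\<lambda>i. K (r k) i x))) \<longlonglongrightarrow> (\<integral>p. f p \<partial>\<gamma>)"
  shows "AE \<omega> in M. \<forall>f::'x \<times> 'y \<Rightarrow> real. continuous_on UNIV f \<longrightarrow> bounded (range f) \<longrightarrow>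
      (\<lambda>k. \<integral>p. f p \<partial>empirical X (r k) (\<lambda>j \<omega>. K (r k) j (X j \<omega>)) \<omega>) \<longlonglongrightarrow> (\<integral>p. f p \<partial>\<gamma>)"
proof -
  let ?s = "\<lambda>k j \<omega>. K (r k) j (X j \<omega>)"
  let ?E = "\<lambda>k. empirical X (r k) (?s k)"
  let ?J = "\<lambda>k. joint \<mu> (\<lambda>x. average (r k) (\<lambda>i. K (r k) i x))"
  have r1: "1 \<le> r k" for k using r[of k] by (rule order_trans[rotated]) simp
  have sP: "?s k j \<omega> \<in> borel_probs" for k j \<omega> using K by (simp add: measurable_family_def)
  have EP: "?E k \<omega> \<in> borel_probs" for k \<omega>
    by (rule empirical_prob[where X = X and s = "?s k" and \<omega> = \<omega>, OF r1 sP])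
  have avg: "measurable_family (\<lambda>x. average (r k) (\<lambda>i. K (r k) i x))" for k
    by (rule measurable_family_average[OF r1 K])
  have JP: "?J k \<in> borel_probs" for k using joint_coupling[OF \<mu>_prob avg] by (simp add: couplings_of_def)
  obtain d :: "nat \<Rightarrow> 'x \<times> 'y" where d: "\<And>z e. 0 < e \<Longrightarrow> \<exists>k. dist z (d k) < e"
    using dense_sequence by blast
  have "AE \<omega> in M. (\<lambda>k. \<integral>p. tent d l p \<partial>?E k \<omega>) \<longlonglongrightarrow> (\<integral>p. tent d l p \<partial>\<gamma>)" for l
  proof -
    obtain b where b: "\<And>z. \<bar>tent d l z\<bar> \<le> b" using tent_bounded by blast
    have b0: "0 \<le> b" using order_trans[OF abs_ge_zero b] .
    let ?h = "\<lambda>p. ennreal (tent d l p)"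
    have h_meas: "?h \<in> borel_measurable borel" using tent_measurable by measurable
    have h_b: "?h p \<le> ennreal b" for p using b[of p] by (intro ennreal_leI) linarith
    define g where "g k i x = enn2real (\<integral>\<^sup>+y. ?h (x, y) \<partial>K (r k) i x)" for k i x
    have g_meas [measurable]: "g k i \<in> borel_measurable borel" for k i
      unfolding g_def using measurable_nn_integral_kernel[OF h_meas K] by measurable
    have g_le: "(\<integral>\<^sup>+y. ?h (x, y) \<partial>K (r k) i x) \<le> ennreal b" for k i x
    proof -
      have "(\<integral>\<^sup>+y. ?h (x, y) \<partial>K (r k) i x) \<le> (\<integral>\<^sup>+y. ennreal b \<partial>K (r k) i x)"
        by (rule nn_integral_mono) (rule h_b)
      then show ?thesis using prob_space.emeasure_space_1[OF measurable_familyD(1)[OF K]] by simp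
    qed
    have g_eq: "(\<integral>\<^sup>+y. ?h (x, y) \<partial>K (r k) i x) = ennreal (g k i x)" for k i x
      unfolding g_def by (rule ennreal_enn2real_bounded[OF g_le, symmetric])
    have g0: "0 \<le> g k i x" for k i x by (simp add: g_def)
    have gb: "\<bar>g k i x\<bar> \<le> b" for k i x
      using g_le[of k i x] b0 g0[of k i x] unfolding g_eq by (simp add: ennreal_le_iff)
    interpret \<mu>: prob_space \<mu> by (rule borel_probsD[OF \<mu>_prob])
    have g_int: "integrable \<mu> (g k i)" for k i
    proof (rule integrable_bounded[OF \<mu>.prob_space_axioms _ gb])
      show "g k i \<in> borel_measurable \<mu>"
        unfolding measurable_cong_sets[OF borel_probsD(2)[OF \<mu>_prob] refl] by (rule g_meas)
    qed
    have E_eq: "(\<integral>p. tent d l p \<partial>?E k \<omega>) = (\<Sum>i<r k. g k i (X i \<omega>)) / r k" for k \<omega>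
    proof -
      have "tent d l \<in> borel_measurable (?E k \<omega>)"
        unfolding measurable_cong_sets[OF borel_probsD(2)[OF EP] refl] by (rule tent_measurable)
      then have "(\<integral>p. tent d l p \<partial>?E k \<omega>) = enn2real (\<integral>\<^sup>+p. ?h p \<partial>?E k \<omega>)"
        by (rule integral_eq_nn_integral) (simp add: tent_nonneg)
      also have "(\<integral>\<^sup>+p. ?h p \<partial>?E k \<omega>) = inverse (of_nat (r k)) * (\<Sum>i<r k. ennreal (g k i (X i \<omega>)))"
        using nn_integral_empirical[where X = X and s = "?s k" and \<omega> = \<omega>, OF r1 sP h_meas] by (simp only: g_eq)
      also have "\<dots> = ennreal ((\<Sum>i<r k. g k i (X i \<omega>)) / r k)"
        by (rule inverse_of_nat_sum_ennreal[OF r1]) (rule g0)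
      finally show ?thesis using g0 by (simp add: sum_nonneg)
    qed
    have J_eq: "(\<integral>p. tent d l p \<partial>?J k) = (\<Sum>i<r k. \<integral>x. g k i x \<partial>\<mu>) / r k" for k
    proof -
      have "tent d l \<in> borel_measurable (?J k)"
        unfolding measurable_cong_sets[OF borel_probsD(2)[OF JP] refl] by (rule tent_measurable)
      then have "(\<integral>p. tent d l p \<partial>?J k) = enn2real (\<integral>\<^sup>+p. ?h p \<partial>?J k)"
        by (rule integral_eq_nn_integral) (simp add: tent_nonneg)
      also have "(\<integral>\<^sup>+p. ?h p \<partial>?J k) = (\<integral>\<^sup>+x. \<integral>\<^sup>+y. ?h (x, y) \<partial>average (r k) (\<lambda>i. K (r k) i x) \<partial>\<mu>)"
        by (rule nn_integral_joint[OF \<mu>_prob avg h_meas])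
      also have "\<dots> = (\<integral>\<^sup>+x. ennreal ((\<Sum>i<r k. g k i x) / r k) \<partial>\<mu>)"
      proof (rule nn_integral_cong)
        fix x
        have P: "K (r k) i x \<in> borel_probs" for i using K by (simp add: measurable_family_def)
        show "(\<integral>\<^sup>+y. ?h (x, y) \<partial>average (r k) (\<lambda>i. K (r k) i x)) = ennreal ((\<Sum>i<r k. g k i x) / r k)"
          using nn_integral_average[where \<nu> = "\<lambda>i. K (r k) i x", OF r1 P measurable_Pair_borel(1)[OF h_meas]]
            inverse_of_nat_sum_ennreal[OF r1, of k "\<lambda>i. g k i x"] g0
          by (simp only: g_eq)
      qed
      also have "\<dots> = ennreal (\<integral>x. (\<Sum>i<r k. g k i x) / r k \<partial>\<mu>)"
        using g_int g0 by (intro nn_integral_eq_integral) (auto intro!: AE_I2 divide_nonneg_nonneg sum_nonneg)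
      finally have "(\<integral>p. tent d l p \<partial>?J k) = (\<integral>x. (\<Sum>i<r k. g k i x) / r k \<partial>\<mu>)"
        using g0 by (simp add: integral_nonneg_AE sum_nonneg)
      then show ?thesis using g_int by simp
    qed
    define D where "D k \<omega> = (\<Sum>i<r k. g k i (X i \<omega>)) / r k - (\<Sum>i<r k. \<integral>x. g k i x \<partial>\<mu>) / r k" for k \<omega>
    have D_meas [measurable]: "D k \<in> borel_measurable M" for k unfolding D_def by measurable
    have "AE \<omega> in M. (\<lambda>k. D k \<omega>) \<longlonglongrightarrow> 0"
    proof (rule AE_tendsto_zero_if_second_moments_summable[OF D_meas])
      have m_b: "0 \<le> (\<integral>x. g k i x \<partial>\<mu>)" "(\<integral>x. g k i x \<partial>\<mu>) \<le> b" for k i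
      proof -
        show "0 \<le> (\<integral>x. g k i x \<partial>\<mu>)" by (rule integral_nonneg_AE) (simp add: g0)
        have "(\<integral>x. g k i x \<partial>\<mu>) \<le> (\<integral>x. b \<partial>\<mu>)" using gb g_int by (intro integral_mono) (auto simp: abs_le_iff)
        then show "(\<integral>x. g k i x \<partial>\<mu>) \<le> b" by (simp add: \<mu>.prob_space)
      qed
      have mean_b: "0 \<le> (\<Sum>i<n. a i) / real n \<and> (\<Sum>i<n. a i) / real n \<le> b"
        if "\<And>i. 0 \<le> a i" "\<And>i. a i \<le> b" "1 \<le> n" for a and n :: nat
        using that sum_bounded_above[of "{..<n}" a b] by (auto simp: divide_simps sum_nonneg mult.commute)
      have D_b: "\<bar>D k \<omega>\<bar> \<le> b" for k \<omega>
      proof -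
        have "0 \<le> (\<Sum>i<r k. g k i (X i \<omega>)) / r k \<and> (\<Sum>i<r k. g k i (X i \<omega>)) / r k \<le> b"
          by (rule mean_b) (use g0 gb r1 in \<open>auto simp: abs_le_iff\<close>)
        moreover have "0 \<le> (\<Sum>i<r k. \<integral>x. g k i x \<partial>\<mu>) / r k \<and> (\<Sum>i<r k. \<integral>x. g k i x \<partial>\<mu>) / r k \<le> b"
          by (rule mean_b[OF m_b r1])
        ultimately show ?thesis unfolding D_def by linarith
      qed
      show "integrable M (\<lambda>\<omega>. (D k \<omega>)\<^sup>2)" for k
      proof (rule integrable_bounded[OF prob_space_axioms, where b = "b\<^sup>2"])
        show "\<bar>(D k \<omega>)\<^sup>2\<bar> \<le> b\<^sup>2" for \<omega>
          using power_mono[OF D_b[of k \<omega>], of 2] by simp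
      qed measurable
      show "(\<integral>\<omega>. (D k \<omega>)\<^sup>2 \<partial>M) \<le> 4 * b\<^sup>2 * inverse (real (Suc k) ^ 2)" for k
      proof -
        have "(\<integral>\<omega>. (D k \<omega>)\<^sup>2 \<partial>M) \<le> 4 * b\<^sup>2 / r k"
          unfolding D_def by (rule second_moment_empirical_mean[OF g_meas gb r1])
        also have "\<dots> \<le> 4 * b\<^sup>2 / (real (Suc k) ^ 2)"
        proof (rule divide_left_mono)
          have "real ((Suc k)\<^sup>2) \<le> real (r k)" using r[of k] by (rule of_nat_mono)
          then show "real (Suc k) ^ 2 \<le> real (r k)" by simp
          show "0 < real (r k) * real (Suc k) ^ 2" using r1[of k] by (intro mult_pos_pos) auto
        qed simp
        finally show ?thesis by (simp add: divide_inverse)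
      qed
      have "summable (\<lambda>k. inverse (real (Suc k) ^ 2))"
        using inverse_power_summable[of 2, where 'a = real] by (subst summable_Suc_iff) simp
      then show "summable (\<lambda>k. 4 * b\<^sup>2 * inverse (real (Suc k) ^ 2))" by (rule summable_mult)
    qed
    moreover have J_lim: "(\<lambda>k. \<integral>p. tent d l p \<partial>?J k) \<longlonglongrightarrow> (\<integral>p. tent d l p \<partial>\<gamma>)"
      by (rule conv[OF tent_continuous]) (use b in \<open>auto simp: bounded_iff\<close>)
    ultimately show ?thesis
    proof (elim eventually_mono)
      fix \<omega> assume "(\<lambda>k. D k \<omega>) \<longlonglongrightarrow> 0"
      from tendsto_add[OF this J_lim] show "(\<lambda>k. \<integral>p. tent d l p \<partial>?E k \<omega>) \<longlonglongrightarrow> (\<integral>p. tent d l p \<partial>\<gamma>)"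
        unfolding J_eq E_eq D_def by simp
    qed
  qed
  then have "AE \<omega> in M. \<forall>l. (\<lambda>k. \<integral>p. tent d l p \<partial>?E k \<omega>) \<longlonglongrightarrow> (\<integral>p. tent d l p \<partial>\<gamma>)"
    by (simp add: AE_all_countable)
  then show ?thesis
  proof (rule eventually_mono, intro allI impI)
    fix \<omega> and f :: "'x \<times> 'y \<Rightarrow> real"
    assume tents: "\<forall>l. (\<lambda>k. \<integral>p. tent d l p \<partial>?E k \<omega>) \<longlonglongrightarrow> (\<integral>p. tent d l p \<partial>\<gamma>)"
      and f: "continuous_on UNIV f" "bounded (range f)"
    show "(\<lambda>k. \<integral>p. f p \<partial>?E k \<omega>) \<longlonglongrightarrow> (\<integral>p. f p \<partial>\<gamma>)"
      by (rule tents_determine_narrow_convergence[where \<nu> = "\<lambda>k. ?E k \<omega>", OF d EP \<gamma> spec[OF tents] f])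
  qed
qed

end

text \<open>
  With an almost surely convergent representation of the laws, lower semicontinuity of integral
  functionals is Fatou's lemma.
\<close>

locale skorokhod = prob_space \<Omega>
  for \<Omega> :: "'a measure" +
  fixes z :: "nat \<Rightarrow> 'a \<Rightarrow> 'z::{metric_space, second_countable_topology}" and z\<^sub>0
  assumes z [measurable]: "\<And>n. z n \<in> borel_measurable \<Omega>" and z\<^sub>0 [measurable]: "z\<^sub>0 \<in> borel_measurable \<Omega>"
    and z_lim: "AE \<omega> in \<Omega>. (\<lambda>n. z n \<omega>) \<longlonglongrightarrow> z\<^sub>0 \<omega>"
begin

lemma law_probs: "distr \<Omega> borel (z n) \<in> borel_probs" "distr \<Omega> borel z\<^sub>0 \<in> borel_probs"
  by (simp_all add: borel_probs_def prob_space_distr)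

lemma tendsto_integral:
  fixes f :: "'z \<Rightarrow> real"
  assumes f: "continuous_on UNIV f" and b: "\<And>p. \<bar>f p\<bar> \<le> b"
  shows "(\<lambda>n. \<integral>p. f p \<partial>distr \<Omega> borel (z n)) \<longlonglongrightarrow> (\<integral>p. f p \<partial>distr \<Omega> borel z\<^sub>0)"
proof -
  have [measurable]: "f \<in> borel_measurable borel" using f by (rule borel_measurable_continuous_onI)
  have "(\<lambda>n. \<integral>\<omega>. f (z n \<omega>) \<partial>\<Omega>) \<longlonglongrightarrow> (\<integral>\<omega>. f (z\<^sub>0 \<omega>) \<partial>\<Omega>)"
  proof (rule integral_dominated_convergence[where w = "\<lambda>_. b"])
    show "AE \<omega> in \<Omega>. (\<lambda>n. f (z n \<omega>)) \<longlonglongrightarrow> f (z\<^sub>0 \<omega>)"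
      using z_lim by (rule eventually_mono) (rule continuous_on_tendsto_compose[OF f], simp_all)
  qed (simp_all add: b)
  then show ?thesis by (simp add: integral_distr)
qed

lemma nn_integral_le_liminf:
  assumes f: "lower_semicontinuous f"
  shows "(\<integral>\<^sup>+p. f p \<partial>distr \<Omega> borel z\<^sub>0) \<le> liminf (\<lambda>n. \<integral>\<^sup>+p. f p \<partial>distr \<Omega> borel (z n))"
proof -
  have [measurable]: "f \<in> borel_measurable borel" using f by (rule lower_semicontinuous_borel)
  have "(\<integral>\<^sup>+\<omega>. f (z\<^sub>0 \<omega>) \<partial>\<Omega>) \<le> (\<integral>\<^sup>+\<omega>. liminf (\<lambda>n. f (z n \<omega>)) \<partial>\<Omega>)"
    by (rule nn_integral_mono_AE, rule eventually_mono[OF z_lim])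
       (rule lower_semicontinuous_liminf[OF f])
  also have "\<dots> \<le> liminf (\<lambda>n. \<integral>\<^sup>+\<omega>. f (z n \<omega>) \<partial>\<Omega>)" by (rule nn_integral_liminf) measurable
  finally show ?thesis by (simp add: nn_integral_distr)
qed

lemma interaction_eq:
  fixes H :: "'z \<times> 'z \<Rightarrow> ennreal"
  assumes H: "H \<in> borel_measurable borel" and u: "u \<in> borel_measurable \<Omega>"
  shows "interaction H (distr \<Omega> borel u) (distr \<Omega> borel u) = (\<integral>\<^sup>+\<omega>. \<integral>\<^sup>+\<omega>'. H (u \<omega>, u \<omega>') \<partial>\<Omega> \<partial>\<Omega>)"
proof -
  note [measurable] = u
  have P: "distr \<Omega> borel u \<in> borel_probs" by (simp add: borel_probs_def prob_space_distr)
  have "interaction H (distr \<Omega> borel u) (distr \<Omega> borel u) =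
      (\<integral>\<^sup>+\<omega>. \<integral>\<^sup>+y'. H (u \<omega>, y') \<partial>distr \<Omega> borel u \<partial>\<Omega>)"
    unfolding interaction_fst[OF P P H]
    by (rule nn_integral_distr[OF u]) (simp add: measurable_nn_integral_const[OF H P])
  also have "\<dots> = (\<integral>\<^sup>+\<omega>. \<integral>\<^sup>+\<omega>'. H (u \<omega>, u \<omega>') \<partial>\<Omega> \<partial>\<Omega>)"
    by (intro nn_integral_cong nn_integral_distr[OF u]) (simp add: measurable_Pair_borel(1)[OF H])
  finally show ?thesis .
qed

text \<open>
  Two independent copies of the representation and Fatou's lemma for each of them.
\<close>

lemma interaction_le_liminf:
  fixes H :: "'z \<times> 'z \<Rightarrow> ennreal"
  assumes H: "lower_semicontinuous H"
  shows "interaction H (distr \<Omega> borel z\<^sub>0) (distr \<Omega> borel z\<^sub>0) \<le>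
    liminf (\<lambda>n. interaction H (distr \<Omega> borel (z n)) (distr \<Omega> borel (z n)))"
proof -
  have Hm: "H \<in> borel_measurable borel" using H by (rule lower_semicontinuous_borel)
  have [measurable]: "H \<in> borel_measurable (borel \<Otimes>\<^sub>M borel)" using Hm by (simp add: borel_prod)
  have inner: "(\<lambda>\<omega>. \<integral>\<^sup>+\<omega>'. H (z n \<omega>, z n \<omega>') \<partial>\<Omega>) \<in> borel_measurable \<Omega>" for n by measurable
  have "(\<integral>\<^sup>+\<omega>. \<integral>\<^sup>+\<omega>'. H (z\<^sub>0 \<omega>, z\<^sub>0 \<omega>') \<partial>\<Omega> \<partial>\<Omega>) \<le>
      (\<integral>\<^sup>+\<omega>. liminf (\<lambda>n. \<integral>\<^sup>+\<omega>'. H (z n \<omega>, z n \<omega>') \<partial>\<Omega>) \<partial>\<Omega>)"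
  proof (rule nn_integral_mono_AE, rule eventually_mono[OF z_lim])
    fix \<omega> assume \<omega>: "(\<lambda>n. z n \<omega>) \<longlonglongrightarrow> z\<^sub>0 \<omega>"
    have "(\<integral>\<^sup>+\<omega>'. H (z\<^sub>0 \<omega>, z\<^sub>0 \<omega>') \<partial>\<Omega>) \<le> (\<integral>\<^sup>+\<omega>'. liminf (\<lambda>n. H (z n \<omega>, z n \<omega>')) \<partial>\<Omega>)"
      by (rule nn_integral_mono_AE, rule eventually_mono[OF z_lim])
         (rule lower_semicontinuous_liminf[OF H tendsto_Pair[OF \<omega>]])
    also have "\<dots> \<le> liminf (\<lambda>n. \<integral>\<^sup>+\<omega>'. H (z n \<omega>, z n \<omega>') \<partial>\<Omega>)"
      by (rule nn_integral_liminf) measurable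
    finally show "(\<integral>\<^sup>+\<omega>'. H (z\<^sub>0 \<omega>, z\<^sub>0 \<omega>') \<partial>\<Omega>) \<le> liminf (\<lambda>n. \<integral>\<^sup>+\<omega>'. H (z n \<omega>, z n \<omega>') \<partial>\<Omega>)" .
  qed
  also have "\<dots> \<le> liminf (\<lambda>n. \<integral>\<^sup>+\<omega>. \<integral>\<^sup>+\<omega>'. H (z n \<omega>, z n \<omega>') \<partial>\<Omega> \<partial>\<Omega>)"
    by (rule nn_integral_liminf[OF inner])
  finally show ?thesis by (simp only: interaction_eq[OF Hm z\<^sub>0] interaction_eq[OF Hm z])
qed

end

section \<open>Mixtures of kernels and the cost \<open>\<Phi>\<close>\<close>

text \<open>
  A convex combination as a \<open>bind\<close> with a Bernoulli index; the weight
  \<open>a\<close> is that of \<open>\<nu>'\<close>.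
\<close>

definition mix :: "real \<Rightarrow> 'z measure \<Rightarrow> 'z measure \<Rightarrow> 'z measure" where
  "mix a \<nu> \<nu>' = measure_pmf (bernoulli_pmf a) \<bind> (\<lambda>b. if b then \<nu>' else \<nu>)"

lemma
  assumes a: "0 \<le> a" "a \<le> 1" and \<nu>: "\<nu> \<in> borel_probs" "\<nu>' \<in> borel_probs"
  shows mix_prob: "mix a \<nu> \<nu>' \<in> borel_probs"
    and nn_integral_mix: "f \<in> borel_measurable borel \<Longrightarrow>
      (\<integral>\<^sup>+z. f z \<partial>mix a \<nu> \<nu>') = ennreal a * (\<integral>\<^sup>+z. f z \<partial>\<nu>') + ennreal (1 - a) * (\<integral>\<^sup>+z. f z \<partial>\<nu>)"
proof -
  let ?p = "measure_pmf (bernoulli_pmf a)" and ?k = "\<lambda>b. if b then \<nu>' else \<nu>"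
  have k: "?k \<in> ?p \<rightarrow>\<^sub>M subprob_algebra borel"
    using borel_probsD[OF \<nu>(1)] borel_probsD[OF \<nu>(2)]
    by (auto simp: space_subprob_algebra intro: prob_space_imp_subprob_space split: if_splits)
  show "mix a \<nu> \<nu>' \<in> borel_probs"
    unfolding borel_probs_def mix_def
  proof (intro CollectI conjI)
    show "prob_space (?p \<bind> ?k)"
      by (rule measure_pmf.prob_space_bind[OF AE_I2 k]) (simp add: borel_probsD(1)[OF \<nu>(1)] borel_probsD(1)[OF \<nu>(2)])
    show "sets (?p \<bind> ?k) = sets borel"
      by (rule sets_bind_measurable[OF k measure_pmf.not_empty])
  qed
  show "(\<integral>\<^sup>+z. f z \<partial>mix a \<nu> \<nu>') = ennreal a * (\<integral>\<^sup>+z. f z \<partial>\<nu>') + ennreal (1 - a) * (\<integral>\<^sup>+z. f z \<partial>\<nu>)"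
    if "f \<in> borel_measurable borel"
    unfolding mix_def nn_integral_bind[OF that k] using a by (simp add: mult.commute)
qed

lemma measurable_family_mix:
  assumes a: "a \<in> borel_measurable borel" "\<And>x. 0 \<le> a x" "\<And>x. a x \<le> 1"
    and K: "measurable_family K" and K': "measurable_family K'"
  shows "measurable_family (\<lambda>x. mix (a x) (K x) (K' x))"
  unfolding measurable_family_def
proof (intro conjI allI ballI)
  have P: "K x \<in> borel_probs" "K' x \<in> borel_probs" for x using K K' by (simp_all add: measurable_family_def)
  show M: "mix (a x) (K x) (K' x) \<in> borel_probs" for x by (rule mix_prob[OF a(2,3) P])
  fix B :: "'b set" assume B: "B \<in> sets borel"
  have "emeasure (mix (a x) (K x) (K' x)) B = ennreal (a x) * emeasure (K' x) B + ennreal (1 - a x) * emeasure (K x) B" for x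
    using nn_integral_mix[where f = "indicator B", OF a(2,3) P, of x x x] B
      borel_probsD(2)[OF M, of x] borel_probsD(2)[OF P(1), of x] borel_probsD(2)[OF P(2), of x] by simp
  moreover have "(\<lambda>x. emeasure (K x) B) \<in> borel_measurable borel" "(\<lambda>x. emeasure (K' x) B) \<in> borel_measurable borel"
    using K K' B by (simp_all add: measurable_family_def)
  ultimately show "(\<lambda>x. emeasure (mix (a x) (K x) (K' x)) B) \<in> borel_measurable borel"
    using a(1) by simp
qed

lemma interaction_mix:
  fixes H :: "'y::second_countable_topology \<times> 'y \<Rightarrow> ennreal"
  assumes a: "0 \<le> a" "a \<le> 1" and \<nu>: "\<nu> \<in> borel_probs" "\<nu>' \<in> borel_probs" "\<rho> \<in> borel_probs"
    and H: "H \<in> borel_measurable borel"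
  shows "interaction H (mix a \<nu> \<nu>') \<rho> = ennreal a * interaction H \<nu>' \<rho> + ennreal (1 - a) * interaction H \<nu> \<rho>"
    and "interaction H \<rho> (mix a \<nu> \<nu>') = ennreal a * interaction H \<rho> \<nu>' + ennreal (1 - a) * interaction H \<rho> \<nu>"
proof -
  note m = mix_prob[OF a \<nu>(1,2)]
  show "interaction H (mix a \<nu> \<nu>') \<rho> = ennreal a * interaction H \<nu>' \<rho> + ennreal (1 - a) * interaction H \<nu> \<rho>"
    unfolding interaction_fst[OF m \<nu>(3) H] interaction_fst[OF \<nu>(1,3) H] interaction_fst[OF \<nu>(2,3) H]
    by (rule nn_integral_mix[OF a \<nu>(1,2) measurable_nn_integral_const[OF H \<nu>(3)]])
  have "(\<lambda>y'. \<integral>\<^sup>+y. H (y, y') \<partial>\<rho>) \<in> borel_measurable borel"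
    by (rule measurable_nn_integral_const_fst[OF H \<nu>(3)])
  then show "interaction H \<rho> (mix a \<nu> \<nu>') = ennreal a * interaction H \<rho> \<nu>' + ennreal (1 - a) * interaction H \<rho> \<nu>"
    unfolding interaction_snd[OF \<nu>(3) m H] interaction_snd[OF \<nu>(3,1) H] interaction_snd[OF \<nu>(3,2) H]
    by (rule nn_integral_mix[OF a \<nu>(1,2)])
qed

text \<open>
  Here \<open>U\<close>, \<open>V\<close>, \<open>V'\<close> and \<open>W\<close> stand for the
  values of a bilinear form at the four pairs formed from old and new measures, when the first
  argument is replaced with weight \<open>a\<close> and the second with weight \<open>b\<close>.
  The values may be infinite, so the negative first-order terms are added on the left.
\<close>

lemma bilinear_mix_le:
  fixes U V V' W :: ennreal
  assumes "0 \<le> a" "a \<le> 1" "0 \<le> b" "b \<le> 1"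
  shows "ennreal a * (ennreal b * W + ennreal (1 - b) * V) + ennreal (1 - a) * (ennreal b * V' + ennreal (1 - b) * U)
      + (ennreal a * U + ennreal b * U)
    \<le> U + ennreal a * V + ennreal b * V' + ennreal (a * b) * (U + W)"
proof -
  have e: "ennreal x * (ennreal y * Z) = ennreal (x * y) * Z" if "0 \<le> x" "0 \<le> y" for x y and Z :: ennreal
    using that by (simp add: ennreal_mult mult.assoc)
  have "ennreal a * (ennreal b * W + ennreal (1 - b) * V) + ennreal (1 - a) * (ennreal b * V' + ennreal (1 - b) * U)
      + (ennreal a * U + ennreal b * U)
     = ennreal (a * b) * W + ennreal (a * (1 - b)) * V + ennreal ((1 - a) * b) * V'
      + (ennreal ((1 - a) * (1 - b)) + ennreal a + ennreal b) * U"
    using assms by (simp add: distrib_left distrib_right e add.assoc)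
  also have "ennreal ((1 - a) * (1 - b)) + ennreal a + ennreal b = ennreal (1 + a * b)"
  proof -
    have "0 \<le> (1 - a) * (1 - b)" using assms by simp
    then have "ennreal ((1 - a) * (1 - b)) + ennreal a + ennreal b = ennreal ((1 - a) * (1 - b) + a + b)"
      using assms by (simp add: ennreal_plus[symmetric] del: ennreal_plus)
    also have "(1 - a) * (1 - b) + a + b = 1 + a * b" by (simp add: algebra_simps)
    finally show ?thesis .
  qed
  also have "ennreal (a * b) * W + ennreal (a * (1 - b)) * V + ennreal ((1 - a) * b) * V' + ennreal (1 + a * b) * U
     \<le> ennreal (a * b) * W + ennreal a * V + ennreal b * V' + ennreal (1 + a * b) * U"
    using assms by (intro add_mono order_refl mult_right_mono ennreal_leI) (simp_all add: mult_left_le mult_left_le_one_le)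
  also have "\<dots> = U + ennreal a * V + ennreal b * V' + ennreal (a * b) * (U + W)"
    using assms by (simp add: distrib_left distrib_right ac_simps)
  finally show ?thesis .
qed

locale costs =
  fixes c :: "'x::{complete_space, second_countable_topology} \<times> 'y::{complete_space, second_countable_topology} \<Rightarrow> ennreal"
    and L :: "'y \<Rightarrow> ennreal" and H :: "'y \<times> 'y \<Rightarrow> ennreal" and \<mu> :: "'x measure"
  assumes c_lsc: "lower_semicontinuous c" and L_lsc: "lower_semicontinuous L" and H_lsc: "lower_semicontinuous H"
    and H_sym: "\<And>y y'. H (y, y') = H (y', y)"
    and L_compact: "\<And>r::real. 0 < r \<Longrightarrow> compact {y. L y \<le> ennreal r}"
    and \<mu>: "\<mu> \<in> borel_probs"
begin

lemma c_meas: "c \<in> borel_measurable borel" and L_meas: "L \<in> borel_measurable borel" and H_meas: "H \<in> borel_measurable borel"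
  using c_lsc L_lsc H_lsc by (simp_all add: lower_semicontinuous_borel)

lemma \<mu>_meas: "f \<in> borel_measurable borel \<Longrightarrow> f \<in> borel_measurable \<mu>"
  unfolding measurable_cong_sets[OF borel_probsD(2)[OF \<mu>] refl] .

abbreviation \<Phi> :: "'y measure \<Rightarrow> 'x \<times> 'y \<Rightarrow> ennreal" where
  "\<Phi> \<nu> p \<equiv> Phi c L H (fst p) (snd p) \<nu>"

lemma Phi_lsc:
  assumes \<nu>: "\<nu> \<in> borel_probs" and p: "p \<longlonglongrightarrow> p\<^sub>0"
  shows "\<Phi> \<nu> p\<^sub>0 \<le> liminf (\<lambda>n. \<Phi> \<nu> (p n))"
proof -
  let ?h = "\<lambda>y. \<integral>\<^sup>+y'. H (y, y') \<partial>\<nu>"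
  have y: "(\<lambda>n. snd (p n)) \<longlonglongrightarrow> snd p\<^sub>0" using p by (rule tendsto_snd)
  have Hm: "(\<lambda>y'. H (y, y')) \<in> borel_measurable \<nu>" for y
    unfolding measurable_cong_sets[OF borel_probsD(2)[OF \<nu>] refl] by (rule measurable_Pair_borel(1)[OF H_meas])
  have "?h (snd p\<^sub>0) \<le> (\<integral>\<^sup>+y'. liminf (\<lambda>n. H (snd (p n), y')) \<partial>\<nu>)"
    by (intro nn_integral_mono lower_semicontinuous_liminf[OF H_lsc] tendsto_Pair y tendsto_const)
  also have "\<dots> \<le> liminf (\<lambda>n. ?h (snd (p n)))"
    by (rule nn_integral_liminf[OF Hm])
  finally have h: "?h (snd p\<^sub>0) \<le> liminf (\<lambda>n. ?h (snd (p n)))" .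
  have "\<Phi> \<nu> p\<^sub>0 = c p\<^sub>0 + L (snd p\<^sub>0) + (?h (snd p\<^sub>0) + ?h (snd p\<^sub>0))"
    by (simp add: Phi_def mult_2)
  also have "\<dots> \<le> (liminf (\<lambda>n. c (p n)) + liminf (\<lambda>n. L (snd (p n)))) +
      (liminf (\<lambda>n. ?h (snd (p n))) + liminf (\<lambda>n. ?h (snd (p n))))"
    by (intro add_mono h lower_semicontinuous_liminf[OF c_lsc p] lower_semicontinuous_liminf[OF L_lsc y])
  also have "\<dots> \<le> liminf (\<lambda>n. c (p n) + L (snd (p n))) + liminf (\<lambda>n. ?h (snd (p n)) + ?h (snd (p n)))"
    by (intro add_mono liminf_add_le)
  also have "\<dots> \<le> liminf (\<lambda>n. (c (p n) + L (snd (p n))) + (?h (snd (p n)) + ?h (snd (p n))))"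
    by (rule liminf_add_le)
  also have "\<dots> = liminf (\<lambda>n. \<Phi> \<nu> (p n))" by (simp add: Phi_def mult_2)
  finally show ?thesis .
qed

lemma Phi_measurable:
  assumes \<nu>: "\<nu> \<in> borel_probs"
  shows "\<Phi> \<nu> \<in> borel_measurable borel"
proof -
  have [measurable]: "c \<in> borel_measurable (borel \<Otimes>\<^sub>M borel)" using c_meas by (simp add: borel_prod)
  note [measurable] = L_meas measurable_nn_integral_const[OF H_meas \<nu>]
  have "(\<lambda>p. c (fst p, snd p) + L (snd p) + 2 * (\<integral>\<^sup>+y'. H (snd p, y') \<partial>\<nu>)) \<in> borel_measurable (borel \<Otimes>\<^sub>M borel)"
    by measurable
  then show ?thesis by (simp add: Phi_def[abs_def] borel_prod)
qed

lemma Phi_argmin: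
  assumes \<nu>: "\<nu> \<in> borel_probs"
  obtains T where "T \<in> borel_measurable borel" "\<And>x y. Phi c L H x (T x) \<nu> \<le> Phi c L H x y \<nu>"
proof -
  have "\<exists>C. compact C \<and> (\<forall>x y. \<Phi> \<nu> (x, y) \<le> ennreal r \<longrightarrow> y \<in> C)" if "0 < r" for r :: real
  proof (intro exI conjI allI impI)
    show "compact {y. L y \<le> ennreal r}" by (rule L_compact[OF that])
    fix x y assume "\<Phi> \<nu> (x, y) \<le> ennreal r"
    moreover have "L y \<le> \<Phi> \<nu> (x, y)" by (simp add: Phi_def add_increasing add_increasing2)
    ultimately show "y \<in> {y. L y \<le> ennreal r}" by simp
  qed
  from measurable_argmin[of "\<Phi> \<nu>", OF Phi_lsc[OF \<nu>] this]
  obtain T where "T \<in> borel_measurable borel" "\<And>x y. \<Phi> \<nu> (x, T x) \<le> \<Phi> \<nu> (x, y)" by metis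
  then show ?thesis by (intro that[of T]) simp_all
qed

lemma nn_integral_Phi_kernel:
  assumes \<nu>: "\<nu> \<in> borel_probs" and \<rho>: "\<rho> \<in> borel_probs"
  shows "(\<integral>\<^sup>+y. Phi c L H x y \<nu> \<partial>\<rho>) = (\<integral>\<^sup>+y. c (x, y) \<partial>\<rho>) + (\<integral>\<^sup>+y. L y \<partial>\<rho>) + 2 * interaction H \<rho> \<nu>"
proof -
  note m = measurable_cong_sets[OF borel_probsD(2)[OF \<rho>] refl, of borel]
  have [measurable]: "(\<lambda>y. c (x, y)) \<in> borel_measurable \<rho>" "L \<in> borel_measurable \<rho>"
    "(\<lambda>y. \<integral>\<^sup>+y'. H (y, y') \<partial>\<nu>) \<in> borel_measurable \<rho>"
    unfolding m using measurable_Pair_borel(1)[OF c_meas] L_meas measurable_nn_integral_const[OF H_meas \<nu>] by auto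
  show ?thesis unfolding Phi_def interaction_fst[OF \<rho> \<nu> H_meas]
    by (simp add: nn_integral_add nn_integral_cmult)
qed

lemma Phi_kernel_measurable:
  assumes \<nu>: "\<nu> \<in> borel_probs" and K: "measurable_family K"
  shows "(\<lambda>x. \<integral>\<^sup>+y. Phi c L H x y \<nu> \<partial>K x) \<in> borel_measurable borel"
  using measurable_nn_integral_kernel[OF Phi_measurable[OF \<nu>] K] by simp

lemma state_measurable:
  assumes K: "measurable_family K"
  shows "(\<lambda>x. (\<integral>\<^sup>+y. c (x, y) \<partial>K x) + (\<integral>\<^sup>+y. L y \<partial>K x)) \<in> borel_measurable borel"
proof -
  have [measurable]: "(\<lambda>x. \<integral>\<^sup>+y. L y \<partial>K x) \<in> borel_measurable borel"
    using measurable_compose[OF measurable_family_kernel[OF K] nn_integral_measurable_subprob_algebra[OF L_meas]] .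
  note [measurable] = measurable_nn_integral_kernel[OF c_meas K]
  show ?thesis by measurable
qed

lemma nn_integral_Phi:
  assumes \<nu>: "\<nu> \<in> borel_probs" and K: "measurable_family K"
  shows "(\<integral>\<^sup>+x. \<integral>\<^sup>+y. Phi c L H x y \<nu> \<partial>K x \<partial>\<mu>) = state_cost c L \<mu> K + 2 * interaction H (mean_law \<mu> K) \<nu>"
proof -
  have P: "K x \<in> borel_probs" for x using K by (simp add: measurable_family_def)
  have i: "(\<lambda>x. interaction H (K x) \<nu>) \<in> borel_measurable borel"
    unfolding interaction_fst[OF P \<nu> H_meas]
    using measurable_compose[OF measurable_family_kernel[OF K]
        nn_integral_measurable_subprob_algebra[OF measurable_nn_integral_const[OF H_meas \<nu>]]] .
  show ?thesis
    unfolding nn_integral_Phi_kernel[OF \<nu> P] state_cost_def interaction_mean_law_left[OF \<mu> K \<nu> H_meas]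
    using \<mu>_meas[OF i] \<mu>_meas[OF state_measurable[OF K]]
    by (subst nn_integral_add) (simp_all add: nn_integral_cmult)
qed

lemma state_cost_joint:
  assumes K: "measurable_family K"
  shows "(\<integral>\<^sup>+p. c p \<partial>joint \<mu> K) + (\<integral>\<^sup>+y. L y \<partial>mean_law \<mu> K) = state_cost c L \<mu> K"
proof -
  have l: "(\<lambda>x. \<integral>\<^sup>+y. L y \<partial>K x) \<in> borel_measurable borel"
    using measurable_compose[OF measurable_family_kernel[OF K] nn_integral_measurable_subprob_algebra[OF L_meas]] .
  show ?thesis
    unfolding nn_integral_joint[OF \<mu> K c_meas] nn_integral_mean_law[OF \<mu> K L_meas] state_cost_def
    using \<mu>_meas[OF l] \<mu>_meas[OF measurable_nn_integral_kernel[OF c_meas K]]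
    by (subst nn_integral_add) simp_all
qed

lemma mean_field_cost_joint:
  assumes K: "measurable_family K"
  shows "mean_field_cost c L H (joint \<mu> K) = state_cost c L \<mu> K + interaction H (mean_law \<mu> K) (mean_law \<mu> K)"
  unfolding mean_field_cost_def Let_def distr_joint_snd[OF \<mu> K] state_cost_joint[OF K] ..

text \<open>
  The cost is nowhere below its pointwise minimum, so if its integral does not exceed that of the
  minimum, the two agree almost surely. Finiteness allows the subtraction.
\<close>

lemma cournot_nashI:
  assumes \<gamma>: "\<gamma> \<in> couplings_of \<mu>" and T: "T \<in> borel_measurable borel"
    and argmin: "\<And>x y. Phi c L H x (T x) (distr \<gamma> borel snd) \<le> Phi c L H x y (distr \<gamma> borel snd)"
    and le: "(\<integral>\<^sup>+p. \<Phi> (distr \<gamma> borel snd) p \<partial>\<gamma>) \<le> (\<integral>\<^sup>+x. Phi c L H x (T x) (distr \<gamma> borel snd) \<partial>\<mu>)"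
    and fin: "(\<integral>\<^sup>+x. Phi c L H x (T x) (distr \<gamma> borel snd) \<partial>\<mu>) < \<infinity>"
  shows "cournot_nash c L H \<mu> \<gamma>"
proof -
  define \<nu> where "\<nu> = distr \<gamma> borel snd"
  have \<gamma>P: "\<gamma> \<in> borel_probs" and \<gamma>\<mu>: "distr \<gamma> borel fst = \<mu>" using \<gamma> by (auto simp: couplings_of_def)
  note D = borel_probsD[OF \<gamma>P]
  interpret prob_space \<gamma> by (rule D)
  have fst: "fst \<in> \<gamma> \<rightarrow>\<^sub>M borel" and snd: "snd \<in> \<gamma> \<rightarrow>\<^sub>M borel"
    unfolding measurable_cong_sets[OF D(2) refl] by (simp_all add: borel_prod[symmetric])
  have \<nu>: "\<nu> \<in> borel_probs" unfolding \<nu>_def borel_probs_def by (simp add: prob_space_distr[OF snd])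
  define m where "m x = Phi c L H x (T x) \<nu>" for x
  have m_meas: "m \<in> borel_measurable borel"
  proof -
    have "(\<lambda>x. (x, T x)) \<in> borel \<rightarrow>\<^sub>M (borel :: ('x \<times> 'y) measure)"
      using T unfolding borel_prod[symmetric] by measurable
    from measurable_compose[OF this Phi_measurable[OF \<nu>]] show ?thesis by (simp add: m_def[abs_def])
  qed
  have Pm: "\<Phi> \<nu> \<in> borel_measurable \<gamma>"
    unfolding measurable_cong_sets[OF D(2) refl] by (rule Phi_measurable[OF \<nu>])
  have mm: "(\<lambda>p. m (fst p)) \<in> borel_measurable \<gamma>" by (rule measurable_compose[OF fst m_meas])
  have m_int: "(\<integral>\<^sup>+p. m (fst p) \<partial>\<gamma>) = (\<integral>\<^sup>+x. m x \<partial>\<mu>)"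
    unfolding \<gamma>\<mu>[symmetric] by (rule nn_integral_distr[OF fst, symmetric]) (simp add: m_meas)
  have m_le: "m (fst p) \<le> \<Phi> \<nu> p" for p unfolding m_def \<nu>_def by (rule argmin)
  have fin': "(\<integral>\<^sup>+p. m (fst p) \<partial>\<gamma>) \<noteq> \<infinity>"
    unfolding m_int using fin by (simp add: m_def[abs_def] \<nu>_def)
  have le': "(\<integral>\<^sup>+p. \<Phi> \<nu> p \<partial>\<gamma>) \<le> (\<integral>\<^sup>+p. m (fst p) \<partial>\<gamma>)"
    unfolding m_int using le by (simp only: m_def[abs_def] \<nu>_def)
  have "(\<integral>\<^sup>+p. \<Phi> \<nu> p - m (fst p) \<partial>\<gamma>) = (\<integral>\<^sup>+p. \<Phi> \<nu> p \<partial>\<gamma>) - (\<integral>\<^sup>+p. m (fst p) \<partial>\<gamma>)"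
    by (rule nn_integral_diff[OF Pm mm fin']) (simp add: m_le)
  also have "\<dots> = 0"
    using le' fin' by (intro diff_eq_0_ennreal) (auto simp: less_top[symmetric] top_unique)
  finally have "AE p in \<gamma>. \<Phi> \<nu> p - m (fst p) = 0"
    using Pm mm by (subst (asm) nn_integral_0_iff_AE) simp_all
  then have "AE p in \<gamma>. \<Phi> \<nu> p \<le> m (fst p)"
    by (rule eventually_mono) (simp add: diff_eq_0_iff_ennreal)
  moreover have "{p\<in>space \<gamma>. \<Phi> \<nu> p \<le> m (fst p)} \<in> sets \<gamma>"
    using Pm mm by (rule borel_measurable_le)
  ultimately have "emeasure \<gamma> {p\<in>space \<gamma>. \<Phi> \<nu> p \<le> m (fst p)} = 1"
    by (simp add: emeasure_eq_1_AE)
  moreover have "{p\<in>space \<gamma>. \<Phi> \<nu> p \<le> m (fst p)} = {(x, y). \<forall>y'. Phi c L H x y \<nu> \<le> Phi c L H x y' \<nu>}"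
    using m_le unfolding D(3) m_def by (auto intro: order_trans)
  ultimately show ?thesis
    unfolding cournot_nash_def Let_def \<nu>_def[symmetric] using \<gamma> by simp
qed

end

section \<open>First-order optimality in the mean-field problem\<close>

context costs
begin

lemma interaction_sym:
  assumes "\<nu> \<in> borel_probs" "\<nu>' \<in> borel_probs"
  shows "interaction H \<nu> \<nu>' = interaction H \<nu>' \<nu>"
  unfolding interaction_fst[OF assms H_meas] interaction_snd[OF assms(2,1) H_meas]
  by (subst H_sym) (rule refl)

abbreviation total_cost :: "('x \<Rightarrow> 'y measure) \<Rightarrow> ennreal" where
  "total_cost K \<equiv> state_cost c L \<mu> K + interaction H (mean_law \<mu> K) (mean_law \<mu> K)"

lemma nn_integral_pair:
  assumes G: "G \<in> borel_measurable (borel \<Otimes>\<^sub>M borel)"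
  shows "(\<integral>\<^sup>+p. G p \<partial>(\<mu> \<Otimes>\<^sub>M \<mu>)) = (\<integral>\<^sup>+x. \<integral>\<^sup>+x'. G (x, x') \<partial>\<mu> \<partial>\<mu>)"
    and "(\<integral>\<^sup>+p. G p \<partial>(\<mu> \<Otimes>\<^sub>M \<mu>)) = (\<integral>\<^sup>+x'. \<integral>\<^sup>+x. G (x, x') \<partial>\<mu> \<partial>\<mu>)"
    and "G \<in> borel_measurable (\<mu> \<Otimes>\<^sub>M \<mu>)"
proof -
  interpret \<mu>: prob_space \<mu> by (rule borel_probsD[OF \<mu>])
  interpret P: pair_sigma_finite \<mu> \<mu> ..
  have "sets (\<mu> \<Otimes>\<^sub>M \<mu>) = sets (borel \<Otimes>\<^sub>M borel)"
    by (rule sets_pair_measure_cong) (rule borel_probsD[OF \<mu>])+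
  note sets_eq = this
  show G': "G \<in> borel_measurable (\<mu> \<Otimes>\<^sub>M \<mu>)"
    unfolding measurable_cong_sets[OF sets_eq refl] by (rule G)
  show "(\<integral>\<^sup>+p. G p \<partial>(\<mu> \<Otimes>\<^sub>M \<mu>)) = (\<integral>\<^sup>+x. \<integral>\<^sup>+x'. G (x, x') \<partial>\<mu> \<partial>\<mu>)"
    by (rule \<mu>.nn_integral_fst[OF G', symmetric])
  show "(\<integral>\<^sup>+p. G p \<partial>(\<mu> \<Otimes>\<^sub>M \<mu>)) = (\<integral>\<^sup>+x'. \<integral>\<^sup>+x. G (x, x') \<partial>\<mu> \<partial>\<mu>)"
    by (rule P.nn_integral_snd[OF G', symmetric])
qed

text \<open>
  The first-order expansion of the total cost when \<open>K\<close> is moved towards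
  \<open>K'\<close> on \<open>A\<close> with weight \<open>t\<close>. Since \<open>H\<close> is
  symmetric, the linear part of the interaction appears twice, which produces exactly the factor 2
  in \<open>Phi\<close>. The quadratic remainder needs the interaction of the new actions among
  themselves and is finite because of the bound on \<open>A\<close>. Negative terms stand on the
  left.
\<close>

lemma total_cost_mix_le:
  assumes K: "measurable_family K" and K': "measurable_family K'" and A: "A \<in> sets borel"
    and W: "\<And>x x'. x \<in> A \<Longrightarrow> x' \<in> A \<Longrightarrow> interaction H (K' x) (K' x') \<le> ennreal B"
    and t: "0 \<le> t" "t \<le> 1"
  shows "total_cost (\<lambda>x. mix (t * indicator A x) (K x) (K' x)) +
      (\<integral>\<^sup>+x. ennreal (t * indicator A x) * (\<integral>\<^sup>+y. Phi c L H x y (mean_law \<mu> K) \<partial>K x) \<partial>\<mu>)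
    \<le> total_cost K + (\<integral>\<^sup>+x. ennreal (t * indicator A x) * (\<integral>\<^sup>+y. Phi c L H x y (mean_law \<mu> K) \<partial>K' x) \<partial>\<mu>)
      + ennreal (t\<^sup>2) * (interaction H (mean_law \<mu> K) (mean_law \<mu> K) + ennreal B)"
proof -
  interpret \<mu>: prob_space \<mu> by (rule borel_probsD[OF \<mu>])
  define \<nu> where "\<nu> = mean_law \<mu> K"
  have \<nu>: "\<nu> \<in> borel_probs" unfolding \<nu>_def by (rule mean_law_prob[OF \<mu> K])
  define a where "a x = t * indicator A x" for x :: 'x
  have a01: "0 \<le> a x" "a x \<le> 1" for x using t by (auto simp: a_def indicator_def)
  have a_meas [measurable]: "a \<in> borel_measurable borel" unfolding a_def using A by measurable
  define Kt where "Kt x = mix (a x) (K x) (K' x)" for x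
  have Kt: "measurable_family Kt" unfolding Kt_def by (rule measurable_family_mix[OF a_meas a01 K K'])
  have P: "K x \<in> borel_probs" "K' x \<in> borel_probs" "Kt x \<in> borel_probs" for x
    using K K' Kt by (simp_all add: measurable_family_def)
  define S where "S J x = (\<integral>\<^sup>+y. c (x, y) \<partial>J x) + (\<integral>\<^sup>+y. L y \<partial>J x)" for J :: "'x \<Rightarrow> 'y measure" and x
  have S_meas: "S J \<in> borel_measurable borel" if "measurable_family J" for J
    unfolding S_def by (rule state_measurable[OF that])
  note [measurable] = S_meas[OF K] S_meas[OF K'] S_meas[OF Kt]
  have S_mix: "S Kt x + ennreal (a x) * S K x = S K x + ennreal (a x) * S K' x" for x
  proof -
    have "S Kt x = ennreal (a x) * S K' x + ennreal (1 - a x) * S K x"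
      unfolding S_def Kt_def nn_integral_mix[OF a01 P(1,2) measurable_Pair_borel(1)[OF c_meas]]
        nn_integral_mix[OF a01 P(1,2) L_meas] by (simp add: distrib_left ac_simps)
    moreover have "ennreal (1 - a x) * S K x + ennreal (a x) * S K x = S K x"
      using a01[of x] by (simp add: distrib_right[symmetric] ennreal_plus[symmetric] del: ennreal_plus)
    ultimately show ?thesis by (simp add: add.assoc add.commute)
  qed
  have state: "state_cost c L \<mu> Kt + (\<integral>\<^sup>+x. ennreal (a x) * S K x \<partial>\<mu>) =
      state_cost c L \<mu> K + (\<integral>\<^sup>+x. ennreal (a x) * S K' x \<partial>\<mu>)"
  proof -
    have m: "S Kt \<in> borel_measurable \<mu>" "S K \<in> borel_measurable \<mu>"
      "(\<lambda>x. ennreal (a x) * S K x) \<in> borel_measurable \<mu>" "(\<lambda>x. ennreal (a x) * S K' x) \<in> borel_measurable \<mu>"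
      by (rule \<mu>_meas, measurable)+
    have "(\<integral>\<^sup>+x. S Kt x + ennreal (a x) * S K x \<partial>\<mu>) = (\<integral>\<^sup>+x. S K x + ennreal (a x) * S K' x \<partial>\<mu>)"
      by (simp only: S_mix)
    moreover have "state_cost c L \<mu> J = (\<integral>\<^sup>+x. S J x \<partial>\<mu>)" for J
      unfolding state_cost_def S_def[abs_def] ..
    ultimately show ?thesis
      by (simp only: nn_integral_add[OF m(1,3)] nn_integral_add[OF m(2,4)])
  qed
  define U where "U p = interaction H (K (fst p)) (K (snd p))" for p
  define V where "V p = interaction H (K' (fst p)) (K (snd p))" for p
  define V' where "V' p = interaction H (K (fst p)) (K' (snd p))" for p
  define W' where "W' p = interaction H (K' (fst p)) (K' (snd p))" for p
  define I where "I p = interaction H (Kt (fst p)) (Kt (snd p))" for p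
  have [measurable]: "U \<in> borel_measurable (borel \<Otimes>\<^sub>M borel)" "V \<in> borel_measurable (borel \<Otimes>\<^sub>M borel)"
    "V' \<in> borel_measurable (borel \<Otimes>\<^sub>M borel)" "W' \<in> borel_measurable (borel \<Otimes>\<^sub>M borel)"
    "I \<in> borel_measurable (borel \<Otimes>\<^sub>M borel)"
    using measurable_interaction_kernels[OF H_meas K K] measurable_interaction_kernels[OF H_meas K' K]
      measurable_interaction_kernels[OF H_meas K K'] measurable_interaction_kernels[OF H_meas K' K']
      measurable_interaction_kernels[OF H_meas Kt Kt]
    unfolding U_def V_def V'_def W'_def I_def case_prod_beta' by auto
  let ?a = "\<lambda>p. ennreal (a (fst p))" and ?b = "\<lambda>p. ennreal (a (snd p))"
  let ?P = "\<mu> \<Otimes>\<^sub>M \<mu>"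
  have pointwise: "I p + (?a p * U p + ?b p * U p) \<le> U p + ?a p * V p + ?b p * V' p + ennreal (t\<^sup>2) * (U p + ennreal B)" for p
  proof -
    have "I p + (?a p * U p + ?b p * U p) \<le> U p + ?a p * V p + ?b p * V' p + ennreal (a (fst p) * a (snd p)) * (U p + W' p)"
      unfolding I_def U_def V_def V'_def W'_def Kt_def interaction_mix(1)[OF a01 P(1,2) P(3)[unfolded Kt_def] H_meas]
        interaction_mix(2)[OF a01 P(1,2) P(1) H_meas] interaction_mix(2)[OF a01 P(1,2) P(2) H_meas]
      by (rule bilinear_mix_le[OF a01 a01])
    also have "ennreal (a (fst p) * a (snd p)) * (U p + W' p) \<le> ennreal (t\<^sup>2) * (U p + ennreal B)"
    proof (cases "fst p \<in> A \<and> snd p \<in> A")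
      case True
      then have "W' p \<le> ennreal B" unfolding W'_def by (intro W) auto
      then show ?thesis using True by (auto simp: a_def power2_eq_square intro!: mult_left_mono add_left_mono)
    qed (auto simp: a_def indicator_def)
    finally show ?thesis by (simp add: add_left_mono)
  qed
  note pair = nn_integral_pair
  have intU: "(\<integral>\<^sup>+p. U p \<partial>?P) = interaction H \<nu> \<nu>"
    by (subst pair(1), measurable)
       (simp add: U_def \<nu>_def interaction_mean_law_right[OF \<mu> K P(1) H_meas, symmetric]
          interaction_mean_law_left[OF \<mu> K mean_law_prob[OF \<mu> K] H_meas, symmetric])
  have intI: "(\<integral>\<^sup>+p. I p \<partial>?P) = interaction H (mean_law \<mu> Kt) (mean_law \<mu> Kt)"
    by (subst pair(1), measurable)
       (simp add: I_def interaction_mean_law_right[OF \<mu> Kt P(3) H_meas, symmetric]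
          interaction_mean_law_left[OF \<mu> Kt mean_law_prob[OF \<mu> Kt] H_meas, symmetric])
  have slice: "(\<lambda>x'. interaction H \<rho> (J x')) \<in> borel_measurable \<mu>" "(\<lambda>x'. interaction H (J x') \<rho>) \<in> borel_measurable \<mu>"
    if "measurable_family J" "\<rho> \<in> borel_probs" for J \<rho>
  proof -
    have JP: "J x \<in> borel_probs" for x using that by (simp add: measurable_family_def)
    have "(\<lambda>x'. interaction H (J x') \<rho>) \<in> borel_measurable borel"
      unfolding interaction_fst[OF JP that(2) H_meas]
      using measurable_compose[OF measurable_family_kernel[OF that(1)]
          nn_integral_measurable_subprob_algebra[OF measurable_nn_integral_const[OF H_meas that(2)]]] .
    then show "(\<lambda>x'. interaction H (J x') \<rho>) \<in> borel_measurable \<mu>" by (rule \<mu>_meas)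
    then show "(\<lambda>x'. interaction H \<rho> (J x')) \<in> borel_measurable \<mu>" by (simp only: interaction_sym[OF that(2) JP])
  qed
  have left: "(\<integral>\<^sup>+p. ?a p * interaction H (J (fst p)) (K (snd p)) \<partial>?P) = (\<integral>\<^sup>+x. ennreal (a x) * interaction H (J x) \<nu> \<partial>\<mu>)"
    if J: "measurable_family J" for J
  proof -
    have JP: "J x \<in> borel_probs" for x using J by (simp add: measurable_family_def)
    have [measurable]: "(\<lambda>p. interaction H (J (fst p)) (K (snd p))) \<in> borel_measurable (borel \<Otimes>\<^sub>M borel)"
      using measurable_interaction_kernels[OF H_meas J K] by (simp add: case_prod_beta')
    have "(\<integral>\<^sup>+p. ?a p * interaction H (J (fst p)) (K (snd p)) \<partial>?P) =
        (\<integral>\<^sup>+x. \<integral>\<^sup>+x'. ennreal (a x) * interaction H (J x) (K x') \<partial>\<mu> \<partial>\<mu>)"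
      by (subst pair(1), measurable)
    also have "\<dots> = (\<integral>\<^sup>+x. ennreal (a x) * (\<integral>\<^sup>+x'. interaction H (J x) (K x') \<partial>\<mu>) \<partial>\<mu>)"
      by (intro nn_integral_cong nn_integral_cmult slice K JP)
    finally show ?thesis by (simp only: \<nu>_def interaction_mean_law_right[OF \<mu> K JP H_meas])
  qed
  have right: "(\<integral>\<^sup>+p. ?b p * interaction H (K (fst p)) (J (snd p)) \<partial>?P) = (\<integral>\<^sup>+x. ennreal (a x) * interaction H (J x) \<nu> \<partial>\<mu>)"
    if J: "measurable_family J" for J
  proof -
    have JP: "J x \<in> borel_probs" for x using J by (simp add: measurable_family_def)
    have [measurable]: "(\<lambda>p. interaction H (K (fst p)) (J (snd p))) \<in> borel_measurable (borel \<Otimes>\<^sub>M borel)"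
      using measurable_interaction_kernels[OF H_meas K J] by (simp add: case_prod_beta')
    have "(\<integral>\<^sup>+p. ?b p * interaction H (K (fst p)) (J (snd p)) \<partial>?P) =
        (\<integral>\<^sup>+x'. \<integral>\<^sup>+x. ennreal (a x') * interaction H (K x) (J x') \<partial>\<mu> \<partial>\<mu>)"
      by (subst pair(2), measurable)
    also have "\<dots> = (\<integral>\<^sup>+x'. ennreal (a x') * (\<integral>\<^sup>+x. interaction H (K x) (J x') \<partial>\<mu>) \<partial>\<mu>)"
      by (intro nn_integral_cong nn_integral_cmult slice K JP)
    also have "\<dots> = (\<integral>\<^sup>+x'. ennreal (a x') * interaction H \<nu> (J x') \<partial>\<mu>)"
      by (simp only: \<nu>_def interaction_mean_law_left[OF \<mu> K JP H_meas])
    finally show ?thesis by (simp only: interaction_sym[OF \<nu> JP])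
  qed
  define \<alpha> where "\<alpha> = (\<integral>\<^sup>+x. ennreal (a x) * interaction H (K x) \<nu> \<partial>\<mu>)"
  define \<beta> where "\<beta> = (\<integral>\<^sup>+x. ennreal (a x) * interaction H (K' x) \<nu> \<partial>\<mu>)"
  have meas_P: "I \<in> borel_measurable ?P" "U \<in> borel_measurable ?P"
    "(\<lambda>p. ?a p * U p) \<in> borel_measurable ?P" "(\<lambda>p. ?b p * U p) \<in> borel_measurable ?P"
    "(\<lambda>p. ?a p * V p) \<in> borel_measurable ?P" "(\<lambda>p. ?b p * V' p) \<in> borel_measurable ?P"
    by (rule pair(3); measurable)+
  interpret PP: pair_prob_space \<mu> \<mu> ..
  have "(\<integral>\<^sup>+p. I p + (?a p * U p + ?b p * U p) \<partial>?P) \<le>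
      (\<integral>\<^sup>+p. U p + ?a p * V p + ?b p * V' p + ennreal (t\<^sup>2) * (U p + ennreal B) \<partial>?P)"
    by (intro nn_integral_mono pointwise)
  also have "(\<integral>\<^sup>+p. I p + (?a p * U p + ?b p * U p) \<partial>?P) =
      interaction H (mean_law \<mu> Kt) (mean_law \<mu> Kt) + (\<alpha> + \<alpha>)"
    using meas_P left[OF K] right[OF K] by (simp add: nn_integral_add intI U_def \<alpha>_def)
  also have "(\<integral>\<^sup>+p. U p + ?a p * V p + ?b p * V' p + ennreal (t\<^sup>2) * (U p + ennreal B) \<partial>?P) =
      interaction H \<nu> \<nu> + \<beta> + \<beta> + ennreal (t\<^sup>2) * (interaction H \<nu> \<nu> + ennreal B)"
    using meas_P left[OF K'] right[OF K'] PP.emeasure_space_1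
    by (simp add: nn_integral_add nn_integral_cmult intU V_def V'_def \<beta>_def)
  finally have inter: "interaction H (mean_law \<mu> Kt) (mean_law \<mu> Kt) + (\<alpha> + \<alpha>) \<le>
      interaction H \<nu> \<nu> + \<beta> + \<beta> + ennreal (t\<^sup>2) * (interaction H \<nu> \<nu> + ennreal B)" .
  have lin: "(\<integral>\<^sup>+x. ennreal (a x) * (\<integral>\<^sup>+y. Phi c L H x y \<nu> \<partial>J x) \<partial>\<mu>) =
      (\<integral>\<^sup>+x. ennreal (a x) * S J x \<partial>\<mu>) + ((\<integral>\<^sup>+x. ennreal (a x) * interaction H (J x) \<nu> \<partial>\<mu>)
        + (\<integral>\<^sup>+x. ennreal (a x) * interaction H (J x) \<nu> \<partial>\<mu>))"
    if J: "measurable_family J" for J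
  proof -
    have JP: "J x \<in> borel_probs" for x using J by (simp add: measurable_family_def)
    have am: "(\<lambda>x. ennreal (a x)) \<in> borel_measurable \<mu>" by (rule \<mu>_meas) measurable
    have m: "(\<lambda>x. ennreal (a x) * S J x) \<in> borel_measurable \<mu>"
      "(\<lambda>x. ennreal (a x) * interaction H (J x) \<nu>) \<in> borel_measurable \<mu>"
      using am \<mu>_meas[OF S_meas[OF J]] slice(2)[OF J \<nu>] by simp_all
    have "(\<integral>\<^sup>+x. ennreal (a x) * (\<integral>\<^sup>+y. Phi c L H x y \<nu> \<partial>J x) \<partial>\<mu>) =
        (\<integral>\<^sup>+x. ennreal (a x) * S J x + (ennreal (a x) * interaction H (J x) \<nu> + ennreal (a x) * interaction H (J x) \<nu>) \<partial>\<mu>)"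
      unfolding nn_integral_Phi_kernel[OF \<nu> JP] S_def by (simp add: distrib_left mult_2 ac_simps)
    then show ?thesis using m by (simp add: nn_integral_add)
  qed
  have "total_cost Kt + (\<integral>\<^sup>+x. ennreal (a x) * (\<integral>\<^sup>+y. Phi c L H x y \<nu> \<partial>K x) \<partial>\<mu>) =
      (state_cost c L \<mu> Kt + (\<integral>\<^sup>+x. ennreal (a x) * S K x \<partial>\<mu>)) +
      (interaction H (mean_law \<mu> Kt) (mean_law \<mu> Kt) + (\<alpha> + \<alpha>))"
    unfolding lin[OF K] \<alpha>_def by (simp add: ac_simps)
  also have "\<dots> \<le> (state_cost c L \<mu> K + (\<integral>\<^sup>+x. ennreal (a x) * S K' x \<partial>\<mu>)) +
      (interaction H \<nu> \<nu> + \<beta> + \<beta> + ennreal (t\<^sup>2) * (interaction H \<nu> \<nu> + ennreal B))"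
    unfolding state by (intro add_left_mono inter)
  also have "\<dots> = total_cost K + (\<integral>\<^sup>+x. ennreal (a x) * (\<integral>\<^sup>+y. Phi c L H x y \<nu> \<partial>K' x) \<partial>\<mu>)
      + ennreal (t\<^sup>2) * (interaction H \<nu> \<nu> + ennreal B)"
    unfolding lin[OF K'] \<beta>_def[symmetric] by (simp add: \<nu>_def ac_simps)
  finally show ?thesis unfolding a_def Kt_def \<nu>_def .
qed

text \<open>
  The first-order condition. A deviation that gains \<open>\<delta>\<close> on \<open>A\<close>
  changes the total cost by at most \<open>- t * \<delta> * \<mu> A + t\<^sup>2 * Q\<close>, which
  is negative for small \<open>t\<close> unless \<open>A\<close> is null.
\<close>

lemma no_profitable_deviation:
  assumes K: "measurable_family K" and K': "measurable_family K'" and A: "A \<in> sets borel"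
    and W: "\<And>x x'. x \<in> A \<Longrightarrow> x' \<in> A \<Longrightarrow> interaction H (K' x) (K' x') \<le> ennreal B"
    and fin: "total_cost K < \<infinity>"
    and min: "\<And>J. measurable_family J \<Longrightarrow> total_cost K \<le> total_cost J"
    and \<delta>: "0 < \<delta>" and gain: "\<And>x. x \<in> A \<Longrightarrow> (\<integral>\<^sup>+y. Phi c L H x y (mean_law \<mu> K) \<partial>K' x) + ennreal \<delta>
        \<le> (\<integral>\<^sup>+y. Phi c L H x y (mean_law \<mu> K) \<partial>K x)"
  shows "A \<in> null_sets \<mu>"
proof -
  interpret \<mu>: prob_space \<mu> by (rule borel_probsD[OF \<mu>])
  define \<nu> where "\<nu> = mean_law \<mu> K"
  have \<nu>: "\<nu> \<in> borel_probs" unfolding \<nu>_def by (rule mean_law_prob[OF \<mu> K])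
  define F where "F x = (\<integral>\<^sup>+y. Phi c L H x y \<nu> \<partial>K x)" for x
  define G where "G x = (\<integral>\<^sup>+y. Phi c L H x y \<nu> \<partial>K' x)" for x
  have F_meas: "F \<in> borel_measurable \<mu>" and G_meas: "G \<in> borel_measurable \<mu>"
    unfolding F_def G_def by (rule \<mu>_meas, rule Phi_kernel_measurable[OF \<nu>], fact)+
  have A\<mu>: "A \<in> sets \<mu>" using A borel_probsD(2)[OF \<mu>] by simp
  have fins: "state_cost c L \<mu> K < \<infinity>" "interaction H \<nu> \<nu> < \<infinity>"
    using fin by (auto simp: \<nu>_def)
  have F_fin: "(\<integral>\<^sup>+x. F x \<partial>\<mu>) < \<infinity>"
    unfolding F_def nn_integral_Phi[OF \<nu> K] using fins by (simp add: \<nu>_def ennreal_mult_less_top)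
  define FA where "FA = (\<integral>\<^sup>+x. indicator A x * F x \<partial>\<mu>)"
  define GA where "GA = (\<integral>\<^sup>+x. indicator A x * G x \<partial>\<mu>)"
  have gain_int: "GA + ennreal \<delta> * emeasure \<mu> A \<le> FA"
  proof -
    have "GA + ennreal \<delta> * emeasure \<mu> A = (\<integral>\<^sup>+x. indicator A x * G x + ennreal \<delta> * indicator A x \<partial>\<mu>)"
      using G_meas A\<mu> by (simp add: GA_def nn_integral_add nn_integral_cmult)
    also have "\<dots> \<le> FA"
      unfolding FA_def using gain by (intro nn_integral_mono) (auto simp: indicator_def F_def G_def \<nu>_def)
    finally show ?thesis .
  qed
  have "FA \<le> (\<integral>\<^sup>+x. F x \<partial>\<mu>)" unfolding FA_def by (intro nn_integral_mono) (auto simp: indicator_def)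
  then have FA_fin: "FA < \<infinity>" using F_fin by (rule le_less_trans)
  have "GA \<le> FA" using gain_int by (rule order_trans[rotated]) simp
  then have GA_fin: "GA < \<infinity>" using FA_fin by (rule le_less_trans)
  define Q where "Q = interaction H \<nu> \<nu> + ennreal B"
  have Q_fin: "Q < \<infinity>" using fins(2) by (simp add: Q_def)
  have step: "ennreal \<delta> * emeasure \<mu> A \<le> ennreal t * Q" if t: "0 < t" "t \<le> 1" for t
  proof -
    have a01: "0 \<le> t * indicator A x" "t * indicator A x \<le> 1" for x :: 'x using t by (auto simp: indicator_def)
    have Kt: "measurable_family (\<lambda>x. mix (t * indicator A x) (K x) (K' x))"
      using A by (intro measurable_family_mix a01 K K') simp
    have scale: "(\<integral>\<^sup>+x. ennreal (t * indicator A x) * f x \<partial>\<mu>) = ennreal t * (\<integral>\<^sup>+x. indicator A x * f x \<partial>\<mu>)"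
      if "f \<in> borel_measurable \<mu>" for f :: "'x \<Rightarrow> ennreal"
    proof -
      have "(\<integral>\<^sup>+x. ennreal (t * indicator A x) * f x \<partial>\<mu>) = (\<integral>\<^sup>+x. ennreal t * (indicator A x * f x) \<partial>\<mu>)"
        by (intro nn_integral_cong) (auto simp: indicator_def)
      also have "\<dots> = ennreal t * (\<integral>\<^sup>+x. indicator A x * f x \<partial>\<mu>)"
        using that A\<mu> by (intro nn_integral_cmult) simp
      finally show ?thesis .
    qed
    have "total_cost K + ennreal t * FA \<le>
        total_cost (\<lambda>x. mix (t * indicator A x) (K x) (K' x)) + ennreal t * FA"
      by (intro add_right_mono min Kt)
    also have "\<dots> \<le> total_cost K + ennreal t * GA + ennreal (t\<^sup>2) * Q"
      using total_cost_mix_le[OF K K' A W, of t] t scale[OF F_meas] scale[OF G_meas]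
      unfolding \<nu>_def[symmetric] F_def[symmetric] G_def[symmetric] Q_def FA_def GA_def by simp
    finally have "total_cost K + ennreal t * FA \<le> total_cost K + (ennreal t * GA + ennreal (t\<^sup>2) * Q)"
      by (simp only: add.assoc)
    then have "ennreal t * FA \<le> ennreal t * GA + ennreal (t\<^sup>2) * Q"
      using fin by (subst (asm) ennreal_add_left_cancel_le) auto
    also have "ennreal (t\<^sup>2) * Q = ennreal t * (ennreal t * Q)"
      using t by (simp add: power2_eq_square ennreal_mult mult.assoc)
    finally have "ennreal t * FA \<le> ennreal t * (GA + ennreal t * Q)" by (simp add: distrib_left)
    then have "FA \<le> GA + ennreal t * Q"
      using t by (subst (asm) ennreal_mult_le_mult_iff) auto
    with gain_int have "GA + ennreal \<delta> * emeasure \<mu> A \<le> GA + ennreal t * Q" by (rule order_trans)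
    then show ?thesis using GA_fin by (subst (asm) ennreal_add_left_cancel_le) auto
  qed
  obtain q where q: "Q = ennreal q" "0 \<le> q" using Q_fin by (cases Q) auto
  have real_step: "\<delta> * measure \<mu> A \<le> t * q" if t: "0 < t" "t \<le> 1" for t
    using step[OF t] t q(2) \<delta> unfolding q(1)
    by (simp add: \<mu>.emeasure_eq_measure ennreal_mult[symmetric] ennreal_le_iff)
  have "measure \<mu> A = 0"
  proof (rule ccontr)
    assume "measure \<mu> A \<noteq> 0"
    then have s: "0 < \<delta> * measure \<mu> A" using \<delta> by (simp add: zero_less_measure_iff)
    define t where "t = min 1 (\<delta> * measure \<mu> A / (2 * (q + 1)))"
    have t: "0 < t" "t \<le> 1" using s q(2) by (auto simp: t_def)
    have "t * q \<le> \<delta> * measure \<mu> A / (2 * (q + 1)) * q"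
      using q(2) by (intro mult_right_mono) (auto simp: t_def)
    also have "\<dots> \<le> \<delta> * measure \<mu> A / 2"
      using s q(2) by (simp add: field_simps)
    finally show False using real_step[OF t] s by simp
  qed
  then show ?thesis using A\<mu> by (auto simp: null_sets_def \<mu>.emeasure_eq_measure)
qed

text \<open>
  Moving directly to a best reply \<open>T x\<close> may create an infinite interaction among the
  deviating players. The kernels \<open>\<kappa> n\<close> spread the best replies out: where
  \<open>L (T x)\<close> is bounded, the interaction of the deviations \<open>\<kappa> n (T
  x)\<close> is bounded too, so that they are not profitable. Letting \<open>n\<close> tend to
  infinity, their costs converge to the minimum of \<open>Phi\<close>, and the conditional cost
  \<open>F\<close> of the minimizer cannot exceed it on a set of positive measure.
\<close>

lemma minimizer_cournot_nash:
  fixes \<kappa> :: "nat \<Rightarrow> 'y \<Rightarrow> 'y measure" and C :: "nat \<Rightarrow> real"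
  assumes C_pos: "\<And>n. 0 < C n" and kappa: "\<And>n. measurable_family (\<kappa> n)"
    and kappa_bound: "\<And>n y y'. interaction H (\<kappa> n y) (\<kappa> n y') \<le> ennreal (C n) * (1 + L y + L y')"
    and kappa_lim: "\<And>x y \<nu>. (x, y, \<nu>) \<in> dom_Phi c L H \<Longrightarrow>
        (\<lambda>n. \<integral>\<^sup>+z. Phi c L H x z \<nu> \<partial>\<kappa> n y) \<longlonglongrightarrow> Phi c L H x y \<nu>"
    and K: "measurable_family K" and fin: "total_cost K < \<infinity>"
    and min: "\<And>J. measurable_family J \<Longrightarrow> total_cost K \<le> total_cost J"
  shows "cournot_nash c L H \<mu> (joint \<mu> K)"
proof -
  interpret \<mu>: prob_space \<mu> by (rule borel_probsD[OF \<mu>])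
  define \<nu> where "\<nu> = mean_law \<mu> K"
  have \<nu>: "\<nu> \<in> borel_probs" unfolding \<nu>_def by (rule mean_law_prob[OF \<mu> K])
  obtain T where T: "T \<in> borel_measurable borel" "\<And>x y. Phi c L H x (T x) \<nu> \<le> Phi c L H x y \<nu>"
    using Phi_argmin[OF \<nu>] by metis
  define m where "m x = Phi c L H x (T x) \<nu>" for x
  define \<kappa>T where "\<kappa>T n x = \<kappa> n (T x)" for n x
  have \<kappa>T: "measurable_family (\<kappa>T n)" for n
    unfolding measurable_family_iff \<kappa>T_def
    by (rule measurable_compose[OF T(1) kappa[of n, unfolded measurable_family_iff]])
  define F where "F x = (\<integral>\<^sup>+y. Phi c L H x y \<nu> \<partial>K x)" for x
  define G where "G n x = (\<integral>\<^sup>+y. Phi c L H x y \<nu> \<partial>\<kappa>T n x)" for n x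
  have F_meas: "F \<in> borel_measurable borel" unfolding F_def by (rule Phi_kernel_measurable[OF \<nu> K])
  have G_meas: "G n \<in> borel_measurable borel" for n unfolding G_def by (rule Phi_kernel_measurable[OF \<nu> \<kappa>T])
  note [measurable] = F_meas G_meas
  have fins: "state_cost c L \<mu> K < \<infinity>" "interaction H \<nu> \<nu> < \<infinity>"
    using fin by (auto simp: \<nu>_def)
  have F_fin: "(\<integral>\<^sup>+x. F x \<partial>\<mu>) < \<infinity>"
    unfolding F_def nn_integral_Phi[OF \<nu> K] using fins by (simp add: \<nu>_def ennreal_mult_less_top)
  have m_le_F: "m x \<le> F x" for x
  proof -
    have "m x = (\<integral>\<^sup>+y. m x \<partial>K x)"
      using prob_space.emeasure_space_1[OF measurable_familyD(1)[OF K]] by simp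
    also have "\<dots> \<le> F x" unfolding F_def m_def by (intro nn_integral_mono T(2))
    finally show ?thesis .
  qed
  \<comment> \<open>A single parameter \<open>R\<close> bounds the cost, which bounds \<open>L (T
  x)\<close>, and fixes the gain of the deviation.\<close>
  define A where "A n R = {x. F x \<le> ennreal (real R) \<and> G n x + ennreal (1 / Suc R) \<le> F x}" for n R
  have A_null: "A n R \<in> null_sets \<mu>" for n R
  proof (rule no_profitable_deviation[OF K \<kappa>T[of n] _ _ fin min, where \<delta> = "1 / Suc R" and B = "C n * (1 + 2 * real R)"])
    show "A n R \<in> sets borel" unfolding A_def by measurable
    show "(\<integral>\<^sup>+y. Phi c L H x y (mean_law \<mu> K) \<partial>\<kappa>T n x) + ennreal (1 / Suc R)
        \<le> (\<integral>\<^sup>+y. Phi c L H x y (mean_law \<mu> K) \<partial>K x)" if "x \<in> A n R" for x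
      using that by (simp add: A_def F_def G_def \<nu>_def)
    have L_le: "L (T x) \<le> ennreal (real R)" if "x \<in> A n R" for x
    proof -
      have "L (T x) \<le> m x" by (simp add: m_def Phi_def add_increasing add_increasing2)
      also note m_le_F
      also have "F x \<le> ennreal (real R)" using that by (simp add: A_def)
      finally show ?thesis .
    qed
    fix x x' assume x: "x \<in> A n R" and x': "x' \<in> A n R"
    have "interaction H (\<kappa>T n x) (\<kappa>T n x') \<le> ennreal (C n) * (1 + L (T x) + L (T x'))"
      unfolding \<kappa>T_def by (rule kappa_bound)
    also have "\<dots> \<le> ennreal (C n) * (1 + ennreal (real R) + ennreal (real R))"
      by (intro mult_left_mono add_mono order_refl L_le x x') simp
    also have "1 + ennreal (real R) + ennreal (real R) = ennreal (1 + 2 * real R)"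
      by (simp add: ennreal_plus[symmetric] ennreal_1[symmetric] del: ennreal_plus ennreal_1)
    also have "ennreal (C n) * \<dots> = ennreal (C n * (1 + 2 * real R))"
      using C_pos[of n] by (intro ennreal_mult[symmetric]) auto
    finally show "interaction H (\<kappa>T n x) (\<kappa>T n x') \<le> ennreal (C n * (1 + 2 * real R))" .
  qed simp_all
  have "AE x in \<mu>. \<forall>n R. x \<notin> A n R"
    unfolding AE_all_countable using AE_not_in[OF A_null] by blast
  moreover have "AE x in \<mu>. F x \<noteq> \<infinity>"
    using F_fin by (intro nn_integral_noteq_infinite \<mu>_meas[OF F_meas]) auto
  ultimately have F_le_m: "AE x in \<mu>. F x \<le> m x"
  proof eventually_elim
    case (elim x)
    show "F x \<le> m x"
    proof (rule ccontr)
      assume "\<not> F x \<le> m x"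
      then have lt: "m x < F x" by simp
      have Ffin: "F x < \<infinity>" using elim(2) by (simp add: less_top)
      then have "(x, T x, \<nu>) \<in> dom_Phi c L H"
        using lt \<nu> by (auto simp: dom_Phi_def m_def)
      from kappa_lim[OF this] have lim: "(\<lambda>n. G n x) \<longlonglongrightarrow> m x" by (simp add: G_def \<kappa>T_def m_def)
      have "(\<lambda>R. m x + ennreal (1 / real (Suc R))) \<longlonglongrightarrow> m x + ennreal 0"
        using LIMSEQ_inverse_real_of_nat
        by (intro tendsto_add tendsto_const tendsto_ennrealI) (simp add: inverse_eq_divide)
      then have "\<forall>\<^sub>F R in sequentially. m x + ennreal (1 / real (Suc R)) < F x"
        using lt by (intro order_tendstoD(2)) simp_all
      moreover have "\<forall>\<^sub>F R in sequentially. F x \<le> ennreal (real R)"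
      proof -
        obtain s where s: "F x = ennreal s" "0 \<le> s" using Ffin by (cases "F x") auto
        have "\<forall>\<^sub>F R in sequentially. s \<le> real R"
          using filterlim_real_sequentially by (simp add: filterlim_at_top)
        then show ?thesis by (rule eventually_mono) (simp add: s ennreal_leI)
      qed
      ultimately have "\<forall>\<^sub>F R in sequentially. m x + ennreal (1 / real (Suc R)) < F x \<and> F x \<le> ennreal (real R)"
        by (rule eventually_conj)
      then obtain R where R: "m x + ennreal (1 / real (Suc R)) < F x" "F x \<le> ennreal (real R)"
        using eventually_happens'[OF sequentially_bot] by blast
      have "(\<lambda>n. G n x + ennreal (1 / real (Suc R))) \<longlonglongrightarrow> m x + ennreal (1 / real (Suc R))"
        by (intro tendsto_add lim tendsto_const)
      then have "\<forall>\<^sub>F n in sequentially. G n x + ennreal (1 / real (Suc R)) < F x"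
        using R(1) by (rule order_tendstoD)
      then obtain n where "G n x + ennreal (1 / real (Suc R)) < F x"
        using eventually_happens'[OF sequentially_bot] by blast
      with R(2) have "x \<in> A n R" by (simp add: A_def less_imp_le)
      with elim(1) show False by blast
    qed
  qed
  note snd_eq = distr_joint_snd[OF \<mu> K, folded \<nu>_def]
  show ?thesis
  proof (rule cournot_nashI[OF joint_coupling[OF \<mu> K] T(1)], unfold snd_eq)
    show "Phi c L H x (T x) \<nu> \<le> Phi c L H x y \<nu>" for x y by (rule T(2))
    have "(\<integral>\<^sup>+p. \<Phi> \<nu> p \<partial>joint \<mu> K) = (\<integral>\<^sup>+x. F x \<partial>\<mu>)"
      unfolding F_def by (subst nn_integral_joint[OF \<mu> K Phi_measurable[OF \<nu>]]) simp
    also have "\<dots> \<le> (\<integral>\<^sup>+x. m x \<partial>\<mu>)" by (rule nn_integral_mono_AE[OF F_le_m])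
    finally show "(\<integral>\<^sup>+p. \<Phi> \<nu> p \<partial>joint \<mu> K) \<le> (\<integral>\<^sup>+x. Phi c L H x (T x) \<nu> \<partial>\<mu>)" unfolding m_def .
    have "(\<integral>\<^sup>+x. m x \<partial>\<mu>) \<le> (\<integral>\<^sup>+x. F x \<partial>\<mu>)" by (intro nn_integral_mono m_le_F)
    then show "(\<integral>\<^sup>+x. Phi c L H x (T x) \<nu> \<partial>\<mu>) < \<infinity>" unfolding m_def using F_fin by (rule le_less_trans)
  qed
qed

end

section \<open>Averaged profiles of the finite game\<close>

lemma inverse_of_nat_cancel:
  assumes "1 \<le> N"
  shows "inverse (of_nat N) * (of_nat N * a) = (a :: ennreal)"
proof -
  have "inverse (of_nat N) * (of_nat N :: ennreal) = ennreal (inverse (real N) * real N)"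
    using assms by (simp add: ennreal_of_nat_eq_real_of_nat inverse_ennreal ennreal_mult[symmetric])
  also have "\<dots> = 1" using assms by simp
  finally show ?thesis by (simp add: mult.assoc[symmetric])
qed

lemma inverse_of_nat_square:
  assumes "1 \<le> N"
  shows "1 / (of_nat N)\<^sup>2 = inverse (of_nat N) * (inverse (of_nat N) :: ennreal)"
proof -
  have "1 / (of_nat N)\<^sup>2 = ennreal 1 / ennreal ((real N)\<^sup>2)"
    by (simp add: ennreal_of_nat_eq_real_of_nat ennreal_power)
  also have "\<dots> = ennreal (1 / (real N)\<^sup>2)" using assms by (intro divide_ennreal) auto
  also have "1 / (real N)\<^sup>2 = inverse (real N) * inverse (real N)" by (simp add: power2_eq_square divide_inverse)
  also have "ennreal \<dots> = inverse (of_nat N) * (inverse (of_nat N) :: ennreal)"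
    using assms by (simp add: ennreal_of_nat_eq_real_of_nat inverse_ennreal ennreal_mult)
  finally show ?thesis .
qed

lemma interaction_le_bound:
  fixes H :: "'y::second_countable_topology \<times> 'y \<Rightarrow> ennreal"
  assumes "\<nu> \<in> borel_probs" "\<nu>' \<in> borel_probs" "H \<in> borel_measurable borel" and b: "\<And>p. H p \<le> b"
  shows "interaction H \<nu> \<nu>' \<le> b"
proof -
  have "interaction H \<nu> \<nu>' \<le> (\<integral>\<^sup>+y. \<integral>\<^sup>+y'. b \<partial>\<nu>' \<partial>\<nu>)"
    unfolding interaction_fst[OF assms(1-3)] by (intro nn_integral_mono b)
  then show ?thesis
    using prob_space.emeasure_space_1[OF borel_probsD(1)[OF assms(1)]]
      prob_space.emeasure_space_1[OF borel_probsD(1)[OF assms(2)]] by simp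
qed

lemma
  fixes K :: "nat \<Rightarrow> 'x::second_countable_topology \<Rightarrow> 'y::second_countable_topology measure"
  assumes \<mu>: "\<mu> \<in> borel_probs" and N: "1 \<le> N" and K: "\<And>i. measurable_family (K i)"
  shows nn_integral_mean_law_average: "f \<in> borel_measurable borel \<Longrightarrow>
      (\<integral>\<^sup>+y. f y \<partial>mean_law \<mu> (\<lambda>x. average N (\<lambda>i. K i x))) = inverse (of_nat N) * (\<Sum>i<N. \<integral>\<^sup>+y. f y \<partial>mean_law \<mu> (K i))"
    and interaction_average_left: "\<rho> \<in> borel_probs \<Longrightarrow> H \<in> borel_measurable borel \<Longrightarrow>
      interaction H (mean_law \<mu> (\<lambda>x. average N (\<lambda>i. K i x))) \<rho> = inverse (of_nat N) * (\<Sum>i<N. interaction H (mean_law \<mu> (K i)) \<rho>)"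
    and interaction_average_right: "\<rho> \<in> borel_probs \<Longrightarrow> H \<in> borel_measurable borel \<Longrightarrow>
      interaction H \<rho> (mean_law \<mu> (\<lambda>x. average N (\<lambda>i. K i x))) = inverse (of_nat N) * (\<Sum>i<N. interaction H \<rho> (mean_law \<mu> (K i)))"
proof -
  have P: "K i x \<in> borel_probs" for i x using K by (simp add: measurable_family_def)
  note avg = measurable_family_average[OF N K]
  note m = mean_law_prob[OF \<mu> avg] and mi = mean_law_prob[OF \<mu> K]
  have int: "(\<integral>\<^sup>+y. f y \<partial>mean_law \<mu> (\<lambda>x. average N (\<lambda>i. K i x))) = inverse (of_nat N) * (\<Sum>i<N. \<integral>\<^sup>+y. f y \<partial>mean_law \<mu> (K i))"
    if f: "f \<in> borel_measurable borel" for f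
  proof -
    have [measurable]: "(\<lambda>x. \<integral>\<^sup>+y. f y \<partial>K i x) \<in> borel_measurable \<mu>" for i
      unfolding measurable_cong_sets[OF borel_probsD(2)[OF \<mu>] refl]
      using measurable_compose[OF measurable_family_kernel[OF K] nn_integral_measurable_subprob_algebra[OF f]] .
    have "(\<integral>\<^sup>+y. f y \<partial>mean_law \<mu> (\<lambda>x. average N (\<lambda>i. K i x))) = (\<integral>\<^sup>+x. inverse (of_nat N) * (\<Sum>i<N. \<integral>\<^sup>+y. f y \<partial>K i x) \<partial>\<mu>)"
      unfolding nn_integral_mean_law[OF \<mu> avg f]
      by (rule nn_integral_cong) (rule nn_integral_average[OF N P f])
    also have "\<dots> = inverse (of_nat N) * (\<Sum>i<N. \<integral>\<^sup>+x. \<integral>\<^sup>+y. f y \<partial>K i x \<partial>\<mu>)"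
      by (subst nn_integral_cmult) (simp_all add: nn_integral_sum)
    finally show ?thesis by (simp only: nn_integral_mean_law[OF \<mu> K f])
  qed
  then show "f \<in> borel_measurable borel \<Longrightarrow>
      (\<integral>\<^sup>+y. f y \<partial>mean_law \<mu> (\<lambda>x. average N (\<lambda>i. K i x))) = inverse (of_nat N) * (\<Sum>i<N. \<integral>\<^sup>+y. f y \<partial>mean_law \<mu> (K i))" .
  assume \<rho>: "\<rho> \<in> borel_probs" and H: "H \<in> borel_measurable borel"
  show "interaction H (mean_law \<mu> (\<lambda>x. average N (\<lambda>i. K i x))) \<rho> = inverse (of_nat N) * (\<Sum>i<N. interaction H (mean_law \<mu> (K i)) \<rho>)"
    unfolding interaction_fst[OF m \<rho> H] interaction_fst[OF mi \<rho> H]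
    by (rule int[OF measurable_nn_integral_const[OF H \<rho>]])
  show "interaction H \<rho> (mean_law \<mu> (\<lambda>x. average N (\<lambda>i. K i x))) = inverse (of_nat N) * (\<Sum>i<N. interaction H \<rho> (mean_law \<mu> (K i)))"
    unfolding interaction_snd[OF \<rho> m H] interaction_snd[OF \<rho> mi H]
    by (rule int[OF measurable_nn_integral_const_fst[OF H \<rho>]])
qed

text \<open>
  The interaction of the average contains the \<open>N\<close> diagonal terms that the game omits;
  each is at most \<open>b\<close> and has weight \<open>1 / N\<^sup>2\<close>.
\<close>

lemma interaction_average_le:
  fixes K :: "nat \<Rightarrow> 'x::second_countable_topology \<Rightarrow> 'y::second_countable_topology measure"
  assumes \<mu>: "\<mu> \<in> borel_probs" and N: "1 \<le> N" and K: "\<And>i. measurable_family (K i)"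
    and H: "H \<in> borel_measurable borel" and b: "\<And>p. H p \<le> ennreal b"
  shows "interaction H (mean_law \<mu> (\<lambda>x. average N (\<lambda>i. K i x))) (mean_law \<mu> (\<lambda>x. average N (\<lambda>i. K i x))) \<le>
    1 / (of_nat N)\<^sup>2 * (\<Sum>i<N. \<Sum>j\<in>{..<N} - {i}. interaction H (mean_law \<mu> (K i)) (mean_law \<mu> (K j)))
    + inverse (of_nat N) * ennreal b"
proof -
  let ?w = "inverse (of_nat N) :: ennreal" and ?I = "\<lambda>i j. interaction H (mean_law \<mu> (K i)) (mean_law \<mu> (K j))"
  note avg = measurable_family_average[OF N K]
  note m = mean_law_prob[OF \<mu> avg] and mi = mean_law_prob[OF \<mu> K]
  have "interaction H (mean_law \<mu> (\<lambda>x. average N (\<lambda>i. K i x))) (mean_law \<mu> (\<lambda>x. average N (\<lambda>i. K i x))) =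
      ?w * (\<Sum>i<N. ?w * (\<Sum>j<N. ?I i j))"
    by (simp only: interaction_average_left[OF \<mu> N K m H] interaction_average_right[OF \<mu> N K mi H])
  also have "\<dots> \<le> ?w * (\<Sum>i<N. ?w * ((\<Sum>j\<in>{..<N} - {i}. ?I i j) + ennreal b))"
  proof (intro mult_left_mono sum_mono)
    fix i assume "i \<in> {..<N}"
    then have "(\<Sum>j<N. ?I i j) = ?I i i + (\<Sum>j\<in>{..<N} - {i}. ?I i j)" by (intro sum.remove) auto
    also have "\<dots> \<le> ennreal b + (\<Sum>j\<in>{..<N} - {i}. ?I i j)"
      by (intro add_right_mono interaction_le_bound mi H b)
    finally show "(\<Sum>j<N. ?I i j) \<le> (\<Sum>j\<in>{..<N} - {i}. ?I i j) + ennreal b" by (simp add: add.commute)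
  qed simp_all
  also have "\<dots> = ?w * ?w * (\<Sum>i<N. \<Sum>j\<in>{..<N} - {i}. ?I i j) + ?w * (?w * (of_nat N * ennreal b))"
    by (simp add: sum_distrib_left[symmetric] sum.distrib distrib_left mult.assoc mult.left_commute)
  also have "?w * (of_nat N * ennreal b) = ennreal b" by (rule inverse_of_nat_cancel[OF N])
  finally show ?thesis by (simp only: inverse_of_nat_square[OF N])
qed

context costs
begin

lemma state_cost_average:
  assumes N: "1 \<le> N" and K: "\<And>i. measurable_family (K i)"
  shows "state_cost c L \<mu> (\<lambda>x. average N (\<lambda>i. K i x)) = inverse (of_nat N) * (\<Sum>i<N. state_cost c L \<mu> (K i))"
proof -
  have P: "K i x \<in> borel_probs" for i x using K by (simp add: measurable_family_def)
  have [measurable]: "(\<lambda>x. (\<integral>\<^sup>+y. c (x, y) \<partial>K i x) + (\<integral>\<^sup>+y. L y \<partial>K i x)) \<in> borel_measurable \<mu>" for i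
    by (rule \<mu>_meas[OF state_measurable[OF K]])
  have "state_cost c L \<mu> (\<lambda>x. average N (\<lambda>i. K i x)) =
      (\<integral>\<^sup>+x. inverse (of_nat N) * (\<Sum>i<N. (\<integral>\<^sup>+y. c (x, y) \<partial>K i x) + (\<integral>\<^sup>+y. L y \<partial>K i x)) \<partial>\<mu>)"
    unfolding state_cost_def nn_integral_average[OF N P measurable_Pair_borel(1)[OF c_meas]] nn_integral_average[OF N P L_meas]
    by (simp only: sum.distrib distrib_left)
  also have "\<dots> = inverse (of_nat N) * (\<Sum>i<N. state_cost c L \<mu> (K i))"
    unfolding state_cost_def by (subst nn_integral_cmult) (simp_all add: nn_integral_sum del: nn_integral_add)
  finally show ?thesis .
qed

text \<open>
  All three parts of the cost are lower semicontinuous along the representation.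
\<close>

lemma limit_cost_le:
  fixes \<Omega> :: "'a measure"
  assumes sk: "skorokhod \<Omega> z z\<^sub>0" and K: "\<And>k. measurable_family (K k)"
    and law: "\<And>k. distr \<Omega> borel (z k) = joint \<mu> (K k)" and H': "lower_semicontinuous H'"
    and le: "\<And>k. state_cost c L \<mu> (K k) + interaction H' (mean_law \<mu> (K k)) (mean_law \<mu> (K k)) \<le> D k"
    and D: "D \<longlonglongrightarrow> d"
  shows "(\<integral>\<^sup>+p. c p \<partial>distr \<Omega> borel z\<^sub>0) + (\<integral>\<^sup>+y. L y \<partial>distr (distr \<Omega> borel z\<^sub>0) borel snd)
    + interaction H' (distr (distr \<Omega> borel z\<^sub>0) borel snd) (distr (distr \<Omega> borel z\<^sub>0) borel snd) \<le> d"
proof -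
  interpret skorokhod \<Omega> z z\<^sub>0 by (rule sk)
  have H'm: "H' \<in> borel_measurable borel" using H' by (rule lower_semicontinuous_borel)
  \<comment> \<open>The interaction of second marginals, read as an interaction between points of
  the product, is accessible to the representation \<open>z\<close>.\<close>
  define G where "G w = H' (snd (fst w), snd (snd w))" for w :: "('x \<times> 'y) \<times> ('x \<times> 'y)"
  have G: "lower_semicontinuous G"
    unfolding lower_semicontinuous_def
  proof
    fix t
    have "open ((\<lambda>w :: ('x \<times> 'y) \<times> ('x \<times> 'y). (snd (fst w), snd (snd w))) -` {p. t < H' p})"
      using H' by (intro open_vimage) (auto simp: lower_semicontinuous_def intro!: continuous_intros)
    then show "open {w. t < G w}" by (simp add: G_def vimage_def)
  qed
  have Gm: "G \<in> borel_measurable borel" using G by (rule lower_semicontinuous_borel)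
  have Lsnd: "lower_semicontinuous (\<lambda>p :: 'x \<times> 'y. L (snd p))"
    unfolding lower_semicontinuous_def
  proof
    fix t
    have "open ((snd :: 'x \<times> 'y \<Rightarrow> 'y) -` {y. t < L y})"
      using L_lsc by (intro open_vimage) (auto simp: lower_semicontinuous_def intro!: continuous_intros)
    then show "open {p :: 'x \<times> 'y. t < L (snd p)}" by (simp add: vimage_def)
  qed
  have G_distr: "interaction G \<gamma> \<gamma> = interaction H' (distr \<gamma> borel snd) (distr \<gamma> borel snd)"
    and L_distr: "(\<integral>\<^sup>+y. L y \<partial>distr \<gamma> borel snd) = (\<integral>\<^sup>+p. L (snd p) \<partial>\<gamma>)"
    if \<gamma>: "\<gamma> \<in> borel_probs" for \<gamma> :: "('x \<times> 'y) measure"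
  proof -
    have snd: "snd \<in> \<gamma> \<rightarrow>\<^sub>M borel"
      unfolding measurable_cong_sets[OF borel_probsD(2)[OF \<gamma>] refl] by (simp add: borel_prod[symmetric])
    have \<nu>: "distr \<gamma> borel snd \<in> borel_probs"
      unfolding borel_probs_def using prob_space.prob_space_distr[OF borel_probsD(1)[OF \<gamma>] snd] by simp
    show "(\<integral>\<^sup>+y. L y \<partial>distr \<gamma> borel snd) = (\<integral>\<^sup>+p. L (snd p) \<partial>\<gamma>)"
      by (rule nn_integral_distr[OF snd]) (simp add: L_meas)
    have "interaction H' (distr \<gamma> borel snd) (distr \<gamma> borel snd) =
        (\<integral>\<^sup>+p. \<integral>\<^sup>+y'. H' (snd p, y') \<partial>distr \<gamma> borel snd \<partial>\<gamma>)"
      unfolding interaction_fst[OF \<nu> \<nu> H'm]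
      by (rule nn_integral_distr[OF snd]) (simp add: measurable_nn_integral_const[OF H'm \<nu>])
    also have "\<dots> = (\<integral>\<^sup>+p. \<integral>\<^sup>+q. H' (snd p, snd q) \<partial>\<gamma> \<partial>\<gamma>)"
      by (intro nn_integral_cong nn_integral_distr[OF snd]) (simp add: measurable_Pair_borel(1)[OF H'm])
    also have "\<dots> = interaction G \<gamma> \<gamma>"
      unfolding interaction_fst[OF \<gamma> \<gamma> Gm] by (simp add: G_def)
    finally show "interaction G \<gamma> \<gamma> = interaction H' (distr \<gamma> borel snd) (distr \<gamma> borel snd)" by (rule sym)
  qed
  define a where "a k = (\<integral>\<^sup>+p. c p \<partial>distr \<Omega> borel (z k))" for k
  define l where "l k = (\<integral>\<^sup>+p. L (snd p) \<partial>distr \<Omega> borel (z k))" for k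
  define g where "g k = interaction G (distr \<Omega> borel (z k)) (distr \<Omega> borel (z k))" for k
  have sum_le: "a k + l k + g k \<le> D k" for k
  proof -
    have JP: "joint \<mu> (K k) \<in> borel_probs" using joint_coupling[OF \<mu> K] by (simp add: couplings_of_def)
    have m: "(\<lambda>x. \<integral>\<^sup>+y. c (x, y) \<partial>K k x) \<in> borel_measurable \<mu>" "(\<lambda>x. \<integral>\<^sup>+y. L y \<partial>K k x) \<in> borel_measurable \<mu>"
      by (rule \<mu>_meas, rule measurable_nn_integral_kernel[OF c_meas K])
         (rule \<mu>_meas, rule measurable_compose[OF measurable_family_kernel[OF K] nn_integral_measurable_subprob_algebra[OF L_meas]])
    have "a k + l k = state_cost c L \<mu> (K k)"
      unfolding a_def l_def law state_cost_def nn_integral_add[OF m] nn_integral_joint[OF \<mu> K c_meas]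
        nn_integral_joint[OF \<mu> K lower_semicontinuous_borel[OF Lsnd]] by simp
    moreover have "g k = interaction H' (mean_law \<mu> (K k)) (mean_law \<mu> (K k))"
      unfolding g_def law G_distr[OF JP] distr_joint_snd[OF \<mu> K] ..
    ultimately show ?thesis using le by simp
  qed
  have "(\<integral>\<^sup>+p. c p \<partial>distr \<Omega> borel z\<^sub>0) + (\<integral>\<^sup>+p. L (snd p) \<partial>distr \<Omega> borel z\<^sub>0)
      + interaction G (distr \<Omega> borel z\<^sub>0) (distr \<Omega> borel z\<^sub>0) \<le> liminf a + liminf l + liminf g"
    unfolding a_def l_def g_def
    by (intro add_mono nn_integral_le_liminf c_lsc Lsnd interaction_le_liminf G)
  also have "\<dots> \<le> liminf (\<lambda>k. a k + l k) + liminf g" by (intro add_right_mono liminf_add_le)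
  also have "\<dots> \<le> liminf (\<lambda>k. a k + l k + g k)" by (rule liminf_add_le)
  also have "\<dots> \<le> liminf D" by (intro Liminf_mono always_eventually allI sum_le)
  also have "\<dots> = d" by (rule lim_imp_Liminf[OF sequentially_bot D])
  finally show ?thesis by (simp only: G_distr[OF law_probs(2)] L_distr[OF law_probs(2)])
qed

end

locale game = iid_types M \<mu> X + costs c L H \<mu>
  for M :: "'w measure" and \<mu> :: "'x::{complete_space, second_countable_topology} measure"
    and X :: "nat \<Rightarrow> 'w \<Rightarrow> 'x" and c :: "'x \<times> 'y::{complete_space, second_countable_topology} \<Rightarrow> ennreal"
    and L :: "'y \<Rightarrow> ennreal" and H :: "'y \<times> 'y \<Rightarrow> ennreal"
begin

lemma strategy: "measurable_family K \<Longrightarrow> (\<lambda>\<omega>. K (X i \<omega>)) \<in> strategies X i"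
  unfolding strategies_def by blast

text \<open>
  The default kernel for indices beyond the players makes statements about sequences of kernels
  applicable.
\<close>

lemma strategies_families:
  fixes s :: "nat \<Rightarrow> 'w \<Rightarrow> 'y measure" and K\<^sub>0 :: "'x \<Rightarrow> 'y measure"
  assumes s: "\<And>i. i < N \<Longrightarrow> s i \<in> strategies X i" and K\<^sub>0: "measurable_family K\<^sub>0"
  obtains K :: "nat \<Rightarrow> 'x \<Rightarrow> 'y measure"
  where "\<And>i. measurable_family (K i)" "\<And>i. i < N \<Longrightarrow> s i = (\<lambda>\<omega>. K i (X i \<omega>))"
proof -
  have "\<exists>K :: 'x \<Rightarrow> 'y measure. measurable_family K \<and> (i < N \<longrightarrow> s i = (\<lambda>\<omega>. K (X i \<omega>)))" (is "\<exists>K. ?P i K") for i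
  proof (cases "i < N")
    case True
    then show ?thesis using s[OF True] unfolding strategies_def by blast
  next
    case False
    then show ?thesis using K\<^sub>0 by (intro exI[of _ K\<^sub>0] conjI impI) simp_all
  qed
  then have "\<forall>i. \<exists>K. ?P i K" by (rule allI)
  then have "\<exists>K. \<forall>i. ?P i (K i)" by (rule choice)
  then obtain K where "\<forall>i. ?P i (K i)" by (rule exE)
  then show ?thesis by (intro that[of K]) simp_all
qed

lemma empirical_cong:
  assumes "\<And>i. i < N \<Longrightarrow> s i = s' i"
  shows "empirical X N s = empirical X N s'"
  unfolding empirical_def using assms by simp

text \<open>
  The expected potential of a profile, in terms of its kernels.
\<close>

abbreviation profile_cost :: "nat \<Rightarrow> (nat \<Rightarrow> 'x \<Rightarrow> 'y measure) \<Rightarrow> ennreal" where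
  "profile_cost N K \<equiv> inverse (of_nat N) * (\<Sum>i<N. state_cost c L \<mu> (K i)) +
     1 / (of_nat N)\<^sup>2 * (\<Sum>i<N. \<Sum>j\<in>{..<N} - {i}. interaction H (mean_law \<mu> (K i)) (mean_law \<mu> (K j)))"

text \<open>
  If all players use the same kernel, the potential differs from the mean-field cost only by the
  missing diagonal terms.
\<close>

lemma potential_le_total_cost:
  assumes N: "1 \<le> N" and K: "measurable_family K"
  shows "potential c L H M X N (empirical X N (\<lambda>j \<omega>. K (X j \<omega>))) \<le> total_cost K"
proof -
  let ?s = "\<lambda>(j :: nat) \<omega>. K (X j \<omega>)"
  let ?I = "interaction H (mean_law \<mu> K) (mean_law \<mu> K)"
  have rep: "represents M X N ?s (empirical X N ?s)"
    unfolding represents_def by (simp add: strategy[OF K])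
  have "empirical X N ?s \<in> empirical_random_probs M X N"
    unfolding empirical_random_probs_def using empirical_random_prob[where K = "\<lambda>_. K", OF K N] rep by blast
  then have "potential c L H M X N (empirical X N ?s) \<le>
      (\<integral>\<^sup>+\<omega>. ((\<integral>\<^sup>+p. c p \<partial>empirical X N ?s \<omega>) + 1 / of_nat N * (\<Sum>i<N. \<integral>\<^sup>+y. L y \<partial>?s i \<omega>)
          + 1 / (of_nat N)\<^sup>2 * (\<Sum>i<N. \<Sum>j\<in>{..<N} - {i}. interaction H (?s i \<omega>) (?s j \<omega>))) \<partial>M)"
    unfolding potential_def using rep by (auto intro!: INF_lower2[of ?s])
  also have "\<dots> = profile_cost N (\<lambda>_. K)"
    by (rule potential_integral_eq[where K = "\<lambda>_. K", OF c_meas L_meas H_meas K _ N]) simp_all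
  also have "\<dots> \<le> total_cost K"
  proof (rule add_mono)
    show "inverse (of_nat N) * (\<Sum>i<N. state_cost c L \<mu> K) \<le> state_cost c L \<mu> K"
      using inverse_of_nat_cancel[OF N] by simp
    have "(\<Sum>i<N. \<Sum>j\<in>{..<N} - {i}. ?I) \<le> (\<Sum>i<N. \<Sum>j<N. ?I)"
      by (intro sum_mono sum_mono2) auto
    then have "1 / (of_nat N)\<^sup>2 * (\<Sum>i<N. \<Sum>j\<in>{..<N} - {i}. ?I) \<le> 1 / (of_nat N)\<^sup>2 * (\<Sum>i<N. \<Sum>j<N. ?I)"
      by (rule mult_left_mono) simp
    also have "\<dots> = inverse (of_nat N) * (of_nat N * (inverse (of_nat N) * (of_nat N * ?I)))"
      unfolding inverse_of_nat_square[OF N] by (simp add: ac_simps)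
    also have "\<dots> = ?I" by (simp only: inverse_of_nat_cancel[OF N])
    finally show "1 / (of_nat N)\<^sup>2 * (\<Sum>i<N. \<Sum>j\<in>{..<N} - {i}. ?I) \<le> ?I" .
  qed
  finally show ?thesis .
qed

text \<open>
  The potential is an infimum over the profiles that represent a random measure. A minimizer of
  the potential thus comes with a profile that is optimal up to \<open>1 / N\<close>, and this
  suffices in the limit.
\<close>

lemma minimizer_profile:
  assumes N: "1 \<le> N" and \<Gamma>: "potential_minimizer c L H M X N \<Gamma>"
    and K\<^sub>0: "measurable_family K\<^sub>0" "total_cost K\<^sub>0 < \<infinity>"
  obtains K where "\<And>i. measurable_family (K i)" "AE \<omega> in M. \<Gamma> \<omega> = empirical X N (\<lambda>j \<omega>. K j (X j \<omega>)) \<omega>"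
    "\<And>J. measurable_family J \<Longrightarrow> profile_cost N K \<le> total_cost J + inverse (of_nat N)"
proof -
  have pot_le: "potential c L H M X N \<Gamma> \<le> total_cost J" if J: "measurable_family J" for J
  proof -
    have "potential c L H M X N \<Gamma> \<le> potential c L H M X N (empirical X N (\<lambda>j \<omega>. J (X j \<omega>)))"
      using \<Gamma> empirical_random_prob[where K = "\<lambda>_. J", OF J N] unfolding potential_minimizer_def by blast
    also have "\<dots> \<le> total_cost J" by (rule potential_le_total_cost[OF N J])
    finally show ?thesis .
  qed
  then have fin: "potential c L H M X N \<Gamma> < \<infinity>" using K\<^sub>0 by (blast intro: le_less_trans)
  then have \<Gamma>': "\<Gamma> \<in> empirical_random_probs M X N" unfolding potential_def by (auto split: if_splits)
  let ?V = "\<lambda>s. \<integral>\<^sup>+\<omega>. ((\<integral>\<^sup>+p. c p \<partial>\<Gamma> \<omega>) + 1 / of_nat N * (\<Sum>i<N. \<integral>\<^sup>+y. L y \<partial>s i \<omega>)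
          + 1 / (of_nat N)\<^sup>2 * (\<Sum>i<N. \<Sum>j\<in>{..<N} - {i}. interaction H (s i \<omega>) (s j \<omega>))) \<partial>M"
  have pot: "potential c L H M X N \<Gamma> = (INF s\<in>{s. represents M X N s \<Gamma>}. ?V s)"
    unfolding potential_def using \<Gamma>' by simp
  have "potential c L H M X N \<Gamma> < potential c L H M X N \<Gamma> + inverse (of_nat N)"
    using fin N by (cases "potential c L H M X N \<Gamma>")
      (simp_all add: ennreal_of_nat_eq_real_of_nat inverse_ennreal ennreal_plus[symmetric] ennreal_less_iff del: ennreal_plus)
  then obtain s where s: "represents M X N s \<Gamma>" "?V s < potential c L H M X N \<Gamma> + inverse (of_nat N)"
    unfolding pot by (auto simp: INF_less_iff)
  obtain K where K: "\<And>i. measurable_family (K i)" "\<And>i. i < N \<Longrightarrow> s i = (\<lambda>\<omega>. K i (X i \<omega>))"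
    using strategies_families[of N s, OF _ K\<^sub>0(1)] s(1) unfolding represents_def by blast
  let ?s = "\<lambda>j \<omega>. K j (X j \<omega>)"
  have AE: "AE \<omega> in M. \<Gamma> \<omega> = empirical X N ?s \<omega>"
    using s(1) empirical_cong[of N s ?s, OF K(2)] unfolding represents_def by simp
  have "?V s = ?V ?s"
    by (intro nn_integral_cong arg_cong2[where f = "(+)"] arg_cong2[where f = "(*)"] refl sum.cong) (simp_all add: K(2))
  also have "\<dots> = profile_cost N K"
    by (rule potential_integral_eq[OF c_meas L_meas H_meas K(1) refl N AE])
  finally have V: "?V s = profile_cost N K" .
  show ?thesis
  proof (rule that[OF K(1) AE])
    fix J :: "'x \<Rightarrow> 'y measure" assume "measurable_family J"
    have "profile_cost N K \<le> potential c L H M X N \<Gamma> + inverse (of_nat N)"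
      using s(2) unfolding V by (rule less_imp_le)
    also have "\<dots> \<le> total_cost J + inverse (of_nat N)" by (intro add_right_mono pot_le) fact
    finally show "profile_cost N K \<le> total_cost J + inverse (of_nat N)" .
  qed
qed

end

section \<open>Limits of profiles\<close>

context skorokhod
begin

text \<open>
  Integrating a bounded continuous \<open>H\<close> against the fixed \<open>\<rho>\<close> gives
  a bounded sequentially continuous function of the other argument.
\<close>

lemma interaction_tendsto:
  fixes H :: "'z \<times> 'z \<Rightarrow> ennreal"
  assumes H: "continuous_on UNIV H" and b: "\<And>p. H p \<le> ennreal b" and \<rho>: "\<rho> \<in> borel_probs"
  shows "(\<lambda>n. interaction H \<rho> (distr \<Omega> borel (z n))) \<longlonglongrightarrow> interaction H \<rho> (distr \<Omega> borel z\<^sub>0)"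
proof -
  interpret \<rho>: prob_space \<rho> by (rule borel_probsD[OF \<rho>])
  have Hm: "H \<in> borel_measurable borel" using H by (rule borel_measurable_continuous_onI)
  have Hm': "(\<lambda>y. H (y, y')) \<in> borel_measurable \<rho>" for y'
    unfolding measurable_cong_sets[OF borel_probsD(2)[OF \<rho>] refl] by (rule measurable_Pair_borel(2)[OF Hm])
  define h where "h y' = (\<integral>\<^sup>+y. H (y, y') \<partial>\<rho>)" for y'
  have h_meas [measurable]: "h \<in> borel_measurable borel"
    unfolding h_def by (rule measurable_nn_integral_const_fst[OF Hm \<rho>])
  have h_b: "h y' \<le> ennreal b" for y'
  proof -
    have "h y' \<le> (\<integral>\<^sup>+y. ennreal b \<partial>\<rho>)" unfolding h_def by (intro nn_integral_mono b)
    then show ?thesis by (simp add: \<rho>.emeasure_space_1)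
  qed
  have h_lim: "(\<lambda>n. h (w n)) \<longlonglongrightarrow> h w\<^sub>0" if w: "w \<longlonglongrightarrow> w\<^sub>0" for w w\<^sub>0
    unfolding h_def
  proof (rule nn_integral_dominated_convergence[where w = "\<lambda>_. ennreal b"])
    show "AE y in \<rho>. (\<lambda>n. H (y, w n)) \<longlonglongrightarrow> H (y, w\<^sub>0)"
      by (intro AE_I2 continuous_on_tendsto_compose[OF H] tendsto_Pair tendsto_const w) simp_all
  qed (simp_all add: Hm' b \<rho>.emeasure_space_1)
  have "(\<lambda>n. \<integral>\<^sup>+\<omega>. h (z n \<omega>) \<partial>\<Omega>) \<longlonglongrightarrow> (\<integral>\<^sup>+\<omega>. h (z\<^sub>0 \<omega>) \<partial>\<Omega>)"
  proof (rule nn_integral_dominated_convergence[where w = "\<lambda>_. ennreal b"])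
    show "AE \<omega> in \<Omega>. (\<lambda>n. h (z n \<omega>)) \<longlonglongrightarrow> h (z\<^sub>0 \<omega>)"
      using z_lim by (rule eventually_mono) (rule h_lim)
  qed (simp_all add: h_b emeasure_space_1)
  moreover have "interaction H \<rho> (distr \<Omega> borel u) = (\<integral>\<^sup>+\<omega>. h (u \<omega>) \<partial>\<Omega>)" if u: "u \<in> borel_measurable \<Omega>" for u
  proof -
    have "distr \<Omega> borel u \<in> borel_probs" using u by (simp add: borel_probs_def prob_space_distr)
    from interaction_snd[OF \<rho> this Hm]
    have "interaction H \<rho> (distr \<Omega> borel u) = (\<integral>\<^sup>+y'. h y' \<partial>distr \<Omega> borel u)" by (simp only: h_def)
    also have "\<dots> = (\<integral>\<^sup>+\<omega>. h (u \<omega>) \<partial>\<Omega>)" by (rule nn_integral_distr[OF u]) (simp add: h_meas)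
    finally show ?thesis .
  qed
  ultimately show ?thesis by simp
qed

lemma skorokhod_continuous_image:
  fixes f :: "'z \<Rightarrow> 'y::{metric_space, second_countable_topology}"
  assumes f: "continuous_on UNIV f"
  shows "skorokhod \<Omega> (\<lambda>n \<omega>. f (z n \<omega>)) (\<lambda>\<omega>. f (z\<^sub>0 \<omega>))"
proof -
  have [measurable]: "f \<in> borel_measurable borel" using f by (rule borel_measurable_continuous_onI)
  show ?thesis
  proof (unfold_locales)
    show "AE \<omega> in \<Omega>. (\<lambda>n. f (z n \<omega>)) \<longlonglongrightarrow> f (z\<^sub>0 \<omega>)"
      using z_lim by (rule eventually_mono) (rule continuous_on_tendsto_compose[OF f], simp_all)
  qed measurable
qed

end

context game
begin

text \<open>
  A bound on the costs makes the laws built from the averaged kernels tight. Along a subsequence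
  they converge, and if it is sparse enough the random empirical measures almost surely follow
  their deterministic means.
\<close>

lemma convergent_subsequence:
  fixes K :: "nat \<Rightarrow> nat \<Rightarrow> 'x \<Rightarrow> 'y measure"
  assumes K: "\<And>N i. measurable_family (K N i)" and B: "0 \<le> B"
    and bound: "\<And>N. 1 \<le> N \<Longrightarrow> state_cost c L \<mu> (\<lambda>x. average N (\<lambda>i. K N i x)) \<le> ennreal B"
  obtains r \<gamma> and \<Omega> :: "real measure" and z z\<^sub>0
  where "strict_mono r" "\<And>k. Suc k \<le> r k" "\<gamma> \<in> couplings_of \<mu>"
    "AE \<omega> in M. \<forall>f::'x \<times> 'y \<Rightarrow> real. continuous_on UNIV f \<longrightarrow> bounded (range f) \<longrightarrow>
      (\<lambda>k. \<integral>p. f p \<partial>empirical X (r k) (\<lambda>j \<omega>. K (r k) j (X j \<omega>)) \<omega>) \<longlonglongrightarrow> (\<integral>p. f p \<partial>\<gamma>)"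
    "skorokhod \<Omega> z z\<^sub>0" "\<And>k. distr \<Omega> borel (z k) = joint \<mu> (\<lambda>x. average (r k) (\<lambda>i. K (r k) i x))"
    "distr \<Omega> borel z\<^sub>0 = \<gamma>"
proof -
  define A where "A n x = average (Suc n) (\<lambda>i. K (Suc n) i x)" for n x
  have A: "measurable_family (A n)" for n
    unfolding A_def by (rule measurable_family_average[OF _ K]) simp
  have J: "joint \<mu> (A n) \<in> borel_probs" for n using joint_coupling[OF \<mu> A] by (simp add: couplings_of_def)
  have L_bound: "(\<integral>\<^sup>+x. \<integral>\<^sup>+y. L y \<partial>A n x \<partial>\<mu>) \<le> ennreal B" for n
  proof -
    have "(\<integral>\<^sup>+x. \<integral>\<^sup>+y. L y \<partial>A n x \<partial>\<mu>) \<le> state_cost c L \<mu> (A n)"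
      unfolding state_cost_def by (intro nn_integral_mono) simp
    also have "\<dots> \<le> ennreal B" using bound[of "Suc n"] by (simp add: A_def[abs_def])
    finally show ?thesis .
  qed
  have tight: "\<exists>T. compact T \<and> (\<forall>n. emeasure (joint \<mu> (A n)) (- T) \<le> ennreal \<epsilon>)" if "0 < \<epsilon>" for \<epsilon>
    by (rule joint_tight[OF \<mu> A L_lsc L_compact L_bound B that])
  obtain r' \<Omega> and z' :: "nat \<Rightarrow> real \<Rightarrow> 'x \<times> 'y" and z\<^sub>0 where r': "strict_mono r'" and \<Omega>: "prob_space \<Omega>"
    and z': "\<And>n. z' n \<in> borel_measurable \<Omega>" and z\<^sub>0: "z\<^sub>0 \<in> borel_measurable \<Omega>"
    and law': "\<And>n. distr \<Omega> borel (z' n) = joint \<mu> (A (r' n))" and lim': "AE \<omega> in \<Omega>. (\<lambda>n. z' n \<omega>) \<longlonglongrightarrow> z\<^sub>0 \<omega>"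
  proof (rule prokhorov_skorokhod[OF J tight])
    fix r' :: "nat \<Rightarrow> nat" and \<Omega> :: "real measure" and z' :: "nat \<Rightarrow> real \<Rightarrow> 'x \<times> 'y" and z\<^sub>0
    assume a: "strict_mono r'" "prob_space \<Omega>" "\<And>n. z' n \<in> borel_measurable \<Omega>" "z\<^sub>0 \<in> borel_measurable \<Omega>"
      "\<And>n. distr \<Omega> borel (z' n) = joint \<mu> (A (r' n))" "AE \<omega> in \<Omega>. (\<lambda>n. z' n \<omega>) \<longlonglongrightarrow> z\<^sub>0 \<omega>"
    show thesis by (rule that[OF a])
  qed
  \<comment> \<open>With \<open>(k + 1)\<^sup>2\<close> or more players in the \<open>k\<close>-th
  game the variances are summable.\<close>
  define q where "q k = (Suc k)\<^sup>2" for k :: nat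
  have q: "strict_mono q" unfolding q_def by (rule strict_monoI) (simp add: power_strict_mono)
  define r where "r k = Suc (r' (q k))" for k
  define z where "z k = z' (q k)" for k
  have r: "strict_mono r" unfolding r_def using r' q by (simp add: strict_mono_def)
  have r_ge: "(Suc k)\<^sup>2 \<le> r k" for k
    using strict_mono_imp_increasing[OF r', of "q k"] by (simp add: r_def q_def)
  have r_ge': "Suc k \<le> r k" for k
    using r_ge[of k] by (rule order_trans[rotated]) (simp add: power2_eq_square)
  have law: "distr \<Omega> borel (z k) = joint \<mu> (\<lambda>x. average (r k) (\<lambda>i. K (r k) i x))" for k
    unfolding z_def law' r_def A_def[abs_def] ..
  have sk: "skorokhod \<Omega> z z\<^sub>0"
  proof (intro skorokhod.intro skorokhod_axioms.intro \<Omega> z\<^sub>0)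
    show "z n \<in> borel_measurable \<Omega>" for n unfolding z_def by (rule z')
    show "AE \<omega> in \<Omega>. (\<lambda>n. z n \<omega>) \<longlonglongrightarrow> z\<^sub>0 \<omega>"
      using lim'
    proof (rule eventually_mono)
      fix \<omega> assume "(\<lambda>n. z' n \<omega>) \<longlonglongrightarrow> z\<^sub>0 \<omega>"
      from LIMSEQ_subseq_LIMSEQ[OF this q] show "(\<lambda>n. z n \<omega>) \<longlonglongrightarrow> z\<^sub>0 \<omega>" by (simp add: z_def comp_def)
    qed
  qed
  interpret sk: skorokhod \<Omega> z z\<^sub>0 by (rule sk)
  define \<gamma> where "\<gamma> = distr \<Omega> borel z\<^sub>0"
  have \<gamma>: "\<gamma> \<in> borel_probs" unfolding \<gamma>_def by (rule sk.law_probs)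
  have conv: "(\<lambda>k. \<integral>p. f p \<partial>joint \<mu> (\<lambda>x. average (r k) (\<lambda>i. K (r k) i x))) \<longlonglongrightarrow> (\<integral>p. f p \<partial>\<gamma>)"
    if f: "continuous_on UNIV f" "bounded (range f)" for f :: "'x \<times> 'y \<Rightarrow> real"
  proof -
    obtain b where "\<And>p. \<bar>f p\<bar> \<le> b" using f(2) by (auto simp: bounded_iff)
    from sk.tendsto_integral[OF f(1) this] show ?thesis unfolding law \<gamma>_def .
  qed
  have "distr \<gamma> borel fst = \<mu>"
  proof -
    have fst: "fst \<in> \<nu> \<rightarrow>\<^sub>M borel" if "\<nu> \<in> borel_probs" for \<nu> :: "('x \<times> 'y) measure"
      unfolding measurable_cong_sets[OF borel_probsD(2)[OF that] refl] by (simp add: borel_prod[symmetric])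
    have P: "distr \<gamma> borel fst \<in> borel_probs"
      unfolding borel_probs_def using prob_space.prob_space_distr[OF borel_probsD(1)[OF \<gamma>] fst[OF \<gamma>]] by simp
    obtain d :: "nat \<Rightarrow> 'x" where d: "\<And>z e. 0 < e \<Longrightarrow> \<exists>k. dist z (d k) < e"
      using dense_sequence by blast
    show ?thesis
    proof (rule tents_determine_measure[OF d P \<mu>])
      fix l
      obtain b where b: "\<And>x. \<bar>tent d l x\<bar> \<le> b" using tent_bounded by blast
      have "continuous_on UNIV (\<lambda>p :: 'x \<times> 'y. tent d l (fst p))"
        by (rule continuous_on_compose2[OF tent_continuous]) (auto intro: continuous_intros)
      moreover have "bounded (range (\<lambda>p :: 'x \<times> 'y. tent d l (fst p)))"
        by (rule boundedI[where B = b]) (use b in auto)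
      ultimately have "(\<lambda>k. \<integral>p. tent d l (fst p) \<partial>joint \<mu> (\<lambda>x. average (r k) (\<lambda>i. K (r k) i x))) \<longlonglongrightarrow> (\<integral>p. tent d l (fst p) \<partial>\<gamma>)"
        by (rule conv)
      moreover have "(\<integral>p. tent d l (fst p) \<partial>joint \<mu> (\<lambda>x. average (r k) (\<lambda>i. K (r k) i x))) = (\<integral>x. tent d l x \<partial>\<mu>)" for k
      proof -
        have "measurable_family (\<lambda>x. average (r k) (\<lambda>i. K (r k) i x))"
          using r_ge'[of k] by (intro measurable_family_average K) simp
        from joint_coupling[OF \<mu> this]
        have j: "joint \<mu> (\<lambda>x. average (r k) (\<lambda>i. K (r k) i x)) \<in> borel_probs"
          "distr (joint \<mu> (\<lambda>x. average (r k) (\<lambda>i. K (r k) i x))) borel fst = \<mu>"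
          by (auto simp: couplings_of_def)
        show ?thesis using integral_distr[OF fst[OF j(1)] tent_measurable, of d l] unfolding j(2) by simp
      qed
      ultimately have "(\<lambda>k :: nat. \<integral>x. tent d l x \<partial>\<mu>) \<longlonglongrightarrow> (\<integral>p. tent d l (fst p) \<partial>\<gamma>)" by simp
      then have "(\<integral>p. tent d l (fst p) \<partial>\<gamma>) = (\<integral>x. tent d l x \<partial>\<mu>)"
        by (rule LIMSEQ_unique[OF _ tendsto_const])
      then show "(\<integral>x. tent d l x \<partial>distr \<gamma> borel fst) = (\<integral>x. tent d l x \<partial>\<mu>)"
        by (simp only: integral_distr[OF fst[OF \<gamma>] tent_measurable])
    qed
  qed
  with \<gamma> have \<gamma>c: "\<gamma> \<in> couplings_of \<mu>" by (simp add: couplings_of_def)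
  show ?thesis
    by (rule that[OF r r_ge' \<gamma>c empirical_AE_narrow[OF K r_ge \<gamma> conv] sk law \<gamma>_def[symmetric]])
qed

text \<open>
  The average of the equilibrium inequalities of all players against one common deviation
  \<open>J\<close>. The diagonal terms missing in the game cost at most \<open>2 * b / N\<close>
  on the left; on the right they may be added.
\<close>

lemma nash_average_le:
  assumes N: "1 \<le> N" and K: "\<And>i. measurable_family (K i)" and s: "\<And>i. i < N \<Longrightarrow> s i = (\<lambda>\<omega>. K i (X i \<omega>))"
    and nash: "open_loop_nash c L H M X N s" and b: "\<And>p. H p \<le> ennreal b" and J: "measurable_family J"
  shows "state_cost c L \<mu> (\<lambda>x. average N (\<lambda>i. K i x)) +
      2 * interaction H (mean_law \<mu> (\<lambda>x. average N (\<lambda>i. K i x))) (mean_law \<mu> (\<lambda>x. average N (\<lambda>i. K i x)))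
    \<le> state_cost c L \<mu> J + 2 * interaction H (mean_law \<mu> J) (mean_law \<mu> (\<lambda>x. average N (\<lambda>i. K i x)))
      + 2 * (inverse (of_nat N) * ennreal b)"
proof -
  let ?w = "inverse (of_nat N) :: ennreal" and ?I = "\<lambda>i j. interaction H (mean_law \<mu> (K i)) (mean_law \<mu> (K j))"
  let ?A = "\<lambda>x. average N (\<lambda>i. K i x)"
  let ?R = "state_cost c L \<mu> J + 2 * interaction H (mean_law \<mu> J) (mean_law \<mu> ?A)"
  have w: "2 / of_nat N = 2 * ?w" by (simp add: divide_ennreal_def)
  have player: "state_cost c L \<mu> (K i) + 2 * (?w * (\<Sum>j\<in>{..<N} - {i}. ?I i j)) \<le> ?R" if i: "i < N" for i
  proof -
    have "player_cost c L H M X N i s \<le> player_cost c L H M X N i (s(i := \<lambda>\<omega>. J (X i \<omega>)))"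
      using nash i strategy[OF J, of i] unfolding open_loop_nash_def by blast
    also have "player_cost c L H M X N i s = state_cost c L \<mu> (K i) + 2 * (?w * (\<Sum>j\<in>{..<N} - {i}. ?I i j))"
      using player_cost_eq[OF c_meas L_meas H_meas K s i] by (simp only: w mult.assoc)
    also have "player_cost c L H M X N i (s(i := \<lambda>\<omega>. J (X i \<omega>))) = state_cost c L \<mu> J +
        2 * (?w * (\<Sum>j\<in>{..<N} - {i}. interaction H (mean_law \<mu> J) (mean_law \<mu> (K j))))"
    proof -
      have "player_cost c L H M X N i (s(i := \<lambda>\<omega>. J (X i \<omega>))) = state_cost c L \<mu> ((K(i := J)) i) +
          2 / of_nat N * (\<Sum>j\<in>{..<N} - {i}. interaction H (mean_law \<mu> ((K(i := J)) i)) (mean_law \<mu> ((K(i := J)) j)))"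
      proof (rule player_cost_eq[OF c_meas L_meas H_meas _ _ i])
        show "measurable_family ((K(i := J)) j)" for j using K J by simp
        show "(s(i := \<lambda>\<omega>. J (X i \<omega>))) j = (\<lambda>\<omega>. (K(i := J)) j (X j \<omega>))" if "j < N" for j
          using s[OF that] by simp
      qed
      moreover have "(\<Sum>j\<in>{..<N} - {i}. interaction H (mean_law \<mu> ((K(i := J)) i)) (mean_law \<mu> ((K(i := J)) j))) =
          (\<Sum>j\<in>{..<N} - {i}. interaction H (mean_law \<mu> J) (mean_law \<mu> (K j)))"
        by (intro sum.cong) auto
      ultimately show ?thesis by (simp only: w mult.assoc fun_upd_same)
    qed
    also have "\<dots> \<le> state_cost c L \<mu> J + 2 * (?w * (\<Sum>j<N. interaction H (mean_law \<mu> J) (mean_law \<mu> (K j))))"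
      by (intro add_left_mono mult_left_mono sum_mono2) auto
    also have "\<dots> = ?R"
      by (simp only: interaction_average_right[OF \<mu> N K mean_law_prob[OF \<mu> J] H_meas])
    finally show ?thesis .
  qed
  have "state_cost c L \<mu> ?A + 2 * interaction H (mean_law \<mu> ?A) (mean_law \<mu> ?A) \<le>
      ?w * (\<Sum>i<N. state_cost c L \<mu> (K i)) + 2 * (?w * ?w * (\<Sum>i<N. \<Sum>j\<in>{..<N} - {i}. ?I i j) + ?w * ennreal b)"
    unfolding state_cost_average[OF N K]
    using interaction_average_le[OF \<mu> N K H_meas b] unfolding inverse_of_nat_square[OF N]
    by (intro add_left_mono mult_left_mono) simp_all
  also have "\<dots> = ?w * (\<Sum>i<N. state_cost c L \<mu> (K i) + 2 * (?w * (\<Sum>j\<in>{..<N} - {i}. ?I i j))) + 2 * (?w * ennreal b)"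
    by (simp add: sum.distrib distrib_left sum_distrib_left[symmetric] ac_simps)
  also have "\<dots> \<le> ?w * (\<Sum>i<N. ?R) + 2 * (?w * ennreal b)"
    by (intro add_right_mono mult_left_mono sum_mono player) simp_all
  also have "?w * (\<Sum>i<N. ?R) = ?R" using inverse_of_nat_cancel[OF N, of ?R] by simp
  finally show ?thesis .
qed

end

section \<open>Equilibrium in the limit\<close>

lemma inverse_of_nat_tendsto:
  assumes "strict_mono r"
  shows "(\<lambda>k. inverse (of_nat (r k)) :: ennreal) \<longlonglongrightarrow> 0"
proof -
  have "(\<lambda>n. inverse (of_nat n :: ennreal)) \<longlonglongrightarrow> inverse top"
    by (rule continuous_on_tendsto_compose[where s = UNIV, OF continuous_on_inverse_ennreal[OF continuous_on_id] of_nat_tendsto_top_ennreal])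
      simp_all
  from LIMSEQ_subseq_LIMSEQ[OF this assms] show ?thesis by (simp add: comp_def)
qed

lemma inverse_of_nat_le_1:
  assumes "1 \<le> N"
  shows "inverse (of_nat N) \<le> (1 :: ennreal)"
proof -
  have "inverse (of_nat N) = ennreal (inverse (real N))"
    using assms by (simp add: ennreal_of_nat_eq_real_of_nat inverse_ennreal)
  also have "\<dots> \<le> ennreal 1" using assms by (intro ennreal_leI) (simp add: inverse_le_1_iff)
  finally show ?thesis by simp
qed

lemma lower_semicontinuous_min:
  assumes "lower_semicontinuous f"
  shows "lower_semicontinuous (\<lambda>p. min (f p) b)"
  unfolding lower_semicontinuous_def
proof
  fix t
  have "{p. t < min (f p) b} = (if t < b then {p. t < f p} else {})" by auto
  then show "open {p. t < min (f p) b}" using assms by (simp add: lower_semicontinuous_def)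
qed

lemma lower_semicontinuous_if_continuous:
  assumes "continuous_on UNIV f"
  shows "lower_semicontinuous f"
  unfolding lower_semicontinuous_def
proof
  fix t
  have "open (f -` {t<..})" using assms by (intro open_vimage) auto
  then show "open {p. t < f p}" by (simp add: vimage_def)
qed

lemma
  fixes H :: "'y::second_countable_topology \<times> 'y \<Rightarrow> ennreal"
  assumes \<nu>: "\<nu> \<in> borel_probs" and \<nu>': "\<nu>' \<in> borel_probs" and H: "H \<in> borel_measurable borel"
  shows interaction_min_tendsto:
      "(\<lambda>n :: nat. interaction (\<lambda>p. min (H p) (of_nat n)) \<nu> \<nu>') \<longlonglongrightarrow> interaction H \<nu> \<nu>'"
    and interaction_cmult: "interaction (\<lambda>p. a * H p) \<nu> \<nu>' = a * interaction H \<nu> \<nu>'"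
proof -
  have "sets (\<nu> \<Otimes>\<^sub>M \<nu>') = sets (borel :: ('y \<times> 'y) measure)"
    using sets_pair_measure_cong[OF borel_probsD(2)[OF \<nu>] borel_probsD(2)[OF \<nu>']] by (simp only: borel_prod)
  note cong = measurable_cong_sets[OF this refl]
  have Hm [measurable]: "H \<in> borel_measurable (\<nu> \<Otimes>\<^sub>M \<nu>')"
    unfolding cong by (rule H)
  show "interaction (\<lambda>p. a * H p) \<nu> \<nu>' = a * interaction H \<nu> \<nu>'"
    unfolding interaction_def by (rule nn_integral_cmult[OF Hm])
  show "(\<lambda>n :: nat. interaction (\<lambda>p. min (H p) (of_nat n)) \<nu> \<nu>') \<longlonglongrightarrow> interaction H \<nu> \<nu>'"
    unfolding interaction_def
  proof (rule nn_integral_LIMSEQ)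
    show "incseq (\<lambda>(n :: nat) p. min (H p) (of_nat n))"
      by (intro incseq_SucI le_funI min.mono order_refl) (simp add: add_increasing)
    show "(\<lambda>n :: nat. min (H p) (of_nat n)) \<longlonglongrightarrow> H p" for p
      using tendsto_min[OF tendsto_const[of "H p"] of_nat_tendsto_top_ennreal] by (simp add: min_def)
  qed measurable
qed

context game
begin

text \<open>
  A competitor of finite cost, which bounds the costs of minimizers and of equilibria uniformly in
  the number of players.
\<close>

lemma finite_cost_kernel:
  assumes "(INF \<gamma>\<in>couplings_of \<mu>. mean_field_cost c L H \<gamma>) < \<infinity>"
  obtains K where "measurable_family K" "total_cost K < \<infinity>"
proof -
  obtain \<gamma> where \<gamma>: "\<gamma> \<in> couplings_of \<mu>" "mean_field_cost c L H \<gamma> < \<infinity>"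
    using assms unfolding INF_less_iff by (rule bexE)
  obtain K where K: "measurable_family K" "\<gamma> = joint \<mu> K" by (rule disintegration[OF \<mu> \<gamma>(1)])
  show ?thesis using that[OF K(1)] \<gamma>(2) unfolding K(2) mean_field_cost_joint[OF K(1)] .
qed

text \<open>
  Truncating \<open>H\<close> makes the diagonal terms of the averaged profile negligible for
  large \<open>N\<close>, and lowers all others.
\<close>

lemma minimizer_average_le:
  assumes N: "1 \<le> N" and K: "\<And>i. measurable_family (K i)" and le: "profile_cost N K \<le> t"
  shows "state_cost c L \<mu> (\<lambda>x. average N (\<lambda>i. K i x)) +
      interaction (\<lambda>p. min (H p) (of_nat b)) (mean_law \<mu> (\<lambda>x. average N (\<lambda>i. K i x))) (mean_law \<mu> (\<lambda>x. average N (\<lambda>i. K i x)))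
    \<le> t + inverse (of_nat N) * of_nat b"
proof -
  let ?H = "\<lambda>p. min (H p) (of_nat b)" and ?A = "\<lambda>x. average N (\<lambda>i. K i x)"
  have Hb: "?H \<in> borel_measurable borel"
    by (rule lower_semicontinuous_borel[OF lower_semicontinuous_min[OF H_lsc]])
  have b: "?H p \<le> ennreal (real b)" for p by (simp add: ennreal_of_nat_eq_real_of_nat)
  have "interaction ?H (mean_law \<mu> ?A) (mean_law \<mu> ?A) \<le>
      1 / (of_nat N)\<^sup>2 * (\<Sum>i<N. \<Sum>j\<in>{..<N} - {i}. interaction ?H (mean_law \<mu> (K i)) (mean_law \<mu> (K j)))
      + inverse (of_nat N) * ennreal (real b)"
    by (rule interaction_average_le[OF \<mu> N K Hb b])
  also have "\<dots> \<le> 1 / (of_nat N)\<^sup>2 * (\<Sum>i<N. \<Sum>j\<in>{..<N} - {i}. interaction H (mean_law \<mu> (K i)) (mean_law \<mu> (K j)))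
      + inverse (of_nat N) * of_nat b"
    unfolding ennreal_of_nat_eq_real_of_nat[symmetric] interaction_def
    by (intro add_right_mono mult_left_mono sum_mono nn_integral_mono) simp_all
  finally have "state_cost c L \<mu> ?A + interaction ?H (mean_law \<mu> ?A) (mean_law \<mu> ?A) \<le>
      profile_cost N K + inverse (of_nat N) * of_nat b"
    unfolding state_cost_average[OF N K] add.assoc by (rule add_left_mono)
  also have "\<dots> \<le> t + inverse (of_nat N) * of_nat b" by (rule add_right_mono[OF le])
  finally show ?thesis .
qed

text \<open>
  The limit minimizes the mean-field cost: for each truncation of \<open>H\<close> the bound for
  averaged profiles passes to the limit by lower semicontinuity, and the truncation is removed by
  monotone convergence.
\<close>

lemma minimizers_converge:
  fixes \<Gamma> :: "nat \<Rightarrow> 'w \<Rightarrow> ('x \<times> 'y) measure" and \<kappa> :: "nat \<Rightarrow> 'y \<Rightarrow> 'y measure" and C :: "nat \<Rightarrow> real"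
  assumes J_finite: "(INF \<gamma>\<in>couplings_of \<mu>. mean_field_cost c L H \<gamma>) < \<infinity>"
    and C_pos: "\<And>n. 0 < C n" and kappa: "\<And>n. measurable_family (\<kappa> n)"
    and kappa_bound: "\<And>n y y'. interaction H (\<kappa> n y) (\<kappa> n y') \<le> ennreal (C n) * (1 + L y + L y')"
    and kappa_lim: "\<And>x y \<nu>. (x, y, \<nu>) \<in> dom_Phi c L H \<Longrightarrow>
        (\<lambda>n. \<integral>\<^sup>+z. Phi c L H x z \<nu> \<partial>\<kappa> n y) \<longlonglongrightarrow> Phi c L H x y \<nu>"
    and \<Gamma>: "\<And>N. 1 \<le> N \<Longrightarrow> potential_minimizer c L H M X N (\<Gamma> N)"
  shows "\<exists>r \<gamma>. strict_mono r \<and> 1 \<le> r 0 \<and> \<gamma> \<in> couplings_of \<mu> \<and>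
     limitin (random_narrow_topology M) (\<lambda>k. \<Gamma> (r k)) (\<lambda>_. \<gamma>) sequentially \<and> cournot_nash c L H \<mu> \<gamma>"
proof -
  obtain K\<^sub>0 where K\<^sub>0: "measurable_family K\<^sub>0" "total_cost K\<^sub>0 < \<infinity>"
    by (rule finite_cost_kernel[OF J_finite])
  let ?P = "\<lambda>N K. (\<forall>i. measurable_family (K i)) \<and>
     (1 \<le> N \<longrightarrow> (AE \<omega> in M. \<Gamma> N \<omega> = empirical X N (\<lambda>j \<omega>. K j (X j \<omega>)) \<omega>) \<and>
       (\<forall>J. measurable_family J \<longrightarrow> profile_cost N K \<le> total_cost J + inverse (of_nat N)))"
  have "\<exists>K. ?P N K" for N
  proof (cases "1 \<le> N")
    case True
    show ?thesis
    proof (rule minimizer_profile[OF True \<Gamma>[OF True] K\<^sub>0])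
      fix K :: "nat \<Rightarrow> 'x \<Rightarrow> 'y measure"
      assume "\<And>i. measurable_family (K i)" "AE \<omega> in M. \<Gamma> N \<omega> = empirical X N (\<lambda>j \<omega>. K j (X j \<omega>)) \<omega>"
        "\<And>J. measurable_family J \<Longrightarrow> profile_cost N K \<le> total_cost J + inverse (of_nat N)"
      then show ?thesis by (intro exI[of _ K] conjI allI impI)
    qed
  next
    case False
    then show ?thesis using K\<^sub>0(1) by (intro exI[of _ "\<lambda>_. K\<^sub>0"] conjI allI impI) simp_all
  qed
  then have "\<forall>N. \<exists>K. ?P N K" by (rule allI)
  then have "\<exists>K. \<forall>N. ?P N (K N)" by (rule choice)
  then obtain K where P: "\<forall>N. ?P N (K N)" by (rule exE)
  have K: "measurable_family (K N i)" for N i using P by simp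
  have \<Gamma>K: "AE \<omega> in M. \<Gamma> N \<omega> = empirical X N (\<lambda>j \<omega>. K N j (X j \<omega>)) \<omega>" if "1 \<le> N" for N
    using P that by simp
  have cost_le: "profile_cost N (K N) \<le> total_cost J + inverse (of_nat N)"
    if "1 \<le> N" "measurable_family J" for N and J
    using P that by simp
  define B where "B = enn2real (total_cost K\<^sub>0 + 1)"
  have B: "ennreal B = total_cost K\<^sub>0 + 1" using K\<^sub>0(2) by (simp add: B_def)
  have bound: "state_cost c L \<mu> (\<lambda>x. average N (\<lambda>i. K N i x)) \<le> ennreal B" if N: "1 \<le> N" for N
  proof -
    have "state_cost c L \<mu> (\<lambda>x. average N (\<lambda>i. K N i x)) \<le> profile_cost N (K N)"
      unfolding state_cost_average[OF N K] by simp
    also have "\<dots> \<le> total_cost K\<^sub>0 + inverse (of_nat N)" by (rule cost_le[OF N K\<^sub>0(1)])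
    also have "\<dots> \<le> ennreal B" unfolding B by (intro add_left_mono inverse_of_nat_le_1 N)
    finally show ?thesis .
  qed
  have B0: "0 \<le> B" by (simp add: B_def)
  show ?thesis
  proof (rule convergent_subsequence[OF K B0 bound])
    fix r \<gamma> and \<Omega> :: "real measure" and z z\<^sub>0
    assume r: "strict_mono r" and r_ge: "\<And>k. Suc k \<le> r k" and \<gamma>: "\<gamma> \<in> couplings_of \<mu>"
      and AE: "AE \<omega> in M. \<forall>f::'x \<times> 'y \<Rightarrow> real. continuous_on UNIV f \<longrightarrow> bounded (range f) \<longrightarrow>
        (\<lambda>k. \<integral>p. f p \<partial>empirical X (r k) (\<lambda>j \<omega>. K (r k) j (X j \<omega>)) \<omega>) \<longlonglongrightarrow> (\<integral>p. f p \<partial>\<gamma>)"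
      and sk: "skorokhod \<Omega> z z\<^sub>0"
      and law: "\<And>k. distr \<Omega> borel (z k) = joint \<mu> (\<lambda>x. average (r k) (\<lambda>i. K (r k) i x))"
      and law\<^sub>0: "distr \<Omega> borel z\<^sub>0 = \<gamma>"
    have r1: "1 \<le> r k" for k using r_ge[of k] by simp
    have \<gamma>P: "\<gamma> \<in> borel_probs" using \<gamma> by (simp add: couplings_of_def)
    have "AE \<omega> in M. \<forall>k. \<Gamma> (r k) \<omega> = empirical X (r k) (\<lambda>j \<omega>. K (r k) j (X j \<omega>)) \<omega>"
      unfolding AE_all_countable by (intro allI \<Gamma>K r1)
    then have "AE \<omega> in M. \<forall>f::'x \<times> 'y \<Rightarrow> real. continuous_on UNIV f \<longrightarrow> bounded (range f) \<longrightarrow>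
        (\<lambda>k. \<integral>p. f p \<partial>\<Gamma> (r k) \<omega>) \<longlonglongrightarrow> (\<integral>p. f p \<partial>\<gamma>)"
      using AE by eventually_elim simp
    then have lim: "limitin (random_narrow_topology M) (\<lambda>k. \<Gamma> (r k)) (\<lambda>_. \<gamma>) sequentially"
      using \<Gamma>[OF r1] by (intro limitin_random_narrow_if_AE[OF prob_space_axioms _ \<gamma>P]) (simp_all add: potential_minimizer_def)
    have avg: "measurable_family (\<lambda>x. average (r k) (\<lambda>i. K (r k) i x))" for k
      by (rule measurable_family_average[OF r1 K])
    obtain K' where K': "measurable_family K'" "\<gamma> = joint \<mu> K'" by (rule disintegration[OF \<mu> \<gamma>])
    have min: "total_cost K' \<le> total_cost J" if J: "measurable_family J" for J
    proof -
      let ?\<nu> = "distr \<gamma> borel snd"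
      have \<nu>: "?\<nu> \<in> borel_probs" unfolding K'(2) distr_joint_snd[OF \<mu> K'(1)] by (rule mean_law_prob[OF \<mu> K'(1)])
      have "(\<integral>\<^sup>+p. c p \<partial>\<gamma>) + (\<integral>\<^sup>+y. L y \<partial>?\<nu>) + interaction (\<lambda>p. min (H p) (of_nat b)) ?\<nu> ?\<nu> \<le> total_cost J" for b :: nat
        unfolding law\<^sub>0[symmetric]
      proof (rule limit_cost_le[OF sk avg law lower_semicontinuous_min[OF H_lsc]])
        show "state_cost c L \<mu> (\<lambda>x. average (r k) (\<lambda>i. K (r k) i x)) +
            interaction (\<lambda>p. min (H p) (of_nat b)) (mean_law \<mu> (\<lambda>x. average (r k) (\<lambda>i. K (r k) i x)))
              (mean_law \<mu> (\<lambda>x. average (r k) (\<lambda>i. K (r k) i x)))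
          \<le> total_cost J + inverse (of_nat (r k)) + inverse (of_nat (r k)) * of_nat b" for k
          by (rule minimizer_average_le[OF r1 K cost_le[OF r1 J]])
        have "(\<lambda>k. total_cost J + inverse (of_nat (r k)) + of_nat b * inverse (of_nat (r k))) \<longlonglongrightarrow>
            total_cost J + 0 + of_nat b * 0"
          by (intro tendsto_add tendsto_const ennreal_tendsto_cmult inverse_of_nat_tendsto r) (simp add: ennreal_of_nat_eq_real_of_nat)
        then show "(\<lambda>k. total_cost J + inverse (of_nat (r k)) + inverse (of_nat (r k)) * of_nat b) \<longlonglongrightarrow> total_cost J"
          by (simp add: mult.commute)
      qed
      moreover have "(\<lambda>b :: nat. (\<integral>\<^sup>+p. c p \<partial>\<gamma>) + (\<integral>\<^sup>+y. L y \<partial>?\<nu>) + interaction (\<lambda>p. min (H p) (of_nat b)) ?\<nu> ?\<nu>)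
          \<longlonglongrightarrow> (\<integral>\<^sup>+p. c p \<partial>\<gamma>) + (\<integral>\<^sup>+y. L y \<partial>?\<nu>) + interaction H ?\<nu> ?\<nu>"
        by (intro tendsto_add tendsto_const interaction_min_tendsto \<nu> H_meas)
      ultimately have "mean_field_cost c L H \<gamma> \<le> total_cost J"
        unfolding mean_field_cost_def Let_def by (intro LIMSEQ_le_const2) auto
      then show ?thesis unfolding K'(2) mean_field_cost_joint[OF K'(1)] .
    qed
    have "cournot_nash c L H \<mu> \<gamma>" unfolding K'(2)
    proof (rule minimizer_cournot_nash[OF C_pos kappa kappa_bound kappa_lim K'(1) _ min])
      show "total_cost K' < \<infinity>" using min[OF K\<^sub>0(1)] K\<^sub>0(2) by (rule le_less_trans)
    qed
    then show ?thesis using r r1[of 0] \<gamma> lim by (intro exI[of _ r] exI[of _ \<gamma>] conjI)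
  qed
qed

text \<open>
  The averaged equilibrium inequalities pass to the limit, the left side by lower semicontinuity
  and the right side by continuity of \<open>H\<close>. They then say that the mean of
  \<open>Phi\<close> under \<open>\<gamma>\<close> is at most its mean under any kernel
  \<open>J\<close>. The kernel that puts unit mass at a measurable minimizer \<open>T x\<close> is
  the best choice of \<open>J\<close>.
\<close>

lemma nash_limit_cournot_nash:
  fixes \<Gamma> :: "'w \<Rightarrow> ('x \<times> 'y) measure" and s :: "nat \<Rightarrow> nat \<Rightarrow> 'w \<Rightarrow> 'y measure"
  assumes J_finite: "(INF \<gamma>\<in>couplings_of \<mu>. mean_field_cost c L H \<gamma>) < \<infinity>"
    and H_cont: "continuous_on UNIV H" and b: "\<And>p. H p \<le> ennreal b"
    and nash: "\<And>N. 1 \<le> N \<Longrightarrow> open_loop_nash c L H M X N (s N)"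
    and lim: "limitin (random_narrow_topology M) (\<lambda>N. empirical X N (s N)) \<Gamma> sequentially"
  shows "\<exists>\<gamma>. \<gamma> \<in> couplings_of \<mu> \<and> (AE \<omega> in M. \<Gamma> \<omega> = \<gamma>) \<and> cournot_nash c L H \<mu> \<gamma>"
proof -
  obtain K\<^sub>0 where K\<^sub>0: "measurable_family K\<^sub>0" "total_cost K\<^sub>0 < \<infinity>"
    by (rule finite_cost_kernel[OF J_finite])
  let ?P = "\<lambda>N K. (\<forall>i. measurable_family (K i)) \<and> (1 \<le> N \<longrightarrow> (\<forall>i<N. s N i = (\<lambda>\<omega>. K i (X i \<omega>))))"
  have "\<exists>K. ?P N K" for N
  proof (cases "1 \<le> N")
    case True
    have "s N i \<in> strategies X i" if "i < N" for i
      using nash[OF True] that by (simp add: open_loop_nash_def)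
    then show ?thesis
    proof (rule strategies_families[OF _ K\<^sub>0(1)])
      fix K :: "nat \<Rightarrow> 'x \<Rightarrow> 'y measure"
      assume "\<And>i. measurable_family (K i)" "\<And>i. i < N \<Longrightarrow> s N i = (\<lambda>\<omega>. K i (X i \<omega>))"
      then show ?thesis by (intro exI[of _ K] conjI allI impI)
    qed
  next
    case False
    then show ?thesis using K\<^sub>0(1) by (intro exI[of _ "\<lambda>_. K\<^sub>0"] conjI allI impI) simp_all
  qed
  then have "\<forall>N. \<exists>K. ?P N K" by (rule allI)
  then have "\<exists>K. \<forall>N. ?P N (K N)" by (rule choice)
  then obtain K where P: "\<forall>N. ?P N (K N)" by (rule exE)
  have K: "measurable_family (K N i)" for N i using P by simp
  have sK: "s N i = (\<lambda>\<omega>. K N i (X i \<omega>))" if "1 \<le> N" "i < N" for N i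
    using P that by simp
  let ?A = "\<lambda>N x. average N (\<lambda>i. K N i x)"
  have cost_le: "state_cost c L \<mu> (?A N) + 2 * interaction H (mean_law \<mu> (?A N)) (mean_law \<mu> (?A N))
      \<le> state_cost c L \<mu> J + 2 * interaction H (mean_law \<mu> J) (mean_law \<mu> (?A N)) + 2 * (inverse (of_nat N) * ennreal b)"
    if N: "1 \<le> N" and J: "measurable_family J" for N and J
    by (rule nash_average_le[OF N K sK[OF N] nash[OF N] b J])
  have avg: "measurable_family (?A N)" if "1 \<le> N" for N by (rule measurable_family_average[OF that K])
  have inter_b: "interaction H (mean_law \<mu> K\<^sub>0) \<nu> \<le> ennreal b" if "\<nu> \<in> borel_probs" for \<nu>
    by (rule interaction_le_bound[OF mean_law_prob[OF \<mu> K\<^sub>0(1)] that H_meas b])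
  define B where "B = enn2real (state_cost c L \<mu> K\<^sub>0 + 2 * ennreal b + 2 * ennreal b)"
  have B: "ennreal B = state_cost c L \<mu> K\<^sub>0 + 2 * ennreal b + 2 * ennreal b"
    using K\<^sub>0(2) by (auto simp: B_def ennreal_mult_less_top)
  have bound: "state_cost c L \<mu> (?A N) \<le> ennreal B" if N: "1 \<le> N" for N
  proof -
    have "state_cost c L \<mu> (?A N) \<le> state_cost c L \<mu> (?A N) + 2 * interaction H (mean_law \<mu> (?A N)) (mean_law \<mu> (?A N))"
      by simp
    also note cost_le[OF N K\<^sub>0(1)]
    also have "state_cost c L \<mu> K\<^sub>0 + 2 * interaction H (mean_law \<mu> K\<^sub>0) (mean_law \<mu> (?A N)) + 2 * (inverse (of_nat N) * ennreal b)
        \<le> ennreal B"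
      unfolding B using mult_right_mono[OF inverse_of_nat_le_1[OF N], of "ennreal b"]
      by (intro add_mono order_refl mult_left_mono inter_b mean_law_prob[OF \<mu> avg[OF N]]) simp_all
    finally show ?thesis .
  qed
  have B0: "0 \<le> B" by (simp add: B_def)
  show ?thesis
  proof (rule convergent_subsequence[OF K B0 bound])
    fix r \<gamma> and \<Omega> :: "real measure" and z z\<^sub>0
    assume r: "strict_mono r" and r_ge: "\<And>k. Suc k \<le> r k" and \<gamma>: "\<gamma> \<in> couplings_of \<mu>"
      and AE: "AE \<omega> in M. \<forall>f::'x \<times> 'y \<Rightarrow> real. continuous_on UNIV f \<longrightarrow> bounded (range f) \<longrightarrow>
        (\<lambda>k. \<integral>p. f p \<partial>empirical X (r k) (\<lambda>j \<omega>. K (r k) j (X j \<omega>)) \<omega>) \<longlonglongrightarrow> (\<integral>p. f p \<partial>\<gamma>)"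
      and sk: "skorokhod \<Omega> z z\<^sub>0"
      and law: "\<And>k. distr \<Omega> borel (z k) = joint \<mu> (\<lambda>x. average (r k) (\<lambda>i. K (r k) i x))"
      and law\<^sub>0: "distr \<Omega> borel z\<^sub>0 = \<gamma>"
    interpret sk: skorokhod \<Omega> z z\<^sub>0 by (rule sk)
    interpret snd: skorokhod \<Omega> "\<lambda>k \<omega>. snd (z k \<omega>)" "\<lambda>\<omega>. snd (z\<^sub>0 \<omega>)"
      by (rule sk.skorokhod_continuous_image) (rule continuous_on_snd[OF continuous_on_id])
    have r1: "1 \<le> r k" for k using r_ge[of k] by simp
    have \<gamma>P: "\<gamma> \<in> borel_probs" using \<gamma> by (simp add: couplings_of_def)
    have emp: "empirical X (r k) (s (r k)) = empirical X (r k) (\<lambda>j \<omega>. K (r k) j (X j \<omega>))" for k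
      by (rule empirical_cong[OF sK[OF r1]])
    have "limitin (random_narrow_topology M) (\<lambda>k. empirical X (r k) (s (r k))) \<Gamma> sequentially"
      using limitin_subsequence[OF r lim] by (simp add: comp_def)
    then have "AE \<omega> in M. \<Gamma> \<omega> = \<gamma>"
      unfolding emp
      by (rule random_narrow_limit_unique[OF prob_space_axioms])
        (rule limitin_random_narrow_if_AE[OF prob_space_axioms empirical_random_prob[OF K r1] \<gamma>P AE])
    moreover have "cournot_nash c L H \<mu> \<gamma>"
    proof -
      let ?\<nu> = "distr \<gamma> borel snd"
      have snd_m: "snd \<in> borel_measurable (borel :: ('x \<times> 'y) measure)" by (simp add: borel_prod[symmetric])
      have \<nu>_eq: "distr \<Omega> borel (\<lambda>\<omega>. snd (z\<^sub>0 \<omega>)) = ?\<nu>"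
        unfolding law\<^sub>0[symmetric] using distr_distr[OF snd_m sk.z\<^sub>0] by (simp add: comp_def)
      have \<nu>_k: "distr \<Omega> borel (\<lambda>\<omega>. snd (z k \<omega>)) = mean_law \<mu> (?A (r k))" for k
        unfolding distr_joint_snd[OF \<mu> avg[OF r1], symmetric] law[symmetric]
        using distr_distr[OF snd_m sk.z] by (simp add: comp_def)
      have \<nu>: "?\<nu> \<in> borel_probs" using snd.law_probs(2) unfolding \<nu>_eq .
      obtain K' where K': "measurable_family K'" "\<gamma> = joint \<mu> K'" by (rule disintegration[OF \<mu> \<gamma>])
      have \<nu>': "mean_law \<mu> K' = ?\<nu>" unfolding K'(2) distr_joint_snd[OF \<mu> K'(1)] ..
      have limit_le: "(\<integral>\<^sup>+p. \<Phi> ?\<nu> p \<partial>\<gamma>) \<le> (\<integral>\<^sup>+x. \<integral>\<^sup>+y. Phi c L H x y ?\<nu> \<partial>J x \<partial>\<mu>)"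
        if J: "measurable_family J" for J
      proof -
        have two: "(2 :: ennreal) < top" by simp
        have H2: "lower_semicontinuous (\<lambda>p. 2 * H p)"
          by (rule lower_semicontinuous_if_continuous[OF ennreal_continuous_on_cmult[OF two H_cont]])
        have "(\<integral>\<^sup>+p. c p \<partial>\<gamma>) + (\<integral>\<^sup>+y. L y \<partial>?\<nu>) + interaction (\<lambda>p. 2 * H p) ?\<nu> ?\<nu>
            \<le> state_cost c L \<mu> J + 2 * interaction H (mean_law \<mu> J) ?\<nu>"
          unfolding law\<^sub>0[symmetric]
        proof (rule limit_cost_le[OF sk avg[OF r1] law H2])
          note ml = mean_law_prob[OF \<mu> avg[OF r1]]
          show "state_cost c L \<mu> (?A (r k)) + interaction (\<lambda>p. 2 * H p) (mean_law \<mu> (?A (r k))) (mean_law \<mu> (?A (r k)))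
            \<le> state_cost c L \<mu> J + 2 * interaction H (mean_law \<mu> J) (mean_law \<mu> (?A (r k)))
              + 2 * (inverse (of_nat (r k)) * ennreal b)" for k
            unfolding interaction_cmult[OF ml ml H_meas] by (rule cost_le[OF r1 J])
          have I: "(\<lambda>k. interaction H (mean_law \<mu> J) (mean_law \<mu> (?A (r k)))) \<longlonglongrightarrow> interaction H (mean_law \<mu> J) ?\<nu>"
            using snd.interaction_tendsto[OF H_cont b mean_law_prob[OF \<mu> J]] unfolding \<nu>_eq \<nu>_k .
          have "(\<lambda>k. state_cost c L \<mu> J + 2 * interaction H (mean_law \<mu> J) (mean_law \<mu> (?A (r k)))
              + 2 * (ennreal b * inverse (of_nat (r k)))) \<longlonglongrightarrow>
              state_cost c L \<mu> J + 2 * interaction H (mean_law \<mu> J) ?\<nu> + 2 * (ennreal b * 0)"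
            by (intro tendsto_add tendsto_const ennreal_tendsto_cmult two I inverse_of_nat_tendsto r) simp
          then show "(\<lambda>k. state_cost c L \<mu> J + 2 * interaction H (mean_law \<mu> J) (mean_law \<mu> (?A (r k)))
              + 2 * (inverse (of_nat (r k)) * ennreal b)) \<longlonglongrightarrow>
              state_cost c L \<mu> J + 2 * interaction H (mean_law \<mu> J) (distr (distr \<Omega> borel z\<^sub>0) borel snd)"
            by (simp add: mult.commute[of "ennreal b"] law\<^sub>0)
        qed
        also have "(\<integral>\<^sup>+p. c p \<partial>\<gamma>) + (\<integral>\<^sup>+y. L y \<partial>?\<nu>) = state_cost c L \<mu> K'"
          unfolding \<nu>'[symmetric] unfolding K'(2) by (rule state_cost_joint[OF K'(1)])
        also have "state_cost c L \<mu> K' + interaction (\<lambda>p. 2 * H p) ?\<nu> ?\<nu> = (\<integral>\<^sup>+x. \<integral>\<^sup>+y. Phi c L H x y ?\<nu> \<partial>K' x \<partial>\<mu>)"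
          unfolding interaction_cmult[OF \<nu> \<nu> H_meas] nn_integral_Phi[OF \<nu> K'(1)] \<nu>' ..
        also have "\<dots> = (\<integral>\<^sup>+p. \<Phi> ?\<nu> p \<partial>joint \<mu> K')"
          using nn_integral_joint[OF \<mu> K'(1) Phi_measurable[OF \<nu>]] by simp
        finally show ?thesis unfolding K'(2)[symmetric] nn_integral_Phi[OF \<nu> J] .
      qed
      show ?thesis
      proof (rule Phi_argmin[OF \<nu>])
        fix T :: "'x \<Rightarrow> 'y" assume T: "T \<in> borel_measurable borel" "\<And>x y. Phi c L H x (T x) ?\<nu> \<le> Phi c L H x y ?\<nu>"
        show ?thesis
        proof (rule cournot_nashI[OF \<gamma> T])
          have Tm: "measurable_family (\<lambda>x. return borel (T x))"
            unfolding measurable_family_def borel_probs_def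
          proof (intro conjI allI ballI CollectI)
            fix A :: "'y set" assume A: "A \<in> sets borel"
            then have "(\<lambda>x. indicator A (T x) :: ennreal) \<in> borel_measurable borel"
              using T(1) by (intro measurable_compose[OF T(1)]) simp
            then show "(\<lambda>x. emeasure (return borel (T x)) A) \<in> borel_measurable borel" using A by simp
          qed (simp_all add: prob_space_return)
          have "(\<integral>\<^sup>+y. Phi c L H x y ?\<nu> \<partial>return borel (T x)) = Phi c L H x (T x) ?\<nu>" for x
            using measurable_Pair_borel(1)[OF Phi_measurable[OF \<nu>]] by (subst nn_integral_return) simp_all
          then show "(\<integral>\<^sup>+p. \<Phi> ?\<nu> p \<partial>\<gamma>) \<le> (\<integral>\<^sup>+x. Phi c L H x (T x) ?\<nu> \<partial>\<mu>)"
            using limit_le[OF Tm] by simp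
          have "Phi c L H x (T x) ?\<nu> \<le> (\<integral>\<^sup>+y. Phi c L H x y ?\<nu> \<partial>K\<^sub>0 x)" for x
          proof -
            have "Phi c L H x (T x) ?\<nu> = (\<integral>\<^sup>+y. Phi c L H x (T x) ?\<nu> \<partial>K\<^sub>0 x)"
              using prob_space.emeasure_space_1[OF measurable_familyD(1)[OF K\<^sub>0(1)]] by simp
            also have "\<dots> \<le> (\<integral>\<^sup>+y. Phi c L H x y ?\<nu> \<partial>K\<^sub>0 x)" by (intro nn_integral_mono T(2))
            finally show ?thesis .
          qed
          then have "(\<integral>\<^sup>+x. Phi c L H x (T x) ?\<nu> \<partial>\<mu>) \<le> (\<integral>\<^sup>+x. \<integral>\<^sup>+y. Phi c L H x y ?\<nu> \<partial>K\<^sub>0 x \<partial>\<mu>)"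
            by (intro nn_integral_mono)
          also have "\<dots> \<le> state_cost c L \<mu> K\<^sub>0 + 2 * ennreal b"
            unfolding nn_integral_Phi[OF \<nu> K\<^sub>0(1)] by (intro add_left_mono mult_left_mono inter_b \<nu>) simp
          also have "\<dots> < \<infinity>" using K\<^sub>0(2) by (simp add: ennreal_mult_less_top)
          finally show "(\<integral>\<^sup>+x. Phi c L H x (T x) ?\<nu> \<partial>\<mu>) < \<infinity>" .
        qed
      qed
    qed
    ultimately show ?thesis using \<gamma> by (intro exI[of _ \<gamma>] conjI)
  qed
qed

end

theorem theorem4p7:
  fixes \<mu> :: "'x::polish_space measure"
    and c :: "'x \<times> 'y::polish_space \<Rightarrow> ennreal"
    and L :: "'y \<Rightarrow> ennreal"
    and H :: "'y \<times> 'y \<Rightarrow> ennreal"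
    and M :: "'w measure"
    and X :: "nat \<Rightarrow> 'w \<Rightarrow> 'x"
    and C :: "nat \<Rightarrow> real"
    and \<kappa> :: "nat \<Rightarrow> 'y \<Rightarrow> 'y measure"
  assumes mu: "\<mu> \<in> borel_probs" "atomless \<mu>"
    and c_lsc: "lower_semicontinuous c"
    and L_lsc: "lower_semicontinuous L"
    and H_lsc: "lower_semicontinuous H"
    and H_sym: "\<And>y y'. H (y, y') = H (y', y)"
    and L_compact: "\<And>r::real. 0 < r \<Longrightarrow> compact {y. L y \<le> ennreal r}"
    and M: "prob_space M"
    and X_indep: "prob_space.indep_vars M (\<lambda>_. borel) X UNIV"
    and X_law: "\<And>i. distr M borel (X i) = \<mu>"
    and J_finite: "(INF \<gamma>\<in>couplings_of \<mu>. mean_field_cost c L H \<gamma>) < \<infinity>"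
    and C_pos: "\<And>n. 0 < C n"
    and kappa: "\<And>n. measurable_family (\<kappa> n)"
    and kappa_bound: "\<And>n y y'. interaction H (\<kappa> n y) (\<kappa> n y') \<le> ennreal (C n) * (1 + L y + L y')"
    and kappa_lim: "\<And>x y \<nu>. (x, y, \<nu>) \<in> dom_Phi c L H \<Longrightarrow>
        (\<lambda>n. \<integral>\<^sup>+z. Phi c L H x z \<nu> \<partial>\<kappa> n y) \<longlonglongrightarrow> Phi c L H x y \<nu>"
  shows "(\<forall>\<Gamma> :: nat \<Rightarrow> 'w \<Rightarrow> ('x \<times> 'y) measure.
            (\<forall>N\<ge>1. potential_minimizer c L H M X N (\<Gamma> N)) \<longrightarrow>
            (\<exists>r \<gamma>. strict_mono r \<and> 1 \<le> r 0 \<and> \<gamma> \<in> couplings_of \<mu> \<and>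
               limitin (random_narrow_topology M) (\<lambda>k. \<Gamma> (r k)) (\<lambda>_. \<gamma>) sequentially \<and>
               cournot_nash c L H \<mu> \<gamma>)) \<and>
         (continuous_on UNIV H \<and> (\<exists>b::real. \<forall>p. H p \<le> ennreal b) \<longrightarrow>
           (\<forall>(s :: nat \<Rightarrow> nat \<Rightarrow> 'w \<Rightarrow> 'y measure) \<Gamma>.
              (\<forall>N\<ge>1. open_loop_nash c L H M X N (s N)) \<and>
              limitin (random_narrow_topology M) (\<lambda>N. empirical X N (s N)) \<Gamma> sequentially \<longrightarrow>
              (\<exists>\<gamma>. \<gamma> \<in> couplings_of \<mu> \<and> (AE \<omega> in M. \<Gamma> \<omega> = \<gamma>) \<and> cournot_nash c L H \<mu> \<gamma>)))"
proof -
  have game: "game M \<mu> X c L H"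
    by (intro game.intro iid_types.intro iid_types_axioms.intro costs.intro
        M X_indep X_law c_lsc L_lsc H_lsc H_sym L_compact mu)
  show ?thesis
  proof (intro conjI allI impI)
    fix \<Gamma> :: "nat \<Rightarrow> 'w \<Rightarrow> ('x \<times> 'y) measure"
    assume "\<forall>N\<ge>1. potential_minimizer c L H M X N (\<Gamma> N)"
    then show "\<exists>r \<gamma>. strict_mono r \<and> 1 \<le> r 0 \<and> \<gamma> \<in> couplings_of \<mu> \<and>
        limitin (random_narrow_topology M) (\<lambda>k. \<Gamma> (r k)) (\<lambda>_. \<gamma>) sequentially \<and> cournot_nash c L H \<mu> \<gamma>"
      by (intro game.minimizers_converge[OF game J_finite C_pos kappa kappa_bound kappa_lim]) simp_all
  next
    fix s :: "nat \<Rightarrow> nat \<Rightarrow> 'w \<Rightarrow> 'y measure" and \<Gamma> :: "'w \<Rightarrow> ('x \<times> 'y) measure"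
    assume H: "continuous_on UNIV H \<and> (\<exists>b::real. \<forall>p. H p \<le> ennreal b)"
      and nash: "(\<forall>N\<ge>1. open_loop_nash c L H M X N (s N)) \<and>
        limitin (random_narrow_topology M) (\<lambda>N. empirical X N (s N)) \<Gamma> sequentially"
    from H obtain b :: real where "\<forall>p. H p \<le> ennreal b" by (elim conjE exE)
    then have b: "H p \<le> ennreal b" for p by (rule spec)
    show "\<exists>\<gamma>. \<gamma> \<in> couplings_of \<mu> \<and> (AE \<omega> in M. \<Gamma> \<omega> = \<gamma>) \<and> cournot_nash c L H \<mu> \<gamma>"
      using H nash by (intro game.nash_limit_cournot_nash[OF game J_finite _ b, where s = s]) simp_all
  qed
qed

end
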